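(* Let $(N,[\nabla])$ be an orientable manifold of dimension $n\ge2$ with a projective structure, let $\mathcal{T}^*\to N$ be its cotractor bundle, let $\mathcal{M}=\mathbb{P}(\mathcal{T}^* )$ be the fibrewise projectivisation, and let $\mathcal{Z}(\tau)\subset\mathcal{M}$ be the zero locus of the canonical density $\tau=X\lrcorner U$. Then there is a neutral signature metric $g$ on $\mathcal{M}\setminus\mathcal{Z}(\tau)$ determined by the canonical pairing of the horizontal and vertical subspaces of $T(\mathcal{T}^* )$ (as described in the context). This metric is Einstein with non-zero Ricci scalar. Moreover, for a choice of connection $\nabla\in[\nabla]$, with the induced identification $\iota_\nabla:T^*N\to\mathcal{M}\setminus\mathcal{Z}(\tau)$, and in local coordinates $(x^i,\xi_i)$ on $T^*N$ induced by local coordinates $x^i$ on $N$, $g$ agrees with $$d\xi_i\odot dx^i-\left(\Gamma_{ij}^k\xi_k-\xi_i\xi_j-\mathrm{P}_{(ij)}\right)dx^i\odot dx^j,$$ where $\Gamma^k_{ij}$ are the Christoffel symbols and $\mathrm{P}_{ij}$ the Schouten tensor of $\nabla$.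
   Context: Projective structure: an equivalence class $[\nabla]$ of torsion-free affine connections on $N$ sharing the same unparametrised geodesics; $\nabla,\overline\nabla$ are equivalent iff $\overline\nabla_XY=\nabla_XY+\Upsilon(X)Y+\Upsilon(Y)X$ for some one-form $\Upsilon$. Schouten tensor: $\mathrm{P}_{ij}=\frac{1}{n-1}R_{(ij)}+\frac{1}{n+1}R_{[ij]}$, with $R_{ij}=\partial_k\Gamma^k_{ij}-\partial_i\Gamma^k_{kj}+\Gamma^k_{kl}\Gamma^l_{ij}-\Gamma^k_{il}\Gamma^l_{kj}$ the Ricci tensor. Symmetric product: $\alpha\odot\beta=\frac12(\alpha\otimes\beta+\beta\otimes\alpha)$; round and square brackets on indices denote symmetrisation and antisymmetrisation. Cotractor bundle: $\mathcal{E}(1)\to N$ is the standard $-2(n+1)$-th root of the square of the canonical bundle of $N$, and $\mathcal{B}(1)=\mathcal{B}\otimes\mathcal{E}(1)$. The cotractor bundle $\mathcal{T}^*\to N$ is the rank $n+1$ vector bundle whose elements are represented, for each $\nabla\in[\nabla]$, by pairs $(\sigma,\mu)\in\mathcal{E}(1)\oplus T^*N(1)$, where the pair for the connection $\overline\nabla\in[\nabla]$ given by $\overline\nabla_XY=\nabla_XY+\Upsilon(X)Y+\Upsilon(Y)X$, with $\Upsilon$ a one-form on $N$, is $(\sigma,\mu+\sigma\Upsilon)$. There is an exact sequence $0\to T^*N(1)\to\mathcal{T}^*\stackrel{X}{\to}\mathcal{E}(1)\to0$ with $X:(\sigma,\mu)\mapsto\sigma$ (the canonical tractor). The projectively invariant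 tractor connection is $$\nabla^{\mathcal{T}^*}_i(\sigma,\mu_j)=(\nabla_i\sigma-\mu_i,\ \nabla_i\mu_j+\mathrm{P}_{ij}\sigma).$$ Write $\pi:\mathcal{M}=\mathbb{P}(\mathcal{T}^* )\to N$. For $0\neq U\in\mathcal{T}^*_p$ set $\tau(U)=X\lrcorner U\in\mathcal{E}(1)_p$; it is homogeneous of degree one in $U$, so $\mathcal{Z}(\tau)=\{[U]\in\mathcal{M}:\tau(U)=0\}$ is well defined. The metric: the tractor connection splits $T(\mathcal{T}^* )$ into horizontal and vertical sub-bundles, $T(\mathcal{T}^* )=\pi^*TN\oplus\pi^*\mathcal{T}^*$, and pushing forward to $\mathbb{P}(\mathcal{T}^* )$ gives a splitting of $T\mathcal{M}$ into a horizontal sub-bundle isomorphic to $\pi^*TN$ (via $d\pi$) and the vertical sub-bundle $V$, where $V_{[U]}=\mathrm{Hom}(\langle U\rangle,\mathcal{T}^*_p/\langle U\rangle)$. Where $\tau(U)\neq0$ one has $\mathcal{T}^*_p=\langle U\rangle\oplus T^*_pN(1)$, hence $V_{[U]}\cong\mathrm{Hom}(\langle U\rangle,T_p^*N(1))$, and $A\mapsto A(U)/\tau(U)$ identifies $V_{[U]}$ with $T_p^*N$ independently of the representative $U$. Let $\Pi_H=d\pi$, and let $\Pi_V$ be the projection to $V\cong\pi^*T^*N$ along the horizontal sub-bundle. The metric is $$g(w_1,w_2)=\tfrac12\big(\Pi_H(w_1)\lrcorner\,\Pi_V(w_2)+\Pi_H(w_2)\lrcorner\,\Pi_V(w_1)\big).$$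 The identification: given $\nabla\in[\nabla]$, $\iota_\nabla:T^*N\to\mathcal{M}\setminus\mathcal{Z}(\tau)$ sends $\xi\in T_p^*N$ to $[(\tau,\tau\xi)]$ for any $0\neq\tau\in\mathcal{E}(1)_p$, using the pair representation determined by $\nabla$. *)

theory Defs
  imports "HOL-Analysis.Analysis"
begin

section \<open>Smooth manifolds\<close>

text \<open>\<open>Ck_on k S f\<close>, for open \<open>S\<close>: \<open>f\<close> is \<open>k\<close> times continuously differentiable on \<open>S\<close>.\<close>

primrec Ck_on :: "nat \<Rightarrow> 'e::euclidean_space set \<Rightarrow> ('e \<Rightarrow> 'f::real_normed_vector) \<Rightarrow> bool" where
  "Ck_on 0 S f \<longleftrightarrow> continuous_on S f"
| "Ck_on (Suc k) S f \<longleftrightarrow> (\<forall>x\<in>S. f differentiable at x) \<and>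
     (\<forall>v. Ck_on k S (\<lambda>x. frechet_derivative f (at x) v))"

definition smooth_on :: "'e::euclidean_space set \<Rightarrow> ('e \<Rightarrow> 'f::real_normed_vector) \<Rightarrow> bool" where
  "smooth_on S f \<longleftrightarrow> (\<forall>k. Ck_on k S f)"

text \<open>A chart is a pair (domain, coordinate map); values of the map off the domain are irrelevant.\<close>

type_synonym ('a, 'e) chart = "'a set \<times> ('a \<Rightarrow> 'e)"

definition chart_inv :: "('a, 'e) chart \<Rightarrow> 'e \<Rightarrow> 'a" where
  "chart_inv c = inv_into (fst c) (snd c)"

definition chart_image :: "('a, 'e) chart \<Rightarrow> 'e set" where
  "chart_image c = snd c ` fst c"

definition transition :: "('a, 'e) chart \<Rightarrow> ('a, 'e) chart \<Rightarrow> 'e \<Rightarrow> 'e" where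
  "transition c d = snd d \<circ> chart_inv c"

definition dtransition ::
  "('a, 'e::euclidean_space) chart \<Rightarrow> ('a, 'e) chart \<Rightarrow> 'a \<Rightarrow> 'e \<Rightarrow> 'e" where
  "dtransition c d p = frechet_derivative (transition c d) (at (snd c p))"

definition points :: "('a, 'e) chart set \<Rightarrow> 'a set" where
  "points A = (\<Union>c\<in>A. fst c)"

definition atlas_topology :: "('a, 'e::euclidean_space) chart set \<Rightarrow> 'a topology" where
  "atlas_topology A = topology (\<lambda>S. S \<subseteq> points A \<and> (\<forall>c\<in>A. open (snd c ` (S \<inter> fst c))))"

definition smooth_atlas :: "('a, 'e::euclidean_space) chart set \<Rightarrow> bool" where
  "smooth_atlas A \<longleftrightarrow>
     (\<forall>c\<in>A. inj_on (snd c) (fst c) \<and> open (chart_image c)) \<and>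
     (\<forall>c\<in>A. \<forall>d\<in>A. open (snd c ` (fst c \<inter> fst d)) \<and>
        smooth_on (snd c ` (fst c \<inter> fst d)) (transition c d))"

definition smooth_manifold :: "('a, 'e::euclidean_space) chart set \<Rightarrow> bool" where
  "smooth_manifold A \<longleftrightarrow> smooth_atlas A \<and>
     Hausdorff_space (atlas_topology A) \<and> second_countable (atlas_topology A)"

definition open_submanifold :: "('a, 'e) chart set \<Rightarrow> 'a set \<Rightarrow> ('a, 'e) chart set" where
  "open_submanifold A W = {(fst c \<inter> W, snd c) | c. c \<in> A}"

definition smooth_map :: "('a, 'e::euclidean_space) chart set \<Rightarrow> ('b, 'f::euclidean_space) chart set
    \<Rightarrow> ('a \<Rightarrow> 'b) \<Rightarrow> bool" where
  "smooth_map A B F \<longleftrightarrow> (\<forall>c\<in>A. \<forall>d\<in>B.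
     open (snd c ` (fst c \<inter> F -` fst d)) \<and>
     smooth_on (snd c ` (fst c \<inter> F -` fst d)) (snd d \<circ> F \<circ> chart_inv c))"

definition diffeomorphism :: "('a, 'e::euclidean_space) chart set
    \<Rightarrow> ('b, 'f::euclidean_space) chart set \<Rightarrow> ('a \<Rightarrow> 'b) \<Rightarrow> bool" where
  "diffeomorphism A B F \<longleftrightarrow> bij_betw F (points A) (points B) \<and>
     smooth_map A B F \<and> smooth_map B A (inv_into (points A) F)"

definition jacobian_det ::
  "('a, real^'n) chart \<Rightarrow> ('a, real^'n) chart \<Rightarrow> 'a \<Rightarrow> real" where
  "jacobian_det c d p = det (jacobian (transition c d) (at (snd c p)))"

definition orientable :: "('a, real^'n) chart set \<Rightarrow> bool" where
  "orientable A \<longleftrightarrow> (\<exists>B. smooth_atlas (A \<union> B) \<and> points B = points A \<and>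
     (\<forall>c\<in>B. \<forall>d\<in>B. \<forall>p \<in> fst c \<inter> fst d. jacobian_det c d p > 0))"


section \<open>Tangent vectors, covectors, densities\<close>

text \<open>
  Tensors at a point are given by their components in all charts around the point, subject to the
  transformation law of the tensor in question. In charts that are not in the atlas or do not
  contain the point, the components are set to 0, so that equality of tensors is equality of
  functions. Covectors are identified with their component vectors: the value of the covector with
  components \<open>\<eta> c\<close> on the vector with components \<open>v c\<close> is \<open>\<eta> c \<bullet> v c\<close>.
\<close>

type_synonym ('a, 'e) tensor = "('a, 'e) chart \<Rightarrow> 'e"

definition supported_at :: "('a, 'e) chart set \<Rightarrow> 'a \<Rightarrow> (('a, 'e) chart \<Rightarrow> 'b::zero) \<Rightarrow> bool" where
  "supported_at A p v \<longleftrightarrow> (\<forall>c. \<not> (c \<in> A \<and> p \<in> fst c) \<longrightarrow> v c = 0)"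

definition tangent_space :: "('a, 'e::euclidean_space) chart set \<Rightarrow> 'a \<Rightarrow> ('a, 'e) tensor set" where
  "tangent_space A p = {v. supported_at A p v \<and>
     (\<forall>c\<in>A. \<forall>d\<in>A. p \<in> fst c \<inter> fst d \<longrightarrow> v d = dtransition c d p (v c))}"

definition cotangent_space :: "('a, 'e::euclidean_space) chart set \<Rightarrow> 'a \<Rightarrow> ('a, 'e) tensor set" where
  "cotangent_space A p = {\<eta>. supported_at A p \<eta> \<and>
     (\<forall>c\<in>A. \<forall>d\<in>A. p \<in> fst c \<inter> fst d \<longrightarrow> (\<forall>u. \<eta> d \<bullet> dtransition c d p u = \<eta> c \<bullet> u))}"

definition chart_at :: "('a, 'e) chart set \<Rightarrow> 'a \<Rightarrow> ('a, 'e) chart" where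
  "chart_at A p = (SOME c. c \<in> A \<and> p \<in> fst c)"

definition contract :: "('a, 'e::euclidean_space) chart set \<Rightarrow> 'a \<Rightarrow> ('a, 'e) tensor
    \<Rightarrow> ('a, 'e) tensor \<Rightarrow> real" where
  "contract A p v \<eta> = \<eta> (chart_at A p) \<bullet> v (chart_at A p)"

definition tangent_map :: "('a, 'e::euclidean_space) chart set \<Rightarrow> ('b, 'f::euclidean_space) chart set
    \<Rightarrow> ('a \<Rightarrow> 'b) \<Rightarrow> 'a \<Rightarrow> ('a, 'e) tensor \<Rightarrow> ('b, 'f) tensor" where
  "tangent_map A B F p v = (\<lambda>d. if d \<in> B \<and> F p \<in> fst d
     then frechet_derivative (snd d \<circ> F \<circ> chart_inv (chart_at A p))
            (at (snd (chart_at A p) p)) (v (chart_at A p))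
     else 0)"

definition velocity :: "('a, 'e::euclidean_space) chart set \<Rightarrow> (real \<Rightarrow> 'a) \<Rightarrow> ('a, 'e) tensor" where
  "velocity A \<gamma> = (\<lambda>c. if c \<in> A \<and> \<gamma> 0 \<in> fst c
     then vector_derivative (\<lambda>t. snd c (\<gamma> t)) (at 0) else 0)"

text \<open>The tangent vector at \<open>p\<close> whose component vector in the chart \<open>c\<close> is \<open>u\<close>.\<close>

definition coord_vec :: "('a, 'e::euclidean_space) chart set \<Rightarrow> ('a, 'e) chart \<Rightarrow> 'a \<Rightarrow> 'e
    \<Rightarrow> ('a, 'e) tensor" where
  "coord_vec A c p u = (\<lambda>d. if d \<in> A \<and> p \<in> fst d then dtransition c d p u else 0)"

definition one_form :: "('a, 'e::euclidean_space) chart set \<Rightarrow> ('a \<Rightarrow> ('a, 'e) tensor) \<Rightarrow> bool" where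
  "one_form A \<Upsilon> \<longleftrightarrow> (\<forall>p \<in> points A. \<Upsilon> p \<in> cotangent_space A p) \<and>
     (\<forall>c\<in>A. smooth_on (chart_image c) (\<lambda>x. \<Upsilon> (chart_inv c x) c))"

definition cotangent_chart ::
  "('a, 'e::euclidean_space) chart set \<Rightarrow> ('a, 'e) chart \<Rightarrow> ('a \<times> ('a, 'e) tensor, 'e \<times> 'e) chart" where
  "cotangent_chart A c =
     ({(p, \<xi>). p \<in> fst c \<and> \<xi> \<in> cotangent_space A p}, \<lambda>(p, \<xi>). (snd c p, \<xi> c))"

definition cotangent_atlas ::
  "('a, 'e::euclidean_space) chart set \<Rightarrow> ('a \<times> ('a, 'e) tensor, 'e \<times> 'e) chart set" where
  "cotangent_atlas A = cotangent_chart A ` A"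

text \<open>
  A nowhere vanishing \<open>n\<close>-form \<open>f dx\<^sup>1 \<and> \<dots> \<and> dx\<^sup>n\<close> has component \<open>f / det J\<close> after a change of
  coordinates with Jacobian \<open>J\<close>. The fibre of \<open>\<E>(1)\<close> is the \<open>-2(n+1)\<close>-th root of the (canonically
  oriented) square of the line of \<open>n\<close>-forms, so its elements have components multiplied by
  \<open>\<bar>det J\<bar> powr (1/(n+1))\<close>.
\<close>

definition weight_one ::
  "('a, real^'n) chart \<Rightarrow> ('a, real^'n) chart \<Rightarrow> 'a \<Rightarrow> real" where
  "weight_one c d p = \<bar>jacobian_det c d p\<bar> powr (1 / (real CARD('n) + 1))"

definition density_fibre :: "('a, real^'n) chart set \<Rightarrow> 'a \<Rightarrow> (('a, real^'n) chart \<Rightarrow> real) set" where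
  "density_fibre A p = {\<sigma>. supported_at A p \<sigma> \<and>
     (\<forall>c\<in>A. \<forall>d\<in>A. p \<in> fst c \<inter> fst d \<longrightarrow> \<sigma> d = weight_one c d p * \<sigma> c)}"

text \<open>The fibre of \<open>T\<^sup>*N(1) = T\<^sup>*N \<otimes> \<E>(1)\<close>.\<close>

definition weighted_cotangent_space ::
  "('a, real^'n) chart set \<Rightarrow> 'a \<Rightarrow> ('a, real^'n) tensor set" where
  "weighted_cotangent_space A p = {\<mu>. supported_at A p \<mu> \<and>
     (\<forall>c\<in>A. \<forall>d\<in>A. p \<in> fst c \<inter> fst d \<longrightarrow>
        (\<forall>u. \<mu> d \<bullet> dtransition c d p u = weight_one c d p * (\<mu> c \<bullet> u)))}"


section \<open>Affine connections and projective structures\<close>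

text \<open>
  An affine connection is given by its Christoffel symbols in every chart: \<open>D c x u v\<close> is the
  vector \<open>\<Gamma>\<^sup>k\<^sub>i\<^sub>j(x) u\<^sup>i v\<^sup>j \<partial>\<^sub>k\<close> in the chart \<open>c\<close>. The transformation law says that the covariant
  derivative \<open>cov_deriv\<close> of vector fields does not depend on the chart.
\<close>

type_synonym ('a, 'e) conn = "('a, 'e) chart \<Rightarrow> 'e \<Rightarrow> 'e \<Rightarrow> 'e \<Rightarrow> 'e"

definition affine_connection :: "('a, 'e::euclidean_space) chart set \<Rightarrow> ('a, 'e) conn \<Rightarrow> bool" where
  "affine_connection A D \<longleftrightarrow>
     (\<forall>c x. \<not> (c \<in> A \<and> x \<in> chart_image c) \<longrightarrow> (\<forall>u v. D c x u v = 0)) \<and>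
     (\<forall>c\<in>A. \<forall>x \<in> chart_image c. bilinear (D c x)) \<and>
     (\<forall>c\<in>A. \<forall>u v. smooth_on (chart_image c) (\<lambda>x. D c x u v)) \<and>
     (\<forall>c\<in>A. \<forall>d\<in>A. \<forall>p \<in> fst c \<inter> fst d. \<forall>u v.
        D d (snd d p) (dtransition c d p u) (dtransition c d p v) =
        dtransition c d p (D c (snd c p) u v) -
        frechet_derivative (\<lambda>y. frechet_derivative (transition c d) (at y) v) (at (snd c p)) u)"

definition torsion_free :: "('a, 'e::euclidean_space) chart set \<Rightarrow> ('a, 'e) conn \<Rightarrow> bool" where
  "torsion_free A D \<longleftrightarrow> (\<forall>c\<in>A. \<forall>x \<in> chart_image c. \<forall>u v. D c x u v = D c x v u)"

definition cov_deriv ::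
  "('e \<Rightarrow> 'e \<Rightarrow> 'e \<Rightarrow> 'e) \<Rightarrow> ('e::euclidean_space \<Rightarrow> 'e) \<Rightarrow> ('e \<Rightarrow> 'e) \<Rightarrow> 'e \<Rightarrow> 'e" where
  "cov_deriv \<Gamma> X Y x = frechet_derivative Y (at x) (X x) + \<Gamma> x (X x) (Y x)"

text \<open>\<open>E = D + \<Upsilon> \<otimes> Id + Id \<otimes> \<Upsilon>\<close>, on local vector fields \<open>X\<close>, \<open>Y\<close>.\<close>

definition projective_change :: "('a, 'e::euclidean_space) chart set \<Rightarrow> ('a \<Rightarrow> ('a, 'e) tensor)
    \<Rightarrow> ('a, 'e) conn \<Rightarrow> ('a, 'e) conn \<Rightarrow> bool" where
  "projective_change A \<Upsilon> D E \<longleftrightarrow> one_form A \<Upsilon> \<and>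
     (\<forall>c\<in>A. \<forall>X Y. smooth_on (chart_image c) X \<longrightarrow> smooth_on (chart_image c) Y \<longrightarrow>
        (\<forall>x \<in> chart_image c. cov_deriv (E c) X Y x = cov_deriv (D c) X Y x
           + (\<Upsilon> (chart_inv c x) c \<bullet> X x) *\<^sub>R Y x + (\<Upsilon> (chart_inv c x) c \<bullet> Y x) *\<^sub>R X x))"

definition projective_structure ::
  "('a, 'e::euclidean_space) chart set \<Rightarrow> ('a, 'e) conn set \<Rightarrow> bool" where
  "projective_structure A P \<longleftrightarrow> (\<exists>D. affine_connection A D \<and> torsion_free A D \<and>
     P = {E. affine_connection A E \<and> torsion_free A E \<and> (\<exists>\<Upsilon>. projective_change A \<Upsilon> D E)})"

text \<open>
  \<open>ricci \<Gamma> x u v = R\<^sub>i\<^sub>j u\<^sup>i v\<^sup>j\<close> with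
  \<open>R\<^sub>i\<^sub>j = \<partial>\<^sub>k \<Gamma>\<^sup>k\<^sub>i\<^sub>j - \<partial>\<^sub>i \<Gamma>\<^sup>k\<^sub>k\<^sub>j + \<Gamma>\<^sup>k\<^sub>k\<^sub>l \<Gamma>\<^sup>l\<^sub>i\<^sub>j - \<Gamma>\<^sup>k\<^sub>i\<^sub>l \<Gamma>\<^sup>l\<^sub>k\<^sub>j\<close>.
\<close>

definition ricci :: "('e \<Rightarrow> 'e \<Rightarrow> 'e \<Rightarrow> 'e) \<Rightarrow> 'e::euclidean_space \<Rightarrow> 'e \<Rightarrow> 'e \<Rightarrow> real" where
  "ricci \<Gamma> x u v = (\<Sum>k\<in>Basis.
      (frechet_derivative (\<lambda>y. \<Gamma> y u v) (at x) k - frechet_derivative (\<lambda>y. \<Gamma> y k v) (at x) u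
       + \<Gamma> x k (\<Gamma> x u v) - \<Gamma> x u (\<Gamma> x k v)) \<bullet> k)"

definition schouten :: "('e \<Rightarrow> 'e \<Rightarrow> 'e \<Rightarrow> 'e) \<Rightarrow> 'e::euclidean_space \<Rightarrow> 'e \<Rightarrow> 'e \<Rightarrow> real" where
  "schouten \<Gamma> x u v =
     1 / (real DIM('e) - 1) * ((ricci \<Gamma> x u v + ricci \<Gamma> x v u) / 2) +
     1 / (real DIM('e) + 1) * ((ricci \<Gamma> x u v - ricci \<Gamma> x v u) / 2)"


section \<open>The cotractor bundle and the tractor connection\<close>

text \<open>
  \<open>U D c\<close> is the pair \<open>(\<sigma>, \<mu>)\<close> representing the cotractor \<open>U\<close> with respect to the connection
  \<open>D\<close> of the projective class, in components with respect to the chart \<open>c\<close>.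
\<close>

type_synonym ('a, 'e) cotractor = "('a, 'e) conn \<Rightarrow> ('a, 'e) chart \<Rightarrow> real \<times> 'e"

definition cotractor_fibre :: "('a, real^'n) chart set \<Rightarrow> ('a, real^'n) conn set \<Rightarrow> 'a
    \<Rightarrow> ('a, real^'n) cotractor set" where
  "cotractor_fibre A P p = {U.
     (\<forall>D c. D \<notin> P \<longrightarrow> U D c = 0) \<and>
     (\<forall>D\<in>P. (\<lambda>c. fst (U D c)) \<in> density_fibre A p \<and>
             (\<lambda>c. snd (U D c)) \<in> weighted_cotangent_space A p) \<and>
     (\<forall>D\<in>P. \<forall>E\<in>P. \<forall>\<Upsilon>. projective_change A \<Upsilon> D E \<longrightarrow>
        (\<forall>c\<in>A. p \<in> fst c \<longrightarrow>
           U E c = (fst (U D c), snd (U D c) + fst (U D c) *\<^sub>R \<Upsilon> p c)))}"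

definition cotractor_chart :: "('a, real^'n) chart set \<Rightarrow> ('a, real^'n) conn set
    \<Rightarrow> ('a, real^'n) conn \<Rightarrow> ('a, real^'n) chart
    \<Rightarrow> ('a \<times> ('a, real^'n) cotractor, (real^'n) \<times> (real \<times> (real^'n))) chart" where
  "cotractor_chart A P D c =
     ({(p, U). p \<in> fst c \<and> U \<in> cotractor_fibre A P p}, \<lambda>(p, U). (snd c p, U D c))"

definition cotractor_atlas :: "('a, real^'n) chart set \<Rightarrow> ('a, real^'n) conn set
    \<Rightarrow> ('a \<times> ('a, real^'n) cotractor, (real^'n) \<times> (real \<times> (real^'n))) chart set" where
  "cotractor_atlas A P = {cotractor_chart A P D c | D c. D \<in> P \<and> c \<in> A}"

text \<open>The canonical density \<open>\<tau>(U) = X \<lrcorner> U\<close>; the first slot does not depend on the connection.\<close>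

definition tau :: "('a, 'e) conn set \<Rightarrow> ('a, 'e) cotractor \<Rightarrow> ('a, 'e) chart \<Rightarrow> real" where
  "tau P U = (\<lambda>c. fst (U (SOME D. D \<in> P) c))"

text \<open>
  \<open>tractor_deriv \<Gamma> s x v = v\<^sup>i (\<nabla>\<^sub>i \<sigma> - \<mu>\<^sub>i, \<nabla>\<^sub>i \<mu>\<^sub>j + P\<^sub>i\<^sub>j \<sigma>)\<close> for the local representation \<open>s = (\<sigma>, \<mu>)\<close>
  of a section. On \<open>\<E>(1)\<close> the connection acts by \<open>\<nabla>\<^sub>i \<sigma> = \<partial>\<^sub>i \<sigma> + \<Gamma>\<^sup>k\<^sub>i\<^sub>k \<sigma> / (n+1)\<close>, as induced from
  \<open>\<nabla>\<^sub>i f = \<partial>\<^sub>i f - \<Gamma>\<^sup>k\<^sub>i\<^sub>k f\<close> on \<open>n\<close>-forms, and on \<open>T\<^sup>*N(1)\<close> accordingly.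
\<close>

definition weight_one_form :: "('e \<Rightarrow> 'e \<Rightarrow> 'e \<Rightarrow> 'e) \<Rightarrow> 'e::euclidean_space \<Rightarrow> 'e \<Rightarrow> real" where
  "weight_one_form \<Gamma> x v = (\<Sum>k\<in>Basis. \<Gamma> x v k \<bullet> k) / (real DIM('e) + 1)"

definition density_deriv ::
  "('e \<Rightarrow> 'e \<Rightarrow> 'e \<Rightarrow> 'e) \<Rightarrow> ('e \<Rightarrow> real) \<Rightarrow> 'e::euclidean_space \<Rightarrow> 'e \<Rightarrow> real" where
  "density_deriv \<Gamma> \<sigma> x v = frechet_derivative \<sigma> (at x) v + weight_one_form \<Gamma> x v * \<sigma> x"

definition weighted_covector_deriv ::
  "('e \<Rightarrow> 'e \<Rightarrow> 'e \<Rightarrow> 'e) \<Rightarrow> ('e \<Rightarrow> 'e) \<Rightarrow> 'e::euclidean_space \<Rightarrow> 'e \<Rightarrow> 'e" where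
  "weighted_covector_deriv \<Gamma> \<mu> x v =
     (\<Sum>j\<in>Basis. (frechet_derivative \<mu> (at x) v \<bullet> j - \<mu> x \<bullet> \<Gamma> x v j
                + weight_one_form \<Gamma> x v * (\<mu> x \<bullet> j)) *\<^sub>R j)"

definition tractor_deriv ::
  "('e \<Rightarrow> 'e \<Rightarrow> 'e \<Rightarrow> 'e) \<Rightarrow> ('e \<Rightarrow> real \<times> 'e) \<Rightarrow> 'e::euclidean_space \<Rightarrow> 'e \<Rightarrow> real \<times> 'e" where
  "tractor_deriv \<Gamma> s x v =
     (density_deriv \<Gamma> (\<lambda>y. fst (s y)) x v - snd (s x) \<bullet> v,
      weighted_covector_deriv \<Gamma> (\<lambda>y. snd (s y)) x v
        + (\<Sum>j\<in>Basis. (schouten \<Gamma> x v j * fst (s x)) *\<^sub>R j))"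

definition section_near :: "('a, real^'n) chart set \<Rightarrow> ('a, real^'n) conn set \<Rightarrow> 'a
    \<Rightarrow> ('a \<Rightarrow> ('a, real^'n) cotractor) \<Rightarrow> bool" where
  "section_near A P p s \<longleftrightarrow> (\<exists>W. openin (atlas_topology A) W \<and> p \<in> W \<and>
     (\<forall>q\<in>W. s q \<in> cotractor_fibre A P q) \<and>
     (\<forall>D\<in>P. \<forall>c\<in>A. smooth_on (snd c ` (W \<inter> fst c)) (\<lambda>x. s (chart_inv c x) D c)))"

text \<open>The horizontal subspace at \<open>U\<close>: derivatives of sections along directions in which they are parallel.\<close>

definition horizontal :: "('a, real^'n) chart set \<Rightarrow> ('a, real^'n) conn set \<Rightarrow> 'a
    \<Rightarrow> ('a, real^'n) cotractor
    \<Rightarrow> ('a \<times> ('a, real^'n) cotractor, (real^'n) \<times> (real \<times> (real^'n))) tensor set" where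
  "horizontal A P p U = {tangent_map A (cotractor_atlas A P) (\<lambda>q. (q, s q)) p v | s v.
     section_near A P p s \<and> s p = U \<and> v \<in> tangent_space A p \<and>
     (\<forall>D\<in>P. \<forall>c\<in>A. p \<in> fst c \<longrightarrow>
        tractor_deriv (D c) (\<lambda>x. s (chart_inv c x) D c) (snd c p) (v c) = 0)}"


section \<open>The projectivised cotractor bundle\<close>

definition nonzero :: "('a, 'e::euclidean_space) cotractor \<Rightarrow> bool" where
  "nonzero U \<longleftrightarrow> (\<exists>D c. U D c \<noteq> 0)"

definition line :: "('a, 'e::euclidean_space) cotractor \<Rightarrow> ('a, 'e) cotractor set" where
  "line U = {\<lambda>D c. r *\<^sub>R U D c | r. True}"

type_synonym ('a, 'e) proj_point = "'a \<times> ('a, 'e) cotractor set"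

definition proj :: "'a \<times> ('a, 'e::euclidean_space) cotractor \<Rightarrow> ('a, 'e) proj_point" where
  "proj = (\<lambda>(p, U). (p, line U))"

definition proj_cotractor :: "('a, real^'n) chart set \<Rightarrow> ('a, real^'n) conn set
    \<Rightarrow> ('a, real^'n) proj_point set" where
  "proj_cotractor A P =
     {proj (p, U) | p U. p \<in> points A \<and> U \<in> cotractor_fibre A P p \<and> nonzero U}"

definition zero_locus :: "('a, real^'n) chart set \<Rightarrow> ('a, real^'n) conn set
    \<Rightarrow> ('a, real^'n) proj_point set" where
  "zero_locus A P = {proj (p, U) | p U. p \<in> points A \<and> U \<in> cotractor_fibre A P p \<and> nonzero U \<and>
     tau P U = (\<lambda>c. 0)}"

text \<open>
  Affine coordinates on the projective space of \<open>\<real> \<times> \<real>\<^sup>n\<close>: on lines not orthogonal to the basis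
  vector \<open>b\<close>, take the representative \<open>w\<close> with \<open>w \<bullet> b = 1\<close> and drop its component along \<open>b\<close>. For
  \<open>b = (1, 0)\<close> what remains is \<open>\<mu>\<close>; for \<open>b = (0, e)\<close> it is \<open>\<mu>\<close> with \<open>\<sigma>\<close> in place of the component
  along \<open>e\<close>. Both cases are covered by the formula below.
\<close>

definition drop_component :: "real \<times> 'e \<Rightarrow> real \<times> 'e \<Rightarrow> 'e::euclidean_space" where
  "drop_component b w = snd w + (fst w - snd w \<bullet> snd b) *\<^sub>R snd b"

definition proj_chart :: "('a, real^'n) chart set \<Rightarrow> ('a, real^'n) conn set
    \<Rightarrow> ('a, real^'n) conn \<Rightarrow> ('a, real^'n) chart \<Rightarrow> real \<times> (real^'n)
    \<Rightarrow> (('a, real^'n) proj_point, (real^'n) \<times> (real^'n)) chart" where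
  "proj_chart A P D c b =
     ({proj (p, U) | p U. p \<in> fst c \<and> U \<in> cotractor_fibre A P p \<and> U D c \<bullet> b \<noteq> 0},
      \<lambda>(p, L). (snd c p, drop_component b (SOME w. \<exists>U\<in>L. w = U D c \<and> w \<bullet> b = 1)))"

definition proj_atlas :: "('a, real^'n) chart set \<Rightarrow> ('a, real^'n) conn set
    \<Rightarrow> (('a, real^'n) proj_point, (real^'n) \<times> (real^'n)) chart set" where
  "proj_atlas A P = {proj_chart A P D c b | D c b. D \<in> P \<and> c \<in> A \<and> b \<in> Basis}"


section \<open>The metric\<close>

definition proj_horizontal :: "('a, real^'n) chart set \<Rightarrow> ('a, real^'n) conn set
    \<Rightarrow> ('a, real^'n) proj_point
    \<Rightarrow> (('a, real^'n) proj_point, (real^'n) \<times> (real^'n)) tensor set" where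
  "proj_horizontal A P m =
     {tangent_map (cotractor_atlas A P) (proj_atlas A P) proj (fst m, U) w | U w.
        U \<in> snd m \<and> nonzero U \<and> w \<in> horizontal A P (fst m) U}"

text \<open>
  The element of \<open>V\<^bsub>[U]\<^esub> = Hom(\<langle>U\<rangle>, \<T>\<^sup>*\<^sub>p/\<langle>U\<rangle>)\<close> mapping \<open>U\<close> to the class of \<open>B\<close>, as a tangent vector:
  it is the velocity of the curve \<open>t \<mapsto> [U + t B]\<close>.
\<close>

definition vertical_vec :: "('a, real^'n) chart set \<Rightarrow> ('a, real^'n) conn set
    \<Rightarrow> 'a \<Rightarrow> ('a, real^'n) cotractor \<Rightarrow> ('a, real^'n) cotractor
    \<Rightarrow> (('a, real^'n) proj_point, (real^'n) \<times> (real^'n)) tensor" where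
  "vertical_vec A P p U B = velocity (proj_atlas A P) (\<lambda>t. proj (p, \<lambda>D c. U D c + t *\<^sub>R B D c))"

text \<open>The product \<open>\<tau> \<eta>\<close> of a density and a covector, as an element of \<open>T\<^sup>*\<^sub>pN(1) \<subset> \<T>\<^sup>*\<^sub>p\<close>.\<close>

definition weighted_cotractor :: "('a, 'e::euclidean_space) conn set \<Rightarrow> (('a, 'e) chart \<Rightarrow> real)
    \<Rightarrow> ('a, 'e) tensor \<Rightarrow> ('a, 'e) cotractor" where
  "weighted_cotractor P \<tau> \<eta> = (\<lambda>D c. if D \<in> P then (0, \<tau> c *\<^sub>R \<eta> c) else 0)"

definition Pi_H :: "('a, real^'n) chart set \<Rightarrow> ('a, real^'n) conn set \<Rightarrow> ('a, real^'n) proj_point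
    \<Rightarrow> (('a, real^'n) proj_point, (real^'n) \<times> (real^'n)) tensor \<Rightarrow> ('a, real^'n) tensor" where
  "Pi_H A P m w = tangent_map (proj_atlas A P) A fst m w"

text \<open>
  The covector \<open>\<eta>\<close> is \<open>A(U)/\<tau>(U)\<close>, where \<open>A\<close> is the vertical part of \<open>w\<close>.
\<close>

definition Pi_V :: "('a, real^'n) chart set \<Rightarrow> ('a, real^'n) conn set \<Rightarrow> ('a, real^'n) proj_point
    \<Rightarrow> (('a, real^'n) proj_point, (real^'n) \<times> (real^'n)) tensor \<Rightarrow> ('a, real^'n) tensor" where
  "Pi_V A P m w = (THE \<eta>. \<eta> \<in> cotangent_space A (fst m) \<and>
     (\<exists>h \<in> proj_horizontal A P m. \<exists>U \<in> snd m. nonzero U \<and>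
        w = (\<lambda>e. h e + vertical_vec A P (fst m) U (weighted_cotractor P (tau P U) \<eta>) e)))"

definition tractor_metric :: "('a, real^'n) chart set \<Rightarrow> ('a, real^'n) conn set
    \<Rightarrow> ('a, real^'n) proj_point
    \<Rightarrow> (('a, real^'n) proj_point, (real^'n) \<times> (real^'n)) tensor
    \<Rightarrow> (('a, real^'n) proj_point, (real^'n) \<times> (real^'n)) tensor \<Rightarrow> real" where
  "tractor_metric A P m w1 w2 =
     1 / 2 * (contract A (fst m) (Pi_H A P m w1) (Pi_V A P m w2)
            + contract A (fst m) (Pi_H A P m w2) (Pi_V A P m w1))"

definition iota :: "('a, real^'n) chart set \<Rightarrow> ('a, real^'n) conn set \<Rightarrow> ('a, real^'n) conn
    \<Rightarrow> 'a \<times> ('a, real^'n) tensor \<Rightarrow> ('a, real^'n) proj_point" where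
  "iota A P D = (\<lambda>(p, \<xi>). THE m. \<exists>\<tau> U. \<tau> \<in> density_fibre A p \<and> \<tau> \<noteq> (\<lambda>c. 0) \<and>
     U \<in> cotractor_fibre A P p \<and> (\<forall>c. U D c = (\<tau> c, \<tau> c *\<^sub>R \<xi> c)) \<and> m = proj (p, U))"


section \<open>Pseudo-Riemannian geometry on an open subset of a manifold\<close>

definition metric_coords :: "('a, 'e::euclidean_space) chart set
    \<Rightarrow> ('a \<Rightarrow> ('a, 'e) tensor \<Rightarrow> ('a, 'e) tensor \<Rightarrow> real)
    \<Rightarrow> ('a, 'e) chart \<Rightarrow> 'e \<Rightarrow> 'e \<Rightarrow> 'e \<Rightarrow> real" where
  "metric_coords A g c x u v =
     g (chart_inv c x) (coord_vec A c (chart_inv c x) u) (coord_vec A c (chart_inv c x) v)"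

definition neutral_form :: "('e::euclidean_space \<Rightarrow> 'e \<Rightarrow> real) \<Rightarrow> bool" where
  "neutral_form B \<longleftrightarrow> bilinear B \<and> (\<forall>u v. B u v = B v u) \<and>
     (\<forall>u. (\<forall>v. B u v = 0) \<longrightarrow> u = 0) \<and>
     (\<exists>S. subspace S \<and> 2 * dim S = DIM('e) \<and> (\<forall>u\<in>S. u \<noteq> 0 \<longrightarrow> B u u > 0)) \<and>
     (\<exists>S. subspace S \<and> 2 * dim S = DIM('e) \<and> (\<forall>u\<in>S. u \<noteq> 0 \<longrightarrow> B u u < 0))"

definition neutral_metric_on :: "('a, 'e::euclidean_space) chart set \<Rightarrow> 'a set
    \<Rightarrow> ('a \<Rightarrow> ('a, 'e) tensor \<Rightarrow> ('a, 'e) tensor \<Rightarrow> real) \<Rightarrow> bool" where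
  "neutral_metric_on A W g \<longleftrightarrow> (\<forall>c\<in>A.
     (\<forall>x \<in> snd c ` (fst c \<inter> W). neutral_form (metric_coords A g c x)) \<and>
     (\<forall>u v. smooth_on (snd c ` (fst c \<inter> W)) (\<lambda>x. metric_coords A g c x u v)))"

text \<open>
  The Christoffel symbols of the Levi-Civita connection,
  \<open>G\<^sub>l\<^sub>k \<Gamma>\<^sup>k\<^sub>i\<^sub>j = (\<partial>\<^sub>i G\<^sub>j\<^sub>l + \<partial>\<^sub>j G\<^sub>i\<^sub>l - \<partial>\<^sub>l G\<^sub>i\<^sub>j) / 2\<close>.
\<close>

definition levi_civita :: "('e::euclidean_space \<Rightarrow> 'e \<Rightarrow> 'e \<Rightarrow> real) \<Rightarrow> 'e \<Rightarrow> 'e \<Rightarrow> 'e \<Rightarrow> 'e" where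
  "levi_civita G x u v = (THE w. \<forall>z. G x w z =
     (frechet_derivative (\<lambda>y. G y v z) (at x) u + frechet_derivative (\<lambda>y. G y u z) (at x) v
      - frechet_derivative (\<lambda>y. G y u v) (at x) z) / 2)"

definition scalar_curvature :: "('e::euclidean_space \<Rightarrow> 'e \<Rightarrow> 'e \<Rightarrow> real) \<Rightarrow> 'e \<Rightarrow> real" where
  "scalar_curvature G x =
     (\<Sum>i\<in>Basis. (THE w. \<forall>z. G x w z = ricci (levi_civita G) x i z) \<bullet> i)"

definition einstein_on :: "('a, 'e::euclidean_space) chart set \<Rightarrow> 'a set
    \<Rightarrow> ('a \<Rightarrow> ('a, 'e) tensor \<Rightarrow> ('a, 'e) tensor \<Rightarrow> real) \<Rightarrow> bool" where
  "einstein_on A W g \<longleftrightarrow> (\<exists>\<Lambda>. \<forall>c\<in>A. \<forall>x \<in> snd c ` (fst c \<inter> W). \<forall>u v.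
     ricci (levi_civita (metric_coords A g c)) x u v = \<Lambda> * metric_coords A g c x u v)"

definition sym_prod :: "('v \<Rightarrow> real) \<Rightarrow> ('v \<Rightarrow> real) \<Rightarrow> 'v \<Rightarrow> 'v \<Rightarrow> real" (infixl \<open>\<odot>\<close> 70) where
  "(\<alpha> \<odot> \<beta>) a b = (\<alpha> a * \<beta> b + \<beta> a * \<alpha> b) / 2"

text \<open>The coordinate one-forms \<open>dx\<^sup>i\<close> and \<open>d\<xi>\<^sub>i\<close> on \<open>T\<^sup>*N\<close> induced by a chart of \<open>N\<close>.\<close>

definition d_x :: "('a, real^'n) chart set \<Rightarrow> ('a, real^'n) chart \<Rightarrow> 'n
    \<Rightarrow> ('a \<times> ('a, real^'n) tensor, (real^'n) \<times> (real^'n)) tensor \<Rightarrow> real" where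
  "d_x A c i a = fst (a (cotangent_chart A c)) $ i"

definition d_xi :: "('a, real^'n) chart set \<Rightarrow> ('a, real^'n) chart \<Rightarrow> 'n
    \<Rightarrow> ('a \<times> ('a, real^'n) tensor, (real^'n) \<times> (real^'n)) tensor \<Rightarrow> real" where
  "d_xi A c i a = snd (a (cotangent_chart A c)) $ i"

definition christoffel :: "(real^'n \<Rightarrow> real^'n \<Rightarrow> real^'n \<Rightarrow> real^'n) \<Rightarrow> real^'n
    \<Rightarrow> 'n \<Rightarrow> 'n \<Rightarrow> 'n \<Rightarrow> real" where
  "christoffel \<Gamma> x k i j = \<Gamma> x (axis i 1) (axis j 1) $ k"

definition schouten_sym :: "(real^'n \<Rightarrow> real^'n \<Rightarrow> real^'n \<Rightarrow> real^'n) \<Rightarrow> real^'n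
    \<Rightarrow> 'n \<Rightarrow> 'n \<Rightarrow> real" where
  "schouten_sym \<Gamma> x i j =
     (schouten \<Gamma> x (axis i 1) (axis j 1) + schouten \<Gamma> x (axis j 1) (axis i 1)) / 2"

end

theory Submission
  imports Defs
begin

text \<open>
  Over a chart of \<open>N\<close> and for \<open>\<nabla> \<in> [\<nabla>]\<close>, the points with \<open>\<tau> \<noteq> 0\<close> have coordinates \<open>(x, \<xi>)\<close> with \<open>\<xi> = \<mu>/\<sigma>\<close>. Dividing
  the equations of a parallel section by \<open>\<sigma>\<close>, a horizontal vector over \<open>v\<close> has fibre component
  \<open>v\<^sup>i (\<Gamma>\<^sup>k\<^sub>i\<^sub>j \<xi>\<^sub>k - \<xi>\<^sub>i \<xi>\<^sub>j - P\<^sub>i\<^sub>j)\<close>, and pairing with the vertical part gives the coordinate formula for the metric.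
  Such vectors exist because parallelism at a point depends neither on the chart nor on the connection in
  the class: the Ricci tensor is a tensor, the weight contributes the trace of the second derivative of the
  transition map by Jacobi's formula, and the projective change of the Schouten tensor cancels that of the
  rest. In these coordinates the metric has the form \<open>d\<xi>\<^sub>i \<odot> dx\<^sup>i + T\<^sub>i\<^sub>j dx\<^sup>i \<odot> dx\<^sup>j\<close> with \<open>T\<close> quadratic in \<open>\<xi>\<close>; its
  Levi-Civita connection is explicit and trace-free, and its Ricci tensor is \<open>2(n+1)\<close> times the metric. The
  remaining charts of the projectivised bundle are reached by naturality of the Levi-Civita connection and of
  the Ricci tensor.
\<close>

section \<open>Smooth functions\<close>

text \<open>The metric is built from definite descriptions over tensors that have components in all
  charts at once, and \<open>horizontal\<close> asks a section to be parallel for every connection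
  of the class in every chart. Uniqueness of the vertical part can be tested in one chart; existence
  needs one section that meets all these conditions together. Only parallelism at a single point is
  asked for, so the curvature of the tractor connection raises no obstruction. For each
  \<open>D\<close> and \<open>c\<close> the metric is computed separately in the chart with
  \<open>b = (1, 0)\<close>. The part of any chart \<open>pch D c b\<close> outside the zero locus
  is its overlap with that chart, so one transition map at a time suffices. As to the constant
  2(n+1): the pairing term gets n from a trace over the fibre and 1 from a contraction, while the
  Schouten term collects 4 from fibre derivatives and 2(n-1) from the Ricci tensor of
  \<open>\<Gamma>\<close>. The normalisation of the Schouten tensor makes the two agree. The scalar
  curvature is then 4n(n+1).\<close>

lemma frechet_derivative_eqI:
  "(f has_derivative f') (at x) \<Longrightarrow> frechet_derivative f (at x) = f'"
  by (rule frechet_derivative_at[symmetric])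

lemma has_derivative_frechet:
  "f differentiable at x \<Longrightarrow> (f has_derivative frechet_derivative f (at x)) (at x)"
  by (simp add: frechet_derivative_works)

lemma has_derivative_cong_open:
  assumes "open S" "x \<in> S" "\<And>y. y \<in> S \<Longrightarrow> f y = g y"
  shows "(f has_derivative f') (at x) \<longleftrightarrow> (g has_derivative f') (at x)"
  using assms has_derivative_transform_within_open[of f f' x UNIV S g]
    has_derivative_transform_within_open[of g f' x UNIV S f] by metis

lemma frechet_derivative_cong_open:
  assumes "open S" "x \<in> S" "\<And>y. y \<in> S \<Longrightarrow> f y = g y"
  shows "frechet_derivative f (at x) = frechet_derivative g (at x)"
  unfolding frechet_derivative_def using has_derivative_cong_open[OF assms] by simp

lemma differentiable_cong_open:
  assumes "open S" "x \<in> S" "\<And>y. y \<in> S \<Longrightarrow> f y = g y"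
  shows "f differentiable at x \<longleftrightarrow> g differentiable at x"
  unfolding differentiable_def using has_derivative_cong_open[OF assms] by simp

section \<open>Functions of class C^k on open sets\<close>

lemma Ck_on_cong:
  assumes "open S" "\<And>y. y \<in> S \<Longrightarrow> f y = g y"
  shows "Ck_on k S f \<longleftrightarrow> Ck_on k S g"
  using assms(2)
proof (induction k arbitrary: f g)
  case 0
  then show ?case by (simp cong: continuous_on_cong)
next
  case (Suc k)
  have "Ck_on k S (\<lambda>x. frechet_derivative f (at x) v)
      \<longleftrightarrow> Ck_on k S (\<lambda>x. frechet_derivative g (at x) v)" for v
    by (rule Suc.IH) (simp add: frechet_derivative_cong_open[OF assms(1) _ Suc.prems])
  then show ?case
    using differentiable_cong_open[OF assms(1) _ Suc.prems] by auto
qed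

lemma Ck_on_subset: "Ck_on k S f \<Longrightarrow> T \<subseteq> S \<Longrightarrow> Ck_on k T f"
  by (induction k arbitrary: f) (auto intro: continuous_on_subset)

text \<open>\<open>Ck_on\<close> asks for continuity only at the bottom of its recursion. For k = 0
  differentiability supplies it, and the recursion on directional derivatives passes this
  upwards.\<close>

lemma Ck_on_SucD: "Ck_on (Suc k) S f \<Longrightarrow> Ck_on k S f"
proof (induction k arbitrary: f)
  case 0
  then show ?case
    by (auto intro!: differentiable_imp_continuous_on differentiable_at_imp_differentiable_on)
next
  case (Suc k)
  then show ?case by auto
qed

lemma Ck_on_const: "Ck_on k S (\<lambda>x. c)"
  by (induction k arbitrary: c) auto

lemma Ck_on_bounded_linear:
  assumes "open S" "bounded_linear L" "Ck_on k S f"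
  shows "Ck_on k S (\<lambda>x. L (f x))"
  using assms(3)
proof (induction k arbitrary: f)
  case 0
  then show ?case using assms(2) by (simp add: bounded_linear.continuous_on)
next
  case (Suc k)
  have d: "((\<lambda>x. L (f x)) has_derivative (\<lambda>v. L (frechet_derivative f (at x) v))) (at x)"
    if "x \<in> S" for x
    using Suc.prems that by (intro bounded_linear.has_derivative[OF assms(2)] has_derivative_frechet) auto
  have "Ck_on k S (\<lambda>x. frechet_derivative (\<lambda>x. L (f x)) (at x) v)" for v
    by (subst Ck_on_cong[OF assms(1), where g = "\<lambda>x. L (frechet_derivative f (at x) v)"])
      (use Suc in \<open>auto simp: frechet_derivative_eqI[OF d]\<close>)
  then show ?case using d by (auto simp: differentiable_def)
qed

lemma Ck_on_add:
  assumes "open S" "Ck_on k S f" "Ck_on k S g"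
  shows "Ck_on k S (\<lambda>x. f x + g x)"
  using assms(2,3)
proof (induction k arbitrary: f g)
  case 0
  then show ?case by (auto intro: continuous_on_add)
next
  case (Suc k)
  have d: "((\<lambda>x. f x + g x) has_derivative
      (\<lambda>v. frechet_derivative f (at x) v + frechet_derivative g (at x) v)) (at x)" if "x \<in> S" for x
    using Suc.prems that by (intro has_derivative_add has_derivative_frechet) auto
  have "Ck_on k S (\<lambda>x. frechet_derivative (\<lambda>x. f x + g x) (at x) v)" for v
    by (subst Ck_on_cong[OF assms(1),
          where g = "\<lambda>x. frechet_derivative f (at x) v + frechet_derivative g (at x) v"])
      (use Suc in \<open>auto simp: frechet_derivative_eqI[OF d]\<close>)
  then show ?case using d by (auto simp: differentiable_def)
qed

lemma Ck_on_sum: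
  assumes "open S" "\<And>i. i \<in> I \<Longrightarrow> Ck_on k S (f i)"
  shows "Ck_on k S (\<lambda>x. \<Sum>i\<in>I. f i x)"
  using assms(2)
  by (induction I rule: infinite_finite_induct) (auto intro: Ck_on_const Ck_on_add[OF assms(1)])

text \<open>The Leibniz rule expresses the derivative through \<open>h\<close> again with one factor
  differentiated; the other factor is demoted to class C^k by \<open>Ck_on_SucD\<close>, and the
  induction hypothesis applies to both summands.\<close>

lemma Ck_on_bounded_bilinear:
  assumes "open S" "bounded_bilinear h" "Ck_on k S f" "Ck_on k S g"
  shows "Ck_on k S (\<lambda>x. h (f x) (g x))"
  using assms(3,4)
proof (induction k arbitrary: f g)
  case 0
  then show ?case using assms(2) by (simp add: bounded_bilinear.continuous_on)
next
  case (Suc k)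
  let ?D = "\<lambda>x v. h (f x) (frechet_derivative g (at x) v) + h (frechet_derivative f (at x) v) (g x)"
  have d: "((\<lambda>x. h (f x) (g x)) has_derivative ?D x) (at x)" if "x \<in> S" for x
    using Suc.prems that
    by (intro bounded_bilinear.FDERIV[OF assms(2)] has_derivative_frechet) auto
  have fg: "Ck_on k S f" "Ck_on k S g" using Suc.prems by (auto intro: Ck_on_SucD simp del: Ck_on.simps)
  have "Ck_on k S (\<lambda>x. frechet_derivative (\<lambda>x. h (f x) (g x)) (at x) v)" for v
  proof (subst Ck_on_cong[OF assms(1), where g = "\<lambda>x. ?D x v"])
    show "Ck_on k S (\<lambda>x. ?D x v)"
      using Suc.prems fg by (intro Ck_on_add[OF assms(1)] Suc.IH) auto
  qed (auto simp: frechet_derivative_eqI[OF d])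
  then show ?case using d by (auto simp: differentiable_def)
qed

lemma Ck_on_compose:
  fixes f :: "'e::euclidean_space \<Rightarrow> 'f::euclidean_space"
  assumes "open S" "open T" "f ` S \<subseteq> T" "Ck_on k T g" "Ck_on k S f"
  shows "Ck_on k S (\<lambda>x. g (f x))"
  using assms(4,5)
proof (induction k arbitrary: g)
  case 0
  then show ?case using assms(3)
    by (auto intro: continuous_on_compose2)
next
  case (Suc k)
  let ?D = "\<lambda>x v. frechet_derivative g (at (f x)) (frechet_derivative f (at x) v)"
  \<comment> \<open>In \<open>?D\<close> the direction moves with \<open>x\<close>, whereas the
    induction hypothesis covers derivatives in a fixed direction. Expanding in the standard basis
    turns \<open>?D\<close> into products of the latter with coefficients of class C^k.\<close>
  let ?D' = "\<lambda>x v. \<Sum>b\<in>Basis. (frechet_derivative f (at x) v \<bullet> b) *\<^sub>R frechet_derivative g (at (f x)) b"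
  have d: "((\<lambda>x. g (f x)) has_derivative ?D x) (at x)" if "x \<in> S" for x
    using Suc.prems that assms(3)
    by (intro has_derivative_compose[of f _ x UNIV g] has_derivative_frechet) auto
  have DD': "?D x v = ?D' x v" if "x \<in> S" for x v
  proof -
    have "linear (frechet_derivative g (at (f x)))"
      using Suc.prems that assms(3) by (intro linear_frechet_derivative) auto
    then have "frechet_derivative g (at (f x)) (\<Sum>b\<in>Basis. (frechet_derivative f (at x) v \<bullet> b) *\<^sub>R b)
        = ?D' x v"
      by (simp add: linear_sum linear_scale)
    then show ?thesis by (simp add: euclidean_representation)
  qed
  have f: "Ck_on k S f" using Suc.prems(2) by (rule Ck_on_SucD)
  have "Ck_on k S (\<lambda>x. frechet_derivative (\<lambda>x. g (f x)) (at x) v)" for v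
  proof (subst Ck_on_cong[OF assms(1), where g = "\<lambda>x. ?D' x v"])
    show "Ck_on k S (\<lambda>x. ?D' x v)"
      using Suc.prems f
      by (intro Ck_on_sum[OF assms(1)] Ck_on_bounded_bilinear[OF assms(1) bounded_bilinear_scaleR]
          Ck_on_bounded_linear[OF assms(1) bounded_linear_inner_left] Suc.IH) auto
  qed (auto simp: frechet_derivative_eqI[OF d] DD')
  then show ?case using d by (auto simp: differentiable_def)
qed

section \<open>Closure properties of smooth functions\<close>

lemma smooth_on_cong:
  "open S \<Longrightarrow> (\<And>y. y \<in> S \<Longrightarrow> f y = g y) \<Longrightarrow> smooth_on S f \<longleftrightarrow> smooth_on S g"
  unfolding smooth_on_def using Ck_on_cong by blast

lemma smooth_on_subset: "smooth_on S f \<Longrightarrow> T \<subseteq> S \<Longrightarrow> smooth_on T f"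
  by (auto simp: smooth_on_def intro: Ck_on_subset)

lemma smooth_on_deriv: "smooth_on S f \<Longrightarrow> smooth_on S (\<lambda>x. frechet_derivative f (at x) v)"
  by (metis smooth_on_def Ck_on.simps(2))

lemma smooth_on_differentiable: "smooth_on S f \<Longrightarrow> x \<in> S \<Longrightarrow> f differentiable at x"
  by (metis smooth_on_def Ck_on.simps(2))

lemma smooth_on_has_derivative:
  "smooth_on S f \<Longrightarrow> x \<in> S \<Longrightarrow> (f has_derivative frechet_derivative f (at x)) (at x)"
  by (intro has_derivative_frechet smooth_on_differentiable)

lemma smooth_on_continuous: "smooth_on S f \<Longrightarrow> continuous_on S f"
  by (metis smooth_on_def Ck_on.simps(1))

text \<open>Proving class C^(k+1) for each k and then weakening avoids a separate argument for
  continuity.\<close>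

lemma smooth_onI_deriv:
  assumes "\<And>x. x \<in> S \<Longrightarrow> f differentiable at x"
    and "\<And>v. smooth_on S (\<lambda>x. frechet_derivative f (at x) v)"
  shows "smooth_on S f"
  unfolding smooth_on_def
proof
  fix k show "Ck_on k S f"
    by (rule Ck_on_SucD) (use assms in \<open>auto simp: smooth_on_def\<close>)
qed

lemma smooth_on_const: "smooth_on S (\<lambda>x. c)"
  by (simp add: smooth_on_def Ck_on_const)

lemma smooth_on_linear_compose:
  "open S \<Longrightarrow> bounded_linear L \<Longrightarrow> smooth_on S f \<Longrightarrow> smooth_on S (\<lambda>x. L (f x))"
  by (simp add: smooth_on_def Ck_on_bounded_linear)

lemma smooth_on_bounded_linear:
  assumes "bounded_linear L" shows "smooth_on S L"
proof -
  have "frechet_derivative L (at x) = L" for x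
    by (rule frechet_derivative_eqI) (rule bounded_linear_imp_has_derivative[OF assms])
  then show ?thesis
    by (auto intro!: smooth_onI_deriv[of S L] bounded_linear_imp_differentiable[OF assms] smooth_on_const)
qed

lemma smooth_on_ident: "smooth_on S (\<lambda>x. x)"
  by (rule smooth_on_bounded_linear) (rule bounded_linear_ident)

lemma smooth_on_bilinear_compose:
  "open S \<Longrightarrow> bounded_bilinear h \<Longrightarrow> smooth_on S f \<Longrightarrow> smooth_on S g
    \<Longrightarrow> smooth_on S (\<lambda>x. h (f x) (g x))"
  by (simp add: smooth_on_def Ck_on_bounded_bilinear)

lemma smooth_on_add: "open S \<Longrightarrow> smooth_on S f \<Longrightarrow> smooth_on S g \<Longrightarrow> smooth_on S (\<lambda>x. f x + g x)"
  by (simp add: smooth_on_def Ck_on_add)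

lemma smooth_on_sum:
  "open S \<Longrightarrow> (\<And>i. i \<in> I \<Longrightarrow> smooth_on S (f i)) \<Longrightarrow> smooth_on S (\<lambda>x. \<Sum>i\<in>I. f i x)"
  by (simp add: smooth_on_def Ck_on_sum)

lemma smooth_on_minus: "open S \<Longrightarrow> smooth_on S f \<Longrightarrow> smooth_on S (\<lambda>x. - f x)"
  by (rule smooth_on_linear_compose) (auto intro: bounded_linear_minus bounded_linear_ident)

lemma smooth_on_diff: "open S \<Longrightarrow> smooth_on S f \<Longrightarrow> smooth_on S g \<Longrightarrow> smooth_on S (\<lambda>x. f x - g x)"
  using smooth_on_add[OF _ _ smooth_on_minus, of S f g] by simp

lemmas smooth_on_scaleR = smooth_on_bilinear_compose[OF _ bounded_bilinear_scaleR]
  and smooth_on_mult = smooth_on_bilinear_compose[OF _ bounded_bilinear_mult]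
  and smooth_on_inner = smooth_on_bilinear_compose[OF _ bounded_bilinear_inner]
  and smooth_on_fst = smooth_on_linear_compose[OF _ bounded_linear_fst]
  and smooth_on_snd = smooth_on_linear_compose[OF _ bounded_linear_snd]

lemma smooth_on_divide:
  fixes f :: "'e::euclidean_space \<Rightarrow> real"
  assumes "open S" "smooth_on S f" shows "smooth_on S (\<lambda>x. f x / c)"
  using smooth_on_mult[OF assms(1,2) smooth_on_const[of S "1/c"]] by simp

lemma smooth_on_Pair:
  assumes "open S" "smooth_on S f" "smooth_on S g" shows "smooth_on S (\<lambda>x. (f x, g x))"
proof -
  have "smooth_on S (\<lambda>x. (f x, 0) + (0, g x))"
    using assms by (intro smooth_on_add smooth_on_linear_compose[of S "\<lambda>u. (u, 0)"]
        smooth_on_linear_compose[of S "\<lambda>u. (0, u)"]) (auto intro: bounded_linear_Pair bounded_linear_zero bounded_linear_ident)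
  then show ?thesis by simp
qed

lemma smooth_on_compose:
  fixes f :: "'e::euclidean_space \<Rightarrow> 'f::euclidean_space"
  assumes "open S" "open T" "f ` S \<subseteq> T" "smooth_on T g" "smooth_on S f"
  shows "smooth_on S (\<lambda>x. g (f x))"
  using assms by (auto simp: smooth_on_def intro: Ck_on_compose)

lemma smooth_on_prod:
  fixes f :: "'i \<Rightarrow> 'e::euclidean_space \<Rightarrow> real"
  assumes "open S" "\<And>i. i \<in> I \<Longrightarrow> smooth_on S (f i)"
  shows "smooth_on S (\<lambda>x. \<Prod>i\<in>I. f i x)"
  using assms(2)
  by (induction I rule: infinite_finite_induct) (auto intro: smooth_on_const smooth_on_mult[OF assms(1)])

section \<open>The reciprocal and real powers away from zero\<close>

lemma open_nonzero_real: "open (- {0::real})"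
  by (simp add: open_Compl)

text \<open>The derivative of the reciprocal is a polynomial in the reciprocal itself, so the
  induction on k closes.\<close>

lemma smooth_on_inverse_real: "smooth_on (- {0::real}) inverse"
  unfolding smooth_on_def
proof
  fix k show "Ck_on k (- {0::real}) inverse"
  proof (induction k)
    case 0
    then show ?case by (auto intro!: continuous_intros)
  next
    case (Suc k)
    have d: "(inverse has_derivative (\<lambda>v. - (v * (inverse x * inverse x)))) (at x)" if "x \<noteq> 0" for x :: real
      using has_derivative_inverse'[OF that] by (simp add: algebra_simps)
    have "Ck_on k (- {0::real}) (\<lambda>x. frechet_derivative inverse (at x) v)" for v
    proof (subst Ck_on_cong[OF open_nonzero_real, where g = "\<lambda>x. - (v * (inverse x * inverse x))"])
      show "Ck_on k (- {0::real}) (\<lambda>x. - (v * (inverse x * inverse x)))"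
        by (intro Ck_on_bounded_linear[OF open_nonzero_real, where L = uminus]
            Ck_on_bounded_bilinear[OF open_nonzero_real bounded_bilinear_mult] Suc Ck_on_const
            bounded_linear_minus bounded_linear_ident)
    qed (auto simp: frechet_derivative_eqI[OF d])
    then show ?case using d by (auto simp: differentiable_def)
  qed
qed

lemma smooth_on_inverse:
  fixes f :: "'e::euclidean_space \<Rightarrow> real"
  assumes "open S" "smooth_on S f" "\<And>x. x \<in> S \<Longrightarrow> f x \<noteq> 0"
  shows "smooth_on S (\<lambda>x. inverse (f x))"
  using assms by (intro smooth_on_compose[OF _ open_nonzero_real _ smooth_on_inverse_real]) auto

text \<open>Densities of weight one change by such a power of the Jacobian determinant, whose sign
  is arbitrary. The derivative is written as a multiple of the same power, which lets the induction
  in \<open>smooth_on_abs_powr_real\<close> refer back to itself.\<close>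

lemma has_derivative_abs_powr:
  fixes x :: real
  assumes "x \<noteq> 0"
  shows "((\<lambda>x. \<bar>x\<bar> powr a) has_derivative (\<lambda>v. v * (a * (\<bar>x\<bar> powr a * inverse x)))) (at x)"
proof -
  \<comment> \<open>On the half-line of numbers with the sign of \<open>x\<close> the absolute value
    is multiplication by \<open>sgn x\<close>, and there the ordinary power rule applies.\<close>
  have "((\<lambda>y. (sgn x * y) powr a) has_real_derivative a * (sgn x * x) powr (a - 1) * sgn x) (at x)"
    using assms by (auto intro!: derivative_eq_intros simp: sgn_if)
  then have "((\<lambda>y. \<bar>y\<bar> powr a) has_real_derivative a * (sgn x * x) powr (a - 1) * sgn x) (at x)"
    by (rule has_field_derivative_transform_within_open[where S = "{y. sgn x * y > 0}"])
      (use assms in \<open>auto intro!: open_Collect_less continuous_intros simp: sgn_if split: if_splits\<close>)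
  moreover have "sgn x * x = \<bar>x\<bar>" by (simp add: sgn_if)
  ultimately have "((\<lambda>x. \<bar>x\<bar> powr a) has_real_derivative a * \<bar>x\<bar> powr (a - 1) * sgn x) (at x)"
    by simp
  moreover have "a * \<bar>x\<bar> powr (a - 1) * sgn x = a * (\<bar>x\<bar> powr a * inverse x)"
    using assms by (auto simp: powr_diff sgn_if divide_simps)
  ultimately have "((\<lambda>x. \<bar>x\<bar> powr a) has_real_derivative a * (\<bar>x\<bar> powr a * inverse x)) (at x)"
    by metis
  then show ?thesis
    by (simp only: has_field_derivative_def mult.commute[of _ "a * (\<bar>x\<bar> powr a * inverse x)"])
qed

lemma smooth_on_abs_powr_real: "smooth_on (- {0::real}) (\<lambda>x. \<bar>x\<bar> powr a)"
  unfolding smooth_on_def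
proof
  fix k show "Ck_on k (- {0::real}) (\<lambda>x. \<bar>x\<bar> powr a)"
  proof (induction k)
    case 0
    then show ?case by (auto intro!: continuous_intros)
  next
    case (Suc k)
    have "Ck_on k (- {0::real}) (\<lambda>x. frechet_derivative (\<lambda>x. \<bar>x\<bar> powr a) (at x) v)" for v
    proof (subst Ck_on_cong[OF open_nonzero_real, where g = "\<lambda>x. v * (a * (\<bar>x\<bar> powr a * inverse x))"])
      show "Ck_on k (- {0::real}) (\<lambda>x. v * (a * (\<bar>x\<bar> powr a * inverse x)))"
        using smooth_on_inverse_real
        by (intro Ck_on_bounded_bilinear[OF open_nonzero_real bounded_bilinear_mult] Suc Ck_on_const)
          (auto simp: smooth_on_def)
    qed (auto simp: frechet_derivative_eqI[OF has_derivative_abs_powr])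
    then show ?case using has_derivative_abs_powr by (auto simp: differentiable_def)
  qed
qed

lemma smooth_on_abs_powr:
  fixes f :: "'e::euclidean_space \<Rightarrow> real"
  assumes "open S" "smooth_on S f" "\<And>x. x \<in> S \<Longrightarrow> f x \<noteq> 0"
  shows "smooth_on S (\<lambda>x. \<bar>f x\<bar> powr a)"
  using assms by (intro smooth_on_compose[OF _ open_nonzero_real _ smooth_on_abs_powr_real]) auto

section \<open>Linear and bilinear maps depending on a parameter\<close>

lemma linear_euclidean_expand:
  fixes L :: "'e::euclidean_space \<Rightarrow> 'f::real_vector"
  assumes "linear L" shows "L u = (\<Sum>b\<in>Basis. (u \<bullet> b) *\<^sub>R L b)"
proof -
  have "L (\<Sum>b\<in>Basis. (u \<bullet> b) *\<^sub>R b) = (\<Sum>b\<in>Basis. (u \<bullet> b) *\<^sub>R L b)"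
    by (simp add: linear_sum[OF assms] linear_scale[OF assms])
  then show ?thesis by (simp add: euclidean_representation)
qed

text \<open>Smoothness on each fixed vector is enough: in finite dimension the value is a finite sum
  over the basis with smooth coefficients.\<close>

lemma smooth_on_linear_param:
  fixes B :: "'e::euclidean_space \<Rightarrow> 'g::euclidean_space \<Rightarrow> 'f::real_normed_vector"
  assumes S: "open S" and B: "\<And>u. smooth_on S (\<lambda>x. B x u)" and l: "\<And>x. x \<in> S \<Longrightarrow> linear (B x)"
    and g: "smooth_on S g"
  shows "smooth_on S (\<lambda>x. B x (g x))"
proof -
  have "smooth_on S (\<lambda>x. \<Sum>b\<in>Basis. (g x \<bullet> b) *\<^sub>R B x b)"
    using B g by (intro smooth_on_sum[OF S] smooth_on_scaleR[OF S] smooth_on_inner[OF S] smooth_on_const) auto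
  then show ?thesis
    using smooth_on_cong[OF S linear_euclidean_expand[OF l], of "\<lambda>x. x" g] by blast
qed

lemma smooth_on_bilinear_param:
  fixes B :: "'e::euclidean_space \<Rightarrow> 'g::euclidean_space \<Rightarrow> 'h::euclidean_space \<Rightarrow> 'f::real_normed_vector"
  assumes S: "open S" and B: "\<And>u v. smooth_on S (\<lambda>x. B x u v)"
    and l: "\<And>x. x \<in> S \<Longrightarrow> bilinear (B x)"
    and "smooth_on S f" "smooth_on S g"
  shows "smooth_on S (\<lambda>x. B x (f x) (g x))"
proof -
  have "smooth_on S (\<lambda>x. B x u (g x))" for u
    by (rule smooth_on_linear_param[OF S, where B = "\<lambda>x. B x u"])
      (use assms in \<open>auto simp: bilinear_def\<close>)
  then show ?thesis
    by (rule smooth_on_linear_param[OF S, where B = "\<lambda>x u. B x u (g x)"])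
      (use assms in \<open>auto simp: bilinear_def\<close>)
qed

lemma smooth_on_frechet_derivative:
  fixes f :: "'e::euclidean_space \<Rightarrow> 'g::euclidean_space"
  assumes "open S" "open T" "f ` S \<subseteq> T" "smooth_on T g" "smooth_on S f" "smooth_on S h"
  shows "smooth_on S (\<lambda>x. frechet_derivative g (at (f x)) (h x))"
proof (rule smooth_on_linear_param[OF assms(1), where B = "\<lambda>x. frechet_derivative g (at (f x))"])
  show "smooth_on S (\<lambda>x. frechet_derivative g (at (f x)) u)" for u
    by (rule smooth_on_compose[where f = f and g = "\<lambda>y. frechet_derivative g (at y) u"])
      (use assms in \<open>auto intro: smooth_on_deriv\<close>)
  show "linear (frechet_derivative g (at (f x)))" if "x \<in> S" for x
    using assms that by (intro linear_frechet_derivative) (auto intro: smooth_on_differentiable)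
qed (use assms in auto)

lemma adjoint_expand:
  fixes L :: "'e::euclidean_space \<Rightarrow> 'f::euclidean_space"
  assumes "linear L" shows "adjoint L y = (\<Sum>b\<in>Basis. (y \<bullet> L b) *\<^sub>R b)"
proof -
  have "adjoint L y \<bullet> b = y \<bullet> L b" for b
    using adjoint_works[OF assms] by (simp add: inner_commute)
  then show ?thesis by (metis (no_types, lifting) euclidean_representation sum.cong)
qed

text \<open>Covectors change chart by the adjoint of the inverse Jacobian, so this gives the
  smoothness of their transition maps.\<close>

lemma smooth_on_adjoint:
  fixes B :: "'e::euclidean_space \<Rightarrow> 'g::euclidean_space \<Rightarrow> 'f::euclidean_space"
  assumes S: "open S" and B: "\<And>u. smooth_on S (\<lambda>x. B x u)" and l: "\<And>x. x \<in> S \<Longrightarrow> linear (B x)"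
    and g: "smooth_on S g"
  shows "smooth_on S (\<lambda>x. adjoint (B x) (g x))"
proof -
  have "smooth_on S (\<lambda>x. \<Sum>b\<in>Basis. (g x \<bullet> B x b) *\<^sub>R b)"
    using B g by (intro smooth_on_sum[OF S] smooth_on_scaleR[OF S] smooth_on_inner[OF S] smooth_on_const) auto
  then show ?thesis
    using smooth_on_cong[OF S adjoint_expand[OF l], of "\<lambda>x. x" g] by blast
qed

text \<open>A product rule for evaluation. The family is differentiable only vector by vector, so
  both the moving argument and the partial derivative are expanded in the basis.\<close>

lemma has_derivative_linear_param:
  fixes B :: "'h::real_normed_vector \<Rightarrow> 'g::euclidean_space \<Rightarrow> 'f::real_normed_vector"
  assumes T: "open T" "f x \<in> T" and l: "\<And>y. y \<in> T \<Longrightarrow> linear (B y)"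
    and B: "\<And>u. (\<lambda>y. B y u) differentiable at (f x)"
    and f: "(f has_derivative f') (at x)" and g: "(g has_derivative g') (at x)"
  shows "((\<lambda>y. B (f y) (g y)) has_derivative
    (\<lambda>v. frechet_derivative (\<lambda>y. B y (g x)) (at (f x)) (f' v) + B (f x) (g' v))) (at x)"
proof -
  have lx: "linear (B (f x))" using T l by blast
  have Bf: "((\<lambda>y. B (f y) u) has_derivative (\<lambda>v. frechet_derivative (\<lambda>y. B y u) (at (f x)) (f' v))) (at x)" for u
    using B by (intro has_derivative_compose[OF f] has_derivative_frechet) auto
  have 1: "((\<lambda>y. \<Sum>b\<in>Basis. (g y \<bullet> b) *\<^sub>R B (f y) b) has_derivative
     (\<lambda>v. \<Sum>b\<in>Basis. (g x \<bullet> b) *\<^sub>R frechet_derivative (\<lambda>y. B y b) (at (f x)) (f' v)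
        + (g' v \<bullet> b) *\<^sub>R B (f x) b)) (at x)"
    by (intro has_derivative_sum has_derivative_scaleR has_derivative_inner_left g Bf)
  have 2: "frechet_derivative (\<lambda>y. B y u) (at (f x)) w
      = (\<Sum>b\<in>Basis. (u \<bullet> b) *\<^sub>R frechet_derivative (\<lambda>y. B y b) (at (f x)) w)" for u w
  proof -
    have "((\<lambda>y. \<Sum>b\<in>Basis. (u \<bullet> b) *\<^sub>R B y b) has_derivative
      (\<lambda>w. \<Sum>b\<in>Basis. (u \<bullet> b) *\<^sub>R frechet_derivative (\<lambda>y. B y b) (at (f x)) w)) (at (f x))"
      by (rule has_derivative_sum, rule has_derivative_scaleR_right, rule has_derivative_frechet, rule B)
    then have "((\<lambda>y. B y u) has_derivative
      (\<lambda>w. \<Sum>b\<in>Basis. (u \<bullet> b) *\<^sub>R frechet_derivative (\<lambda>y. B y b) (at (f x)) w)) (at (f x))"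
      by (rule has_derivative_transform_within_open[OF _ T]) (rule linear_euclidean_expand[symmetric, OF l])
    from frechet_derivative_eqI[OF this] show ?thesis by (rule fun_cong)
  qed
  \<comment> \<open>The expansion of \<open>B (f y)\<close> in the basis is valid only where
    \<open>f y\<close> lies in \<open>T\<close>, hence the neighbourhood \<open>U\<close>.\<close>
  have "isCont f x" using f has_derivative_continuous by blast
  then obtain U where U: "open U" "x \<in> U" "f ` U \<subseteq> T"
    using T by (metis continuous_at_open image_subsetI)
  have "((\<lambda>y. B (f y) (g y)) has_derivative
     (\<lambda>v. \<Sum>b\<in>Basis. (g x \<bullet> b) *\<^sub>R frechet_derivative (\<lambda>y. B y b) (at (f x)) (f' v)
        + (g' v \<bullet> b) *\<^sub>R B (f x) b)) (at x)"
    by (rule has_derivative_transform_within_open[OF 1 U(1,2)])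
      (use U(3) in \<open>auto intro!: linear_euclidean_expand[symmetric] l\<close>)
  also have "(\<lambda>v. \<Sum>b\<in>Basis. (g x \<bullet> b) *\<^sub>R frechet_derivative (\<lambda>y. B y b) (at (f x)) (f' v)
        + (g' v \<bullet> b) *\<^sub>R B (f x) b)
    = (\<lambda>v. frechet_derivative (\<lambda>y. B y (g x)) (at (f x)) (f' v) + B (f x) (g' v))"
    unfolding 2[of "g x"] linear_euclidean_expand[OF lx, of "g' _"] by (rule ext) (rule sum.distrib)
  finally show ?thesis .
qed

text \<open>The arguments are treated one after the other: first \<open>g\<close> with the last
  argument frozen, then \<open>h\<close> with the parameter and \<open>g\<close> absorbed into one
  family of linear maps.\<close>

lemma has_derivative_bilinear_param:
  fixes B :: "'k::real_normed_vector \<Rightarrow> 'g::euclidean_space \<Rightarrow> 'h::euclidean_space \<Rightarrow> 'f::real_normed_vector"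
  assumes T: "open T" "f x \<in> T" and l: "\<And>y. y \<in> T \<Longrightarrow> bilinear (B y)"
    and B: "\<And>u v. (\<lambda>y. B y u v) differentiable at (f x)"
    and f: "(f has_derivative f') (at x)" and g: "(g has_derivative g') (at x)"
    and h: "(h has_derivative h') (at x)"
  shows "((\<lambda>y. B (f y) (g y) (h y)) has_derivative
    (\<lambda>v. frechet_derivative (\<lambda>y. B y (g x) (h x)) (at (f x)) (f' v)
       + B (f x) (g' v) (h x) + B (f x) (g x) (h' v))) (at x)"
proof -
  have lin: "linear (B y u)" "linear (\<lambda>u. B y u v)" if "y \<in> T" for y u v
    using l[OF that] by (auto simp: bilinear_def)
  have Bgx: "((\<lambda>y. B (f y) (g y) v) has_derivative (\<lambda>w. frechet_derivative (\<lambda>y. B y (g x) v) (at (f x)) (f' w)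
       + B (f x) (g' w) v)) (at x)" for v
    using lin B by (intro has_derivative_linear_param[OF T _ _ f g, where B = "\<lambda>y u. B y u v"]) auto
  have dv: "(\<lambda>y. B (f y) (g y) v) differentiable at x" for v
    using Bgx by (auto simp: differentiable_def)
  have "isCont f x" using f has_derivative_continuous by blast
  then obtain U where U: "open U" "x \<in> U" "f ` U \<subseteq> T"
    using T by (metis continuous_at_open image_subsetI)
  have "((\<lambda>y. B (f y) (g y) (h y)) has_derivative
     (\<lambda>v. frechet_derivative (\<lambda>y. B (f y) (g y) (h x)) (at x) v + B (f x) (g x) (h' v))) (at x)"
    by (rule has_derivative_linear_param[OF U(1), of "\<lambda>x. x" x "\<lambda>y v. B (f y) (g y) v", OF _ _ _ has_derivative_ident h])
      (use lin U dv in auto)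
  then show ?thesis
    unfolding frechet_derivative_eqI[OF Bgx] by (simp add: add.assoc)
qed

subsection \<open>Symmetry of second derivatives\<close>

lemma has_real_derivative_line:
  fixes f :: "'e::euclidean_space \<Rightarrow> real"
  assumes "f differentiable at (a + s *\<^sub>R u)"
  shows "((\<lambda>s. f (a + s *\<^sub>R u)) has_real_derivative frechet_derivative f (at (a + s *\<^sub>R u)) u) (at s)"
proof -
  have "((\<lambda>s. a + s *\<^sub>R u) has_derivative (\<lambda>h. h *\<^sub>R u)) (at s)"
    by (auto intro!: derivative_eq_intros)
  from has_derivative_compose[OF this has_derivative_frechet[OF assms]]
  show ?thesis
    unfolding has_field_derivative_def
    by (rule has_derivative_eq_rhs)
      (simp add: linear_scale[OF linear_frechet_derivative[OF assms]] fun_eq_iff)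
qed

text \<open>The mean value theorem is applied twice, first along \<open>u\<close> to a difference of
  values of \<open>f\<close>, then along \<open>v\<close> to the derivative of \<open>f\<close> in
  direction \<open>u\<close>.\<close>

lemma second_difference:
  fixes f :: "'e::euclidean_space \<Rightarrow> real"
  assumes f: "smooth_on S f" and t: "t > 0"
    and S: "\<And>a b. 0 \<le> a \<Longrightarrow> a \<le> t \<Longrightarrow> 0 \<le> b \<Longrightarrow> b \<le> t \<Longrightarrow> x + a *\<^sub>R u + b *\<^sub>R v \<in> S"
  obtains a b where "0 \<le> a" "a \<le> t" "0 \<le> b" "b \<le> t"
    "f (x + t *\<^sub>R u + t *\<^sub>R v) - f (x + t *\<^sub>R u) - f (x + t *\<^sub>R v) + f x
      = t * t * frechet_derivative (\<lambda>y. frechet_derivative f (at y) u) (at (x + a *\<^sub>R u + b *\<^sub>R v)) v"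
proof -
  have df: "f differentiable at y" if "y \<in> S" for y
    using smooth_on_differentiable[OF f that] .
  have ddf: "(\<lambda>y. frechet_derivative f (at y) u) differentiable at y" if "y \<in> S" for y
    using smooth_on_differentiable[OF smooth_on_deriv[OF f] that] .
  define h where "h s = f ((x + t *\<^sub>R v) + s *\<^sub>R u) - f (x + s *\<^sub>R u)" for s
  have mem: "x + t *\<^sub>R v + s *\<^sub>R u \<in> S" "x + s *\<^sub>R u \<in> S" if "0 \<le> s" "s \<le> t" for s
    using S[of s t] S[of s 0] that t by (auto simp: algebra_simps)
  have dh: "(h has_real_derivative frechet_derivative f (at (x + t *\<^sub>R v + s *\<^sub>R u)) u
      - frechet_derivative f (at (x + s *\<^sub>R u)) u) (at s)" if "0 \<le> s" "s \<le> t" for s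
    unfolding h_def by (intro DERIV_diff has_real_derivative_line df mem that)
  obtain a where a: "0 < a" "a < t" "h t - h 0 = (t - 0) *
      (frechet_derivative f (at (x + t *\<^sub>R v + a *\<^sub>R u)) u - frechet_derivative f (at (x + a *\<^sub>R u)) u)"
    using MVT2[OF t dh] by blast
  define k where "k s = frechet_derivative f (at ((x + a *\<^sub>R u) + s *\<^sub>R v)) u" for s
  have dk: "(k has_real_derivative frechet_derivative (\<lambda>y. frechet_derivative f (at y) u)
      (at (x + a *\<^sub>R u + s *\<^sub>R v)) v) (at s)" if "0 \<le> s" "s \<le> t" for s
    unfolding k_def using a S that by (intro has_real_derivative_line ddf) auto
  obtain b where b: "0 < b" "b < t" "k t - k 0 = (t - 0) *
      frechet_derivative (\<lambda>y. frechet_derivative f (at y) u) (at (x + a *\<^sub>R u + b *\<^sub>R v)) v"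
    using MVT2[OF t dk] by blast
  have "f (x + t *\<^sub>R u + t *\<^sub>R v) - f (x + t *\<^sub>R u) - f (x + t *\<^sub>R v) + f x = h t - h 0"
    by (simp add: h_def algebra_simps)
  also have "\<dots> = t * (k t - k 0)"
    using a by (simp add: k_def algebra_simps)
  finally show ?thesis
    using a b by (intro that[of a b]) auto
qed

text \<open>The second difference is symmetric in \<open>u\<close> and \<open>v\<close>, so one
  mixed derivative at some point near \<open>x\<close> equals the other at another such point;
  continuity at \<open>x\<close> does the rest.\<close>

lemma second_derivative_symmetric_real:
  fixes f :: "'e::euclidean_space \<Rightarrow> real"
  assumes S: "open S" "x \<in> S" and f: "smooth_on S f"
  shows "frechet_derivative (\<lambda>y. frechet_derivative f (at y) u) (at x) v
       = frechet_derivative (\<lambda>y. frechet_derivative f (at y) v) (at x) u"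
proof (rule ccontr)
  let ?D = "\<lambda>u v y. frechet_derivative (\<lambda>y. frechet_derivative f (at y) u) (at y) v"
  assume ne: "?D u v x \<noteq> ?D v u x"
  \<comment> \<open>Half the gap, so that two errors smaller than \<open>e\<close> cannot bridge
    it.\<close>
  define e where "e = \<bar>?D u v x - ?D v u x\<bar> / 2"
  have e: "e > 0" using ne by (simp add: e_def)
  have "isCont (?D u v) x" "isCont (?D v u) x"
    using smooth_on_continuous[OF smooth_on_deriv[OF smooth_on_deriv[OF f]]] S
    by (simp_all add: continuous_on_eq_continuous_at)
  then have ex: "\<exists>d>0. \<forall>y. dist y x < d \<longrightarrow> dist (?D u v y) (?D u v x) < e"
      "\<exists>d>0. \<forall>y. dist y x < d \<longrightarrow> dist (?D v u y) (?D v u x) < e"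
    using e unfolding continuous_at_eps_delta by auto
  from ex(1) obtain d1 where d1: "d1 > 0" "\<And>y. dist y x < d1 \<Longrightarrow> dist (?D u v y) (?D u v x) < e"
    by blast
  from ex(2) obtain d2 where d2: "d2 > 0" "\<And>y. dist y x < d2 \<Longrightarrow> dist (?D v u y) (?D v u x) < e"
    by blast
  note d = d1 d2
  obtain d3 where d3: "d3 > 0" "ball x d3 \<subseteq> S" using S openE by blast
  \<comment> \<open>With this scale the parallelogram spanned by the multiples of \<open>u\<close>
    and \<open>v\<close> stays within half the smallest radius; the summand 1 covers the case that
    both vectors vanish.\<close>
  define t where "t = min d1 (min d2 d3) / (2 * (norm u + norm v + 1))"
  have pos: "norm u + norm v + 1 > 0" by (smt (verit) norm_ge_zero)
  have t: "t > 0" using d d3 pos by (simp add: t_def)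
  have tn: "t * (norm u + norm v + 1) = min d1 (min d2 d3) / 2"
    using pos unfolding t_def by (simp only: times_divide_eq_left) (simp add: nonzero_divide_eq_eq)
  have near: "dist (x + a *\<^sub>R u + b *\<^sub>R v) x < min d1 (min d2 d3)"
    if "0 \<le> a" "a \<le> t" "0 \<le> b" "b \<le> t" for a b
  proof -
    have "dist (x + a *\<^sub>R u + b *\<^sub>R v) x \<le> norm (a *\<^sub>R u) + norm (b *\<^sub>R v)"
      using norm_triangle_ineq[of "a *\<^sub>R u" "b *\<^sub>R v"] by (simp add: dist_norm add.assoc)
    also have "\<dots> \<le> t * norm u + t * norm v"
      using that by (intro add_mono) (auto intro: mult_right_mono)
    also have "\<dots> \<le> t * (norm u + norm v + 1)" using t by (simp add: algebra_simps)
    also have "\<dots> < min d1 (min d2 d3)" using tn d d3 by linarith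
    finally show ?thesis .
  qed
  have near': "dist (x + a *\<^sub>R v + b *\<^sub>R u) x < min d1 (min d2 d3)"
    if "0 \<le> a" "a \<le> t" "0 \<le> b" "b \<le> t" for a b
    using near[of b a] that by (simp add: add.commute add.left_commute)
  obtain a b where ab: "0 \<le> a" "a \<le> t" "0 \<le> b" "b \<le> t"
    "f (x + t *\<^sub>R u + t *\<^sub>R v) - f (x + t *\<^sub>R u) - f (x + t *\<^sub>R v) + f x
      = t * t * ?D u v (x + a *\<^sub>R u + b *\<^sub>R v)"
    by (rule second_difference[OF f t, of x u v])
      (use near d3 in \<open>auto simp: subset_iff dist_commute\<close>)
  obtain a' b' where ab': "0 \<le> a'" "a' \<le> t" "0 \<le> b'" "b' \<le> t"
    "f (x + t *\<^sub>R v + t *\<^sub>R u) - f (x + t *\<^sub>R v) - f (x + t *\<^sub>R u) + f x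
      = t * t * ?D v u (x + a' *\<^sub>R v + b' *\<^sub>R u)"
    by (rule second_difference[OF f t, of x v u])
      (use near' d3 in \<open>auto simp: subset_iff dist_commute\<close>)
  have "f (x + t *\<^sub>R v + t *\<^sub>R u) = f (x + t *\<^sub>R u + t *\<^sub>R v)" by (simp add: algebra_simps)
  then have "t * t * ?D u v (x + a *\<^sub>R u + b *\<^sub>R v) = t * t * ?D v u (x + a' *\<^sub>R v + b' *\<^sub>R u)"
    using ab(5) ab'(5) by linarith
  then have "?D u v (x + a *\<^sub>R u + b *\<^sub>R v) = ?D v u (x + a' *\<^sub>R v + b' *\<^sub>R u)"
    using t by simp
  moreover have "dist (?D u v (x + a *\<^sub>R u + b *\<^sub>R v)) (?D u v x) < e"
    using near[OF ab(1-4)] by (intro d1(2)) simp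
  moreover have "dist (?D v u (x + a' *\<^sub>R v + b' *\<^sub>R u)) (?D v u x) < e"
    using near'[OF ab'(1-4)] by (intro d2(2)) simp
  moreover have "\<bar>?D u v x - ?D v u x\<bar> = e + e" by (simp add: e_def)
  ultimately show False
    unfolding dist_real_def by linarith
qed

lemma second_derivative_symmetric:
  fixes f :: "'e::euclidean_space \<Rightarrow> 'f::euclidean_space"
  assumes S: "open S" "x \<in> S" and f: "smooth_on S f"
  shows "frechet_derivative (\<lambda>y. frechet_derivative f (at y) u) (at x) v
       = frechet_derivative (\<lambda>y. frechet_derivative f (at y) v) (at x) u"
proof (rule euclidean_eqI)
  fix b :: 'f
  have d1: "frechet_derivative (\<lambda>z. f z \<bullet> b) (at y) w = frechet_derivative f (at y) w \<bullet> b"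
    if "y \<in> S" for y w
    using frechet_derivative_eqI[OF has_derivative_inner_left[OF smooth_on_has_derivative[OF f that]]]
    by simp
  have d2: "frechet_derivative (\<lambda>y. frechet_derivative (\<lambda>z. f z \<bullet> b) (at y) w) (at x) w'
      = frechet_derivative (\<lambda>y. frechet_derivative f (at y) w) (at x) w' \<bullet> b" for w w'
  proof -
    have "frechet_derivative (\<lambda>y. frechet_derivative (\<lambda>z. f z \<bullet> b) (at y) w) (at x)
        = frechet_derivative (\<lambda>y. frechet_derivative f (at y) w \<bullet> b) (at x)"
      by (rule frechet_derivative_cong_open[OF S d1])
    also have "\<dots> = (\<lambda>w'. frechet_derivative (\<lambda>y. frechet_derivative f (at y) w) (at x) w' \<bullet> b)"
      by (rule frechet_derivative_eqI, rule has_derivative_inner_left,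
          rule smooth_on_has_derivative[OF smooth_on_deriv[OF f] S(2)])
    finally show ?thesis by simp
  qed
  have "smooth_on S (\<lambda>z. f z \<bullet> b)"
    using f by (intro smooth_on_inner S smooth_on_const)
  from second_derivative_symmetric_real[OF S this, of u v]
  show "frechet_derivative (\<lambda>y. frechet_derivative f (at y) u) (at x) v \<bullet> b
       = frechet_derivative (\<lambda>y. frechet_derivative f (at y) v) (at x) u \<bullet> b"
    unfolding d2 .
qed

subsection \<open>Traces and the derivative of the determinant\<close>

lemma trace_cyclic:
  fixes L :: "'f::euclidean_space \<Rightarrow> 'e::euclidean_space" and M :: "'e \<Rightarrow> 'f"
  assumes "linear L" "linear M"
  shows "(\<Sum>k\<in>Basis. L (M k) \<bullet> k) = (\<Sum>k\<in>Basis. M (L k) \<bullet> k)"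
proof -
  have "(\<Sum>k\<in>Basis. L (M k) \<bullet> k) = (\<Sum>k\<in>Basis. \<Sum>j\<in>Basis. (M k \<bullet> j) * (L j \<bullet> k))"
    by (subst linear_euclidean_expand[OF assms(1)]) (simp add: inner_sum_left)
  also have "\<dots> = (\<Sum>j\<in>Basis. \<Sum>k\<in>Basis. (L j \<bullet> k) * (M k \<bullet> j))"
    by (subst sum.swap) (simp add: mult.commute)
  also have "\<dots> = (\<Sum>j\<in>Basis. M (L j) \<bullet> j)"
    by (subst (2) linear_euclidean_expand[OF assms(2)]) (simp add: inner_sum_left)
  finally show ?thesis .
qed

text \<open>A permutation other than the identity moves at least two points, so even with row
  \<open>i\<close> left out some factor lies off the diagonal.\<close>

lemma prod_mat_permutes:
  fixes p :: "'n::finite \<Rightarrow> 'n"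
  assumes "p permutes UNIV" "p \<noteq> id"
  shows "(\<Prod>j\<in>UNIV - {i}. (mat 1 :: real^'n^'n) $ j $ p j) = 0"
proof -
  have "\<exists>j. j \<noteq> i \<and> p j \<noteq> j"
  proof (rule ccontr)
    assume "\<not> ?thesis"
    then have fixed: "\<And>j. j \<noteq> i \<Longrightarrow> p j = j" by blast
    have inj: "inj p" using assms(1) permutes_inj by blast
    then have "p i = i" using fixed by (metis injD)
    then show False using fixed assms(2) by (metis eq_id_iff)
  qed
  then obtain j where "j \<in> UNIV - {i}" "(mat 1 :: real^'n^'n) $ j $ p j = 0"
    by (force simp: mat_def)
  then show ?thesis by (intro prod_zero) auto
qed

text \<open>In the Leibniz expansion at the identity matrix every permutation other than
  \<open>id\<close> contributes only products with a vanishing factor, which leaves the diagonal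
  entries.\<close>

lemma has_derivative_det_identity:
  fixes F :: "'e::real_normed_vector \<Rightarrow> real^'n^'n"
  assumes F: "(F has_derivative F') (at x)" and Fx: "F x = mat 1"
  shows "((\<lambda>y. det (F y)) has_derivative (\<lambda>v. trace (F' v))) (at x)"
proof -
  have Fij: "((\<lambda>y. F y $ i $ j) has_derivative (\<lambda>v. F' v $ i $ j)) (at x)" for i j
    by (intro bounded_linear.has_derivative[OF bounded_linear_vec_nth] F)
  have "((\<lambda>y. det (F y)) has_derivative (\<lambda>v. \<Sum>p | p permutes UNIV.
      of_int (sign p) * (\<Sum>i\<in>UNIV. F' v $ i $ p i * (\<Prod>j\<in>UNIV - {i}. F x $ j $ p j)))) (at x)"
    unfolding det_def
    by (intro has_derivative_sum has_derivative_mult_right has_derivative_prod Fij)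
  moreover have "(\<Sum>p | p permutes UNIV. of_int (sign p) *
      (\<Sum>i\<in>UNIV. F' v $ i $ p i * (\<Prod>j\<in>UNIV - {i}. F x $ j $ p j))) = trace (F' v)" for v
  proof -
    have "(\<Sum>p | p permutes (UNIV::'n set). of_int (sign p) *
        (\<Sum>i\<in>UNIV. F' v $ i $ p i * (\<Prod>j\<in>UNIV - {i}. F x $ j $ p j)))
      = (\<Sum>p | p permutes (UNIV::'n set). if p = id then trace (F' v) else 0)"
      by (rule sum.cong) (auto simp: Fx prod_mat_permutes trace_def, simp add: mat_def sign_id)
    also have "\<dots> = trace (F' v)"
      by (simp add: finite_permutations permutes_id)
    finally show ?thesis .
  qed
  ultimately show ?thesis by simp
qed

lemma matrix_linear_compose:
  fixes L M :: "real^'n \<Rightarrow> real^'n"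
  assumes "linear L" "linear M"
  shows "matrix (\<lambda>u. L (M u)) = matrix L ** matrix M"
  using matrix_compose[OF assms(2,1)] by (simp add: o_def)

lemma trace_matrix: "trace (matrix (L :: real^'n \<Rightarrow> real^'n)) = (\<Sum>k\<in>Basis. L k \<bullet> k)"
proof -
  have "(\<Sum>k\<in>Basis. L k \<bullet> k) = (\<Sum>i\<in>UNIV. L (axis i 1) \<bullet> axis i 1)"
  proof -
    have "(Basis :: (real^'n) set) = (\<lambda>i. axis i 1) ` UNIV" by (auto simp: Basis_vec_def)
    moreover have "inj (\<lambda>i::'n. axis i (1::real))" by (auto simp: inj_on_def axis_eq_axis)
    ultimately show ?thesis by (metis (no_types, lifting) sum.reindex_cong)
  qed
  then show ?thesis by (simp add: trace_def matrix_def inner_axis)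
qed

text \<open>Jacobi's formula, reduced to the identity matrix by splitting off the constant factor
  \<open>det (matrix (J x))\<close>. The inverse \<open>K\<close> turns the logarithmic derivative
  into a trace of linear maps, the form in which it later meets the trace of the Christoffel
  symbols.\<close>

lemma has_derivative_det:
  fixes J :: "'e::real_normed_vector \<Rightarrow> real^'n \<Rightarrow> real^'n"
  assumes S: "open S" "x \<in> S" and l: "\<And>y. y \<in> S \<Longrightarrow> linear (J y)"
    and J: "\<And>u. ((\<lambda>y. J y u) has_derivative (\<lambda>v. J' v u)) (at x)"
    and K: "linear K" "\<And>u. K (J x u) = u" "\<And>u. J x (K u) = u"
  shows "((\<lambda>y. det (matrix (J y))) has_derivative
      (\<lambda>v. det (matrix (J x)) * (\<Sum>k\<in>Basis. K (J' v k) \<bullet> k))) (at x)"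
proof -
  let ?F = "\<lambda>y. matrix (\<lambda>u. K (J y u))"
  have Kb: "bounded_linear K" using K(1) linear_conv_bounded_linear by blast
  have entry: "((\<lambda>y. ?F y $ i $ j) has_derivative (\<lambda>v. matrix (\<lambda>u. K (J' v u)) $ i $ j)) (at x)" for i j
    unfolding matrix_def
    by (simp, intro bounded_linear.has_derivative[OF bounded_linear_vec_nth]
        bounded_linear.has_derivative[OF Kb] J)
  have F: "(?F has_derivative (\<lambda>v. matrix (\<lambda>u. K (J' v u)))) (at x)"
  proof (subst has_derivative_componentwise_within, intro ballI)
    fix b :: "real^'n^'n" assume "b \<in> Basis"
    then obtain i j where b: "b = axis i (axis j 1)" by (auto simp: Basis_vec_def)
    have "M \<bullet> b = M $ i $ j" for M :: "real^'n^'n" by (simp add: b inner_axis)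
    then show "((\<lambda>y. ?F y \<bullet> b) has_derivative (\<lambda>v. matrix (\<lambda>u. K (J' v u)) \<bullet> b)) (at x)"
      using entry[of i j] by simp
  qed
  have Fx: "?F x = mat 1" using K(2) by (simp add: matrix_id_mat_1[unfolded id_def])
  have 1: "((\<lambda>y. det (matrix (J x)) * det (?F y)) has_derivative
      (\<lambda>v. det (matrix (J x)) * (\<Sum>k\<in>Basis. K (J' v k) \<bullet> k))) (at x)"
    using has_derivative_det_identity[OF F Fx]
    by (intro has_derivative_mult_right) (simp add: trace_matrix)
  have "det (matrix (J x)) * det (?F y) = det (matrix (J y))" if "y \<in> S" for y
  proof -
    have "linear (\<lambda>u. K (J y u))"
      using linear_compose[OF l[OF that] K(1)] by (simp add: o_def)
    from matrix_linear_compose[OF l[OF S(2)] this] show ?thesis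
      by (simp add: K(3) det_mul)
  qed
  then show ?thesis
    by (rule has_derivative_transform_within_open[OF 1 S])
qed

section \<open>Change of coordinates\<close>

text \<open>In use, \<open>S\<close> and \<open>T\<close> are the images of one overlap in two
  charts. Carrying the inverse map along gives the inverse Jacobian \<open>K\<close> as a derivative
  and lets statements be reversed by \<open>swap\<close>.\<close>

locale coord_change =
  fixes S T :: "'e::euclidean_space set" and \<phi> \<psi> :: "'e \<Rightarrow> 'e"
  assumes open_S: "open S" and open_T: "open T"
    and smooth_phi: "smooth_on S \<phi>" and smooth_psi: "smooth_on T \<psi>"
    and phi_in: "x \<in> S \<Longrightarrow> \<phi> x \<in> T" and psi_in: "y \<in> T \<Longrightarrow> \<psi> y \<in> S"
    and psi_phi: "x \<in> S \<Longrightarrow> \<psi> (\<phi> x) = x" and phi_psi: "y \<in> T \<Longrightarrow> \<phi> (\<psi> y) = y"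
begin

abbreviation J :: "'e \<Rightarrow> 'e \<Rightarrow> 'e" where "J x \<equiv> frechet_derivative \<phi> (at x)"
abbreviation K :: "'e \<Rightarrow> 'e \<Rightarrow> 'e" where "K y \<equiv> frechet_derivative \<psi> (at y)"
abbreviation D2 :: "'e \<Rightarrow> 'e \<Rightarrow> 'e \<Rightarrow> 'e" where
  "D2 x u v \<equiv> frechet_derivative (\<lambda>y. frechet_derivative \<phi> (at y) v) (at x) u"

lemma swap: "coord_change T S \<psi> \<phi>"
  by unfold_locales (auto simp: open_S open_T smooth_phi smooth_psi phi_in psi_in psi_phi phi_psi)

lemma phi_image: "\<phi> ` S \<subseteq> T" using phi_in by auto

lemma J_deriv: "x \<in> S \<Longrightarrow> (\<phi> has_derivative J x) (at x)"
  by (rule smooth_on_has_derivative[OF smooth_phi])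

lemma K_deriv: "y \<in> T \<Longrightarrow> (\<psi> has_derivative K y) (at y)"
  by (rule smooth_on_has_derivative[OF smooth_psi])

lemma linear_J: "x \<in> S \<Longrightarrow> linear (J x)" and linear_K: "y \<in> T \<Longrightarrow> linear (K y)"
  using J_deriv K_deriv has_derivative_linear by blast+

lemma K_J:
  assumes "x \<in> S" shows "K (\<phi> x) (J x u) = u"
proof -
  have "((\<lambda>y. \<psi> (\<phi> y)) has_derivative (\<lambda>u. K (\<phi> x) (J x u))) (at x)"
    by (rule has_derivative_compose[OF J_deriv K_deriv]) (auto simp: assms phi_in)
  then have "((\<lambda>y. y) has_derivative (\<lambda>u. K (\<phi> x) (J x u))) (at x)"
    by (rule has_derivative_transform_within_open[OF _ open_S assms]) (rule psi_phi)
  from frechet_derivative_eqI[OF this] show ?thesis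
    by (simp add: fun_eq_iff)
qed

lemma J_K_psi: "y \<in> T \<Longrightarrow> J (\<psi> y) (K y u) = u"
  by (rule coord_change.K_J[OF swap])

lemma J_K: "x \<in> S \<Longrightarrow> J x (K (\<phi> x) u) = u"
  using J_K_psi[OF phi_in] by (simp add: psi_phi)

lemma smooth_J: "smooth_on S (\<lambda>x. J x u)"
  by (rule smooth_on_deriv[OF smooth_phi])

lemma J_has_derivative: "x \<in> S \<Longrightarrow> ((\<lambda>y. J y v) has_derivative (\<lambda>u. D2 x u v)) (at x)"
  by (rule smooth_on_has_derivative[OF smooth_J])

lemma smooth_D2: "smooth_on S (\<lambda>x. D2 x u v)"
  by (rule smooth_on_deriv[OF smooth_J])

lemma D2_sym: "x \<in> S \<Longrightarrow> D2 x u v = D2 x v u"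
  by (rule second_derivative_symmetric[OF open_S _ smooth_phi])

lemma D2_linear: "x \<in> S \<Longrightarrow> linear (\<lambda>u. D2 x u v)"
  using has_derivative_linear[OF J_has_derivative] .

lemma D2_bilinear:
  assumes "x \<in> S" shows "bilinear (D2 x)"
proof -
  have "D2 x u = (\<lambda>v. D2 x v u)" for u by (rule ext) (rule D2_sym[OF assms])
  then have "linear (D2 x u)" for u using D2_linear[OF assms] by presburger
  then show ?thesis using D2_linear[OF assms] by (auto simp: bilinear_def)
qed

end

section \<open>Curvature under a change of coordinates\<close>

text \<open>The curvature \<open>R(k, u) v\<close> before the trace over \<open>k\<close> is taken;
  it transforms vector by vector, which keeps the trace out of the long computation.\<close>

definition curv :: "('e \<Rightarrow> 'e \<Rightarrow> 'e \<Rightarrow> 'e) \<Rightarrow> 'e::euclidean_space \<Rightarrow> 'e \<Rightarrow> 'e \<Rightarrow> 'e \<Rightarrow> 'e" where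
  "curv \<Gamma> x k u v = frechet_derivative (\<lambda>y. \<Gamma> y u v) (at x) k - frechet_derivative (\<lambda>y. \<Gamma> y k v) (at x) u
       + \<Gamma> x k (\<Gamma> x u v) - \<Gamma> x u (\<Gamma> x k v)"

lemma ricci_curv: "ricci \<Gamma> x u v = (\<Sum>k\<in>Basis. curv \<Gamma> x k u v \<bullet> k)"
  by (simp add: ricci_def curv_def)

lemma ricci_cong:
  assumes "open S" "x \<in> S" "\<And>y u v. y \<in> S \<Longrightarrow> \<Gamma> y u v = \<Gamma>' y u v"
  shows "ricci \<Gamma> x u v = ricci \<Gamma>' x u v"
proof -
  have "frechet_derivative (\<lambda>y. \<Gamma> y u v) (at x) = frechet_derivative (\<lambda>y. \<Gamma>' y u v) (at x)" for u v
    by (rule frechet_derivative_cong_open[OF assms(1,2)]) (rule assms(3))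
  then show ?thesis using assms by (simp add: ricci_def)
qed

lemma bilinear_linear: "bilinear B \<Longrightarrow> linear (B u)" "bilinear B \<Longrightarrow> linear (\<lambda>u. B u v)"
  by (auto simp: bilinear_def)

lemma linear_frechet_param:
  fixes B :: "'e::euclidean_space \<Rightarrow> 'g::euclidean_space \<Rightarrow> 'f::real_normed_vector"
  assumes T: "open T" "x \<in> T" and l: "\<And>y. y \<in> T \<Longrightarrow> linear (B y)"
    and B: "\<And>u. (\<lambda>y. B y u) differentiable at x"
  shows "linear (\<lambda>u. frechet_derivative (\<lambda>y. B y u) (at x) k)"
proof (rule linearI)
  fix u v and r :: real
  have "((\<lambda>y. B y u + B y v) has_derivative (\<lambda>k. frechet_derivative (\<lambda>y. B y u) (at x) k
      + frechet_derivative (\<lambda>y. B y v) (at x) k)) (at x)"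
    by (intro has_derivative_add has_derivative_frechet B)
  then have "((\<lambda>y. B y (u + v)) has_derivative (\<lambda>k. frechet_derivative (\<lambda>y. B y u) (at x) k
      + frechet_derivative (\<lambda>y. B y v) (at x) k)) (at x)"
    by (rule has_derivative_transform_within_open[OF _ T]) (simp add: linear_add[OF l])
  from frechet_derivative_eqI[OF this]
  show "frechet_derivative (\<lambda>y. B y (u + v)) (at x) k = frechet_derivative (\<lambda>y. B y u) (at x) k
      + frechet_derivative (\<lambda>y. B y v) (at x) k" by simp
  have "((\<lambda>y. r *\<^sub>R B y u) has_derivative (\<lambda>k. r *\<^sub>R frechet_derivative (\<lambda>y. B y u) (at x) k)) (at x)"
    by (rule has_derivative_scaleR_right, rule has_derivative_frechet, rule B)
  then have "((\<lambda>y. B y (r *\<^sub>R u)) has_derivative (\<lambda>k. r *\<^sub>R frechet_derivative (\<lambda>y. B y u) (at x) k)) (at x)"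
    by (rule has_derivative_transform_within_open[OF _ T]) (simp add: linear_scale[OF l])
  from frechet_derivative_eqI[OF this]
  show "frechet_derivative (\<lambda>y. B y (r *\<^sub>R u)) (at x) k = r *\<^sub>R frechet_derivative (\<lambda>y. B y u) (at x) k"
    by simp
qed

lemma curv_linear:
  assumes T: "open T" "x \<in> T" and l: "\<And>y. y \<in> T \<Longrightarrow> bilinear (\<Gamma> y)"
    and d: "\<And>u v. (\<lambda>y. \<Gamma> y u v) differentiable at x"
  shows "linear (\<lambda>k. curv \<Gamma> x k u v)"
proof -
  have 1: "linear (\<lambda>k. frechet_derivative (\<lambda>y. \<Gamma> y u v) (at x) k)"
    using linear_frechet_derivative[OF d] .
  have 2: "linear (\<lambda>k. frechet_derivative (\<lambda>y. \<Gamma> y k v) (at x) u)"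
    by (rule linear_frechet_param[OF T, of "\<lambda>y k. \<Gamma> y k v"]) (auto intro: bilinear_linear l d)
  have 3: "linear (\<lambda>k. \<Gamma> x k (\<Gamma> x u v))" by (rule bilinear_linear[OF l[OF T(2)]])
  have 4: "linear (\<lambda>k. \<Gamma> x u (\<Gamma> x k v))"
    using linear_compose[OF bilinear_linear(2)[OF l[OF T(2)]] bilinear_linear(1)[OF l[OF T(2)]]]
    by (simp add: o_def)
  show ?thesis unfolding curv_def
    by (intro linear_compose_sub linear_compose_add 1 2 3 4)
qed

context coord_change
begin

text \<open>The transformation law of the connection is differentiated once. Third derivatives of
  \<open>\<phi>\<close> are symmetric and disappear on exchanging \<open>k\<close> and
  \<open>u\<close>; second derivatives cancel against those that arise when the law is inserted into
  the quadratic terms.\<close>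

lemma curv_transform:
  assumes x: "x \<in> S"
    and bil: "\<And>y. y \<in> S \<Longrightarrow> bilinear (\<Gamma> y)" "\<And>y. y \<in> T \<Longrightarrow> bilinear (\<Gamma>' y)"
    and d: "\<And>u v. (\<lambda>y. \<Gamma> y u v) differentiable at x" "\<And>u v. (\<lambda>y. \<Gamma>' y u v) differentiable at (\<phi> x)"
    and law: "\<And>y u v. y \<in> S \<Longrightarrow> \<Gamma>' (\<phi> y) (J y u) (J y v) = J y (\<Gamma> y u v) - D2 y u v"
  shows "curv \<Gamma>' (\<phi> x) (J x k) (J x u) (J x v) = J x (curv \<Gamma> x k u v)"
proof -
  note lin' = bilinear_linear[OF bil(2)[OF phi_in[OF x]]]
  \<comment> \<open>The law solved for \<open>J y (\<Gamma> y u v)\<close> and differentiated in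
    direction \<open>k\<close>; both sides are derivatives of the same function.\<close>
  have eq: "D2 x k (\<Gamma> x u v) + J x (frechet_derivative (\<lambda>y. \<Gamma> y u v) (at x) k) =
      frechet_derivative (\<lambda>y. \<Gamma>' y (J x u) (J x v)) (at (\<phi> x)) (J x k)
      + \<Gamma>' (\<phi> x) (D2 x k u) (J x v) + \<Gamma>' (\<phi> x) (J x u) (D2 x k v)
      + frechet_derivative (\<lambda>y. D2 y u v) (at x) k" for u v k
  proof -
    have 1: "((\<lambda>y. J y (\<Gamma> y u v)) has_derivative
        (\<lambda>k. D2 x k (\<Gamma> x u v) + J x (frechet_derivative (\<lambda>y. \<Gamma> y u v) (at x) k))) (at x)"
      by (rule has_derivative_linear_param[OF open_S, of "\<lambda>x. x" x J, OF _ linear_J _ has_derivative_ident])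
        (auto simp: x intro: smooth_on_differentiable[OF smooth_J] has_derivative_frechet d)
    have 2: "((\<lambda>y. \<Gamma>' (\<phi> y) (J y u) (J y v) + D2 y u v) has_derivative
      (\<lambda>k. (frechet_derivative (\<lambda>y. \<Gamma>' y (J x u) (J x v)) (at (\<phi> x)) (J x k)
      + \<Gamma>' (\<phi> x) (D2 x k u) (J x v) + \<Gamma>' (\<phi> x) (J x u) (D2 x k v))
      + frechet_derivative (\<lambda>y. D2 y u v) (at x) k)) (at x)"
      by (intro has_derivative_add smooth_on_has_derivative[OF smooth_D2 x]
          has_derivative_bilinear_param[OF open_T phi_in[OF x] bil(2) d(2) J_deriv[OF x]] J_has_derivative[OF x])
    have "((\<lambda>y. J y (\<Gamma> y u v)) has_derivative
      (\<lambda>k. (frechet_derivative (\<lambda>y. \<Gamma>' y (J x u) (J x v)) (at (\<phi> x)) (J x k)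
      + \<Gamma>' (\<phi> x) (D2 x k u) (J x v) + \<Gamma>' (\<phi> x) (J x u) (D2 x k v))
      + frechet_derivative (\<lambda>y. D2 y u v) (at x) k)) (at x)"
      by (rule has_derivative_transform_within_open[OF 2 open_S x]) (simp add: law)
    from has_derivative_unique[OF 1 this] show ?thesis by (rule fun_cong)
  qed
  have eq': "J x (frechet_derivative (\<lambda>y. \<Gamma> y u v) (at x) k) =
      frechet_derivative (\<lambda>y. \<Gamma>' y (J x u) (J x v)) (at (\<phi> x)) (J x k)
      + \<Gamma>' (\<phi> x) (D2 x k u) (J x v) + \<Gamma>' (\<phi> x) (J x u) (D2 x k v)
      + frechet_derivative (\<lambda>y. D2 y u v) (at x) k - D2 x k (\<Gamma> x u v)" for u v k
    using eq[of u v k] by (simp only: eq_diff_eq add.commute)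
  have D3: "frechet_derivative (\<lambda>y. D2 y u v) (at x) k = frechet_derivative (\<lambda>y. D2 y k v) (at x) u"
    by (rule second_derivative_symmetric[OF open_S x smooth_J])
  have law': "J x (\<Gamma> x u v) = \<Gamma>' (\<phi> x) (J x u) (J x v) + D2 x u v" for u v
    using law[OF x, of u v] by simp
  have JJ: "J x (\<Gamma> x a (\<Gamma> x b v)) = \<Gamma>' (\<phi> x) (J x a) (\<Gamma>' (\<phi> x) (J x b) (J x v))
      + \<Gamma>' (\<phi> x) (J x a) (D2 x b v) + D2 x a (\<Gamma> x b v)" for a b
    unfolding law'[of a] law'[of b] linear_add[OF lin'(1)] by simp
  have "J x (curv \<Gamma> x k u v) = J x (frechet_derivative (\<lambda>y. \<Gamma> y u v) (at x) k)
      - J x (frechet_derivative (\<lambda>y. \<Gamma> y k v) (at x) u)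
      + J x (\<Gamma> x k (\<Gamma> x u v)) - J x (\<Gamma> x u (\<Gamma> x k v))"
    by (simp add: curv_def linear_add[OF linear_J[OF x]] linear_diff[OF linear_J[OF x]])
  also have "\<dots> = curv \<Gamma>' (\<phi> x) (J x k) (J x u) (J x v)"
    unfolding JJ curv_def eq' D3 D2_sym[OF x, of u k] by (simp add: algebra_simps)
  finally show ?thesis ..
qed

text \<open>A trace is invariant under conjugation: \<open>trace_cyclic\<close> moves
  \<open>J x\<close> to the other side, where it cancels against its inverse.\<close>

lemma ricci_transform:
  assumes x: "x \<in> S"
    and bil: "\<And>y. y \<in> S \<Longrightarrow> bilinear (\<Gamma> y)" "\<And>y. y \<in> T \<Longrightarrow> bilinear (\<Gamma>' y)"
    and d: "\<And>u v. (\<lambda>y. \<Gamma> y u v) differentiable at x" "\<And>u v. (\<lambda>y. \<Gamma>' y u v) differentiable at (\<phi> x)"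
    and law: "\<And>y u v. y \<in> S \<Longrightarrow> \<Gamma>' (\<phi> y) (J y u) (J y v) = J y (\<Gamma> y u v) - D2 y u v"
  shows "ricci \<Gamma>' (\<phi> x) (J x u) (J x v) = ricci \<Gamma> x u v"
proof -
  have C: "curv \<Gamma>' (\<phi> x) k (J x u) (J x v) = J x (curv \<Gamma> x (K (\<phi> x) k) u v)" for k
    using curv_transform[OF assms, of "K (\<phi> x) k" u v] by (simp add: J_K x)
  have "linear (\<lambda>k. curv \<Gamma> x (K (\<phi> x) k) u v)"
    using linear_compose[OF linear_K[OF phi_in[OF x]] curv_linear[OF open_S x bil(1) d(1)]]
    by (simp add: o_def)
  from trace_cyclic[OF linear_J[OF x] this] show ?thesis
    unfolding ricci_curv C by (simp add: K_J x)
qed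

end

section \<open>The Levi-Civita connection under a change of coordinates\<close>

text \<open>The right-hand side of the equation that characterises \<open>levi_civita\<close>, named
  so that an explicit candidate can be tested against it.\<close>

definition koszul :: "('e \<Rightarrow> 'e \<Rightarrow> 'e \<Rightarrow> real) \<Rightarrow> 'e::euclidean_space \<Rightarrow> 'e \<Rightarrow> 'e \<Rightarrow> 'e \<Rightarrow> real" where
  "koszul G x u v z =
     (frechet_derivative (\<lambda>y. G y v z) (at x) u + frechet_derivative (\<lambda>y. G y u z) (at x) v
      - frechet_derivative (\<lambda>y. G y u v) (at x) z) / 2"

definition nondeg :: "('e::real_vector \<Rightarrow> 'e \<Rightarrow> real) \<Rightarrow> bool" where
  "nondeg B \<longleftrightarrow> bilinear B \<and> (\<forall>u. (\<forall>v. B u v = 0) \<longrightarrow> u = 0)"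

lemma nondeg_unique:
  assumes "nondeg B" "\<And>z. B w z = f z" shows "(THE w. \<forall>z. B w z = f z) = w"
proof (rule the_equality)
  fix w' assume "\<forall>z. B w' z = f z"
  then have "B (w' - w) z = 0" for z
    using assms by (simp add: nondeg_def bilinear_lsub)
  then have "w' - w = 0" using assms(1) unfolding nondeg_def by blast
  then show "w' = w" by simp
qed (use assms in auto)

lemma levi_civita_eqI:
  assumes "nondeg (G x)" "\<And>z. G x w z = koszul G x u v z"
  shows "levi_civita G x u v = w"
  using nondeg_unique[OF assms] by (simp add: levi_civita_def koszul_def)

lemma nondeg_pullback:
  assumes "nondeg B" "linear J" "\<And>u. J (K u) = u" "\<And>u. K (J u) = u"
  shows "nondeg (\<lambda>u v. B (J u) (J v))"
  unfolding nondeg_def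
proof (intro conjI allI impI)
  show "bilinear (\<lambda>u v. B (J u) (J v))"
    using assms(1,2) linear_compose[OF assms(2), of "B _"] linear_compose[OF assms(2), of "\<lambda>u. B u _"]
    by (auto simp: nondeg_def bilinear_def o_def)
  fix u assume "\<forall>v. B (J u) (J v) = 0"
  then have "B (J u) v = 0" for v using assms(3)[of v] by metis
  then have "J u = 0" using assms(1) by (auto simp: nondeg_def)
  then show "u = 0" using assms(2,4) linear_0 by metis
qed

context coord_change
begin

text \<open>Of the six terms with second derivatives of \<open>\<phi>\<close>, four cancel in pairs
  by symmetry and two coincide. What is left is the inhomogeneous term in the transformation law of
  a connection.\<close>

lemma koszul_pullback:
  assumes x: "x \<in> S"
    and bil: "\<And>y. y \<in> T \<Longrightarrow> bilinear (G' y)" and sym: "\<And>y u v. y \<in> T \<Longrightarrow> G' y u v = G' y v u"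
    and d: "\<And>u v. (\<lambda>y. G' y u v) differentiable at (\<phi> x)"
    and G: "\<And>y u v. y \<in> S \<Longrightarrow> G y u v = G' (\<phi> y) (J y u) (J y v)"
  shows "koszul G x u v z = koszul G' (\<phi> x) (J x u) (J x v) (J x z) + G' (\<phi> x) (D2 x u v) (J x z)"
proof -
  have "((\<lambda>y. G y a b) has_derivative (\<lambda>k. frechet_derivative (\<lambda>y. G' y (J x a) (J x b)) (at (\<phi> x)) (J x k)
      + G' (\<phi> x) (D2 x k a) (J x b) + G' (\<phi> x) (J x a) (D2 x k b))) (at x)" for a b
    by (rule has_derivative_transform_within_open[OF has_derivative_bilinear_param[OF open_T phi_in[OF x]
        bil d J_deriv[OF x] J_has_derivative[OF x] J_has_derivative[OF x]] open_S x])
      (auto simp: G)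
  then have "frechet_derivative (\<lambda>y. G y a b) (at x) k = frechet_derivative (\<lambda>y. G' y (J x a) (J x b)) (at (\<phi> x)) (J x k)
      + G' (\<phi> x) (D2 x k a) (J x b) + G' (\<phi> x) (J x a) (D2 x k b)" for a b k
    by (rule fun_cong[OF frechet_derivative_eqI])
  then show ?thesis
    unfolding koszul_def
    by (simp add: D2_sym[OF x, of v u] D2_sym[OF x, of z u] D2_sym[OF x, of z v]
        sym[OF phi_in[OF x], of "D2 x z u" "J x v"] field_simps)
qed

text \<open>The transformation law solved for the Christoffel symbols in the first chart, where
  \<open>L\<close> is an explicit solution of the Koszul equation in the second.\<close>

lemma levi_civita_pullback:
  assumes x: "x \<in> S"
    and nd: "\<And>y. y \<in> T \<Longrightarrow> nondeg (G' y)" and sym: "\<And>y u v. y \<in> T \<Longrightarrow> G' y u v = G' y v u"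
    and d: "\<And>u v. smooth_on T (\<lambda>y. G' y u v)"
    and LC: "\<And>y u v z. y \<in> T \<Longrightarrow> G' y (L y u v) z = koszul G' y u v z"
    and G: "\<And>y u v. y \<in> S \<Longrightarrow> G y u v = G' (\<phi> y) (J y u) (J y v)"
  shows "levi_civita G x u v = K (\<phi> x) (L (\<phi> x) (J x u) (J x v) + D2 x u v)"
proof (rule levi_civita_eqI)
  have bil: "bilinear (G' y)" if "y \<in> T" for y using nd[OF that] by (simp add: nondeg_def)
  have "nondeg (\<lambda>u v. G' (\<phi> x) (J x u) (J x v))"
    by (rule nondeg_pullback[OF nd linear_J, of _ _ "K (\<phi> x)"]) (auto simp: x phi_in K_J J_K)
  then show "nondeg (G x)" using G[OF x] by presburger
  fix z
  show "G x (K (\<phi> x) (L (\<phi> x) (J x u) (J x v) + D2 x u v)) z = koszul G x u v z"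
    by (subst koszul_pullback[OF x bil sym smooth_on_differentiable[OF d phi_in[OF x]] G])
      (auto simp: G[OF x] J_K x LC phi_in bilinear_ladd[OF bil])
qed

text \<open>\<open>levi_civita G\<close> is a definite description, so on \<open>S\<close> it is
  replaced by the explicit field \<open>M\<close>, for which bilinearity and smoothness can be
  checked before the curvature is transformed.\<close>

lemma ricci_levi_civita_pullback:
  assumes x: "x \<in> S"
    and nd: "\<And>y. y \<in> T \<Longrightarrow> nondeg (G' y)" and sym: "\<And>y u v. y \<in> T \<Longrightarrow> G' y u v = G' y v u"
    and d: "\<And>u v. smooth_on T (\<lambda>y. G' y u v)"
    and LC: "\<And>y u v z. y \<in> T \<Longrightarrow> G' y (L y u v) z = koszul G' y u v z"
    and bilL: "\<And>y. y \<in> T \<Longrightarrow> bilinear (L y)" and sL: "\<And>u v. smooth_on T (\<lambda>y. L y u v)"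
    and G: "\<And>y u v. y \<in> S \<Longrightarrow> G y u v = G' (\<phi> y) (J y u) (J y v)"
  shows "ricci (levi_civita G) x u v = ricci L (\<phi> x) (J x u) (J x v)"
proof -
  define M where "M y a b = K (\<phi> y) (L (\<phi> y) (J y a) (J y b) + D2 y a b)" for y a b
  have "ricci (levi_civita G) x u v = ricci M x u v"
    by (rule ricci_cong[OF open_S x]) (simp add: M_def levi_civita_pullback[OF _ nd sym d LC G])
  also have "\<dots> = ricci L (\<phi> x) (J x u) (J x v)"
  proof (rule ricci_transform[symmetric, OF x _ bilL])
    have linK: "linear (K (\<phi> y))" if "y \<in> S" for y using that by (intro linear_K phi_in)
    have bil: "bilinear (\<lambda>a b. L (\<phi> y) (J y a) (J y b) + D2 y a b)" if y: "y \<in> S" for y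
      unfolding bilinear_def
      using linear_compose[OF linear_J[OF y] bilinear_linear(1)[OF bilL[OF phi_in[OF y]]]]
       linear_compose[OF linear_J[OF y] bilinear_linear(2)[OF bilL[OF phi_in[OF y]]]]
       bilinear_linear[OF D2_bilinear[OF y]]
      by (auto simp: o_def intro!: linear_compose_add)
    show "bilinear (M y)" if "y \<in> S" for y
      using linear_compose[OF bilinear_linear(1)[OF bil[OF that]] linK[OF that]]
        linear_compose[OF bilinear_linear(2)[OF bil[OF that]] linK[OF that]]
      by (auto simp: M_def bilinear_def o_def)
    show "(\<lambda>y. L y a b) differentiable at (\<phi> x)" for a b
      using smooth_on_differentiable[OF sL phi_in[OF x]] .
    have "smooth_on S (\<lambda>y. L (\<phi> y) (J y a) (J y b))" for a b
      by (rule smooth_on_bilinear_param[OF open_S, of "\<lambda>y. L (\<phi> y)"])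
        (auto intro!: smooth_on_compose[OF open_S open_T phi_image sL smooth_phi] bilL phi_in smooth_J)
    then have "smooth_on S (\<lambda>y. M y a b)" for a b
      unfolding M_def
      by (intro smooth_on_frechet_derivative[OF open_S open_T phi_image smooth_psi smooth_phi]
          smooth_on_add[OF open_S] smooth_D2)
    then show "(\<lambda>y. M y a b) differentiable at x" for a b
      using x by (rule smooth_on_differentiable)
    show "L (\<phi> y) (J y a) (J y b) = J y (M y a b) - D2 y a b" if "y \<in> S" for y a b
      using that by (simp add: M_def J_K)
  qed
  finally show ?thesis .
qed

end

section \<open>Pullback of neutral forms\<close>

lemma neutral_form_nondeg: "neutral_form B \<Longrightarrow> nondeg B"
  by (auto simp: neutral_form_def nondeg_def)

lemma neutral_form_pullback:
  fixes B :: "'e::euclidean_space \<Rightarrow> 'e \<Rightarrow> real" and J K :: "'e \<Rightarrow> 'e"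
  assumes B: "neutral_form B" and J: "linear J" and K: "linear K" "\<And>u. J (K u) = u" "\<And>u. K (J u) = u"
  shows "neutral_form (\<lambda>u v. B (J u) (J v))"
proof -
  have nd: "nondeg (\<lambda>u v. B (J u) (J v))"
    by (rule nondeg_pullback[OF neutral_form_nondeg[OF B] J K(2,3)])
  have inj: "inj K" using K by (metis injI)
  \<comment> \<open>One argument for both signs: a half-dimensional subspace on which
    \<open>Q\<close> holds is carried over by the inverse map \<open>K\<close>.\<close>
  have sub: "\<exists>S'. subspace S' \<and> 2 * dim S' = DIM('e) \<and> (\<forall>u\<in>S'. u \<noteq> 0 \<longrightarrow> Q (J u))"
    if "\<exists>S. subspace S \<and> 2 * dim S = DIM('e) \<and> (\<forall>u\<in>S. u \<noteq> 0 \<longrightarrow> Q u)" for Q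
  proof -
    from that obtain S where S: "subspace S" "2 * dim S = DIM('e)" "\<And>u. u \<in> S \<Longrightarrow> u \<noteq> 0 \<Longrightarrow> Q u" by blast
    show ?thesis
    proof (intro exI[of _ "K ` S"] conjI ballI impI)
      show "subspace (K ` S)" by (rule linear_subspace_image[OF K(1) S(1)])
      show "2 * dim (K ` S) = DIM('e)"
        using dim_image_eq[OF K(1), of S] inj S(2) by (simp add: inj_on_subset)
      fix u assume "u \<in> K ` S" "u \<noteq> 0"
      then obtain s where s: "s \<in> S" "u = K s" by blast
      then have "s \<noteq> 0" using \<open>u \<noteq> 0\<close> linear_0[OF K(1)] by auto
      then show "Q (J u)" using S(3) s K(2) by simp
    qed
  qed
  show ?thesis
    using B nd sub[of "\<lambda>u. B u u > 0"] sub[of "\<lambda>u. B u u < 0"]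
    unfolding neutral_form_def nondeg_def by auto
qed

section \<open>The metric in fibre coordinates\<close>

lemma sum_Basis_prod:
  fixes f :: "'e::euclidean_space \<times> 'f::euclidean_space \<Rightarrow> 'g::comm_monoid_add"
  shows "(\<Sum>k\<in>Basis. f k) = (\<Sum>k\<in>Basis. f (k, 0)) + (\<Sum>k\<in>Basis. f (0, k))"
proof -
  have "inj_on (\<lambda>u. (u::'e, 0::'f)) Basis" "inj_on (\<lambda>u. (0::'e, u::'f)) Basis"
    by (auto intro!: inj_onI)
  then show ?thesis
    unfolding Basis_prod_def by (subst sum.union_disjoint) (auto simp: sum.reindex)
qed

lemma contract_Basis:
  fixes L :: "'e::euclidean_space \<Rightarrow> real"
  assumes "linear L" shows "(\<Sum>k\<in>Basis. (k \<bullet> w) * L k) = L w" "(\<Sum>k\<in>Basis. (w \<bullet> k) * L k) = L w"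
  using linear_euclidean_expand[OF assms, of w] by (simp_all add: inner_commute)

lemma sum_Basis_inner:
  fixes v w :: "'e::euclidean_space"
  shows "(\<Sum>k\<in>Basis. (w \<bullet> k) * (k \<bullet> v)) = w \<bullet> v" "(\<Sum>k\<in>Basis. (w \<bullet> k) * (v \<bullet> k)) = w \<bullet> v"
  using euclidean_inner[of w v] inner_commute[of v] by simp_all

lemma riesz_sum:
  fixes L :: "'e::euclidean_space \<Rightarrow> real"
  assumes "linear L" shows "(\<Sum>k\<in>Basis. L k *\<^sub>R k) \<bullet> w = L w"
  using contract_Basis(1)[OF assms, of w] by (simp add: inner_sum_left mult.commute)

text \<open>The coefficient of dx \<odot> dx: minus the bracket of the coordinate formula, with
  \<open>s\<close> in the place of the symmetrised Schouten tensor.\<close>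

definition model_tensor :: "('e \<Rightarrow> 'e \<Rightarrow> 'e \<Rightarrow> 'e) \<Rightarrow> ('e \<Rightarrow> 'e \<Rightarrow> 'e \<Rightarrow> real) \<Rightarrow> 'e::euclidean_space \<times> 'e
    \<Rightarrow> 'e \<Rightarrow> 'e \<Rightarrow> real" where
  "model_tensor \<Gamma> s z u v =
     (snd z \<bullet> u) * (snd z \<bullet> v) + s (fst z) u v - snd z \<bullet> \<Gamma> (fst z) u v"

definition model_metric :: "('e \<Rightarrow> 'e \<Rightarrow> 'e \<Rightarrow> 'e) \<Rightarrow> ('e \<Rightarrow> 'e \<Rightarrow> 'e \<Rightarrow> real) \<Rightarrow> 'e::euclidean_space \<times> 'e
    \<Rightarrow> 'e \<times> 'e \<Rightarrow> 'e \<times> 'e \<Rightarrow> real" where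
  "model_metric \<Gamma> s z a b =
     (snd a \<bullet> fst b + snd b \<bullet> fst a) / 2 + model_tensor \<Gamma> s z (fst a) (fst b)"

text \<open>\<open>s\<close> is an arbitrary smooth symmetric form at this stage; its relation to
  the Ricci tensor of \<open>\<Gamma>\<close> enters as a hypothesis of the Einstein equation
  \<open>ricci_LC\<close>.\<close>

locale fibre_model =
  fixes S :: "'e::euclidean_space set" and \<Gamma> :: "'e \<Rightarrow> 'e \<Rightarrow> 'e \<Rightarrow> 'e" and s :: "'e \<Rightarrow> 'e \<Rightarrow> 'e \<Rightarrow> real"
  assumes open_S: "open S"
    and bilG: "x \<in> S \<Longrightarrow> bilinear (\<Gamma> x)" and symG: "x \<in> S \<Longrightarrow> \<Gamma> x u v = \<Gamma> x v u"
    and smoothG: "smooth_on S (\<lambda>x. \<Gamma> x u v)"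
    and bils: "x \<in> S \<Longrightarrow> bilinear (s x)" and syms: "x \<in> S \<Longrightarrow> s x u v = s x v u"
    and smooths: "smooth_on S (\<lambda>x. s x u v)"
begin

abbreviation Z :: "('e \<times> 'e) set" where "Z \<equiv> S \<times> UNIV"
abbreviation T where "T \<equiv> model_tensor \<Gamma> s"
abbreviation G where "G \<equiv> model_metric \<Gamma> s"

text \<open>
  In block form the metric is \<open>(T, I/2; I/2, 0)\<close> with inverse \<open>(0, 2I; 2I, -4T)\<close>. Raising the index of the Koszul
  formula with this inverse gives the base component \<open>C\<close> and the fibre component of \<open>LC\<close>.
\<close>

definition C :: "'e \<times> 'e \<Rightarrow> 'e \<Rightarrow> 'e \<Rightarrow> 'e" where
  "C z u v = \<Gamma> (fst z) u v - (snd z \<bullet> v) *\<^sub>R u - (snd z \<bullet> u) *\<^sub>R v"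

definition dT :: "'e \<times> 'e \<Rightarrow> 'e \<times> 'e \<Rightarrow> 'e \<Rightarrow> 'e \<Rightarrow> real" where
  "dT z c u v = frechet_derivative (\<lambda>z. T z u v) (at z) c"

definition E :: "'e \<times> 'e \<Rightarrow> 'e \<Rightarrow> 'e \<Rightarrow> 'e" where
  "E z u v = (\<Sum>k\<in>Basis. (dT z (u, 0) v k + dT z (v, 0) u k - dT z (k, 0) u v - 2 * T z (C z u v) k) *\<^sub>R k)"

definition LC :: "'e \<times> 'e \<Rightarrow> 'e \<times> 'e \<Rightarrow> 'e \<times> 'e \<Rightarrow> 'e \<times> 'e" where
  "LC z a b = (C z (fst a) (fst b), E z (fst a) (fst b)
     - (\<Sum>k\<in>Basis. (snd a \<bullet> C z (fst b) k + snd b \<bullet> C z (fst a) k) *\<^sub>R k))"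

lemma open_Z: "open Z" using open_S by (simp add: open_Times)

lemmas linG = bilinear_linear[OF bilG] and lins = bilinear_linear[OF bils]

lemma smooth_base:
  assumes "smooth_on S f" shows "smooth_on Z (\<lambda>z. f (fst z))"
  by (rule smooth_on_compose[OF open_Z open_S _ assms])
    (auto intro: smooth_on_fst[OF open_Z] smooth_on_ident)

lemma smooth_fibre: "smooth_on Z (\<lambda>z. snd z \<bullet> u)"
  by (intro smooth_on_inner[OF open_Z] smooth_on_snd[OF open_Z] smooth_on_ident smooth_on_const)

lemma smooth_T: "smooth_on Z (\<lambda>z. T z u v)"
  unfolding model_tensor_def
  by (intro smooth_on_diff[OF open_Z] smooth_on_add[OF open_Z] smooth_on_mult[OF open_Z] smooth_fibre
      smooth_on_inner[OF open_Z] smooth_on_snd[OF open_Z] smooth_on_ident smooth_base smoothG smooths)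

lemma smooth_G: "smooth_on Z (\<lambda>z. G z a b)"
  unfolding model_metric_def by (intro smooth_on_add[OF open_Z] smooth_on_const smooth_T)

lemma smooth_C: "smooth_on Z (\<lambda>z. C z u v)"
  unfolding C_def
  by (intro smooth_on_diff[OF open_Z] smooth_on_scaleR[OF open_Z] smooth_fibre smooth_on_const
      smooth_base smoothG)

lemma smooth_dT: "smooth_on Z (\<lambda>z. dT z c u v)"
  unfolding dT_def by (rule smooth_on_deriv[OF smooth_T])

lemma bil_T: "z \<in> Z \<Longrightarrow> bilinear (T z)"
  unfolding bilinear_def model_tensor_def
  by (auto intro!: linearI simp: linear_add[OF linG(1)] linear_add[OF linG(2)] linear_add[OF lins(1)]
      linear_add[OF lins(2)] linear_scale[OF linG(1)] linear_scale[OF linG(2)] linear_scale[OF lins(1)]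
      linear_scale[OF lins(2)] inner_add algebra_simps)

lemmas linT = bilinear_linear[OF bil_T]

lemma sym_T: "z \<in> Z \<Longrightarrow> T z u v = T z v u"
  using symG[of "fst z" u v] syms[of "fst z" u v] by (auto simp: model_tensor_def)

lemma bil_C: "z \<in> Z \<Longrightarrow> bilinear (C z)"
  unfolding bilinear_def C_def
  by (auto intro!: linearI simp: linear_add[OF linG(1)] linear_add[OF linG(2)]
      linear_scale[OF linG(1)] linear_scale[OF linG(2)] inner_add algebra_simps)

lemmas linC = bilinear_linear[OF bil_C]

lemma sym_C: "z \<in> Z \<Longrightarrow> C z u v = C z v u"
  using symG[of "fst z" u v] by (auto simp: C_def)

lemma smooth_LC: "smooth_on Z (\<lambda>z. LC z a b)"
  unfolding LC_def E_def
  by (intro smooth_on_Pair[OF open_Z] smooth_on_diff[OF open_Z] smooth_on_sum[OF open_Z] smooth_C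
      smooth_on_scaleR[OF open_Z] smooth_on_add[OF open_Z] smooth_on_mult[OF open_Z] smooth_dT
      smooth_on_const smooth_on_inner[OF open_Z]
      smooth_on_bilinear_param[OF open_Z, where B = T, OF smooth_T bil_T])

lemma has_derivative_T:
  assumes z: "(x, \<xi>) \<in> Z"
  shows "((\<lambda>z. T z u v) has_derivative (\<lambda>(h, \<gamma>). (\<gamma> \<bullet> u) * (\<xi> \<bullet> v) + (\<xi> \<bullet> u) * (\<gamma> \<bullet> v)
     + frechet_derivative (\<lambda>y. s y u v) (at x) h - \<gamma> \<bullet> \<Gamma> x u v
     - \<xi> \<bullet> frechet_derivative (\<lambda>y. \<Gamma> y u v) (at x) h)) (at (x, \<xi>))"
proof -
  have x: "x \<in> S" using z by simp
  have 1: "((\<lambda>z. s (fst z) u v) has_derivative (\<lambda>a. frechet_derivative (\<lambda>y. s y u v) (at x) (fst a))) (at (x, \<xi>))"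
    by (rule has_derivative_compose[OF has_derivative_fst[OF has_derivative_ident]])
      (simp add: smooth_on_has_derivative[OF smooths x])
  have 2: "((\<lambda>z. \<Gamma> (fst z) u v) has_derivative (\<lambda>a. frechet_derivative (\<lambda>y. \<Gamma> y u v) (at x) (fst a))) (at (x, \<xi>))"
    by (rule has_derivative_compose[OF has_derivative_fst[OF has_derivative_ident]])
      (simp add: smooth_on_has_derivative[OF smoothG x])
  show ?thesis
    unfolding model_tensor_def
    by (rule has_derivative_eq_rhs, rule has_derivative_diff, rule has_derivative_add,
        rule has_derivative_mult, (rule has_derivative_inner_left, rule has_derivative_snd, rule has_derivative_ident)+,
        rule 1, rule has_derivative_inner, rule has_derivative_snd, rule has_derivative_ident, rule 2)
      (auto simp: fun_eq_iff algebra_simps)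
qed

lemma dT_eq:
  assumes z: "(x, \<xi>) \<in> Z"
  shows "dT (x, \<xi>) (h, \<gamma>) u v = (\<gamma> \<bullet> u) * (\<xi> \<bullet> v) + (\<xi> \<bullet> u) * (\<gamma> \<bullet> v)
     + frechet_derivative (\<lambda>y. s y u v) (at x) h - \<gamma> \<bullet> \<Gamma> x u v
     - \<xi> \<bullet> frechet_derivative (\<lambda>y. \<Gamma> y u v) (at x) h"
  unfolding dT_def by (simp add: frechet_derivative_eqI[OF has_derivative_T[OF z]])

lemma lin_dT:
  assumes z: "z \<in> Z"
  shows "linear (\<lambda>c. dT z c u v)" "linear (\<lambda>u. dT z c u v)" "linear (\<lambda>v. dT z c u v)"
  unfolding dT_def
  using linear_frechet_derivative[OF smooth_on_differentiable[OF smooth_T z]]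
    linear_frechet_param[OF open_Z z, of "\<lambda>y u. T y u v", OF linT(2) smooth_on_differentiable[OF smooth_T z]]
    linear_frechet_param[OF open_Z z, of "\<lambda>y v. T y u v", OF linT(1) smooth_on_differentiable[OF smooth_T z]]
  by simp_all

text \<open>\<open>T\<close> is a quadratic polynomial in the fibre, and its fibre derivative yields
  \<open>C\<close>, which pointwise has the form of the projective change of \<open>\<Gamma>\<close>
  by the covector \<open>- snd z\<close>. All fibre derivatives in the Koszul formula thereby become
  algebraic.\<close>

lemma dT_fibre:
  assumes z: "z \<in> Z" shows "dT z (0, \<gamma>) u v = - (\<gamma> \<bullet> C z u v)"
proof -
  obtain x \<xi> where zx: "z = (x, \<xi>)" by (cases z)
  have x: "x \<in> S" using z zx by simp
  show ?thesis
    unfolding zx using z x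
    by (subst dT_eq) (auto simp: zx C_def inner_diff_right algebra_simps
        linear_0[OF linear_frechet_derivative[OF smooth_on_differentiable[OF smoothG x]]]
        linear_0[OF linear_frechet_derivative[OF smooth_on_differentiable[OF smooths x]]])
qed

lemma dT_split: "z \<in> Z \<Longrightarrow> dT z (h, \<gamma>) u v = dT z (h, 0) u v - \<gamma> \<bullet> C z u v"
  using linear_add[OF lin_dT(1), of z "(h, 0)" "(0, \<gamma>)" u v] dT_fibre[of z \<gamma> u v] by simp

lemma E_inner:
  assumes z: "z \<in> Z"
  shows "E z u v \<bullet> w = dT z (u, 0) v w + dT z (v, 0) u w - dT z (w, 0) u v - 2 * T z (C z u v) w"
proof -
  let ?L = "\<lambda>w. dT z (u, 0) v w + dT z (v, 0) u w - dT z (w, 0) u v - 2 * T z (C z u v) w"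
  have "linear (\<lambda>w. dT z (w, 0) u v)"
    using linear_compose[OF _ lin_dT(1)[OF z], of "\<lambda>w. (w, 0)"] by (simp add: o_def linearI)
  then have "linear ?L"
    using z linear_compose[OF linT(1)[OF z] linear_times[of 2]]
    by (auto intro!: linear_compose_sub linear_compose_add lin_dT simp: o_def)
  from riesz_sum[OF this, of w] show ?thesis by (simp add: E_def)
qed

lemma snd_LC_inner:
  assumes z: "z \<in> Z"
  shows "snd (LC z a b) \<bullet> w = E z (fst a) (fst b) \<bullet> w - snd a \<bullet> C z (fst b) w - snd b \<bullet> C z (fst a) w"
proof -
  have "linear (\<lambda>w. snd a \<bullet> C z (fst b) w + snd b \<bullet> C z (fst a) w)"
    by (auto intro!: linearI simp: linear_add[OF linC(1)[OF z]] linear_scale[OF linC(1)[OF z]] inner_add algebra_simps)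
  from riesz_sum[OF this, of w] show ?thesis by (simp add: LC_def inner_diff_left)
qed

text \<open>The pairing part of the metric has constant coefficients, so only derivatives of
  \<open>T\<close> occur. Splitting each of them into base and fibre directions gives exactly the
  terms collected in \<open>LC\<close>.\<close>

lemma koszul_G:
  assumes z: "z \<in> Z" shows "G z (LC z a b) c = koszul G z a b c"
proof -
  obtain u \<alpha> v \<beta> w \<gamma> where abc: "a = (u, \<alpha>)" "b = (v, \<beta>)" "c = (w, \<gamma>)" by (metis prod.exhaust)
  have "frechet_derivative (\<lambda>z. G z a b) (at z) c = dT z c (fst a) (fst b)" for a b c
  proof -
    have "((\<lambda>z. G z a b) has_derivative (\<lambda>c. 0 + dT z c (fst a) (fst b))) (at z)"
      unfolding model_metric_def dT_def
      by (intro has_derivative_add has_derivative_const smooth_on_has_derivative[OF smooth_T z])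
    from frechet_derivative_eqI[OF this] show ?thesis by simp
  qed
  then have "koszul G z a b c = (dT z (u, \<alpha>) v w + dT z (v, \<beta>) u w - dT z (w, \<gamma>) u v) / 2"
    by (simp add: koszul_def abc)
  also have "\<dots> = (dT z (u, 0) v w + dT z (v, 0) u w - dT z (w, 0) u v
      - \<alpha> \<bullet> C z v w - \<beta> \<bullet> C z u w + \<gamma> \<bullet> C z u v) / 2"
    using z by (simp add: dT_split[of z u \<alpha>] dT_split[of z v \<beta>] dT_split[of z w \<gamma>])
  also have "\<dots> = G z (LC z a b) c"
    using snd_LC_inner[OF z, of a b w] E_inner[OF z, of u v w]
    by (simp add: model_metric_def abc) (simp add: LC_def field_simps)
  finally show ?thesis ..
qed

lemma bil_G: "z \<in> Z \<Longrightarrow> bilinear (G z)"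
  unfolding bilinear_def model_metric_def
  by (auto intro!: linearI simp: linear_add[OF linT(1)] linear_add[OF linT(2)]
      linear_scale[OF linT(1)] linear_scale[OF linT(2)] inner_add field_simps)

lemma sym_G: "z \<in> Z \<Longrightarrow> G z a b = G z b a"
  using sym_T[of z "fst a" "fst b"] by (simp add: model_metric_def)

lemma neutral_G:
  assumes z: "z \<in> Z" shows "neutral_form (G z)"
proof -
  define R where "R u = (\<Sum>k\<in>Basis. T z u k *\<^sub>R k)" for u
  have R: "R u \<bullet> v = T z u v" for u v
    unfolding R_def by (rule riesz_sum[OF linT(1)[OF z]])
  have linR: "linear R"
    by (rule linearI; rule euclidean_eqI)
      (simp_all add: R inner_add_left linear_add[OF linT(2)[OF z]] linear_scale[OF linT(2)[OF z]])
  \<comment> \<open>A test vector along the fibre detects the base part of \<open>u\<close>; once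
    that vanishes, one along the base detects the fibre part.\<close>
  have nd: "u = 0" if "\<forall>v. G z u v = 0" for u
  proof -
    obtain a b where u: "u = (a, b)" by (cases u)
    have "G z u (0, a) = a \<bullet> a / 2"
      by (simp add: u model_metric_def linear_0[OF linT(1)[OF z]])
    then have a: "a = 0" using that by simp
    have "G z u (b, 0) = b \<bullet> b / 2"
      by (simp add: u a model_metric_def linear_0[OF linT(2)[OF z]])
    then show ?thesis using that by (simp add: u a zero_prod_def)
  qed
  have sub: "\<exists>S. subspace S \<and> 2 * dim S = DIM('e \<times> 'e) \<and> (\<forall>u\<in>S. u \<noteq> 0 \<longrightarrow> 0 < c * G z u u)" if "c * c = 1" for c
  proof -
    \<comment> \<open>The image of \<open>f\<close> is a graph over the base. Subtracting
      \<open>R\<close> cancels the contribution of \<open>T\<close>, so on it the metric is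
      \<open>c\<close> times the Euclidean square; the choices 1 and -1 of \<open>c\<close> give the
      two definite subspaces.\<close>
    define f where "f u = (u, c *\<^sub>R u - R u)" for u
    have f: "linear f"
      by (rule linearI) (auto simp: f_def linear_add[OF linR] linear_scale[OF linR] algebra_simps)
    have "inj f" by (auto simp: inj_on_def f_def)
    then have "dim (range f) = DIM('e)" using dim_image_eq[OF f, of UNIV] by (simp add: inj_on_subset)
    moreover have "G z (f u) (f u) = c * (u \<bullet> u)" for u
      by (simp add: f_def model_metric_def inner_diff_left R field_simps)
    then have "c * G z (f u) (f u) = u \<bullet> u" for u using that by simp
    moreover have "f 0 = 0" by (rule linear_0[OF f])
    ultimately show ?thesis
      by (intro exI[of _ "range f"]) (auto simp: linear_subspace_image[OF f subspace_UNIV])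
  qed
  show ?thesis
    unfolding neutral_form_def using bil_G[OF z] sym_G[OF z] nd sub[of 1] sub[of "-1"] by auto
qed

lemma bil_LC:
  assumes z: "z \<in> Z" shows "bilinear (LC z)"
proof -
  have E1: "E z (u + u') v = E z u v + E z u' v" "E z v (u + u') = E z v u + E z v u'" for u u' v
    by (rule euclidean_eqI, simp add: inner_add_left E_inner[OF z] linear_add[OF lin_dT(1)[OF z], of "(_, 0)" "(_, 0)", simplified]
       linear_add[OF lin_dT(2)[OF z]] linear_add[OF lin_dT(3)[OF z]] linear_add[OF linC(1)[OF z]] linear_add[OF linC(2)[OF z]]
       linear_add[OF linT(2)[OF z]])+
  have E2: "E z (r *\<^sub>R u) v = r *\<^sub>R E z u v" "E z v (r *\<^sub>R u) = r *\<^sub>R E z v u" for r u v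
    by (rule euclidean_eqI, simp add: E_inner[OF z] linear_scale[OF lin_dT(1)[OF z], of _ "(_, 0)", simplified]
       linear_scale[OF lin_dT(2)[OF z]] linear_scale[OF lin_dT(3)[OF z]] linear_scale[OF linC(1)[OF z]] linear_scale[OF linC(2)[OF z]]
       linear_scale[OF linT(2)[OF z]] algebra_simps)+
  show ?thesis
    unfolding bilinear_def LC_def
    by (auto intro!: linearI simp: linear_add[OF linC(1)[OF z]] linear_add[OF linC(2)[OF z]]
      linear_scale[OF linC(1)[OF z]] linear_scale[OF linC(2)[OF z]] E1 E2 inner_add scaleR_add_left
      sum.distrib scaleR_sum_right algebra_simps)
qed

lemma E_zero:
  assumes z: "z \<in> Z" shows "E z 0 v = 0" "E z v 0 = 0"
  by (rule euclidean_eqI; simp add: E_inner[OF z] linear_0[OF lin_dT(1)[OF z], unfolded zero_prod_def]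
      linear_0[OF lin_dT(2)[OF z]] linear_0[OF lin_dT(3)[OF z]] linear_0[OF linC(1)[OF z]]
      linear_0[OF linC(2)[OF z]] linear_0[OF linT(2)[OF z]])+

lemma C_zero: "z \<in> Z \<Longrightarrow> C z 0 v = 0" "z \<in> Z \<Longrightarrow> C z v 0 = 0"
  by (auto intro: linear_0 linC)

text \<open>The base block contributes the trace of \<open>C z (fst b)\<close> and the fibre block
  its negative, in agreement with the block matrix of the metric having constant
  determinant.\<close>

lemma trace_LC:
  assumes z: "z \<in> Z" shows "(\<Sum>k\<in>Basis. LC z k b \<bullet> k) = 0"
proof -
  have "LC z (k, 0) b \<bullet> (k, 0) = C z (fst b) k \<bullet> k" for k
    using sym_C[OF z, of "fst b" k] by (simp add: LC_def)
  moreover have "LC z (0, k) b \<bullet> (0, k) = - (C z (fst b) k \<bullet> k)" for k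
    using snd_LC_inner[OF z, of "(0, k)" b k]
    by (simp add: inner_prod_def E_zero[OF z] C_zero[OF z] inner_commute)
  ultimately show ?thesis by (simp add: sum_Basis_prod sum_negf)
qed

text \<open>\<open>LC z a\<close> is block triangular, with \<open>C z (fst a)\<close> on the base
  and minus its adjoint on the fibre. The two diagonal blocks of the product therefore differ only
  by an adjoint and the order of the factors, and a trace ignores both.\<close>

lemma LC_LC_trace:
  assumes z: "z \<in> Z"
  shows "(\<Sum>k\<in>Basis. LC z a (LC z k b) \<bullet> k) = 2 * (\<Sum>k\<in>Basis. C z (fst a) (C z (fst b) k) \<bullet> k)"
proof -
  let ?u = "fst a" and ?v = "fst b"
  have 1: "LC z a (LC z (k, 0) b) \<bullet> (k, 0) = C z ?u (C z ?v k) \<bullet> k" for k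
    using sym_C[OF z, of ?v k] by (simp add: LC_def)
  have 2: "LC z a (LC z (0, k) b) \<bullet> (0, k) = C z ?v (C z ?u k) \<bullet> k" for k
  proof -
    have f: "fst (LC z (0, k) b) = 0" by (simp add: LC_def C_zero[OF z])
    have "snd (LC z a (LC z (0, k) b)) \<bullet> k = - (snd (LC z (0, k) b) \<bullet> C z ?u k)"
      by (simp add: snd_LC_inner[OF z] f E_zero[OF z] C_zero[OF z])
    also have "\<dots> = k \<bullet> C z ?v (C z ?u k)"
      by (simp add: snd_LC_inner[OF z] E_zero[OF z] C_zero[OF z])
    finally show ?thesis by (simp add: inner_prod_def inner_commute)
  qed
  have "(\<Sum>k\<in>Basis. C z ?v (C z ?u k) \<bullet> k) = (\<Sum>k\<in>Basis. C z ?u (C z ?v k) \<bullet> k)"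
    by (rule trace_cyclic[OF linC(1)[OF z] linC(1)[OF z]])
  then show ?thesis by (simp add: sum_Basis_prod 1 2)
qed

text \<open>The trace of \<open>LC\<close> vanishes identically, and so does its derivative; two of
  the four terms of the Ricci tensor drop out.\<close>

lemma ricci_LC_reduced:
  assumes z: "z \<in> Z"
  shows "ricci LC z a b = (\<Sum>k\<in>Basis. frechet_derivative (\<lambda>y. LC y a b) (at z) k \<bullet> k)
    - 2 * (\<Sum>k\<in>Basis. C z (fst a) (C z (fst b) k) \<bullet> k)"
proof -
  have "((\<lambda>y. \<Sum>k\<in>Basis. LC y k b \<bullet> k) has_derivative
      (\<lambda>h. \<Sum>k\<in>Basis. frechet_derivative (\<lambda>y. LC y k b) (at z) h \<bullet> k)) (at z)"
    by (rule has_derivative_sum, rule has_derivative_inner_left,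
        rule smooth_on_has_derivative[OF smooth_LC z])
  then have "((\<lambda>y. 0) has_derivative
      (\<lambda>h. \<Sum>k\<in>Basis. frechet_derivative (\<lambda>y. LC y k b) (at z) h \<bullet> k)) (at z)"
    by (rule has_derivative_transform_within_open[OF _ open_Z z]) (rule trace_LC)
  from fun_cong[OF frechet_derivative_eqI[OF this], of a]
  have "(\<Sum>k\<in>Basis. frechet_derivative (\<lambda>y. LC y k b) (at z) a \<bullet> k) = 0" by simp
  then show ?thesis
    unfolding ricci_def
    by (simp add: inner_diff_left inner_add_left sum.distrib sum_subtractf trace_LC[OF z] LC_LC_trace[OF z])
qed

text \<open>With the covector held fixed, \<open>\<Gamma>\<close> is the only part of
  \<open>C\<close> that varies with the base point.\<close>

lemma LC_deriv_base:
  assumes z: "(x, \<xi>) \<in> Z"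
  shows "frechet_derivative (\<lambda>y. LC y a b) (at (x, \<xi>)) (h, 0) \<bullet> (w, 0)
    = frechet_derivative (\<lambda>y. \<Gamma> y (fst a) (fst b)) (at x) h \<bullet> w"
proof -
  have x: "x \<in> S" using z by simp
  have "((\<lambda>h. (h, \<xi>)) has_derivative (\<lambda>h. (h, 0))) (at x)"
    by (auto intro!: derivative_eq_intros)
  from has_derivative_compose[OF this smooth_on_has_derivative[OF smooth_LC[of a b] z]]
  have 1: "((\<lambda>y. LC (y, \<xi>) a b \<bullet> (w, 0)) has_derivative
      (\<lambda>h. frechet_derivative (\<lambda>y. LC y a b) (at (x, \<xi>)) (h, 0) \<bullet> (w, 0))) (at x)"
    by (rule has_derivative_inner_left)
  have "((\<lambda>y. (\<Gamma> y (fst a) (fst b) - (\<xi> \<bullet> fst b) *\<^sub>R fst a - (\<xi> \<bullet> fst a) *\<^sub>R fst b) \<bullet> w) has_derivative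
      (\<lambda>h. (frechet_derivative (\<lambda>y. \<Gamma> y (fst a) (fst b)) (at x) h - 0 - 0) \<bullet> w)) (at x)"
    by (intro has_derivative_inner_left has_derivative_diff has_derivative_const
        smooth_on_has_derivative[OF smoothG x])
  then have "((\<lambda>y. LC (y, \<xi>) a b \<bullet> (w, 0)) has_derivative
      (\<lambda>h. frechet_derivative (\<lambda>y. \<Gamma> y (fst a) (fst b)) (at x) h \<bullet> w)) (at x)"
    by (simp add: LC_def C_def)
  from has_derivative_unique[OF 1 this] show ?thesis by (rule fun_cong)
qed

text \<open>The summands are arranged as factors free of \<open>k\<close> times contractions in
  \<open>k\<close>, so that the sum over the basis can be evaluated by rewriting in
  \<open>ricci_LC\<close>.\<close>

lemma LC_deriv_fibre:
  assumes z: "(x, \<xi>) \<in> Z"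
  defines "dG \<equiv> \<lambda>h u v. frechet_derivative (\<lambda>y. \<Gamma> y u v) (at x) h"
  shows "frechet_derivative (\<lambda>y. LC y (u, \<alpha>) (v, \<beta>)) (at (x, \<xi>)) (0, k) \<bullet> (0, k)
   = - (dG u v k \<bullet> k) - (dG v u k \<bullet> k) + dG k u v \<bullet> k
     + (k \<bullet> k) * (\<alpha> \<bullet> v + \<beta> \<bullet> u - 2 * (\<xi> \<bullet> \<Gamma> x u v) + 4 * (\<xi> \<bullet> v) * (\<xi> \<bullet> u))
     + (k \<bullet> v) * (\<alpha> \<bullet> k) + (k \<bullet> u) * (\<beta> \<bullet> k)
     - 2 * ((\<xi> \<bullet> k) * (k \<bullet> \<Gamma> x u v)) + (4 * (\<xi> \<bullet> u)) * ((\<xi> \<bullet> k) * (k \<bullet> v))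
     + (4 * (\<xi> \<bullet> v)) * ((\<xi> \<bullet> k) * (k \<bullet> u))
     + 2 * ((k \<bullet> v) * s x u k) + 2 * ((k \<bullet> u) * s x v k) + 2 * (\<Gamma> x (\<Gamma> x u v) k \<bullet> k)
     - 2 * ((k \<bullet> v) * (\<xi> \<bullet> \<Gamma> x u k)) - (2 * (\<xi> \<bullet> v)) * (\<Gamma> x u k \<bullet> k)
     - 2 * ((k \<bullet> u) * (\<xi> \<bullet> \<Gamma> x v k)) - (2 * (\<xi> \<bullet> u)) * (\<Gamma> x v k \<bullet> k)" (is "_ = ?R k")
proof -
  have x: "x \<in> S" using z by simp
  let ?ds = "\<lambda>h u v. frechet_derivative (\<lambda>y. s y u v) (at x) h"
  \<comment> \<open>With the base point fixed this is a cubic polynomial in \<open>\<eta>\<close>;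
    written out, it can be differentiated by the standard rules.\<close>
  have expl: "LC (x, \<eta>) (u, \<alpha>) (v, \<beta>) \<bullet> (0, k) =
      (?ds u v k - \<eta> \<bullet> dG u v k) + (?ds v u k - \<eta> \<bullet> dG v u k) - (?ds k u v - \<eta> \<bullet> dG k u v)
      - 2 * ((\<eta> \<bullet> k) * (\<eta> \<bullet> \<Gamma> x u v - 2 * ((\<eta> \<bullet> v) * (\<eta> \<bullet> u)))
         + s x (\<Gamma> x u v) k - (\<eta> \<bullet> v) * s x u k - (\<eta> \<bullet> u) * s x v k
         - \<eta> \<bullet> \<Gamma> x (\<Gamma> x u v) k + (\<eta> \<bullet> v) * (\<eta> \<bullet> \<Gamma> x u k) + (\<eta> \<bullet> u) * (\<eta> \<bullet> \<Gamma> x v k))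
      - (\<alpha> \<bullet> \<Gamma> x v k - (\<eta> \<bullet> k) * (\<alpha> \<bullet> v) - (\<eta> \<bullet> v) * (\<alpha> \<bullet> k))
      - (\<beta> \<bullet> \<Gamma> x u k - (\<eta> \<bullet> k) * (\<beta> \<bullet> u) - (\<eta> \<bullet> u) * (\<beta> \<bullet> k))" for \<eta>
  proof -
    have z': "(x, \<eta>) \<in> Z" using x by simp
    have "LC (x, \<eta>) (u, \<alpha>) (v, \<beta>) \<bullet> (0, k) = snd (LC (x, \<eta>) (u, \<alpha>) (v, \<beta>)) \<bullet> k"
      by (simp add: inner_prod_def)
    then show ?thesis
      unfolding snd_LC_inner[OF z'] fst_conv snd_conv E_inner[OF z'] dT_eq[OF z'] model_tensor_def C_def dG_def
      by (simp add: linear_diff[OF linG(2)[OF x]] linear_scale[OF linG(2)[OF x]]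
          linear_diff[OF lins(2)[OF x]] linear_scale[OF lins(2)[OF x]] linear_add[OF linG(2)[OF x]]
          linear_add[OF lins(2)[OF x]] inner_diff_right inner_add_right algebra_simps)
  qed
  have "((\<lambda>h. (x, h)) has_derivative (\<lambda>h. (0, h))) (at \<xi>)"
    by (auto intro!: derivative_eq_intros)
  from has_derivative_compose[OF this smooth_on_has_derivative[OF smooth_LC[of "(u, \<alpha>)" "(v, \<beta>)"] z]]
  have 1: "((\<lambda>y. LC (x, y) (u, \<alpha>) (v, \<beta>) \<bullet> (0, k)) has_derivative
      (\<lambda>h. frechet_derivative (\<lambda>y. LC y (u, \<alpha>) (v, \<beta>)) (at (x, \<xi>)) (0, h) \<bullet> (0, k))) (at \<xi>)"
    by (rule has_derivative_inner_left)
  have 2: "((\<lambda>y. LC (x, y) (u, \<alpha>) (v, \<beta>) \<bullet> (0, k)) has_derivative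
     (\<lambda>h. - (h \<bullet> dG u v k) - h \<bullet> dG v u k + h \<bullet> dG k u v
      - 2 * ((h \<bullet> k) * (\<xi> \<bullet> \<Gamma> x u v - 2 * ((\<xi> \<bullet> v) * (\<xi> \<bullet> u)))
         + (\<xi> \<bullet> k) * (h \<bullet> \<Gamma> x u v - 2 * ((h \<bullet> v) * (\<xi> \<bullet> u) + (\<xi> \<bullet> v) * (h \<bullet> u)))
         - (h \<bullet> v) * s x u k - (h \<bullet> u) * s x v k
         - h \<bullet> \<Gamma> x (\<Gamma> x u v) k + (h \<bullet> v) * (\<xi> \<bullet> \<Gamma> x u k) + (\<xi> \<bullet> v) * (h \<bullet> \<Gamma> x u k)
         + (h \<bullet> u) * (\<xi> \<bullet> \<Gamma> x v k) + (\<xi> \<bullet> u) * (h \<bullet> \<Gamma> x v k))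
      + (h \<bullet> k) * (\<alpha> \<bullet> v) + (h \<bullet> v) * (\<alpha> \<bullet> k)
      + (h \<bullet> k) * (\<beta> \<bullet> u) + (h \<bullet> u) * (\<beta> \<bullet> k))) (at \<xi>)"
    unfolding expl
    by (rule derivative_eq_intros refl)+ (simp add: fun_eq_iff algebra_simps)
  show ?thesis
    unfolding fun_cong[OF has_derivative_unique[OF 1 2], of k]
    by (simp add: inner_commute[of k "dG _ _ _"] inner_commute[of k "\<Gamma> x (\<Gamma> x u v) k"]
        inner_commute[of k "\<Gamma> x u k"] inner_commute[of k "\<Gamma> x v k"] algebra_simps)
qed

text \<open>The derivatives of \<open>\<Gamma>\<close>, the trace at \<open>\<Gamma> x u v\<close>
  and \<open>q\<close> combine to the symmetrised Ricci tensor of \<open>\<Gamma>\<close>, that is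
  2(n-1) times \<open>s\<close>, which joins the 4 times \<open>s\<close> of the divergence. The
  terms with \<open>t u\<close> and \<open>t v\<close> cancel between divergence and product. The
  quadratic terms in \<open>\<xi>\<close> come with 4n + 8 from the divergence and 2(n+3) from the
  product, a difference of 2(n+1).\<close>

lemma ricci_LC:
  assumes z: "z \<in> Z"
    and ric: "\<And>u v. 2 * (real DIM('e) - 1) * s (fst z) u v = ricci \<Gamma> (fst z) u v + ricci \<Gamma> (fst z) v u"
  shows "ricci LC z a b = 2 * (real DIM('e) + 1) * G z a b"
proof -
  obtain x \<xi> where zx: "z = (x, \<xi>)" by (cases z)
  obtain u \<alpha> v \<beta> where ab: "a = (u, \<alpha>)" "b = (v, \<beta>)" by (metis prod.exhaust)
  have x: "x \<in> S" using z zx by simp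
  define n where "n = real DIM('e)"
  define dG where "dG h u v = frechet_derivative (\<lambda>y. \<Gamma> y u v) (at x) h" for h u v
  define a1 where "a1 = (\<Sum>k\<in>Basis. dG k u v \<bullet> k)"
  define a2 where "a2 = (\<Sum>k\<in>Basis. dG u v k \<bullet> k)"
  define a3 where "a3 = (\<Sum>k\<in>Basis. dG v u k \<bullet> k)"
  define t where "t w = (\<Sum>k\<in>Basis. \<Gamma> x w k \<bullet> k)" for w
  define q where "q = (\<Sum>k\<in>Basis. \<Gamma> x u (\<Gamma> x v k) \<bullet> k)"
  have q': "(\<Sum>k\<in>Basis. \<Gamma> x v (\<Gamma> x u k) \<bullet> k) = q"
    unfolding q_def by (rule trace_cyclic[OF linG(1)[OF x] linG(1)[OF x]])
  have dG_sym: "dG h a b = dG h b a" for h a b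
    unfolding dG_def by (rule fun_cong[OF frechet_derivative_cong_open[OF open_S x]]) (rule symG)
  have G_sym: "\<Gamma> x v u = \<Gamma> x u v" by (rule symG[OF x])
  have R0: "ricci \<Gamma> x u v = (\<Sum>k\<in>Basis. dG k u v \<bullet> k) - (\<Sum>k\<in>Basis. dG u v k \<bullet> k) + t (\<Gamma> x u v)
      - (\<Sum>k\<in>Basis. \<Gamma> x u (\<Gamma> x v k) \<bullet> k)" for u v
  proof -
    have "(dG k u v - dG u k v + \<Gamma> x k (\<Gamma> x u v) - \<Gamma> x u (\<Gamma> x k v)) \<bullet> k =
      dG k u v \<bullet> k - dG u v k \<bullet> k + \<Gamma> x (\<Gamma> x u v) k \<bullet> k - \<Gamma> x u (\<Gamma> x v k) \<bullet> k" for k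
      by (simp only: dG_sym[of u k v] symG[OF x, of k "\<Gamma> x u v"] symG[OF x, of k v]
          inner_diff_left inner_add_left)
    then show ?thesis
      unfolding ricci_def dG_def[symmetric] t_def by (simp only: sum.distrib sum_subtractf)
  qed
  have R: "ricci \<Gamma> x u v = a1 - a2 + t (\<Gamma> x u v) - q" "ricci \<Gamma> x v u = a1 - a3 + t (\<Gamma> x u v) - q"
    unfolding R0 G_sym q' dG_sym[of _ v u] a1_def a2_def a3_def q_def by simp_all
  have lin: "linear (\<lambda>k. \<xi> \<bullet> \<Gamma> x w k)" for w
    using linG(1)[OF x] by (auto intro!: linearI simp: linear_add linear_scale inner_add_right)
  have D: "(\<Sum>k\<in>Basis. frechet_derivative (\<lambda>y. LC y a b) (at z) k \<bullet> k) =
      2 * a1 - a2 - a3 + n * (\<alpha> \<bullet> v + \<beta> \<bullet> u - 2 * (\<xi> \<bullet> \<Gamma> x u v) + 4 * (\<xi> \<bullet> v) * (\<xi> \<bullet> u))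
      + \<alpha> \<bullet> v + \<beta> \<bullet> u - 2 * (\<xi> \<bullet> \<Gamma> x u v) + 8 * ((\<xi> \<bullet> u) * (\<xi> \<bullet> v))
      + 4 * s x u v + 2 * t (\<Gamma> x u v) - 4 * (\<xi> \<bullet> \<Gamma> x u v)
      - 2 * (\<xi> \<bullet> v) * t u - 2 * (\<xi> \<bullet> u) * t v"
  proof -
    have nsum: "(\<Sum>k\<in>(Basis::'e set). (k \<bullet> k) * c) = n * c" for c :: real
      by (simp add: n_def)
    show ?thesis
      unfolding sum_Basis_prod ab zx LC_deriv_base[OF z[unfolded zx]] LC_deriv_fibre[OF z[unfolded zx]]
        fst_conv snd_conv dG_def[symmetric]
      by (simp only: sum.distrib sum_subtractf sum_negf sum_distrib_left[symmetric] contract_Basis[OF lins(1)[OF x]]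
          contract_Basis[OF lin] sum_Basis_inner nsum contract_Basis(1)[OF bounded_linear.linear[OF bounded_linear_inner_right[of \<alpha>]]]
          contract_Basis(1)[OF bounded_linear.linear[OF bounded_linear_inner_right[of \<beta>]]] a1_def[symmetric] a2_def[symmetric] a3_def[symmetric]
          t_def[symmetric])
        (simp add: syms[OF x, of v u] symG[OF x, of v u] algebra_simps)
  qed
  have Ck: "C z u (C z v k) \<bullet> k = \<Gamma> x u (\<Gamma> x v k) \<bullet> k - (\<xi> \<bullet> k) * (\<Gamma> x u v \<bullet> k)
      - (\<xi> \<bullet> v) * (\<Gamma> x u k \<bullet> k) - (u \<bullet> k) * (\<xi> \<bullet> \<Gamma> x v k)
      + (2 * (\<xi> \<bullet> v)) * ((\<xi> \<bullet> k) * (u \<bullet> k)) - (\<xi> \<bullet> u) * (\<Gamma> x v k \<bullet> k)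
      + (\<xi> \<bullet> u) * ((\<xi> \<bullet> k) * (v \<bullet> k)) + (k \<bullet> k) * ((\<xi> \<bullet> u) * (\<xi> \<bullet> v))" for k
    by (simp add: C_def zx linear_diff[OF linG(1)[OF x]] linear_scale[OF linG(1)[OF x]]
        linear_add[OF linG(1)[OF x]] inner_add_left inner_diff_left inner_diff_right algebra_simps)
  have CC: "(\<Sum>k\<in>Basis. C z u (C z v k) \<bullet> k) = q - 2 * (\<xi> \<bullet> \<Gamma> x u v) - (\<xi> \<bullet> v) * t u - (\<xi> \<bullet> u) * t v
      + (3 + n) * ((\<xi> \<bullet> u) * (\<xi> \<bullet> v))"
  proof -
    have nsum: "(\<Sum>k\<in>(Basis::'e set). (k \<bullet> k) * c) = n * c" for c :: real
      by (simp add: n_def)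
    show ?thesis
      unfolding Ck
      by (simp only: sum.distrib sum_subtractf sum_negf sum_distrib_left[symmetric]
          contract_Basis[OF lin] sum_Basis_inner nsum t_def[symmetric] q_def[symmetric])
        (simp add: symG[OF x, of v u] algebra_simps)
  qed
  have "2 * (n - 1) * s x u v = 2 * a1 - a2 - a3 + 2 * t (\<Gamma> x u v) - 2 * q"
    using ric[of u v] R by (simp add: zx n_def)
  then show ?thesis
    unfolding ricci_LC_reduced[OF z] D unfolding ab fst_conv CC
    by (simp add: model_metric_def model_tensor_def zx n_def[symmetric] field_simps)
qed

end

section \<open>Atlases and tangent vectors\<close>

locale atlas =
  fixes A :: "('a, 'e::euclidean_space) chart set"
  assumes smooth_atlas: "smooth_atlas A"
begin

lemma inj_chart: "c \<in> A \<Longrightarrow> inj_on (snd c) (fst c)"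
  using smooth_atlas by (auto simp: smooth_atlas_def)

lemma open_chart_image: "c \<in> A \<Longrightarrow> open (chart_image c)"
  using smooth_atlas by (auto simp: smooth_atlas_def)

lemma chart_inv_snd: "c \<in> A \<Longrightarrow> p \<in> fst c \<Longrightarrow> chart_inv c (snd c p) = p"
  using inj_chart by (simp add: chart_inv_def)

end

lemma chart_inv_in: "x \<in> chart_image c \<Longrightarrow> chart_inv c x \<in> fst c"
  by (auto simp: chart_inv_def chart_image_def intro: inv_into_into)

lemma snd_chart_inv: "x \<in> chart_image c \<Longrightarrow> snd c (chart_inv c x) = x"
  by (auto simp: chart_inv_def chart_image_def intro: f_inv_into_f)

definition overlap :: "('a, 'e) chart \<Rightarrow> ('a, 'e) chart \<Rightarrow> 'e set" where
  "overlap c d = snd c ` (fst c \<inter> fst d)"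

lemma overlap_subset: "overlap c d \<subseteq> chart_image c"
  by (auto simp: overlap_def chart_image_def)

context atlas
begin

lemma overlap_iff: "c \<in> A \<Longrightarrow> x \<in> overlap c d \<longleftrightarrow> x \<in> chart_image c \<and> chart_inv c x \<in> fst d"
  using inj_chart[of c] chart_inv_snd[of c]
  by (auto simp: overlap_def chart_image_def image_iff)

lemma snd_overlap: "p \<in> fst c \<Longrightarrow> p \<in> fst d \<Longrightarrow> snd c p \<in> overlap c d"
  by (auto simp: overlap_def)

lemma open_overlap: "c \<in> A \<Longrightarrow> d \<in> A \<Longrightarrow> open (overlap c d)"
  using smooth_atlas by (auto simp: smooth_atlas_def overlap_def)

lemma coord_change:
  assumes c: "c \<in> A" and d: "d \<in> A"
  shows "coord_change (overlap c d) (overlap d c) (transition c d) (transition d c)"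
proof
  show "open (overlap c d)" "open (overlap d c)" using assms by (simp_all add: open_overlap)
  show "smooth_on (overlap c d) (transition c d)" "smooth_on (overlap d c) (transition d c)"
    using smooth_atlas assms by (auto simp: smooth_atlas_def overlap_def)
qed (use assms in \<open>auto simp: overlap_def transition_def chart_inv_snd\<close>)

lemma smooth_transition: "c \<in> A \<Longrightarrow> d \<in> A \<Longrightarrow> smooth_on (overlap c d) (transition c d)"
  using coord_change.smooth_phi[OF coord_change] .

lemma transition_snd: "c \<in> A \<Longrightarrow> p \<in> fst c \<Longrightarrow> transition c d (snd c p) = snd d p"
  by (simp add: transition_def chart_inv_snd)

lemma transition_in: "c \<in> A \<Longrightarrow> d \<in> A \<Longrightarrow> x \<in> overlap c d \<Longrightarrow> transition c d x \<in> overlap d c"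
  using coord_change.phi_in[OF coord_change] .

lemma chart_inv_transition:
  "c \<in> A \<Longrightarrow> d \<in> A \<Longrightarrow> x \<in> overlap c d \<Longrightarrow> chart_inv d (transition c d x) = chart_inv c x"
  by (simp add: transition_def chart_inv_snd overlap_iff)

lemma dtransition_has_derivative:
  "c \<in> A \<Longrightarrow> d \<in> A \<Longrightarrow> p \<in> fst c \<Longrightarrow> p \<in> fst d
    \<Longrightarrow> (transition c d has_derivative dtransition c d p) (at (snd c p))"
  unfolding dtransition_def by (rule coord_change.J_deriv[OF coord_change]) (auto intro: snd_overlap)

lemma linear_dtransition:
  "c \<in> A \<Longrightarrow> d \<in> A \<Longrightarrow> p \<in> fst c \<Longrightarrow> p \<in> fst d \<Longrightarrow> linear (dtransition c d p)"
  using dtransition_has_derivative has_derivative_linear by blast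

lemma dtransition_trans:
  assumes A: "c \<in> A" "d \<in> A" "e \<in> A" and p: "p \<in> fst c" "p \<in> fst d" "p \<in> fst e"
  shows "dtransition d e p (dtransition c d p u) = dtransition c e p u"
proof -
  have "((\<lambda>x. transition d e (transition c d x)) has_derivative (\<lambda>u. dtransition d e p (dtransition c d p u))) (at (snd c p))"
    using A p by (intro has_derivative_compose[OF dtransition_has_derivative])
      (auto simp: transition_snd intro: dtransition_has_derivative)
  then have "(transition c e has_derivative (\<lambda>u. dtransition d e p (dtransition c d p u))) (at (snd c p))"
    by (rule has_derivative_transform_within_open[OF _ open_overlap[OF A(1,2)]])
      (use A p in \<open>auto simp: snd_overlap chart_inv_transition transition_def[of d e] transition_def[of c e]\<close>)
  from frechet_derivative_eqI[OF this] show ?thesis by (simp add: dtransition_def)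
qed

lemma dtransition_refl:
  assumes "c \<in> A" "p \<in> fst c" shows "dtransition c c p u = u"
proof -
  have "((\<lambda>x. x) has_derivative (\<lambda>u. u)) (at (snd c p))" by (rule has_derivative_ident)
  then have "(transition c c has_derivative (\<lambda>u. u)) (at (snd c p))"
    by (rule has_derivative_transform_within_open[OF _ open_chart_image[OF assms(1)]])
      (use assms in \<open>auto simp: chart_image_def transition_def chart_inv_snd\<close>)
  from frechet_derivative_eqI[OF this] show ?thesis by (simp add: dtransition_def)
qed

text \<open>That the defining family is closed under intersections rests on the injectivity of the
  charts: only then is the image of an intersection the intersection of the images.\<close>

lemma openin_atlas_topology:
  "openin (atlas_topology A) W \<longleftrightarrow> W \<subseteq> points A \<and> (\<forall>c\<in>A. open (snd c ` (W \<inter> fst c)))"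
proof -
  have "istopology (\<lambda>S. S \<subseteq> points A \<and> (\<forall>c\<in>A. open (snd c ` (S \<inter> fst c))))"
    unfolding istopology_def
  proof (intro conjI allI impI ballI)
    fix S T assume ST: "S \<subseteq> points A \<and> (\<forall>c\<in>A. open (snd c ` (S \<inter> fst c)))"
      "T \<subseteq> points A \<and> (\<forall>c\<in>A. open (snd c ` (T \<inter> fst c)))"
    then show "S \<inter> T \<subseteq> points A" by auto
    fix c assume c: "c \<in> A"
    have "snd c ` (S \<inter> T \<inter> fst c) = snd c ` (S \<inter> fst c) \<inter> snd c ` (T \<inter> fst c)"
      using inj_chart[OF c] by (auto simp: inj_on_def)
    then show "open (snd c ` (S \<inter> T \<inter> fst c))" using ST c by auto
  next
    fix \<K> assume K: "\<forall>K\<in>\<K>. K \<subseteq> points A \<and> (\<forall>c\<in>A. open (snd c ` (K \<inter> fst c)))"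
    then show "\<Union> \<K> \<subseteq> points A" by auto
    fix c assume c: "c \<in> A"
    have "snd c ` (\<Union> \<K> \<inter> fst c) = (\<Union>K\<in>\<K>. snd c ` (K \<inter> fst c))" by auto
    then show "open (snd c ` (\<Union> \<K> \<inter> fst c))" using K c by auto
  qed
  then show ?thesis unfolding atlas_topology_def by (simp add: topology_inverse')
qed

lemma openin_chart: "c \<in> A \<Longrightarrow> openin (atlas_topology A) (fst c)"
  unfolding openin_atlas_topology using open_overlap
  by (auto simp: points_def overlap_def Int_commute)

section \<open>Tangent vectors determined by one chart\<close>

lemma tangent_spaceI:
  assumes c: "c \<in> A" "p \<in> fst c" and s: "supported_at A p v"
    and v: "\<And>d. d \<in> A \<Longrightarrow> p \<in> fst d \<Longrightarrow> v d = dtransition c d p (v c)"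
  shows "v \<in> tangent_space A p"
  unfolding tangent_space_def
proof (safe intro!: s)
  fix d e assume "d \<in> A" "e \<in> A" "p \<in> fst d" "p \<in> fst e"
  then show "v e = dtransition d e p (v d)"
    using v[of d] v[of e] dtransition_trans[of c d e p "v c"] c by auto
qed

lemma tangent_space_D:
  "v \<in> tangent_space A p \<Longrightarrow> c \<in> A \<Longrightarrow> d \<in> A \<Longrightarrow> p \<in> fst c \<Longrightarrow> p \<in> fst d \<Longrightarrow> v d = dtransition c d p (v c)"
  unfolding tangent_space_def by blast

lemma supported_eqI:
  assumes "supported_at A p v" "supported_at A p w" "\<And>d. d \<in> A \<Longrightarrow> p \<in> fst d \<Longrightarrow> v d = w d"
  shows "v = w"
proof
  fix d show "v d = w d"
  proof (cases "d \<in> A \<and> p \<in> fst d")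
    case False
    then show ?thesis
      using assms(1,2)[unfolded supported_at_def, rule_format, OF False] by simp
  qed (use assms(3) in blast)
qed

lemma tangent_space_eqI:
  assumes v: "v \<in> tangent_space A p" and w: "w \<in> tangent_space A p"
    and c: "c \<in> A" "p \<in> fst c" and e: "v c = w c"
  shows "v = w"
proof (rule supported_eqI)
  show "supported_at A p v" "supported_at A p w" using v w by (auto simp: tangent_space_def)
  show "v d = w d" if "d \<in> A" "p \<in> fst d" for d
    using tangent_space_D[OF v c(1) that(1) c(2) that(2)] tangent_space_D[OF w c(1) that(1) c(2) that(2)] e by simp
qed

lemma coord_vec_in: "c \<in> A \<Longrightarrow> p \<in> fst c \<Longrightarrow> coord_vec A c p u \<in> tangent_space A p"
  by (rule tangent_spaceI[of c]) (auto simp: coord_vec_def supported_at_def dtransition_refl)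

lemma coord_vec_self: "c \<in> A \<Longrightarrow> p \<in> fst c \<Longrightarrow> coord_vec A c p u c = u"
  by (simp add: coord_vec_def dtransition_refl)

lemma coord_vec_apply: "d \<in> A \<Longrightarrow> p \<in> fst d \<Longrightarrow> coord_vec A c p u d = dtransition c d p u"
  by (simp add: coord_vec_def)

lemma coord_vec_change:
  "c \<in> A \<Longrightarrow> d \<in> A \<Longrightarrow> p \<in> fst c \<Longrightarrow> p \<in> fst d \<Longrightarrow> coord_vec A c p u = coord_vec A d p (dtransition c d p u)"
  by (rule tangent_space_eqI[of _ p _ d])
    (auto simp: coord_vec_in coord_vec_self coord_vec_apply)

lemma tangent_space_add:
  assumes v: "v \<in> tangent_space A p" and w: "w \<in> tangent_space A p" and c: "c \<in> A" "p \<in> fst c"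
  shows "(\<lambda>e. v e + w e) \<in> tangent_space A p"
proof (rule tangent_spaceI[OF c])
  show "supported_at A p (\<lambda>e. v e + w e)"
    using v w by (auto simp: tangent_space_def supported_at_def)
  show "v d + w d = dtransition c d p (v c + w c)" if "d \<in> A" "p \<in> fst d" for d
    using tangent_space_D[OF v c(1) that(1) c(2) that(2)] tangent_space_D[OF w c(1) that(1) c(2) that(2)]
    by (simp add: linear_add[OF linear_dtransition[OF c(1) that(1) c(2) that(2)]])
qed

lemma chart_at_props:
  assumes "c \<in> A" "p \<in> fst c" shows "chart_at A p \<in> A" "p \<in> fst (chart_at A p)"
  unfolding chart_at_def by (rule someI2[of _ c], use assms in auto)+

lemma contract_eq:
  assumes "v \<in> tangent_space A p" "\<eta> \<in> cotangent_space A p" "c \<in> A" "p \<in> fst c"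
  shows "contract A p v \<eta> = \<eta> c \<bullet> v c"
proof -
  note ca = chart_at_props[OF assms(3,4)]
  have "\<eta> (chart_at A p) \<bullet> dtransition c (chart_at A p) p (v c) = \<eta> c \<bullet> v c"
    using assms ca by (auto simp: cotangent_space_def)
  then show ?thesis
    unfolding contract_def using tangent_space_D[OF assms(1) assms(3) ca(1) assms(4) ca(2)] by simp
qed

text \<open>\<open>tangent_map\<close> differentiates in an arbitrarily chosen chart at
  \<open>p\<close>; the chain rule with the transition map frees it from that choice.\<close>

lemma tangent_map_chart:
  assumes c: "c \<in> A" "p \<in> fst c" and d: "d \<in> B" "F p \<in> fst d" and v: "v \<in> tangent_space A p"
    and D: "((\<lambda>x. snd d (F (chart_inv c x))) has_derivative D) (at (snd c p))"
  shows "tangent_map A B F p v d = D (v c)"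
proof -
  let ?c = "chart_at A p"
  note ca = chart_at_props[OF c]
  have "((\<lambda>x. snd d (F (chart_inv c (transition ?c c x)))) has_derivative
      (\<lambda>u. D (dtransition ?c c p u))) (at (snd ?c p))"
    using has_derivative_compose[OF dtransition_has_derivative[OF ca(1) c(1) ca(2) c(2)],
        of "\<lambda>x. snd d (F (chart_inv c x))" D] D
    by (simp add: transition_snd ca)
  then have "((snd d \<circ> F \<circ> chart_inv ?c) has_derivative (\<lambda>u. D (dtransition ?c c p u))) (at (snd ?c p))"
    by (rule has_derivative_transform_within_open[OF _ open_overlap[OF ca(1) c(1)] snd_overlap[OF ca(2) c(2)]])
      (simp add: chart_inv_transition ca c)
  from frechet_derivative_eqI[OF this] show ?thesis
    unfolding tangent_map_def using d tangent_space_D[OF v ca(1) c(1) ca(2) c(2)] by simp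
qed

end

text \<open>The neighbourhood \<open>N\<close> is mapped into a single target chart, so that
  components in any other target chart arise by composing with a transition map near the
  point.\<close>

lemma (in atlas) tangent_map_in:
  fixes B :: "('b, 'f::euclidean_space) chart set"
  assumes B: "atlas B"
    and c: "c \<in> A" "p \<in> fst c" and d: "d \<in> B" "F p \<in> fst d" and v: "v \<in> tangent_space A p"
    and N: "open N" "snd c p \<in> N" "\<And>x. x \<in> N \<Longrightarrow> F (chart_inv c x) \<in> fst d"
    and D: "((\<lambda>x. snd d (F (chart_inv c x))) has_derivative D) (at (snd c p))"
  shows "tangent_map A B F p v \<in> tangent_space B (F p)" "tangent_map A B F p v d = D (v c)"
proof -
  interpret B: atlas B by fact
  show 1: "tangent_map A B F p v d = D (v c)"
    by (rule tangent_map_chart[OF c d v D])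
  show "tangent_map A B F p v \<in> tangent_space B (F p)"
  proof (rule B.tangent_spaceI[OF d])
    show "supported_at B (F p) (tangent_map A B F p v)"
      by (auto simp: supported_at_def tangent_map_def)
    fix e assume e: "e \<in> B" "F p \<in> fst e"
    have "((\<lambda>x. transition d e (snd d (F (chart_inv c x)))) has_derivative (\<lambda>u. dtransition d e (F p) (D u))) (at (snd c p))"
      by (rule has_derivative_compose[OF D])
        (use B.dtransition_has_derivative[OF d(1) e(1) d(2) e(2)] in \<open>simp add: chart_inv_snd c\<close>)
    then have "((\<lambda>x. snd e (F (chart_inv c x))) has_derivative (\<lambda>u. dtransition d e (F p) (D u))) (at (snd c p))"
      by (rule has_derivative_transform_within_open[OF _ N(1,2)]) (simp add: B.transition_snd d N(3))
    from tangent_map_chart[OF c, of e B F, OF e v this]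
    show "tangent_map A B F p v e = dtransition d e (F p) (tangent_map A B F p v d)"
      by (simp add: 1)
  qed
qed

lemma (in atlas) velocity_in:
  assumes d: "d \<in> A" and N: "open N" "0 \<in> N" "\<And>t. t \<in> N \<Longrightarrow> \<gamma> t \<in> fst d"
    and D: "((\<lambda>t. snd d (\<gamma> t)) has_vector_derivative w) (at 0)"
  shows "velocity A \<gamma> \<in> tangent_space A (\<gamma> 0)" "velocity A \<gamma> d = w"
proof -
  have d0: "\<gamma> 0 \<in> fst d" using N by blast
  show 1: "velocity A \<gamma> d = w"
    using d d0 D by (simp add: velocity_def vector_derivative_at)
  show "velocity A \<gamma> \<in> tangent_space A (\<gamma> 0)"
  proof (rule tangent_spaceI[OF d d0])
    show "supported_at A (\<gamma> 0) (velocity A \<gamma>)"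
      by (auto simp: supported_at_def velocity_def)
    fix e assume e: "e \<in> A" "\<gamma> 0 \<in> fst e"
    note lin = linear_dtransition[OF d e(1) d0 e(2)]
    have "((\<lambda>t. transition d e (snd d (\<gamma> t))) has_derivative (\<lambda>h. dtransition d e (\<gamma> 0) (h *\<^sub>R w))) (at 0)"
      by (rule has_derivative_compose[OF D[unfolded has_vector_derivative_def]
          dtransition_has_derivative[OF d e(1) d0 e(2)]])
    then have "((\<lambda>t. snd e (\<gamma> t)) has_derivative (\<lambda>h. dtransition d e (\<gamma> 0) (h *\<^sub>R w))) (at 0)"
      by (rule has_derivative_transform_within_open[OF _ N(1,2)]) (simp add: transition_snd d N(3))
    then have "((\<lambda>t. snd e (\<gamma> t)) has_vector_derivative dtransition d e (\<gamma> 0) w) (at 0)"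
      by (simp add: has_vector_derivative_def linear_scale[OF lin])
    then show "velocity A \<gamma> e = dtransition d e (\<gamma> 0) (velocity A \<gamma> d)"
      using e by (simp add: 1) (simp add: velocity_def vector_derivative_at)
  qed
qed

text \<open>The intermediate atlas enters only through the chosen chart at \<open>F p\<close>. This
  form is meant for the cotractor bundle, whose charts are handled individually and not as a smooth
  atlas.\<close>

lemma tangent_map_compose:
  fixes A :: "('a, 'e::euclidean_space) chart set" and B :: "('b, 'f::euclidean_space) chart set"
    and C :: "('c, 'g::euclidean_space) chart set" and F :: "'a \<Rightarrow> 'b" and G :: "'b \<Rightarrow> 'c" and p :: 'a
  defines "c \<equiv> chart_at A p" and "k \<equiv> chart_at B (F p)"
  assumes k: "k \<in> B" "F p \<in> fst k" "inj_on (snd k) (fst k)"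
    and p: "chart_inv c (snd c p) = p"
    and N: "open N" "snd c p \<in> N" "\<And>x. x \<in> N \<Longrightarrow> F (chart_inv c x) \<in> fst k"
    and F: "(\<lambda>x. snd k (F (chart_inv c x))) differentiable at (snd c p)"
    and G: "\<And>e. e \<in> C \<Longrightarrow> G (F p) \<in> fst e \<Longrightarrow> (\<lambda>y. snd e (G (chart_inv k y))) differentiable at (snd k (F p))"
  shows "tangent_map B C G (F p) (tangent_map A B F p v) = tangent_map A C (\<lambda>q. G (F q)) p v"
proof
  fix e
  show "tangent_map B C G (F p) (tangent_map A B F p v) e = tangent_map A C (\<lambda>q. G (F q)) p v e"
  proof (cases "e \<in> C \<and> G (F p) \<in> fst e")
    case False
    then show ?thesis by (auto simp: tangent_map_def)
  next
    case True
    let ?f = "\<lambda>x. snd k (F (chart_inv c x))" and ?g = "\<lambda>y. snd e (G (chart_inv k y))"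
    have "((\<lambda>x. ?g (?f x)) has_derivative
        (\<lambda>u. frechet_derivative ?g (at (snd k (F p))) (frechet_derivative ?f (at (snd c p)) u))) (at (snd c p))"
      by (rule has_derivative_compose[OF has_derivative_frechet[OF F]])
        (use has_derivative_frechet[OF G[of e]] True in \<open>simp add: p\<close>)
    moreover have "chart_inv k (?f x) = F (chart_inv c x)" if "x \<in> N" for x
      using N(3)[OF that] k(3) by (simp add: chart_inv_def)
    ultimately have "((\<lambda>x. snd e (G (F (chart_inv c x)))) has_derivative
        (\<lambda>u. frechet_derivative ?g (at (snd k (F p))) (frechet_derivative ?f (at (snd c p)) u))) (at (snd c p))"
      by (elim has_derivative_transform_within_open[OF _ N(1,2)]) simp
    from frechet_derivative_eqI[OF this] show ?thesis
      using True k(1,2) by (simp add: tangent_map_def o_def c_def[symmetric] k_def[symmetric])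
  qed
qed

section \<open>Metrics that agree with a model in one chart\<close>

text \<open>Holds for any function \<open>g\<close> of pairs of tangent vectors: both sides evaluate
  it at the same two vectors, seen from two charts.\<close>

lemma (in atlas) metric_coords_change:
  assumes "c \<in> A" "d \<in> A" "x \<in> overlap c d"
  shows "metric_coords A g c x u v = metric_coords A g d (transition c d x)
    (frechet_derivative (transition c d) (at x) u) (frechet_derivative (transition c d) (at x) v)"
proof -
  have x: "x \<in> chart_image c" "chart_inv c x \<in> fst d" using assms overlap_iff by auto
  have "dtransition c d (chart_inv c x) = frechet_derivative (transition c d) (at x)"
    by (simp add: dtransition_def snd_chart_inv x)
  then show ?thesis
    unfolding metric_coords_def chart_inv_transition[OF assms]
    using coord_vec_change[OF assms(1,2) chart_inv_in[OF x(1)] x(2)] by simp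
qed

text \<open>\<open>d\<close> is a chart with an explicit metric and connection and \<open>c\<close>
  is any other chart; the conclusions concern the part of \<open>c\<close> where both are
  defined.\<close>

locale atlas_model = atlas A for A :: "('a, 'e::euclidean_space) chart set" +
  fixes g and c d :: "('a, 'e) chart" and G :: "'e \<Rightarrow> 'e \<Rightarrow> 'e \<Rightarrow> real" and L :: "'e \<Rightarrow> 'e \<Rightarrow> 'e \<Rightarrow> 'e" and \<Lambda> :: real
  assumes c: "c \<in> A" and d: "d \<in> A"
    and gG: "y \<in> chart_image d \<Longrightarrow> metric_coords A g d y u v = G y u v"
    and neutral: "y \<in> chart_image d \<Longrightarrow> neutral_form (G y)"
    and smoothG: "smooth_on (chart_image d) (\<lambda>y. G y u v)"
    and koszul: "y \<in> chart_image d \<Longrightarrow> G y (L y u v) z = koszul G y u v z"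
    and bilL: "y \<in> chart_image d \<Longrightarrow> bilinear (L y)"
    and smoothL: "smooth_on (chart_image d) (\<lambda>y. L y u v)"
    and einstein: "y \<in> chart_image d \<Longrightarrow> ricci L y u v = \<Lambda> * G y u v"
begin

sublocale cc: coord_change "overlap c d" "overlap d c" "transition c d" "transition d c"
  by (rule coord_change[OF c d])

lemma dom: "y \<in> overlap d c \<Longrightarrow> y \<in> chart_image d"
  by (rule subsetD[OF overlap_subset])

lemma pullback:
  "x \<in> overlap c d \<Longrightarrow> metric_coords A g c x u v = G (transition c d x) (cc.J x u) (cc.J x v)"
  using metric_coords_change[OF c d] gG[OF dom[OF cc.phi_in]] by simp

lemma neutral_c:
  assumes x: "x \<in> overlap c d" shows "neutral_form (metric_coords A g c x)"
proof -
  have "neutral_form (\<lambda>u v. G (transition c d x) (cc.J x u) (cc.J x v))"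
    by (rule neutral_form_pullback[OF neutral[OF dom[OF cc.phi_in[OF x]]] cc.linear_J[OF x]
          cc.linear_K[OF cc.phi_in[OF x]]]) (simp_all add: cc.J_K cc.K_J x)
  then show ?thesis using pullback[OF x] by presburger
qed

lemma smooth_c: "smooth_on (overlap c d) (\<lambda>x. metric_coords A g c x u v)"
proof -
  have "smooth_on (overlap c d) (\<lambda>x. G (transition c d x) (cc.J x u) (cc.J x v))"
  proof (rule smooth_on_bilinear_param[OF cc.open_S, where B = "\<lambda>x. G (transition c d x)"])
    show "smooth_on (overlap c d) (\<lambda>x. G (transition c d x) a b)" for a b
      by (rule smooth_on_compose[OF cc.open_S cc.open_T cc.phi_image smooth_on_subset[OF smoothG] cc.smooth_phi])
        (rule overlap_subset)
    show "bilinear (G (transition c d x))" if "x \<in> overlap c d" for x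
      using neutral[OF dom[OF cc.phi_in[OF that]]] by (simp add: neutral_form_def)
  qed (rule cc.smooth_J)+
  then show ?thesis
    by (subst smooth_on_cong[OF cc.open_S, where g = "\<lambda>x. G (transition c d x) (cc.J x u) (cc.J x v)"])
      (simp_all add: pullback)
qed

lemma einstein_c:
  assumes x: "x \<in> overlap c d"
  shows "ricci (levi_civita (metric_coords A g c)) x u v = \<Lambda> * metric_coords A g c x u v"
proof -
  have "ricci (levi_civita (metric_coords A g c)) x u v = ricci L (transition c d x) (cc.J x u) (cc.J x v)"
  proof (rule cc.ricci_levi_civita_pullback[OF x])
    show "nondeg (G y)" if "y \<in> overlap d c" for y using neutral[OF dom[OF that]] by (rule neutral_form_nondeg)
    show "G y u v = G y v u" if "y \<in> overlap d c" for y u v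
      using neutral[OF dom[OF that]] by (auto simp: neutral_form_def)
    show "smooth_on (overlap d c) (\<lambda>y. G y u v)" "smooth_on (overlap d c) (\<lambda>y. L y u v)" for u v
      using smooth_on_subset[OF smoothG overlap_subset] smooth_on_subset[OF smoothL overlap_subset] .
  qed (auto simp: koszul dom pullback bilL)
  also have "\<dots> = \<Lambda> * metric_coords A g c x u v"
    by (simp add: pullback[OF x] einstein[OF dom[OF cc.phi_in[OF x]]])
  finally show ?thesis .
qed

text \<open>Raising an index in the Einstein equation gives \<open>\<Lambda>\<close> times the
  identity, whose trace is \<open>\<Lambda>\<close> times the dimension.\<close>

lemma scalar_curvature_c:
  assumes x: "x \<in> overlap c d"
  shows "scalar_curvature (metric_coords A g c) x = \<Lambda> * real DIM('e)"
proof -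
  let ?g = "metric_coords A g c"
  note n = neutral_form_nondeg[OF neutral_c[OF x]]
  have "(THE w. \<forall>z. ?g x w z = ricci (levi_civita ?g) x i z) = \<Lambda> *\<^sub>R i" for i
    by (rule nondeg_unique[OF n]) (use n in \<open>simp add: einstein_c[OF x] nondeg_def bilinear_lmul\<close>)
  then show ?thesis by (simp add: scalar_curvature_def)
qed

end

section \<open>Cotractors in coordinates\<close>

text \<open>Charts are pairs, so these rules would split every quantifier over charts.\<close>

declare split_paired_All [simp del] split_paired_Ex [simp del]

lemma cotangent_space_diff:
  "\<eta> \<in> cotangent_space A p \<Longrightarrow> \<theta> \<in> cotangent_space A p \<Longrightarrow> (\<lambda>c. \<eta> c - \<theta> c) \<in> cotangent_space A p"
  by (auto simp: cotangent_space_def supported_at_def inner_diff_left)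

lemma one_form_diff:
  assumes "atlas A" "one_form A \<Upsilon>" "one_form A \<Theta>" shows "one_form A (\<lambda>p c. \<Upsilon> p c - \<Theta> p c)"
  using assms(2,3) unfolding one_form_def
  by (auto intro!: cotangent_space_diff smooth_on_diff atlas.open_chart_image[OF assms(1)])

lemma one_form_zero: "one_form A (\<lambda>p c. 0)"
  by (auto simp: one_form_def cotangent_space_def supported_at_def smooth_on_const)

text \<open>Constant vector fields already see the pointwise identity. Conversely the derivatives of
  the fields are the same on both sides and cancel.\<close>

lemma projective_change_iff:
  "projective_change A \<Upsilon> D E \<longleftrightarrow> one_form A \<Upsilon> \<and>
     (\<forall>c\<in>A. \<forall>x\<in>chart_image c. \<forall>u v. E c x u v
        = D c x u v + (\<Upsilon> (chart_inv c x) c \<bullet> u) *\<^sub>R v + (\<Upsilon> (chart_inv c x) c \<bullet> v) *\<^sub>R u)"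
    (is "?l \<longleftrightarrow> one_form A \<Upsilon> \<and> ?r")
proof
  assume l: ?l
  have "E c x u v = D c x u v + (\<Upsilon> (chart_inv c x) c \<bullet> u) *\<^sub>R v + (\<Upsilon> (chart_inv c x) c \<bullet> v) *\<^sub>R u"
    if "c \<in> A" "x \<in> chart_image c" for c x u v
    using l[unfolded projective_change_def, THEN conjunct2, rule_format,
        OF that(1) smooth_on_const smooth_on_const that(2), of u v]
    by (simp add: cov_deriv_def)
  then show "one_form A \<Upsilon> \<and> ?r" using l by (simp add: projective_change_def)
next
  assume "one_form A \<Upsilon> \<and> ?r"
  then show ?l by (simp add: projective_change_def cov_deriv_def)
qed

lemma covector_unique:
  fixes a b :: "'e::euclidean_space"
  assumes "\<And>u v. (a \<bullet> u) *\<^sub>R v + (a \<bullet> v) *\<^sub>R u = (b \<bullet> u) *\<^sub>R v + (b \<bullet> v) *\<^sub>R u"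
  shows "a = b"
proof -
  let ?d = "a - b"
  \<comment> \<open>At \<open>u = v = a - b\<close> the two sides of the hypothesis differ by this
    multiple of \<open>a - b\<close>.\<close>
  have "(2 * (?d \<bullet> ?d)) *\<^sub>R ?d = 0"
    using assms[of ?d ?d] by (simp add: inner_diff_left algebra_simps scaleR_2[symmetric])
  then show ?thesis by auto
qed

locale projective = atlas A for A :: "('a, real^'n) chart set" +
  fixes P :: "('a, real^'n) conn set"
  assumes proj_struct: "projective_structure A P" and dim2: "CARD('n) \<ge> 2"
begin

lemma P_affine: "D \<in> P \<Longrightarrow> affine_connection A D" and P_torsion: "D \<in> P \<Longrightarrow> torsion_free A D"
  using proj_struct by (auto simp: projective_structure_def)

lemma P_nonempty: "P \<noteq> {}"
proof -
  obtain D where D: "affine_connection A D" "torsion_free A D"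
    "P = {E. affine_connection A E \<and> torsion_free A E \<and> (\<exists>\<Upsilon>. projective_change A \<Upsilon> D E)}"
    using proj_struct by (auto simp: projective_structure_def)
  have "projective_change A (\<lambda>p c. 0) D D" by (simp add: projective_change_iff one_form_zero)
  then show ?thesis using D by blast
qed

lemma P_change:
  assumes "D \<in> P" "E \<in> P" shows "\<exists>\<Upsilon>. projective_change A \<Upsilon> D E"
proof -
  obtain D0 where D0: "P = {E. affine_connection A E \<and> torsion_free A E \<and> (\<exists>\<Upsilon>. projective_change A \<Upsilon> D0 E)}"
    using proj_struct by (auto simp: projective_structure_def)
  then obtain \<Upsilon> \<Theta> where "projective_change A \<Upsilon> D0 D" "projective_change A \<Theta> D0 E"
    using assms by auto
  then have "projective_change A (\<lambda>p c. \<Theta> p c - \<Upsilon> p c) D E"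
    by (auto simp: projective_change_iff one_form_diff[OF atlas_axioms] inner_diff_left algebra_simps)
  then show ?thesis by - (rule exI)
qed

text \<open>The choice is immaterial: by \<open>covector_unique\<close> the one-form of a projective
  change is determined in every chart around a point.\<close>

definition ups :: "('a, real^'n) conn \<Rightarrow> ('a, real^'n) conn \<Rightarrow> 'a \<Rightarrow> ('a, real^'n) tensor" where
  "ups D E = (SOME \<Upsilon>. projective_change A \<Upsilon> D E)"

lemma ups: "D \<in> P \<Longrightarrow> E \<in> P \<Longrightarrow> projective_change A (ups D E) D E"
  unfolding ups_def by (rule someI_ex[OF P_change])

lemma ups_eq:
  "D \<in> P \<Longrightarrow> E \<in> P \<Longrightarrow> c \<in> A \<Longrightarrow> x \<in> chart_image c \<Longrightarrow> E c x u v
        = D c x u v + (ups D E (chart_inv c x) c \<bullet> u) *\<^sub>R v + (ups D E (chart_inv c x) c \<bullet> v) *\<^sub>R u"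
  using ups[of D E] unfolding projective_change_iff by blast

lemma ups_one_form: "D \<in> P \<Longrightarrow> E \<in> P \<Longrightarrow> one_form A (ups D E)"
  using ups[of D E] unfolding projective_change_iff by blast

lemma ups_unique:
  assumes D: "D \<in> P" "E \<in> P" and c: "c \<in> A" "p \<in> fst c" and U: "projective_change A \<Upsilon> D E"
  shows "\<Upsilon> p c = ups D E p c"
proof (rule covector_unique)
  fix u v
  have x: "snd c p \<in> chart_image c" using c by (simp add: chart_image_def)
  have "E c (snd c p) u v = D c (snd c p) u v + (\<Upsilon> p c \<bullet> u) *\<^sub>R v + (\<Upsilon> p c \<bullet> v) *\<^sub>R u"
    using U c x unfolding projective_change_iff by (metis chart_inv_snd)
  then show "(\<Upsilon> p c \<bullet> u) *\<^sub>R v + (\<Upsilon> p c \<bullet> v) *\<^sub>R u = (ups D E p c \<bullet> u) *\<^sub>R v + (ups D E p c \<bullet> v) *\<^sub>R u"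
    using ups_eq[OF D c(1) x, of u v] by (simp add: chart_inv_snd c)
qed

text \<open>The cocycle property on which the consistency of the pair representation of cotractors
  rests.\<close>

lemma ups_add:
  assumes P: "D \<in> P" "E \<in> P" "F \<in> P" and c: "c \<in> A" "p \<in> fst c"
  shows "ups D F p c = ups D E p c + ups E F p c"
proof (rule covector_unique)
  fix u v
  have x: "snd c p \<in> chart_image c" using c by (simp add: chart_image_def)
  show "(ups D F p c \<bullet> u) *\<^sub>R v + (ups D F p c \<bullet> v) *\<^sub>R u
    = ((ups D E p c + ups E F p c) \<bullet> u) *\<^sub>R v + ((ups D E p c + ups E F p c) \<bullet> v) *\<^sub>R u"
    using ups_eq[OF P(1,2) c(1) x, of u v] ups_eq[OF P(2,3) c(1) x, of u v] ups_eq[OF P(1,3) c(1) x, of u v]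
    by (simp add: chart_inv_snd c inner_add_left algebra_simps)
qed

lemma ups_self: "D \<in> P \<Longrightarrow> c \<in> A \<Longrightarrow> p \<in> fst c \<Longrightarrow> ups D D p c = 0"
  using ups_add[of D D D c p] by simp

lemma ups_cotangent: "D \<in> P \<Longrightarrow> E \<in> P \<Longrightarrow> c \<in> A \<Longrightarrow> p \<in> fst c \<Longrightarrow> ups D E p \<in> cotangent_space A p"
  using ups_one_form[of D E] by (auto simp: one_form_def points_def)

lemma smooth_ups: "D \<in> P \<Longrightarrow> E \<in> P \<Longrightarrow> c \<in> A \<Longrightarrow> smooth_on (chart_image c) (\<lambda>x. ups D E (chart_inv c x) c)"
  using ups_one_form[of D E] by (auto simp: one_form_def)

subsection \<open>Weights\<close>

lemma jacobian_det_eq: "jacobian_det c d p = det (matrix (dtransition c d p))"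
  by (simp add: jacobian_det_def jacobian_def dtransition_def)

lemma jacobian_det_trans:
  assumes "c \<in> A" "d \<in> A" "e \<in> A" "p \<in> fst c" "p \<in> fst d" "p \<in> fst e"
  shows "jacobian_det c e p = jacobian_det d e p * jacobian_det c d p"
proof -
  have "matrix (dtransition c e p) = matrix (dtransition d e p) ** matrix (dtransition c d p)"
    using matrix_linear_compose[of "dtransition d e p" "dtransition c d p"] assms
    by (simp add: dtransition_trans linear_dtransition)
  then show ?thesis by (simp add: jacobian_det_eq det_mul)
qed

lemma jacobian_det_refl: "c \<in> A \<Longrightarrow> p \<in> fst c \<Longrightarrow> jacobian_det c c p = 1"
proof -
  assume "c \<in> A" "p \<in> fst c"
  then have "dtransition c c p = id" by (auto simp: dtransition_refl)
  then show ?thesis by (simp add: jacobian_det_eq matrix_id_mat_1)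
qed

lemma jacobian_det_nonzero:
  "c \<in> A \<Longrightarrow> d \<in> A \<Longrightarrow> p \<in> fst c \<Longrightarrow> p \<in> fst d \<Longrightarrow> jacobian_det c d p \<noteq> 0"
  using jacobian_det_trans[of c d c p] jacobian_det_refl[of c p] by auto

lemma weight_one_trans:
  "c \<in> A \<Longrightarrow> d \<in> A \<Longrightarrow> e \<in> A \<Longrightarrow> p \<in> fst c \<Longrightarrow> p \<in> fst d \<Longrightarrow> p \<in> fst e
    \<Longrightarrow> weight_one c e p = weight_one d e p * weight_one c d p"
  by (simp add: weight_one_def jacobian_det_trans[of c d e p] abs_mult powr_mult)

lemma weight_one_refl: "c \<in> A \<Longrightarrow> p \<in> fst c \<Longrightarrow> weight_one c c p = 1"
  by (simp add: weight_one_def jacobian_det_refl)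

lemma smooth_jacobian_det:
  assumes c: "c \<in> A" and d: "d \<in> A"
  shows "smooth_on (overlap c d) (\<lambda>x. det (matrix (frechet_derivative (transition c d) (at x))))"
proof -
  interpret cc: coord_change "overlap c d" "overlap d c" "transition c d" "transition d c"
    by (rule coord_change[OF c d])
  have "smooth_on (overlap c d) (\<lambda>x. frechet_derivative (transition c d) (at x) u $ i)" for u i
    by (rule smooth_on_linear_compose[OF cc.open_S bounded_linear_vec_nth cc.smooth_J])
  then show ?thesis
    unfolding det_def matrix_def
    by (auto intro!: smooth_on_sum[OF cc.open_S] smooth_on_mult[OF cc.open_S] smooth_on_const smooth_on_prod[OF cc.open_S])
qed

lemma weight_one_chart:
  "c \<in> A \<Longrightarrow> x \<in> overlap c d \<Longrightarrow> weight_one c d (chart_inv c x)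
    = \<bar>det (matrix (frechet_derivative (transition c d) (at x)))\<bar> powr (1 / (real CARD('n) + 1))"
  using snd_chart_inv[OF subsetD[OF overlap_subset], of x c d]
  by (simp add: weight_one_def jacobian_det_def jacobian_def)

lemma smooth_weight_one:
  assumes c: "c \<in> A" and d: "d \<in> A"
  shows "smooth_on (overlap c d) (\<lambda>x. weight_one c d (chart_inv c x))"
proof -
  have nz: "det (matrix (frechet_derivative (transition c d) (at x))) \<noteq> 0" if "x \<in> overlap c d" for x
    using jacobian_det_nonzero[OF c d, of "chart_inv c x"] that overlap_iff[OF c, of x d]
    by (simp add: jacobian_det_eq dtransition_def chart_inv_in snd_chart_inv)
  show ?thesis
    by (subst smooth_on_cong[OF open_overlap[OF c d] weight_one_chart])
      (auto intro!: smooth_on_abs_powr open_overlap c d smooth_jacobian_det nz)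
qed

subsection \<open>Change of representation of a cotractor\<close>

text \<open>First the shift by \<open>\<Upsilon>\<close> in the chart \<open>c\<close>, then the transformation law of weighted covectors from \<open>c\<close> to \<open>d\<close>.\<close>

definition ctr :: "('a, real^'n) conn \<Rightarrow> ('a, real^'n) chart \<Rightarrow> ('a, real^'n) conn \<Rightarrow> ('a, real^'n) chart
    \<Rightarrow> 'a \<Rightarrow> real \<times> (real^'n) \<Rightarrow> real \<times> (real^'n)" where
  "ctr D c E d p w = (weight_one c d p * fst w,
     adjoint (dtransition d c p) (weight_one c d p *\<^sub>R (snd w + fst w *\<^sub>R ups D E p c)))"

lemma adjoint_dtransition:
  "c \<in> A \<Longrightarrow> d \<in> A \<Longrightarrow> p \<in> fst c \<Longrightarrow> p \<in> fst d \<Longrightarrow> adjoint (dtransition d c p) y \<bullet> u = y \<bullet> dtransition d c p u"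
  using adjoint_works[OF linear_dtransition, of d c p u y] by (simp add: inner_commute)

lemma inner_eqI: "(\<And>u. x \<bullet> u = y \<bullet> u) \<Longrightarrow> x = y" for x y :: "'b::euclidean_space"
  by (rule euclidean_eqI) blast

lemma covector_change:
  assumes "\<eta> \<in> cotangent_space A p" "c \<in> A" "d \<in> A" "p \<in> fst c" "p \<in> fst d"
  shows "\<eta> d = adjoint (dtransition d c p) (\<eta> c)"
proof (rule inner_eqI)
  fix u
  have "\<eta> c \<bullet> dtransition d c p u = \<eta> d \<bullet> u"
    using assms(1) assms(2-5) unfolding cotangent_space_def by blast
  then show "\<eta> d \<bullet> u = adjoint (dtransition d c p) (\<eta> c) \<bullet> u"
    using assms by (simp add: adjoint_dtransition)
qed

lemma linear_ctr:
  assumes "c \<in> A" "d \<in> A" "p \<in> fst c" "p \<in> fst d"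
  shows "linear (ctr D c E d p)"
  using adjoint_linear[OF linear_dtransition[OF assms(2,1,4,3)]]
  by (auto intro!: linearI simp: ctr_def linear_add linear_scale algebra_simps)

text \<open>A cotractor is determined by any one of its pairs: the connection is changed first,
  within the chart \<open>c\<close>, and then the chart, for the connection
  \<open>E\<close>.\<close>

lemma cotractor_fibre_ctr:
  assumes U: "U \<in> cotractor_fibre A P p" and D: "D \<in> P" "E \<in> P" and c: "c \<in> A" "d \<in> A" "p \<in> fst c" "p \<in> fst d"
  shows "U E d = ctr D c E d p (U D c)"
proof -
  have E: "U E c = (fst (U D c), snd (U D c) + fst (U D c) *\<^sub>R ups D E p c)"
    using U D c ups[OF D] unfolding cotractor_fibre_def by blast
  have 1: "fst (U E d) = weight_one c d p * fst (U E c)"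
    using U D c unfolding cotractor_fibre_def density_fibre_def by blast
  have 2: "snd (U E d) = adjoint (dtransition d c p) (weight_one c d p *\<^sub>R snd (U E c))"
  proof (rule inner_eqI)
    fix u
    have "snd (U E c) \<bullet> dtransition d c p u = weight_one d c p * (snd (U E d) \<bullet> u)"
      using U D c unfolding cotractor_fibre_def weighted_cotangent_space_def by blast
    moreover have "weight_one c d p * weight_one d c p = 1"
      using weight_one_trans[of d c d p] weight_one_refl[of d p] c by simp
    ultimately show "snd (U E d) \<bullet> u = adjoint (dtransition d c p) (weight_one c d p *\<^sub>R snd (U E c)) \<bullet> u"
      by (simp add: adjoint_dtransition c)
  qed
  show ?thesis using 1 2 E by (simp add: ctr_def prod_eq_iff)
qed

section \<open>Cotractors built from one pair of components\<close>

definition mk_cotractor :: "('a, real^'n) conn \<Rightarrow> ('a, real^'n) chart \<Rightarrow> 'a \<Rightarrow> real \<times> (real^'n)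
    \<Rightarrow> ('a, real^'n) cotractor" where
  "mk_cotractor D c p w = (\<lambda>E d. if E \<in> P \<and> d \<in> A \<and> p \<in> fst d then ctr D c E d p w else 0)"

text \<open>Compatibility over all connections and charts comes from three cocycle laws: those of
  the weights, of the Jacobians and of \<open>ups\<close>.\<close>

lemma mk_cotractor_in:
  assumes D: "D \<in> P" and c: "c \<in> A" "p \<in> fst c"
  shows "mk_cotractor D c p w \<in> cotractor_fibre A P p"
  unfolding cotractor_fibre_def
proof (intro CollectI conjI allI ballI impI)
  let ?U = "mk_cotractor D c p w"
  show "?U E d = 0" if "E \<notin> P" for E d using that by (simp add: mk_cotractor_def)
  fix E assume E: "E \<in> P"
  show "(\<lambda>d. fst (?U E d)) \<in> density_fibre A p"
    unfolding density_fibre_def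
  proof (intro CollectI conjI ballI impI)
    show "supported_at A p (\<lambda>d. fst (?U E d))"
      by (simp add: supported_at_def mk_cotractor_def)
    fix d e assume d: "d \<in> A" "e \<in> A" "p \<in> fst d \<inter> fst e"
    then show "fst (?U E e) = weight_one d e p * fst (?U E d)"
      using c E weight_one_trans[of c d e p] by (simp add: mk_cotractor_def ctr_def)
  qed
  have snd_U: "snd (?U E d) \<bullet> u = weight_one c d p * ((snd w + fst w *\<^sub>R ups D E p c) \<bullet> dtransition d c p u)"
    if "d \<in> A" "p \<in> fst d" for d u
    using that c E by (simp add: mk_cotractor_def ctr_def adjoint_dtransition)
  show "(\<lambda>d. snd (?U E d)) \<in> weighted_cotangent_space A p"
    unfolding weighted_cotangent_space_def
  proof (intro CollectI conjI ballI impI allI)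
    show "supported_at A p (\<lambda>d. snd (?U E d))"
      using E by (simp add: supported_at_def mk_cotractor_def)
    fix d e u assume d: "d \<in> A" "e \<in> A" "p \<in> fst d \<inter> fst e"
    then show "snd (?U E e) \<bullet> dtransition d e p u = weight_one d e p * (snd (?U E d) \<bullet> u)"
      using c weight_one_trans[of c d e p] by (simp add: snd_U dtransition_trans)
  qed
  fix F \<Upsilon> d assume F: "F \<in> P" and U: "projective_change A \<Upsilon> E F" and d: "d \<in> A" "p \<in> fst d"
  have "\<Upsilon> p d = adjoint (dtransition d c p) (ups E F p c)"
    using ups_unique[OF E F d U] covector_change[OF ups_cotangent[OF E F c] c(1) d(1) c(2) d(2)] by simp
  then show "?U F d = (fst (?U E d), snd (?U E d) + fst (?U E d) *\<^sub>R \<Upsilon> p d)"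
    using adjoint_linear[OF linear_dtransition[OF d(1) c(1) d(2) c(2)]]
    by (simp add: mk_cotractor_def E F d ctr_def ups_add[OF D E F c] linear_add linear_scale algebra_simps)
qed

lemma ctr_refl:
  assumes "D \<in> P" "c \<in> A" "p \<in> fst c" shows "ctr D c D c p w = w"
proof -
  have "adjoint (dtransition c c p) y = y" for y
    by (rule inner_eqI) (simp add: adjoint_dtransition dtransition_refl assms)
  then show ?thesis by (simp add: ctr_def weight_one_refl ups_self assms)
qed

lemma mk_cotractor_self: "D \<in> P \<Longrightarrow> c \<in> A \<Longrightarrow> p \<in> fst c \<Longrightarrow> mk_cotractor D c p w D c = w"
  by (simp add: mk_cotractor_def ctr_refl)

lemma mk_cotractor_apply:
  "E \<in> P \<Longrightarrow> d \<in> A \<Longrightarrow> p \<in> fst d \<Longrightarrow> mk_cotractor D c p w E d = ctr D c E d p w"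
  by (simp add: mk_cotractor_def)

lemma cotractor_supported:
  assumes U: "U \<in> cotractor_fibre A P p" and n: "\<not> (E \<in> P \<and> d \<in> A \<and> p \<in> fst d)"
  shows "U E d = 0"
proof (cases "E \<in> P")
  case True
  then have "fst (U E d) = 0" "snd (U E d) = 0"
    using U n unfolding cotractor_fibre_def density_fibre_def weighted_cotangent_space_def supported_at_def
    by blast+
  then show ?thesis by (simp add: prod_eq_iff)
next
  case False
  then show ?thesis using U unfolding cotractor_fibre_def by blast
qed

lemma cotractor_eq_mk:
  assumes U: "U \<in> cotractor_fibre A P p" and D: "D \<in> P" and c: "c \<in> A" "p \<in> fst c"
  shows "U = mk_cotractor D c p (U D c)"
proof (intro ext)
  fix E d show "U E d = mk_cotractor D c p (U D c) E d"
    using cotractor_fibre_ctr[OF U D, of E c d] cotractor_supported[OF U, of E d] c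
    by (auto simp: mk_cotractor_def)
qed

lemma cotractor_eqI:
  assumes "U \<in> cotractor_fibre A P p" "V \<in> cotractor_fibre A P p" "D \<in> P" "c \<in> A" "p \<in> fst c" "U D c = V D c"
  shows "U = V"
  using cotractor_eq_mk[of U p D c] cotractor_eq_mk[of V p D c] assms by simp

lemma mk_cotractor_scale:
  assumes c: "c \<in> A" "p \<in> fst c"
  shows "mk_cotractor D c p (r *\<^sub>R w) = (\<lambda>E d. r *\<^sub>R mk_cotractor D c p w E d)"
  by (intro ext) (simp add: mk_cotractor_def linear_scale[OF linear_ctr[OF c(1) _ c(2)]])

lemma mk_cotractor_add:
  assumes c: "c \<in> A" "p \<in> fst c"
  shows "mk_cotractor D c p (w + w') = (\<lambda>E d. mk_cotractor D c p w E d + mk_cotractor D c p w' E d)"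
  by (intro ext) (simp add: mk_cotractor_def linear_add[OF linear_ctr[OF c(1) _ c(2)]])

lemma nonzero_iff:
  assumes U: "U \<in> cotractor_fibre A P p" and D: "D \<in> P" and c: "c \<in> A" "p \<in> fst c"
  shows "nonzero U \<longleftrightarrow> U D c \<noteq> 0"
proof
  assume "nonzero U"
  then obtain E d where Ed: "U E d \<noteq> 0" by (auto simp: nonzero_def)
  then have "E \<in> P" "d \<in> A" "p \<in> fst d" using cotractor_supported[OF U] by metis+
  then have "U E d = ctr D c E d p (U D c)" using cotractor_fibre_ctr[OF U D] c by blast
  then show "U D c \<noteq> 0"
    using Ed linear_0[OF linear_ctr[OF c(1) \<open>d \<in> A\<close> c(2) \<open>p \<in> fst d\<close>]] by auto
next
  assume "U D c \<noteq> 0"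
  then show "nonzero U" unfolding nonzero_def by blast
qed

lemma tau_eq:
  assumes U: "U \<in> cotractor_fibre A P p" and D: "D \<in> P" and c: "c \<in> A" "p \<in> fst c"
  shows "tau P U c = fst (U D c)"
proof -
  have E: "(SOME D. D \<in> P) \<in> P" using P_nonempty some_in_eq by blast
  have "U (SOME D. D \<in> P) c = ctr D c (SOME D. D \<in> P) c p (U D c)"
    by (rule cotractor_fibre_ctr[OF U D E c(1) c(1) c(2) c(2)])
  then show ?thesis by (simp add: tau_def ctr_def weight_one_refl c)
qed

lemma tau_zero_iff:
  assumes U: "U \<in> cotractor_fibre A P p" and D: "D \<in> P" and c: "c \<in> A" "p \<in> fst c"
  shows "tau P U = (\<lambda>c. 0) \<longleftrightarrow> fst (U D c) = 0"
proof
  assume "fst (U D c) = 0"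
  have E: "(SOME D. D \<in> P) \<in> P" using P_nonempty some_in_eq by blast
  have "tau P U d = 0" for d
  proof (cases "d \<in> A \<and> p \<in> fst d")
    case True
    then show ?thesis
      using cotractor_fibre_ctr[OF U D E, of c d] c \<open>fst (U D c) = 0\<close> by (simp add: tau_def ctr_def)
  next
    case False
    then have "U (SOME D. D \<in> P) d = 0" using cotractor_supported[OF U] by blast
    then show ?thesis by (simp add: tau_def)
  qed
  then show "tau P U = (\<lambda>c. 0)" by auto
qed (use tau_eq[OF assms] in auto)

text \<open>Base point and pair may both depend on a parameter; transition maps of the projectivised
  bundle and sections seen from other charts are instances.\<close>

lemma smooth_ctr:
  assumes D: "D \<in> P" "E \<in> P" and c: "c \<in> A" and d: "d \<in> A"
    and Z: "open Z" and f: "smooth_on Z f" "f ` Z \<subseteq> overlap c d" and w: "smooth_on Z w"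
  shows "smooth_on Z (\<lambda>z. ctr D c E d (chart_inv c (f z)) (w z))"
proof -
  interpret cc: coord_change "overlap c d" "overlap d c" "transition c d" "transition d c"
    by (rule coord_change[OF c d])
  have wt: "smooth_on Z (\<lambda>z. weight_one c d (chart_inv c (f z)))"
    by (rule smooth_on_compose[OF Z cc.open_S f(2) smooth_weight_one[OF c d] f(1)])
  have up: "smooth_on Z (\<lambda>z. ups D E (chart_inv c (f z)) c)"
    by (rule smooth_on_compose[OF Z cc.open_S f(2) smooth_on_subset[OF smooth_ups[OF D c] overlap_subset] f(1)])
  have tf: "smooth_on Z (\<lambda>z. transition c d (f z))"
    by (rule smooth_on_compose[OF Z cc.open_S f(2) cc.smooth_phi f(1)])
  have K: "smooth_on Z (\<lambda>z. adjoint (cc.K (transition c d (f z)))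
     (weight_one c d (chart_inv c (f z)) *\<^sub>R (snd (w z) + fst (w z) *\<^sub>R ups D E (chart_inv c (f z)) c)))"
  proof (rule smooth_on_adjoint[OF Z])
    show "smooth_on Z (\<lambda>z. cc.K (transition c d (f z)) u)" for u
      by (rule smooth_on_frechet_derivative[OF Z cc.open_T _ cc.smooth_psi tf smooth_on_const])
        (use f(2) cc.phi_in in auto)
    show "linear (cc.K (transition c d (f z)))" if "z \<in> Z" for z
      using that f(2) cc.phi_in by (intro cc.linear_K) auto
    show "smooth_on Z (\<lambda>z. weight_one c d (chart_inv c (f z)) *\<^sub>R
        (snd (w z) + fst (w z) *\<^sub>R ups D E (chart_inv c (f z)) c))"
      by (intro smooth_on_scaleR[OF Z] smooth_on_add[OF Z] smooth_on_fst[OF Z] smooth_on_snd[OF Z] wt up w)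
  qed
  have "dtransition d c (chart_inv c (f z)) = cc.K (transition c d (f z))" for z
    by (simp add: dtransition_def transition_def)
  then show ?thesis
    unfolding ctr_def
    by (intro smooth_on_Pair[OF Z] smooth_on_mult[OF Z] wt smooth_on_fst[OF Z] w) (simp add: K)
qed

end

section \<open>The projectivised cotractor bundle\<close>

subsection \<open>Affine coordinates on projective space\<close>

text \<open>
  \<open>rep b a\<close> is the vector \<open>w\<close> with \<open>w \<bullet> b = 1\<close> and affine coordinates \<open>a\<close>; the formula covers both \<open>b = (1, 0)\<close> and
  \<open>b = (0, e)\<close>.
\<close>

definition rep :: "real \<times> 'e \<Rightarrow> 'e \<Rightarrow> real \<times> 'e::euclidean_space" where
  "rep b a = (fst b + a \<bullet> snd b, a + (1 - a \<bullet> snd b) *\<^sub>R snd b)"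

definition nrm :: "real \<times> 'e \<Rightarrow> real \<times> 'e \<Rightarrow> 'e::euclidean_space" where
  "nrm b w = drop_component b (inverse (w \<bullet> b) *\<^sub>R w)"

lemma Basis_cases:
  assumes "b \<in> (Basis :: (real \<times> 'e::euclidean_space) set)"
  obtains "b = (1, 0)" | e where "e \<in> Basis" "b = (0, e)"
  using assms by (auto simp: Basis_prod_def)

lemma rep_inner: "b \<in> Basis \<Longrightarrow> rep b a \<bullet> b = 1"
  by (erule Basis_cases) (auto simp: rep_def inner_prod_def inner_add_left)

lemma rep_drop: "b \<in> Basis \<Longrightarrow> w \<bullet> b = 1 \<Longrightarrow> rep b (drop_component b w) = w"
  by (erule Basis_cases) (auto simp: rep_def drop_component_def inner_prod_def inner_add_left algebra_simps prod_eq_iff)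

lemma drop_rep: "b \<in> Basis \<Longrightarrow> drop_component b (rep b a) = a"
  by (erule Basis_cases) (auto simp: rep_def drop_component_def inner_prod_def inner_add_left algebra_simps)

lemma nrm_rep: "b \<in> Basis \<Longrightarrow> nrm b (rep b a) = a"
  by (simp add: nrm_def rep_inner drop_rep)

lemma rep_nrm: "b \<in> Basis \<Longrightarrow> w \<bullet> b \<noteq> 0 \<Longrightarrow> rep b (nrm b w) = inverse (w \<bullet> b) *\<^sub>R w"
  by (simp add: nrm_def rep_drop)

lemma nrm_scale: "r \<noteq> 0 \<Longrightarrow> nrm b (r *\<^sub>R w) = nrm b w"
proof -
  assume "r \<noteq> 0"
  then have "inverse (r * (w \<bullet> b)) * r = inverse (w \<bullet> b)" by (simp add: field_simps)
  then show ?thesis by (simp only: nrm_def inner_scaleR_left scaleR_scaleR)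
qed

lemma nrm_infinity: "nrm (1, 0) w = inverse (fst w) *\<^sub>R snd w"
  by (simp add: nrm_def drop_component_def inner_prod_def)

lemma rep_infinity: "rep (1, 0) a = (1, a)"
  by (simp add: rep_def)

lemma infinity_Basis: "(1, 0) \<in> (Basis :: (real \<times> 'e::euclidean_space) set)"
  by (simp add: Basis_prod_def)

lemma smooth_nrm:
  assumes Z: "open Z" and w: "smooth_on Z w" and nz: "\<And>z. z \<in> Z \<Longrightarrow> w z \<bullet> b \<noteq> 0"
  shows "smooth_on Z (\<lambda>z. nrm b (w z))"
  unfolding nrm_def drop_component_def
  by (intro smooth_on_add[OF Z] smooth_on_diff[OF Z] smooth_on_scaleR[OF Z] smooth_on_inverse[OF Z] nz
      smooth_on_inner[OF Z] smooth_on_fst[OF Z] smooth_on_snd[OF Z] w smooth_on_const)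

lemma smooth_rep:
  assumes Z: "open Z" and w: "smooth_on Z w"
  shows "smooth_on Z (\<lambda>z. rep b (w z))"
  unfolding rep_def
  by (intro smooth_on_Pair[OF Z] smooth_on_add[OF Z] smooth_on_diff[OF Z] smooth_on_scaleR[OF Z]
      smooth_on_inner[OF Z] w smooth_on_const)

subsection \<open>Lines\<close>

lemma line_self: "U \<in> line U"
  by (auto simp: line_def intro!: exI[of _ 1])

lemma line_scale: "r \<noteq> 0 \<Longrightarrow> line (\<lambda>D c. r *\<^sub>R U D c) = line U"
proof -
  assume "r \<noteq> 0"
  have "(\<lambda>D c. s *\<^sub>R U D c) = (\<lambda>D c. (s / r) *\<^sub>R r *\<^sub>R U D c)" for s
    using \<open>r \<noteq> 0\<close> by simp
  then show ?thesis unfolding line_def by (auto, metis scaleR_scaleR)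
qed

lemma line_memE:
  assumes "V \<in> line U" obtains r where "\<And>D c. V D c = r *\<^sub>R U D c"
  using assms by (auto simp: line_def)

lemma proj_Pair: "proj (p, U) = (p, line U)"
  by (simp add: proj_def)

lemma proj_eqD: "proj (p, U) = proj (q, V) \<Longrightarrow> p = q \<and> (\<exists>r. \<forall>D c. U D c = r *\<^sub>R V D c)"
  using line_self[of U] by (auto simp: proj_Pair elim: line_memE)

section \<open>Charts of the projectivised bundle and their compatibility\<close>

context projective
begin

abbreviation PAt where "PAt \<equiv> proj_atlas A P"
abbreviation pch where "pch \<equiv> proj_chart A P"

lemma fibre_scale:
  assumes U: "U \<in> cotractor_fibre A P p" and p: "c \<in> A" "p \<in> fst c"
  shows "(\<lambda>D c. r *\<^sub>R U D c) \<in> cotractor_fibre A P p"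
proof -
  obtain D where D: "D \<in> P" using P_nonempty by blast
  have "(\<lambda>E d. r *\<^sub>R U E d) = mk_cotractor D c p (r *\<^sub>R U D c)"
    using cotractor_eq_mk[OF U D p] mk_cotractor_scale[OF p, of D r "U D c"] by metis
  then show ?thesis using mk_cotractor_in[OF D p] by simp
qed

lemma fibre_line:
  assumes U: "U \<in> cotractor_fibre A P p" and V: "V \<in> line U" and p: "c \<in> A" "p \<in> fst c"
  shows "V \<in> cotractor_fibre A P p"
  using fibre_scale[OF U p] V by (auto simp: line_def)

lemma pch_dom:
  "fst (pch D c b) = {proj (p, U) | p U. p \<in> fst c \<and> U \<in> cotractor_fibre A P p \<and> U D c \<bullet> b \<noteq> 0}"
  by (simp add: proj_chart_def)

lemma pch_dom_iff:
  assumes U: "U \<in> cotractor_fibre A P p"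
  shows "proj (p, U) \<in> fst (pch D c b) \<longleftrightarrow> p \<in> fst c \<and> U D c \<bullet> b \<noteq> 0"
proof
  assume "proj (p, U) \<in> fst (pch D c b)"
  then obtain q V where V: "proj (p, U) = proj (q, V)" "q \<in> fst c" "V D c \<bullet> b \<noteq> 0"
    unfolding pch_dom by blast
  then obtain r where "p = q" "\<And>D c. V D c = r *\<^sub>R U D c"
    using proj_eqD[OF V(1)[symmetric]] by blast
  then show "p \<in> fst c \<and> U D c \<bullet> b \<noteq> 0" using V by auto
qed (use U in \<open>auto simp: pch_dom\<close>)

text \<open>The \<open>SOME\<close> in the chart has a single candidate, the representative scaled
  to product 1 with \<open>b\<close>.\<close>

lemma pch_coords:
  assumes b: "b \<in> Basis" and nz: "U D c \<bullet> b \<noteq> 0"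
  shows "snd (pch D c b) (proj (p, U)) = (snd c p, nrm b (U D c))"
proof -
  have "(SOME w. \<exists>V\<in>line U. w = V D c \<and> w \<bullet> b = 1) = inverse (U D c \<bullet> b) *\<^sub>R U D c"
  proof (rule some_equality)
    show "\<exists>V\<in>line U. inverse (U D c \<bullet> b) *\<^sub>R U D c = V D c \<and> inverse (U D c \<bullet> b) *\<^sub>R U D c \<bullet> b = 1"
      using nz by (auto simp: line_def)
    fix w assume "\<exists>V\<in>line U. w = V D c \<and> w \<bullet> b = 1"
    then obtain V where V: "V \<in> line U" "w = V D c" "w \<bullet> b = 1" by blast
    obtain r where "\<And>D c. V D c = r *\<^sub>R U D c" using line_memE[OF V(1)] by blast
    then have r: "w = r *\<^sub>R U D c" "r * (U D c \<bullet> b) = 1" using V(2,3) by simp_all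
    then have "r = inverse (U D c \<bullet> b)" using nz by (simp add: field_simps)
    then show "w = inverse (U D c \<bullet> b) *\<^sub>R U D c" using r by simp
  qed
  then show ?thesis by (simp add: proj_chart_def proj_Pair nrm_def)
qed

text \<open>Homogeneous coordinates over a chart of the base. All affine charts of the bundle factor
  through this one parametrisation, so their transitions need no case distinction on
  \<open>b\<close>.\<close>

definition PT :: "('a, real^'n) conn \<Rightarrow> ('a, real^'n) chart \<Rightarrow> real^'n \<Rightarrow> real \<times> (real^'n) \<Rightarrow> ('a, real^'n) proj_point" where
  "PT D c x w = proj (chart_inv c x, mk_cotractor D c (chart_inv c x) w)"

lemma PT_scale:
  assumes "D \<in> P" "c \<in> A" "x \<in> chart_image c" "r \<noteq> 0" shows "PT D c x (r *\<^sub>R w) = PT D c x w"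
  using assms by (simp add: PT_def proj_Pair mk_cotractor_scale chart_inv_in line_scale)

lemma PT_dom_iff:
  assumes "D \<in> P" "E \<in> P" "c \<in> A" "d \<in> A" "x \<in> chart_image c"
  shows "PT D c x w \<in> fst (pch E d b) \<longleftrightarrow> x \<in> overlap c d \<and> ctr D c E d (chart_inv c x) w \<bullet> b \<noteq> 0"
  unfolding PT_def pch_dom_iff[OF mk_cotractor_in[OF assms(1,3) chart_inv_in[OF assms(5)]]]
  using assms overlap_iff[OF assms(3), of x d] by (auto simp: mk_cotractor_apply)

lemma PT_coords:
  assumes "D \<in> P" "E \<in> P" "c \<in> A" "d \<in> A" "x \<in> chart_image c" "b \<in> Basis" "PT D c x w \<in> fst (pch E d b)"
  shows "snd (pch E d b) (PT D c x w) = (transition c d x, nrm b (ctr D c E d (chart_inv c x) w))"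
proof -
  have x: "x \<in> overlap c d" and nz: "ctr D c E d (chart_inv c x) w \<bullet> b \<noteq> 0"
    using assms PT_dom_iff by auto
  then have "chart_inv c x \<in> fst d" using overlap_iff assms(3) by auto
  then have "mk_cotractor D c (chart_inv c x) w E d = ctr D c E d (chart_inv c x) w"
    using assms by (simp add: mk_cotractor_apply)
  then show ?thesis
    unfolding PT_def using pch_coords[OF assms(6), of "mk_cotractor D c (chart_inv c x) w" E d] nz
    by (simp add: transition_def)
qed

lemma PT_self:
  assumes "D \<in> P" "c \<in> A" "x \<in> chart_image c" "b \<in> Basis"
  shows "PT D c x w \<in> fst (pch D c b) \<longleftrightarrow> w \<bullet> b \<noteq> 0"
    and "w \<bullet> b \<noteq> 0 \<Longrightarrow> snd (pch D c b) (PT D c x w) = (x, nrm b w)"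
proof -
  have p: "chart_inv c x \<in> fst c" using assms by (simp add: chart_inv_in)
  show 1: "PT D c x w \<in> fst (pch D c b) \<longleftrightarrow> w \<bullet> b \<noteq> 0"
    unfolding PT_def pch_dom_iff[OF mk_cotractor_in[OF assms(1,2) p]]
    using assms p by (simp add: mk_cotractor_self)
  show "snd (pch D c b) (PT D c x w) = (x, nrm b w)" if "w \<bullet> b \<noteq> 0"
    unfolding PT_def
    using pch_coords[OF assms(4), of "mk_cotractor D c (chart_inv c x) w" D c] that assms p
    by (simp add: mk_cotractor_self snd_chart_inv)
qed

lemma PT_cover:
  assumes D: "D \<in> P" and c: "c \<in> A" and p: "p \<in> fst c" and U: "U \<in> cotractor_fibre A P p"
  shows "proj (p, U) = PT D c (snd c p) (U D c)"
  using cotractor_eq_mk[OF U D c p] by (simp add: PT_def chart_inv_snd c p)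

lemma pch_inverse:
  assumes D: "D \<in> P" and c: "c \<in> A" and b: "b \<in> Basis" and m: "m \<in> fst (pch D c b)"
  shows "fst (snd (pch D c b) m) \<in> chart_image c"
    and "PT D c (fst (snd (pch D c b) m)) (rep b (snd (snd (pch D c b) m))) = m"
proof -
  obtain p U where U: "m = proj (p, U)" "p \<in> fst c" "U \<in> cotractor_fibre A P p" "U D c \<bullet> b \<noteq> 0"
    using m unfolding pch_dom by blast
  have x: "snd c p \<in> chart_image c" using U by (simp add: chart_image_def)
  note co = pch_coords[where U = U and D = D and c = c and p = p, OF b U(4)]
  show "fst (snd (pch D c b) m) \<in> chart_image c" using x by (simp add: U(1) co)
  show "PT D c (fst (snd (pch D c b) m)) (rep b (snd (snd (pch D c b) m))) = m"
    unfolding U(1) co fst_conv snd_conv rep_nrm[OF b U(4)]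
    using PT_cover[OF D c U(2,3)] PT_scale[OF D c x, of "inverse (U D c \<bullet> b)" "U D c"] U(4) by simp
qed

lemma pch_inj: "D \<in> P \<Longrightarrow> c \<in> A \<Longrightarrow> b \<in> Basis \<Longrightarrow> inj_on (snd (pch D c b)) (fst (pch D c b))"
  by (rule inj_onI) (metis pch_inverse(2))

lemma pch_image:
  assumes D: "D \<in> P" and c: "c \<in> A" and b: "b \<in> Basis"
  shows "chart_image (pch D c b) = chart_image c \<times> UNIV"
proof (intro set_eqI iffI)
  fix z assume "z \<in> chart_image (pch D c b)"
  then obtain m where "m \<in> fst (pch D c b)" "z = snd (pch D c b) m" by (auto simp: chart_image_def)
  then show "z \<in> chart_image c \<times> UNIV" using pch_inverse(1)[OF D c b] by (simp add: mem_Times_iff)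
next
  fix z :: "(real^'n) \<times> (real^'n)" assume "z \<in> chart_image c \<times> UNIV"
  then have x: "fst z \<in> chart_image c" by auto
  have "rep b (snd z) \<bullet> b \<noteq> 0" using rep_inner[OF b] by simp
  then have "PT D c (fst z) (rep b (snd z)) \<in> fst (pch D c b)"
    "snd (pch D c b) (PT D c (fst z) (rep b (snd z))) = z"
    using PT_self[OF D c x b] by (simp_all add: nrm_rep b)
  then show "z \<in> chart_image (pch D c b)" unfolding chart_image_def by (metis imageI)
qed

lemma pch_inv:
  assumes D: "D \<in> P" and c: "c \<in> A" and b: "b \<in> Basis" and x: "x \<in> chart_image c"
  shows "chart_inv (pch D c b) (x, a) = PT D c x (rep b a)"
proof -
  have "rep b a \<bullet> b \<noteq> 0" using rep_inner[OF b] by simp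
  then have "PT D c x (rep b a) \<in> fst (pch D c b)" "snd (pch D c b) (PT D c x (rep b a)) = (x, a)"
    using PT_self[OF D c x b] by (simp_all add: nrm_rep b)
  then show ?thesis using pch_inj[OF D c b] unfolding chart_inv_def by (metis inv_into_f_f)
qed

text \<open>The common source of smoothness: the transition maps of the bundle, the projection from
  the cotractor bundle and \<open>iota\<close> are all instances with different
  \<open>w\<close>.\<close>

lemma proj_param:
  assumes D: "D \<in> P" "E \<in> P" and c: "c \<in> A" and d: "d \<in> A" and b: "b \<in> Basis"
    and Z: "open Z" and f: "smooth_on Z f" "f ` Z \<subseteq> chart_image c" and w: "smooth_on Z w"
  shows "open {z \<in> Z. PT D c (f z) (w z) \<in> fst (pch E d b)}" (is "open ?Z'")
    and "smooth_on {z \<in> Z. PT D c (f z) (w z) \<in> fst (pch E d b)} (\<lambda>z. snd (pch E d b) (PT D c (f z) (w z)))"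
proof -
  define Z1 where "Z1 = f -` overlap c d \<inter> Z"
  define h where "h z = ctr D c E d (chart_inv c (f z)) (w z)" for z
  have Z1: "open Z1"
    unfolding Z1_def by (subst Int_commute) (rule continuous_open_preimage[OF smooth_on_continuous[OF f(1)] Z open_overlap[OF c d]])
  have h: "smooth_on Z1 h"
    unfolding h_def by (rule smooth_ctr[OF D c d Z1])
      (auto simp: Z1_def intro: smooth_on_subset[OF f(1)] smooth_on_subset[OF w])
  have Z': "?Z' = {z \<in> Z1. h z \<bullet> b \<noteq> 0}"
  proof (rule Collect_cong)
    fix z show "z \<in> Z \<and> PT D c (f z) (w z) \<in> fst (pch E d b) \<longleftrightarrow> z \<in> Z1 \<and> h z \<bullet> b \<noteq> 0"
      using PT_dom_iff[OF D c d, of "f z" "w z" b] f(2) by (cases "z \<in> Z") (simp_all add: Z1_def h_def image_subset_iff)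
  qed
  have "open (Z1 \<inter> (\<lambda>z. h z \<bullet> b) -` (- {0}))"
    by (rule continuous_open_preimage[OF _ Z1 open_nonzero_real])
      (intro smooth_on_continuous smooth_on_inner[OF Z1] h smooth_on_const)
  moreover have "Z1 \<inter> (\<lambda>z. h z \<bullet> b) -` (- {0}) = ?Z'" unfolding Z' by auto
  ultimately show oZ': "open ?Z'" by simp
  have sub: "?Z' \<subseteq> Z1" unfolding Z' by auto
  have "smooth_on ?Z' (\<lambda>z. (transition c d (f z), nrm b (h z)))"
  proof (rule smooth_on_Pair[OF oZ'])
    show "smooth_on ?Z' (\<lambda>z. transition c d (f z))"
      by (rule smooth_on_compose[OF oZ' open_overlap[OF c d] _ smooth_transition[OF c d]])
        (use sub in \<open>auto simp: Z1_def intro: smooth_on_subset[OF f(1)]\<close>)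
    show "smooth_on ?Z' (\<lambda>z. nrm b (h z))"
      by (rule smooth_nrm[OF oZ' smooth_on_subset[OF h sub]]) (auto simp: Z')
  qed
  then show "smooth_on ?Z' (\<lambda>z. snd (pch E d b) (PT D c (f z) (w z)))"
    by (subst smooth_on_cong[OF oZ', where g = "\<lambda>z. (transition c d (f z), nrm b (h z))"])
      (use PT_coords[OF D c d _ b] f(2) in \<open>simp_all add: h_def image_subset_iff\<close>)
qed

lemma pch_overlap:
  assumes D: "D \<in> P" and c: "c \<in> A" and b: "b \<in> Basis"
  shows "snd (pch D c b) ` (fst (pch D c b) \<inter> W)
    = {z \<in> chart_image c \<times> UNIV. PT D c (fst z) (rep b (snd z)) \<in> W}"
proof (intro set_eqI iffI)
  fix z assume "z \<in> snd (pch D c b) ` (fst (pch D c b) \<inter> W)"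
  then obtain m where "m \<in> fst (pch D c b)" "m \<in> W" "z = snd (pch D c b) m" by auto
  then show "z \<in> {z \<in> chart_image c \<times> UNIV. PT D c (fst z) (rep b (snd z)) \<in> W}"
    using pch_inverse[OF D c b] by (simp add: mem_Times_iff)
next
  fix z assume z: "z \<in> {z \<in> chart_image c \<times> UNIV. PT D c (fst z) (rep b (snd z)) \<in> W}"
  then have x: "fst z \<in> chart_image c" by auto
  have "rep b (snd z) \<bullet> b \<noteq> 0" using rep_inner[OF b] by simp
  then have "PT D c (fst z) (rep b (snd z)) \<in> fst (pch D c b)"
    "snd (pch D c b) (PT D c (fst z) (rep b (snd z))) = z"
    using PT_self[OF D c x b] by (simp_all add: nrm_rep b)
  then show "z \<in> snd (pch D c b) ` (fst (pch D c b) \<inter> W)" using z by (metis (mono_tags, lifting) IntI imageI mem_Collect_eq)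
qed

lemma PAt_iff: "e \<in> PAt \<longleftrightarrow> (\<exists>D\<in>P. \<exists>c\<in>A. \<exists>b\<in>Basis. e = pch D c b)"
  by (auto simp: proj_atlas_def)

lemma smooth_atlas_PAt: "smooth_atlas PAt"
  unfolding smooth_atlas_def
proof (intro conjI ballI)
  fix e assume "e \<in> PAt"
  then obtain D c b where e: "D \<in> P" "c \<in> A" "b \<in> Basis" "e = pch D c b" by (auto simp: PAt_iff)
  show "inj_on (snd e) (fst e)" "open (chart_image e)"
    using e by (auto simp: pch_inj pch_image open_Times open_chart_image)
  fix e' assume "e' \<in> PAt"
  then obtain E d b' where e': "E \<in> P" "d \<in> A" "b' \<in> Basis" "e' = pch E d b'" by (auto simp: PAt_iff)
  have Z: "open (chart_image c \<times> (UNIV :: (real^'n) set))"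
    using e by (simp add: open_Times open_chart_image)
  note pp = proj_param[OF e(1) e'(1) e(2) e'(2,3) Z, of fst "\<lambda>z. rep b (snd z)",
      OF smooth_on_fst[OF Z smooth_on_ident] _ smooth_rep[OF Z smooth_on_snd[OF Z smooth_on_ident]]]
  show o: "open (snd e ` (fst e \<inter> fst e'))"
    unfolding e(4) e'(4) pch_overlap[OF e(1-3)] using pp(1) by auto
  show "smooth_on (snd e ` (fst e \<inter> fst e')) (transition e e')"
    using o unfolding e(4) e'(4) pch_overlap[OF e(1-3)]
    by (subst smooth_on_cong[where g = "\<lambda>z. snd (pch E d b') (PT D c (fst z) (rep b (snd z)))"])
      (use pp(2) pch_inv[OF e(1-3)] in \<open>auto simp: transition_def\<close>)
qed

sublocale PA: atlas PAt
  by unfold_locales (rule smooth_atlas_PAt)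

lemma points_PAt: "points PAt = proj_cotractor A P"
proof (intro set_eqI iffI)
  fix m assume "m \<in> points PAt"
  then obtain e where "e \<in> PAt" "m \<in> fst e" unfolding points_def by blast
  then obtain D c b where e: "D \<in> P" "c \<in> A" "b \<in> Basis" "m \<in> fst (pch D c b)"
    unfolding PAt_iff by blast
  then obtain p U where U: "m = proj (p, U)" "p \<in> fst c" "U \<in> cotractor_fibre A P p" "U D c \<bullet> b \<noteq> 0"
    unfolding pch_dom by blast
  then have "nonzero U" unfolding nonzero_def by (metis inner_zero_left)
  then show "m \<in> proj_cotractor A P"
    unfolding proj_cotractor_def using U e by (auto simp: points_def)
next
  fix m assume "m \<in> proj_cotractor A P"
  then obtain p U c where U: "m = proj (p, U)" "c \<in> A" "p \<in> fst c" "U \<in> cotractor_fibre A P p" "nonzero U"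
    unfolding proj_cotractor_def points_def by blast
  obtain D where D: "D \<in> P" using P_nonempty by blast
  have "U D c \<noteq> 0" using nonzero_iff U D by blast
  then obtain b where b: "b \<in> Basis" "U D c \<bullet> b \<noteq> 0" using euclidean_all_zero_iff by blast
  then have "m \<in> fst (pch D c b)" using U pch_dom_iff by blast
  moreover have "pch D c b \<in> PAt" unfolding PAt_iff using D U(2) b(1) by blast
  ultimately show "m \<in> points PAt" unfolding points_def by blast
qed

section \<open>The complement of the zero locus\<close>

definition MZ :: "('a, real^'n) proj_point set" where "MZ = proj_cotractor A P - zero_locus A P"

lemma MZ_iff:
  assumes D: "D \<in> P" and c: "c \<in> A" "p \<in> fst c" and U: "U \<in> cotractor_fibre A P p"
  shows "proj (p, U) \<in> MZ \<longleftrightarrow> fst (U D c) \<noteq> 0"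
proof
  assume M: "proj (p, U) \<in> MZ"
  then obtain q V where V: "proj (p, U) = proj (q, V)" "V \<in> cotractor_fibre A P q" "nonzero V"
    unfolding MZ_def proj_cotractor_def by blast
  then have "p = q" and "\<exists>r. \<forall>D c. V D c = r *\<^sub>R U D c" using proj_eqD[OF V(1)[symmetric]] by auto
  \<comment> \<open>Membership only provides some non-zero representative \<open>V\<close>; being a
    multiple of \<open>U\<close>, it forces the given \<open>U\<close> to be non-zero as
    well.\<close>
  then have nU: "nonzero U" using V(3) unfolding nonzero_def by (metis scaleR_zero_right)
  show "fst (U D c) \<noteq> 0"
  proof
    assume "fst (U D c) = 0"
    then have "tau P U = (\<lambda>c. 0)" using tau_zero_iff[OF U D c] by simp
    then have "proj (p, U) \<in> zero_locus A P"
      unfolding zero_locus_def using nU U c by (auto simp: points_def)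
    then show False using M by (simp add: MZ_def)
  qed
next
  assume nz: "fst (U D c) \<noteq> 0"
  then have "nonzero U" using nonzero_iff[OF U D c] by auto
  then have 1: "proj (p, U) \<in> proj_cotractor A P"
    unfolding proj_cotractor_def using U c by (auto simp: points_def)
  have "proj (p, U) \<notin> zero_locus A P"
  proof
    assume "proj (p, U) \<in> zero_locus A P"
    then obtain q V where V: "proj (p, U) = proj (q, V)" "V \<in> cotractor_fibre A P q" "tau P V = (\<lambda>c. 0)"
      unfolding zero_locus_def by blast
    then have q: "p = q" and "\<exists>r. \<forall>D c. U D c = r *\<^sub>R V D c" using proj_eqD[OF V(1)] by auto
    then obtain r where r: "\<And>D c. U D c = r *\<^sub>R V D c" by blast
    have "fst (V D c) = 0" using tau_zero_iff[of V p D c] V q D c by simp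
    then show False using nz r by simp
  qed
  then show "proj (p, U) \<in> MZ" using 1 by (simp add: MZ_def)
qed

text \<open>Non-vanishing of the first slot is the domain condition of the chart with
  \<open>b = (1, 0)\<close>. The part of any chart outside the zero locus is therefore an overlap of
  two charts, where a transition map is available.\<close>

lemma MZ_chart:
  assumes D: "D \<in> P" and c: "c \<in> A"
  shows "fst (pch D c b) \<inter> MZ = fst (pch D c b) \<inter> fst (pch D c (1, 0))"
proof -
  have "m \<in> MZ \<longleftrightarrow> m \<in> fst (pch D c (1, 0))" if m: "m \<in> fst (pch D c b)" for m
  proof -
    obtain p U where U: "m = proj (p, U)" "p \<in> fst c" "U \<in> cotractor_fibre A P p"
      using m unfolding pch_dom by blast
    show ?thesis
      unfolding U(1) MZ_iff[OF D c U(2,3)] pch_dom_iff[OF U(3)] using U(2) by (simp add: inner_prod_def)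
  qed
  then show ?thesis by blast
qed

lemma MZ_sub: "MZ \<subseteq> points PAt" by (auto simp: points_PAt MZ_def)

lemma MZ_cover:
  assumes "m \<in> MZ"
  obtains c p U where "c \<in> A" "p \<in> fst c" "m = proj (p, U)" "U \<in> cotractor_fibre A P p"
  using assms unfolding MZ_def proj_cotractor_def points_def by blast

lemma MZ_in_chart:
  assumes D: "D \<in> P" and c: "c \<in> A" and m: "m \<in> MZ" "fst m \<in> fst c"
  shows "m \<in> fst (pch D c (1, 0))"
proof -
  obtain d p U where U: "d \<in> A" "p \<in> fst d" "m = proj (p, U)" "U \<in> cotractor_fibre A P p"
    using MZ_cover[OF m(1)] .
  have p: "p \<in> fst c" using m(2) U by (simp add: proj_Pair)
  show ?thesis
    using m(1) p unfolding U(3) pch_dom_iff[OF U(4)] MZ_iff[OF D c p U(4)] by (simp add: inner_prod_def)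
qed

lemma pch_infinity_MZ:
  assumes D: "D \<in> P" and c: "c \<in> A"
  shows "fst (pch D c (1, 0)) = {m \<in> MZ. fst m \<in> fst c}"
proof -
  have "m \<in> MZ \<and> fst m \<in> fst c" if m: "m \<in> fst (pch D c (1, 0))" for m
    using MZ_chart[OF D c, of "(1, 0)"] m unfolding pch_dom by (auto simp: proj_Pair)
  then show ?thesis using MZ_in_chart[OF D c] by blast
qed

lemma openin_MZ: "openin (atlas_topology PAt) MZ"
  unfolding PA.openin_atlas_topology
proof (intro conjI ballI MZ_sub)
  fix e assume "e \<in> PAt"
  then obtain D c b where e: "D \<in> P" "c \<in> A" "b \<in> Basis" "e = pch D c b" by (auto simp: PAt_iff)
  have "pch D c (1, 0) \<in> PAt" using e infinity_Basis by (auto simp: PAt_iff)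
  then have "open (overlap e (pch D c (1, 0)))" using \<open>e \<in> PAt\<close> by (rule PA.open_overlap[rotated])
  then show "open (snd e ` (MZ \<inter> fst e))"
    using MZ_chart[OF e(1,2), of b] by (simp add: overlap_def e(4) Int_commute)
qed

end

section \<open>Invariance of the tractor connection\<close>

locale smooth_conn =
  fixes S :: "'e::euclidean_space set" and \<Gamma> :: "'e \<Rightarrow> 'e \<Rightarrow> 'e \<Rightarrow> 'e"
  assumes open_S: "open S" and bil: "x \<in> S \<Longrightarrow> bilinear (\<Gamma> x)"
    and smooth: "smooth_on S (\<lambda>x. \<Gamma> x u v)" and sym: "x \<in> S \<Longrightarrow> \<Gamma> x u v = \<Gamma> x v u"
begin

lemmas lin = bilinear_linear[OF bil]

lemma diff: "x \<in> S \<Longrightarrow> (\<lambda>y. \<Gamma> y u v) differentiable at x"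
  using smooth_on_differentiable[OF smooth] .

lemma smooth_ricci: "smooth_on S (\<lambda>x. ricci \<Gamma> x u v)"
  unfolding ricci_def
  by (intro smooth_on_sum[OF open_S] smooth_on_inner[OF open_S] smooth_on_add[OF open_S] smooth_on_diff[OF open_S]
      smooth_on_deriv smooth smooth_on_const smooth_on_bilinear_param[OF open_S, where B = \<Gamma>] bil)

lemma bilinear_ricci:
  assumes x: "x \<in> S" shows "bilinear (ricci \<Gamma> x)"
proof -
  have d1: "linear (\<lambda>u. frechet_derivative (\<lambda>y. \<Gamma> y u v) (at x) k)" for v k
    by (rule linear_frechet_param[OF open_S x, of "\<lambda>y u. \<Gamma> y u v"]) (auto intro: lin diff x)
  have d2: "linear (\<lambda>v. frechet_derivative (\<lambda>y. \<Gamma> y u v) (at x) k)" for u k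
    by (rule linear_frechet_param[OF open_S x, of "\<lambda>y v. \<Gamma> y u v"]) (auto intro: lin diff x)
  have d3: "linear (frechet_derivative (\<lambda>y. \<Gamma> y u v) (at x))" for u v
    by (rule linear_frechet_derivative[OF diff[OF x]])
  show ?thesis
    unfolding bilinear_def ricci_def
    by (auto intro!: linearI simp: linear_add[OF d1] linear_add[OF d2] linear_add[OF d3]
        linear_scale[OF d1] linear_scale[OF d2] linear_scale[OF d3]
        linear_add[OF lin(1)[OF x]] linear_add[OF lin(2)[OF x]]
        linear_scale[OF lin(1)[OF x]] linear_scale[OF lin(2)[OF x]]
        inner_add_left inner_diff_left sum.distrib sum_subtractf sum_distrib_left algebra_simps)
qed

lemmas linR = bilinear_linear[OF bilinear_ricci]

lemma bilinear_schouten: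
  assumes x: "x \<in> S" shows "bilinear (schouten \<Gamma> x)"
  unfolding bilinear_def schouten_def
  by (auto intro!: linearI simp: linear_add[OF linR(1)[OF x]] linear_add[OF linR(2)[OF x]]
        linear_scale[OF linR(1)[OF x]] linear_scale[OF linR(2)[OF x]] add_divide_distrib
        diff_divide_distrib distrib_left right_diff_distrib)

lemma smooth_schouten: "smooth_on S (\<lambda>x. schouten \<Gamma> x u v)"
  unfolding schouten_def
  by (intro smooth_on_add[OF open_S] smooth_on_mult[OF open_S] smooth_on_const smooth_on_divide[OF open_S]
      smooth_on_diff[OF open_S] smooth_ricci)

text \<open>Pairing with an arbitrary vector instead of basis vectors allows Jacobians to be
  inserted later.\<close>

lemma tractor_deriv_snd:
  assumes x: "x \<in> S"
  shows "snd (tractor_deriv \<Gamma> s x v) \<bullet> z = frechet_derivative (\<lambda>y. snd (s y)) (at x) v \<bullet> z - snd (s x) \<bullet> \<Gamma> x v z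
    + weight_one_form \<Gamma> x v * (snd (s x) \<bullet> z) + schouten \<Gamma> x v z * fst (s x)"
proof -
  have 1: "linear (\<lambda>j. frechet_derivative (\<lambda>y. snd (s y)) (at x) v \<bullet> j - snd (s x) \<bullet> \<Gamma> x v j
      + weight_one_form \<Gamma> x v * (snd (s x) \<bullet> j))"
    by (auto intro!: linearI simp: linear_add[OF lin(1)[OF x]] linear_scale[OF lin(1)[OF x]] inner_add_right algebra_simps)
  have 2: "linear (\<lambda>j. schouten \<Gamma> x v j * fst (s x))"
    using bilinear_linear(1)[OF bilinear_schouten[OF x]]
    by (auto intro!: linearI simp: linear_add linear_scale algebra_simps)
  show ?thesis
    unfolding tractor_deriv_def weighted_covector_deriv_def snd_conv inner_add_left riesz_sum[OF 1] riesz_sum[OF 2] ..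
qed

lemma tractor_deriv_fst:
  "fst (tractor_deriv \<Gamma> s x v) = frechet_derivative (\<lambda>y. fst (s y)) (at x) v + weight_one_form \<Gamma> x v * fst (s x)
    - snd (s x) \<bullet> v"
  by (simp add: tractor_deriv_def density_deriv_def)

text \<open>\<open>nab\<close> is the covariant derivative of the one-form. Each summand of the
  trace is first put in the form of contractions over \<open>k\<close>; the mixed terms in
  \<open>\<Upsilon>\<close> and \<open>\<Gamma>\<close> then cancel except for those that complete
  the derivatives of \<open>\<Upsilon>\<close> to \<open>nab\<close>.\<close>

lemma ricci_projective_change:
  assumes x: "x \<in> S" and U: "smooth_on S \<Upsilon>"
    and G': "\<And>y u v. y \<in> S \<Longrightarrow> \<Gamma>' y u v = \<Gamma> y u v + (\<Upsilon> y \<bullet> u) *\<^sub>R v + (\<Upsilon> y \<bullet> v) *\<^sub>R u"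
  defines "nab \<equiv> \<lambda>u v. frechet_derivative \<Upsilon> (at x) u \<bullet> v - \<Upsilon> x \<bullet> \<Gamma> x u v"
  shows "ricci \<Gamma>' x u v = ricci \<Gamma> x u v + nab v u - real DIM('e) * nab u v
    + (real DIM('e) - 1) * ((\<Upsilon> x \<bullet> u) * (\<Upsilon> x \<bullet> v))"
proof -
  define n where "n = real DIM('e)"
  define a where "a = \<Upsilon> x"
  define dU where "dU = frechet_derivative \<Upsilon> (at x)"
  define dG where "dG h u v = frechet_derivative (\<lambda>y. \<Gamma> y u v) (at x) h" for h u v
  define t where "t w = (\<Sum>k\<in>Basis. \<Gamma> x w k \<bullet> k)" for w
  have dGsym: "dG h u v = dG h v u" for h u v
    unfolding dG_def by (rule fun_cong[OF frechet_derivative_cong_open[OF open_S x]]) (rule sym)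
  have linU: "linear dU"
    unfolding dU_def by (rule linear_frechet_derivative[OF smooth_on_differentiable[OF U x]])
  have Ud: "(\<Upsilon> has_derivative dU) (at x)"
    unfolding dU_def by (rule smooth_on_has_derivative[OF U x])
  have d: "frechet_derivative (\<lambda>y. \<Gamma>' y u v) (at x) h = dG h u v + (dU h \<bullet> u) *\<^sub>R v + (dU h \<bullet> v) *\<^sub>R u" for u v h
  proof -
    have "((\<lambda>y. \<Gamma> y u v + (\<Upsilon> y \<bullet> u) *\<^sub>R v + (\<Upsilon> y \<bullet> v) *\<^sub>R u) has_derivative
        (\<lambda>h. dG h u v + (dU h \<bullet> u) *\<^sub>R v + (dU h \<bullet> v) *\<^sub>R u)) (at x)"
      unfolding dG_def
      by (intro has_derivative_add has_derivative_scaleR_left has_derivative_inner_left Ud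
          smooth_on_has_derivative[OF smooth x])
    then have "((\<lambda>y. \<Gamma>' y u v) has_derivative
        (\<lambda>h. dG h u v + (dU h \<bullet> u) *\<^sub>R v + (dU h \<bullet> v) *\<^sub>R u)) (at x)"
      by (rule has_derivative_transform_within_open[OF _ open_S x]) (simp add: G')
    from frechet_derivative_eqI[OF this] show ?thesis by simp
  qed
  have G'x: "\<Gamma>' x u v = \<Gamma> x u v + (a \<bullet> u) *\<^sub>R v + (a \<bullet> v) *\<^sub>R u" for u v
    using G'[OF x] by (simp add: a_def)
  have summand: "(frechet_derivative (\<lambda>y. \<Gamma>' y u v) (at x) k - frechet_derivative (\<lambda>y. \<Gamma>' y k v) (at x) u
      + \<Gamma>' x k (\<Gamma>' x u v) - \<Gamma>' x u (\<Gamma>' x k v)) \<bullet> k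
    = (dG k u v - dG u k v + \<Gamma> x k (\<Gamma> x u v) - \<Gamma> x u (\<Gamma> x k v)) \<bullet> k
      + (v \<bullet> k) * (dU k \<bullet> u) + (u \<bullet> k) * (dU k \<bullet> v) - (dU u \<bullet> k) * (v \<bullet> k) - (k \<bullet> k) * (dU u \<bullet> v)
      + (a \<bullet> u) * (\<Gamma> x v k \<bullet> k) + (a \<bullet> v) * (\<Gamma> x u k \<bullet> k)
      + (a \<bullet> k) * (\<Gamma> x u v \<bullet> k) + (a \<bullet> u) * ((a \<bullet> k) * (v \<bullet> k)) + (a \<bullet> v) * ((a \<bullet> k) * (u \<bullet> k))
      + (k \<bullet> k) * (a \<bullet> \<Gamma> x u v + 2 * ((a \<bullet> u) * (a \<bullet> v)))
      - (a \<bullet> k) * (\<Gamma> x u v \<bullet> k) - (a \<bullet> v) * (\<Gamma> x u k \<bullet> k)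
      - (a \<bullet> u) * (\<Gamma> x v k \<bullet> k) - (a \<bullet> u) * ((a \<bullet> k) * (v \<bullet> k)) - (k \<bullet> k) * ((a \<bullet> u) * (a \<bullet> v))
      - (u \<bullet> k) * (a \<bullet> \<Gamma> x v k) - (2 * (a \<bullet> v)) * ((a \<bullet> k) * (u \<bullet> k))" for k
    unfolding d G'x
    by (simp add: linear_add[OF lin(1)[OF x]] linear_scale[OF lin(1)[OF x]] linear_add[OF lin(2)[OF x]]
        linear_scale[OF lin(2)[OF x]] inner_add_left inner_diff_left inner_add_right
        sym[OF x, of k v] sym[OF x, of k u] algebra_simps)
  have nsum: "(\<Sum>k\<in>(Basis::'e set). (k \<bullet> k) * c) = n * c" for c :: real
    by (simp add: n_def)
  have lu: "linear (\<lambda>k. dU k \<bullet> w)" for w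
    using linU by (auto intro!: linearI simp: linear_add linear_scale inner_add_left)
  have la: "linear (\<lambda>k. a \<bullet> \<Gamma> x w k)" for w
    using lin(1)[OF x] by (auto intro!: linearI simp: linear_add linear_scale inner_add_right)
  have "ricci \<Gamma>' x u v = ricci \<Gamma> x u v + dU v \<bullet> u + dU u \<bullet> v - dU u \<bullet> v - n * (dU u \<bullet> v)
     + (a \<bullet> u) * t v + (a \<bullet> v) * t u + a \<bullet> \<Gamma> x u v + (a \<bullet> u) * (a \<bullet> v) + (a \<bullet> v) * (a \<bullet> u)
     + n * (a \<bullet> \<Gamma> x u v + 2 * ((a \<bullet> u) * (a \<bullet> v))) - a \<bullet> \<Gamma> x u v - (a \<bullet> v) * t u - (a \<bullet> u) * t v
     - (a \<bullet> u) * (a \<bullet> v) - n * ((a \<bullet> u) * (a \<bullet> v)) - a \<bullet> \<Gamma> x v u - 2 * (a \<bullet> v) * (a \<bullet> u)"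
    unfolding ricci_def summand
    by (simp only: sum.distrib sum_subtractf sum_distrib_left[symmetric] contract_Basis(2)[OF lu]
        contract_Basis(2)[OF la] sum_Basis_inner nsum dG_def[symmetric] t_def[symmetric])
  then show ?thesis
    by (simp add: nab_def a_def[symmetric] dU_def[symmetric] n_def[symmetric] sym[OF x, of v u] algebra_simps)
qed

text \<open>The normalisation of the Schouten tensor is tuned to this: the symmetric part of the
  Ricci tensor changes by a multiple of n - 1 and the antisymmetric part by a multiple of n + 1, so
  that the resulting change is free of n.\<close>

lemma schouten_projective_change:
  assumes x: "x \<in> S" and U: "smooth_on S \<Upsilon>"
    and G': "\<And>y u v. y \<in> S \<Longrightarrow> \<Gamma>' y u v = \<Gamma> y u v + (\<Upsilon> y \<bullet> u) *\<^sub>R v + (\<Upsilon> y \<bullet> v) *\<^sub>R u"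
    and n: "DIM('e) \<ge> 2"
  shows "schouten \<Gamma>' x u v = schouten \<Gamma> x u v
    - (frechet_derivative \<Upsilon> (at x) u \<bullet> v - \<Upsilon> x \<bullet> \<Gamma> x u v) + (\<Upsilon> x \<bullet> u) * (\<Upsilon> x \<bullet> v)"
proof -
  define n where "n = real DIM('e)"
  define p q r where "p = frechet_derivative \<Upsilon> (at x) u \<bullet> v - \<Upsilon> x \<bullet> \<Gamma> x u v"
    and "q = frechet_derivative \<Upsilon> (at x) v \<bullet> u - \<Upsilon> x \<bullet> \<Gamma> x v u" and "r = (\<Upsilon> x \<bullet> u) * (\<Upsilon> x \<bullet> v)"
  have R: "ricci \<Gamma>' x u v = ricci \<Gamma> x u v + q - n * p + (n - 1) * r"
    "ricci \<Gamma>' x v u = ricci \<Gamma> x v u + p - n * q + (n - 1) * r"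
    using ricci_projective_change[OF x U G', of u v] ricci_projective_change[OF x U G', of v u]
    by (simp_all add: n_def p_def q_def r_def)
  have nn: "n - 1 \<noteq> 0" "n + 1 \<noteq> 0" using n by (auto simp: n_def)
  have "ricci \<Gamma>' x u v + ricci \<Gamma>' x v u = ricci \<Gamma> x u v + ricci \<Gamma> x v u + (n - 1) * (2 * r - p - q)"
    "ricci \<Gamma>' x u v - ricci \<Gamma>' x v u = ricci \<Gamma> x u v - ricci \<Gamma> x v u + (n + 1) * (q - p)"
    unfolding R by (simp_all add: algebra_simps)
  then have "schouten \<Gamma>' x u v = schouten \<Gamma> x u v + (2 * r - p - q) / 2 + (q - p) / 2"
    unfolding schouten_def n_def[symmetric] using nn by (simp add: add_divide_distrib distrib_left)
  then show ?thesis by (simp add: p_def[symmetric] r_def[symmetric] field_simps)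
qed

end

context projective
begin

lemma smooth_conn:
  assumes D: "D \<in> P" and c: "c \<in> A" shows "smooth_conn (chart_image c) (D c)"
proof
  show "open (chart_image c)" by (rule open_chart_image[OF c])
  show "bilinear (D c x)" if "x \<in> chart_image c" for x
    using P_affine[OF D] c that unfolding affine_connection_def by blast
  show "smooth_on (chart_image c) (\<lambda>x. D c x u v)" for u v
    using P_affine[OF D] c unfolding affine_connection_def by blast
  show "D c x u v = D c x v u" if "x \<in> chart_image c" for x u v
    using P_torsion[OF D] c that unfolding torsion_free_def by blast
qed

lemma conn_law:
  assumes D: "D \<in> P" and c: "c \<in> A" "d \<in> A" and y: "y \<in> overlap c d"
  shows "D d (transition c d y) (frechet_derivative (transition c d) (at y) u) (frechet_derivative (transition c d) (at y) v)
    = frechet_derivative (transition c d) (at y) (D c y u v)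
      - frechet_derivative (\<lambda>z. frechet_derivative (transition c d) (at z) v) (at y) u"
proof -
  have x: "y \<in> chart_image c" "chart_inv c y \<in> fst d" using y overlap_iff[OF c(1)] by auto
  have "\<forall>p \<in> fst c \<inter> fst d. \<forall>u v.
        D d (snd d p) (dtransition c d p u) (dtransition c d p v) =
        dtransition c d p (D c (snd c p) u v) -
        frechet_derivative (\<lambda>y. frechet_derivative (transition c d) (at y) v) (at (snd c p)) u"
    using P_affine[OF D] c unfolding affine_connection_def by blast
  from this[rule_format, of "chart_inv c y" u v] show ?thesis
    using x by (simp add: chart_inv_in dtransition_def snd_chart_inv transition_def)
qed

text \<open>The trace of the connection changes by (n+1) times \<open>\<Upsilon>\<close>, hence the
  weight form by \<open>\<Upsilon>\<close>. The derivative of \<open>\<Upsilon>\<close> that comes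
  from the shifted second slot is compensated by the change of the Schouten tensor. The new second
  slot of the derivative is then the old one plus \<open>\<Upsilon>\<close> times the old first
  slot, and both vanish.\<close>

lemma tractor_zero_conn:
  assumes D: "D \<in> P" "E \<in> P" and c: "c \<in> A" and x: "x \<in> chart_image c"
    and W: "open W" "x \<in> W" "W \<subseteq> chart_image c"
    and f: "f differentiable at x"
    and g: "\<And>y. y \<in> W \<Longrightarrow> g y = (fst (f y), snd (f y) + fst (f y) *\<^sub>R ups D E (chart_inv c y) c)"
    and z: "tractor_deriv (D c) f x v = 0"
  shows "tractor_deriv (E c) g x v = 0"
proof -
  interpret D: smooth_conn "chart_image c" "D c" by (rule smooth_conn[OF D(1) c])
  interpret E: smooth_conn "chart_image c" "E c" by (rule smooth_conn[OF D(2) c])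
  define n where "n = real CARD('n)"
  define \<Upsilon> where "\<Upsilon> y = ups D E (chart_inv c y) c" for y
  have Us: "smooth_on (chart_image c) \<Upsilon>" unfolding \<Upsilon>_def by (rule smooth_ups[OF D c])
  have G': "E c y u v = D c y u v + (\<Upsilon> y \<bullet> u) *\<^sub>R v + (\<Upsilon> y \<bullet> v) *\<^sub>R u" if "y \<in> chart_image c" for y u v
    unfolding \<Upsilon>_def by (rule ups_eq[OF D c that])
  let ?f' = "frechet_derivative f (at x)" and ?dU = "frechet_derivative \<Upsilon> (at x)"
  note fd = has_derivative_frechet[OF f]
  have ff: "((\<lambda>y. fst (f y)) has_derivative (\<lambda>h. fst (?f' h))) (at x)"
    "((\<lambda>y. snd (f y)) has_derivative (\<lambda>h. snd (?f' h))) (at x)"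
    by (intro has_derivative_fst has_derivative_snd fd)+
  have g1: "((\<lambda>y. fst (g y)) has_derivative (\<lambda>h. fst (?f' h))) (at x)"
    by (rule has_derivative_transform_within_open[OF ff(1) W(1,2)]) (simp add: g)
  have "((\<lambda>y. snd (f y) + fst (f y) *\<^sub>R \<Upsilon> y) has_derivative
     (\<lambda>h. snd (?f' h) + (fst (f x) *\<^sub>R ?dU h + fst (?f' h) *\<^sub>R \<Upsilon> x))) (at x)"
    by (intro has_derivative_add ff has_derivative_scaleR smooth_on_has_derivative[OF Us x])
  then have g2: "((\<lambda>y. snd (g y)) has_derivative
     (\<lambda>h. snd (?f' h) + (fst (f x) *\<^sub>R ?dU h + fst (?f' h) *\<^sub>R \<Upsilon> x))) (at x)"
    by (rule has_derivative_transform_within_open[OF _ W(1,2)]) (simp add: g \<Upsilon>_def)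
  have w: "weight_one_form (E c) x v = weight_one_form (D c) x v + \<Upsilon> x \<bullet> v"
  proof -
    have nz: "n + 1 \<noteq> 0" by (simp add: n_def)
    have "(\<Sum>k\<in>Basis. E c x v k \<bullet> k) = (\<Sum>k\<in>Basis. D c x v k \<bullet> k) + (n + 1) * (\<Upsilon> x \<bullet> v)"
      by (simp add: G'[OF x] inner_add_left sum.distrib sum_Basis_inner inner_commute[of v "\<Upsilon> x"] n_def algebra_simps)
    then show ?thesis
      unfolding weight_one_form_def using nz by (simp add: n_def add_divide_distrib)
  qed
  have sch: "schouten (E c) x v z = schouten (D c) x v z - (?dU v \<bullet> z - \<Upsilon> x \<bullet> D c x v z) + (\<Upsilon> x \<bullet> v) * (\<Upsilon> x \<bullet> z)" for z
    by (rule D.schouten_projective_change[OF x Us G']) (use dim2 in auto)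
  have gx: "g x = (fst (f x), snd (f x) + fst (f x) *\<^sub>R \<Upsilon> x)" using g[OF W(2)] by (simp add: \<Upsilon>_def)
  have top: "fst (?f' v) + weight_one_form (D c) x v * fst (f x) - snd (f x) \<bullet> v = 0"
    using arg_cong[OF z, of fst] unfolding D.tractor_deriv_fst frechet_derivative_eqI[OF ff(1)] by simp
  have bot: "snd (?f' v) \<bullet> z - snd (f x) \<bullet> D c x v z + weight_one_form (D c) x v * (snd (f x) \<bullet> z)
      + schouten (D c) x v z * fst (f x) = 0" for z
    using D.tractor_deriv_snd[OF x, of f v z] z unfolding frechet_derivative_eqI[OF ff(2)] by simp
  have "fst (tractor_deriv (E c) g x v) = 0"
    unfolding E.tractor_deriv_fst frechet_derivative_eqI[OF g1] w gx using top
    by (simp add: inner_add_left algebra_simps)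
  moreover have "snd (tractor_deriv (E c) g x v) \<bullet> z = 0" for z
  proof -
    have "snd (tractor_deriv (E c) g x v) \<bullet> z
      = (snd (?f' v) \<bullet> z - snd (f x) \<bullet> D c x v z + weight_one_form (D c) x v * (snd (f x) \<bullet> z)
        + schouten (D c) x v z * fst (f x))
        + (\<Upsilon> x \<bullet> z) * (fst (?f' v) + weight_one_form (D c) x v * fst (f x) - snd (f x) \<bullet> v)"
      unfolding E.tractor_deriv_snd[OF x] frechet_derivative_eqI[OF g2] w gx sch G'[OF x]
      by (simp add: inner_add_left inner_add_right algebra_simps)
    then show ?thesis using top bot by simp
  qed
  moreover from this have "snd (tractor_deriv (E c) g x v) = 0" by - (rule inner_eqI, simp)
  ultimately show ?thesis by (simp add: prod_eq_iff)
qed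

text \<open>By Jacobi's formula the derivative of the weight contributes the trace \<open>t\<close>
  divided by n + 1, and the trace of the Christoffel symbols loses \<open>t\<close> under the law of
  the connection, so the two cancel. In the second slot the derivative of the Jacobian cancels the
  inhomogeneous term of that law.\<close>

lemma tractor_zero_chart:
  assumes E: "E \<in> P" and c: "c \<in> A" "d \<in> A" and x: "x \<in> overlap c d"
    and f: "f differentiable at x" and g: "g differentiable at (transition c d x)"
    and W: "open W" "x \<in> W" "W \<subseteq> overlap c d"
    and gf: "\<And>y. y \<in> W \<Longrightarrow> fst (g (transition c d y)) = weight_one c d (chart_inv c y) * fst (f y)"
      "\<And>y u. y \<in> W \<Longrightarrow> snd (g (transition c d y)) \<bullet> frechet_derivative (transition c d) (at y) u
        = weight_one c d (chart_inv c y) * (snd (f y) \<bullet> u)"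
    and z: "tractor_deriv (E c) f x v = 0"
  shows "tractor_deriv (E d) g (transition c d x) (frechet_derivative (transition c d) (at x) v) = 0"
proof -
  interpret C: smooth_conn "chart_image c" "E c" by (rule smooth_conn[OF E c(1)])
  interpret D: smooth_conn "chart_image d" "E d" by (rule smooth_conn[OF E c(2)])
  interpret cc: coord_change "overlap c d" "overlap d c" "transition c d" "transition d c"
    by (rule coord_change[OF c])
  let ?\<phi> = "transition c d" and ?K = "cc.K (transition c d x)"
  have xc: "x \<in> chart_image c" and yd: "?\<phi> x \<in> chart_image d"
    by (rule subsetD[OF overlap_subset x], rule subsetD[OF overlap_subset cc.phi_in[OF x]])
  define n where "n = real CARD('n)"
  define w where "w y = weight_one c d (chart_inv c y)" for y
  define t where "t = (\<Sum>k\<in>Basis. ?K (cc.D2 x v k) \<bullet> k)"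
  let ?f' = "frechet_derivative f (at x)" and ?g' = "frechet_derivative g (at (?\<phi> x))"
  have wd: "(w has_derivative (\<lambda>h. w x * (\<Sum>k\<in>Basis. ?K (cc.D2 x h k) \<bullet> k) / (n + 1))) (at x)"
  proof -
    have dd: "((\<lambda>y. det (matrix (cc.J y))) has_derivative
        (\<lambda>h. det (matrix (cc.J x)) * (\<Sum>k\<in>Basis. ?K (cc.D2 x h k) \<bullet> k))) (at x)"
      by (rule has_derivative_det[OF cc.open_S x cc.linear_J cc.J_has_derivative[OF x] cc.linear_K[OF cc.phi_in[OF x]]])
        (simp_all add: cc.K_J cc.J_K x)
    have nz: "det (matrix (cc.J x)) \<noteq> 0"
      using jacobian_det_nonzero[OF c, of "chart_inv c x"] x overlap_iff[OF c(1), of x d]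
      by (simp add: jacobian_det_eq dtransition_def chart_inv_in snd_chart_inv)
    have "((\<lambda>y. \<bar>det (matrix (cc.J y))\<bar> powr (1 / (n + 1))) has_derivative
        (\<lambda>h. (det (matrix (cc.J x)) * (\<Sum>k\<in>Basis. ?K (cc.D2 x h k) \<bullet> k)) *
          (1 / (n + 1) * (\<bar>det (matrix (cc.J x))\<bar> powr (1 / (n + 1)) * inverse (det (matrix (cc.J x))))))) (at x)"
      by (rule has_derivative_compose[OF dd has_derivative_abs_powr[OF nz]])
    moreover have "w y = \<bar>det (matrix (cc.J y))\<bar> powr (1 / (n + 1))" if "y \<in> overlap c d" for y
      unfolding w_def n_def by (rule weight_one_chart[OF c(1) that])
    ultimately have wd0: "(w has_derivative
        (\<lambda>h. (det (matrix (cc.J x)) * (\<Sum>k\<in>Basis. ?K (cc.D2 x h k) \<bullet> k)) *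
          (1 / (n + 1) * (w x * inverse (det (matrix (cc.J x))))))) (at x)"
      by (simp add: x has_derivative_cong_open[OF cc.open_S x, of w])
    have cancel: "(d * s) * (1 / N * (W * inverse d)) = W * s / N" if "d \<noteq> 0" for d s N W :: real
    proof -
      have "(d * s) * (1 / N * (W * inverse d)) = W * s / N * (d * inverse d)"
        by (simp add: divide_inverse mult_ac)
      then show ?thesis using that by simp
    qed
    show ?thesis by (rule has_derivative_eq_rhs[OF wd0], rule ext, rule cancel[OF nz])
  qed
  note fd = has_derivative_frechet[OF f] and gd = has_derivative_frechet[OF g]
  have f1: "((\<lambda>y. fst (f y)) has_derivative (\<lambda>h. fst (?f' h))) (at x)"
    and f2: "((\<lambda>y. snd (f y)) has_derivative (\<lambda>h. snd (?f' h))) (at x)"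
    and g1: "((\<lambda>y. fst (g y)) has_derivative (\<lambda>h. fst (?g' h))) (at (?\<phi> x))"
    and g2: "((\<lambda>y. snd (g y)) has_derivative (\<lambda>h. snd (?g' h))) (at (?\<phi> x))"
    by (intro has_derivative_fst has_derivative_snd fd gd)+
  have e1: "fst (?g' (cc.J x v)) = w x * fst (?f' v) + w x * t / (n + 1) * fst (f x)"
  proof -
    have 1: "((\<lambda>y. fst (g (?\<phi> y))) has_derivative (\<lambda>h. fst (?g' (cc.J x h)))) (at x)"
      by (rule has_derivative_compose[OF cc.J_deriv[OF x] g1])
    have "((\<lambda>y. w y * fst (f y)) has_derivative
       (\<lambda>h. w x * fst (?f' h) + w x * (\<Sum>k\<in>Basis. ?K (cc.D2 x h k) \<bullet> k) / (n + 1) * fst (f x))) (at x)"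
      by (rule has_derivative_mult[OF wd f1])
    then have "((\<lambda>y. fst (g (?\<phi> y))) has_derivative
       (\<lambda>h. w x * fst (?f' h) + w x * (\<Sum>k\<in>Basis. ?K (cc.D2 x h k) \<bullet> k) / (n + 1) * fst (f x))) (at x)"
      by (rule has_derivative_transform_within_open[OF _ W(1,2)]) (simp add: gf(1) w_def)
    from fun_cong[OF has_derivative_unique[OF 1 this], of v] show ?thesis by (simp add: t_def)
  qed
  have e2: "snd (?g' (cc.J x v)) \<bullet> cc.J x u + snd (g (?\<phi> x)) \<bullet> cc.D2 x v u
      = w x * (snd (?f' v) \<bullet> u) + w x * t / (n + 1) * (snd (f x) \<bullet> u)" for u
  proof -
    have 1: "((\<lambda>y. snd (g (?\<phi> y)) \<bullet> cc.J y u) has_derivative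
        (\<lambda>h. snd (g (?\<phi> x)) \<bullet> cc.D2 x h u + snd (?g' (cc.J x h)) \<bullet> cc.J x u)) (at x)"
      by (rule has_derivative_inner[OF has_derivative_compose[OF cc.J_deriv[OF x] g2] cc.J_has_derivative[OF x]])
    have "((\<lambda>y. w y * (snd (f y) \<bullet> u)) has_derivative
       (\<lambda>h. w x * (snd (?f' h) \<bullet> u) + w x * (\<Sum>k\<in>Basis. ?K (cc.D2 x h k) \<bullet> k) / (n + 1) * (snd (f x) \<bullet> u))) (at x)"
      by (rule has_derivative_mult[OF wd has_derivative_inner_left[OF f2]])
    then have "((\<lambda>y. snd (g (?\<phi> y)) \<bullet> cc.J y u) has_derivative
       (\<lambda>h. w x * (snd (?f' h) \<bullet> u) + w x * (\<Sum>k\<in>Basis. ?K (cc.D2 x h k) \<bullet> k) / (n + 1) * (snd (f x) \<bullet> u))) (at x)"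
      by (rule has_derivative_transform_within_open[OF _ W(1,2)]) (simp add: gf(2) w_def)
    from fun_cong[OF has_derivative_unique[OF 1 this], of v] show ?thesis by (simp add: t_def)
  qed
  have law: "E d (?\<phi> y) (cc.J y a) (cc.J y b) = cc.J y (E c y a b) - cc.D2 y a b" if "y \<in> overlap c d" for y a b
    by (rule conn_law[OF E c that])
  have wf: "weight_one_form (E d) (?\<phi> x) (cc.J x v) = weight_one_form (E c) x v - t / (n + 1)"
  proof -
    have linK: "linear ?K" by (rule cc.linear_K[OF cc.phi_in[OF x]])
    have linM: "linear (\<lambda>k. E c x v k - ?K (cc.D2 x v k))"
      using linear_compose[OF bilinear_linear(1)[OF cc.D2_bilinear[OF x]] linK]
      by (intro linear_compose_sub C.lin(1)[OF xc]) (simp add: o_def)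
    have "E d (?\<phi> x) (cc.J x v) k = cc.J x (E c x v (?K k) - ?K (cc.D2 x v (?K k)))" for k
      using law[OF x, of v "?K k"] by (simp add: cc.J_K x linear_diff[OF cc.linear_J[OF x]])
    moreover have "(\<Sum>k\<in>Basis. cc.J x (E c x v (?K k) - ?K (cc.D2 x v (?K k))) \<bullet> k)
       = (\<Sum>k\<in>Basis. (E c x v k - ?K (cc.D2 x v k)) \<bullet> k)"
      using trace_cyclic[OF cc.linear_J[OF x], of "\<lambda>k. E c x v (?K k) - ?K (cc.D2 x v (?K k))"]
        linear_compose[OF linK linM] by (simp add: o_def cc.K_J x)
    ultimately have "(\<Sum>k\<in>Basis. E d (?\<phi> x) (cc.J x v) k \<bullet> k) = (\<Sum>k\<in>Basis. E c x v k \<bullet> k) - t"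
      by (simp add: t_def inner_diff_left sum_subtractf)
    then show ?thesis by (simp add: weight_one_form_def n_def diff_divide_distrib)
  qed
  have ric: "ricci (E d) (?\<phi> x) (cc.J x a) (cc.J x b) = ricci (E c) x a b" for a b
    by (rule cc.ricci_transform[OF x _ _ C.diff[OF xc] D.diff[OF yd] law])
      (auto intro: C.bil D.bil subsetD[OF overlap_subset])
  have sch: "schouten (E d) (?\<phi> x) (cc.J x a) (cc.J x b) = schouten (E c) x a b" for a b
    by (simp add: schouten_def ric)
  have gx: "fst (g (?\<phi> x)) = w x * fst (f x)" "snd (g (?\<phi> x)) \<bullet> cc.J x u = w x * (snd (f x) \<bullet> u)" for u
    using gf[OF W(2)] by (simp_all add: w_def)
  have top: "fst (?f' v) + weight_one_form (E c) x v * fst (f x) - snd (f x) \<bullet> v = 0"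
    using arg_cong[OF z, of fst] unfolding C.tractor_deriv_fst frechet_derivative_eqI[OF f1] by simp
  have bot: "snd (?f' v) \<bullet> u - snd (f x) \<bullet> E c x v u + weight_one_form (E c) x v * (snd (f x) \<bullet> u)
      + schouten (E c) x v u * fst (f x) = 0" for u
    using C.tractor_deriv_snd[OF xc, of f v u] z unfolding frechet_derivative_eqI[OF f2] by simp
  let ?T = "tractor_deriv (E d) g (?\<phi> x) (cc.J x v)"
  have "fst ?T = w x * (fst (?f' v) + weight_one_form (E c) x v * fst (f x) - snd (f x) \<bullet> v)"
    unfolding D.tractor_deriv_fst frechet_derivative_eqI[OF g1] wf gx e1 by (simp add: algebra_simps)
  then have 1: "fst ?T = 0" using top by simp
  have 2: "snd ?T \<bullet> cc.J x u = 0" for u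
  proof -
    have "snd ?T \<bullet> cc.J x u = (snd (?g' (cc.J x v)) \<bullet> cc.J x u + snd (g (?\<phi> x)) \<bullet> cc.D2 x v u)
       - w x * (snd (f x) \<bullet> E c x v u) + (weight_one_form (E c) x v - t / (n + 1)) * (w x * (snd (f x) \<bullet> u))
       + schouten (E c) x v u * (w x * fst (f x))"
      unfolding D.tractor_deriv_snd[OF yd] frechet_derivative_eqI[OF g2] wf law[OF x] sch
      by (simp add: inner_diff_right gx)
    also have "\<dots> = w x * (snd (?f' v) \<bullet> u - snd (f x) \<bullet> E c x v u + weight_one_form (E c) x v * (snd (f x) \<bullet> u)
      + schouten (E c) x v u * fst (f x))"
      unfolding e2 by (simp add: algebra_simps)
    finally show ?thesis using bot by simp
  qed
  have "snd ?T \<bullet> u = 0" for u using 2[of "?K u"] by (simp add: cc.J_K x)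
  then have "snd ?T = 0" by - (rule inner_eqI, simp)
  then show ?thesis using 1 by (simp add: prod_eq_iff)
qed

end

section \<open>Horizontal and vertical vectors in coordinates\<close>

context projective
begin

lemma section_open:
  assumes "openin (atlas_topology A) W" "c \<in> A" shows "open (snd c ` (W \<inter> fst c))"
  using assms by (simp add: openin_atlas_topology)

lemma section_domain_iff:
  assumes c: "c \<in> A" shows "x \<in> snd c ` (W \<inter> fst c) \<longleftrightarrow> x \<in> chart_image c \<and> chart_inv c x \<in> W"
proof
  assume "x \<in> snd c ` (W \<inter> fst c)"
  then obtain q where "q \<in> W" "q \<in> fst c" "x = snd c q" by blast
  then show "x \<in> chart_image c \<and> chart_inv c x \<in> W" by (simp add: chart_image_def chart_inv_snd c)
next
  assume x: "x \<in> chart_image c \<and> chart_inv c x \<in> W"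
  then have "chart_inv c x \<in> W \<inter> fst c" "x = snd c (chart_inv c x)"
    by (simp_all add: chart_inv_in snd_chart_inv)
  then show "x \<in> snd c ` (W \<inter> fst c)" by blast
qed

lemma fibre_conn_change:
  assumes U: "U \<in> cotractor_fibre A P q" and D: "D \<in> P" "E \<in> P" and c: "c \<in> A" "q \<in> fst c"
  shows "U E c = (fst (U D c), snd (U D c) + fst (U D c) *\<^sub>R ups D E q c)"
  using U D c ups[OF D] unfolding cotractor_fibre_def by blast

lemma fibre_chart_change:
  assumes U: "U \<in> cotractor_fibre A P q" and E: "E \<in> P" and c: "c \<in> A" "d \<in> A" "q \<in> fst c" "q \<in> fst d"
  shows "fst (U E d) = weight_one c d q * fst (U E c)"
    "snd (U E d) \<bullet> dtransition c d q u = weight_one c d q * (snd (U E c) \<bullet> u)"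
proof -
  show "fst (U E d) = weight_one c d q * fst (U E c)"
    using U E c unfolding cotractor_fibre_def density_fibre_def by blast
  show "snd (U E d) \<bullet> dtransition c d q u = weight_one c d q * (snd (U E c) \<bullet> u)"
    using U E c unfolding cotractor_fibre_def weighted_cotangent_space_def by blast
qed

text \<open>The two invariance statements are composed: change of connection within
  \<open>c\<close>, then change of chart for \<open>E\<close>. For the second, the domain of the
  section is cut down to the overlap, where both representations can be compared near the
  point.\<close>

lemma tractor_zero_transport:
  assumes W: "openin (atlas_topology A) W" "p \<in> W"
    and s: "\<And>q. q \<in> W \<Longrightarrow> s q \<in> cotractor_fibre A P q"
    and sm: "\<And>D c. D \<in> P \<Longrightarrow> c \<in> A \<Longrightarrow> smooth_on (snd c ` (W \<inter> fst c)) (\<lambda>x. s (chart_inv c x) D c)"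
    and D: "D \<in> P" "E \<in> P" and c: "c \<in> A" "d \<in> A" "p \<in> fst c" "p \<in> fst d"
    and z: "tractor_deriv (D c) (\<lambda>x. s (chart_inv c x) D c) (snd c p) v = 0"
  shows "tractor_deriv (E d) (\<lambda>x. s (chart_inv d x) E d) (snd d p) (dtransition c d p v) = 0"
proof -
  let ?Wc = "snd c ` (W \<inter> fst c)" and ?Wd = "snd d ` (W \<inter> fst d)"
  have p: "snd c p \<in> ?Wc" "snd d p \<in> ?Wd" using W c by blast+
  have diff: "(\<lambda>x. s (chart_inv c x) F c) differentiable at (snd c p)"
    "(\<lambda>x. s (chart_inv d x) F d) differentiable at (snd d p)" if "F \<in> P" for F
    using smooth_on_differentiable[OF sm[OF that c(1)] p(1)] smooth_on_differentiable[OF sm[OF that c(2)] p(2)] .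
  have z1: "tractor_deriv (E c) (\<lambda>x. s (chart_inv c x) E c) (snd c p) v = 0"
  proof (rule tractor_zero_conn[OF D c(1) _ section_open[OF W(1) c(1)] p(1) _ diff(1)[OF D(1)] _ z])
    show "snd c p \<in> chart_image c" using c by (simp add: chart_image_def)
    show "?Wc \<subseteq> chart_image c" by (auto simp: chart_image_def)
    fix y assume "y \<in> ?Wc"
    note iffD1[OF section_domain_iff[OF c(1)] this]
    then have y: "chart_inv c y \<in> W" "chart_inv c y \<in> fst c" by (simp_all add: chart_inv_in)
    show "s (chart_inv c y) E c = (fst (s (chart_inv c y) D c), snd (s (chart_inv c y) D c)
        + fst (s (chart_inv c y) D c) *\<^sub>R ups D E (chart_inv c y) c)"
      by (rule fibre_conn_change[OF s[OF y(1)] D c(1) y(2)])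
  qed
  have x: "snd c p \<in> overlap c d" by (rule snd_overlap[OF c(3,4)])
  have "tractor_deriv (E d) (\<lambda>x. s (chart_inv d x) E d) (transition c d (snd c p))
    (frechet_derivative (transition c d) (at (snd c p)) v) = 0"
  proof (rule tractor_zero_chart[OF D(2) c(1,2) x diff(1)[OF D(2)] _ _ _ _ _ _ z1])
    show "(\<lambda>x. s (chart_inv d x) E d) differentiable at (transition c d (snd c p))"
      using diff(2)[OF D(2)] by (simp add: transition_snd c)
    show "open (?Wc \<inter> overlap c d)" by (intro open_Int section_open W c open_overlap)
    show "snd c p \<in> ?Wc \<inter> overlap c d" using p x by simp
    show "?Wc \<inter> overlap c d \<subseteq> overlap c d" by simp
    fix y assume y: "y \<in> ?Wc \<inter> overlap c d"
    note iffD1[OF section_domain_iff[OF c(1)] IntD1[OF y]] iffD1[OF overlap_iff[OF c(1)] IntD2[OF y]]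
    then have q: "chart_inv c y \<in> W" "chart_inv c y \<in> fst c" "chart_inv c y \<in> fst d" "snd c (chart_inv c y) = y"
      by (simp_all add: chart_inv_in snd_chart_inv)
    have tr: "chart_inv d (transition c d y) = chart_inv c y"
      by (rule chart_inv_transition[OF c(1,2)]) (use y in blast)
    note ch = fibre_chart_change[OF s[OF q(1)] D(2) c(1,2) q(2,3)]
    show "fst (s (chart_inv d (transition c d y)) E d) = weight_one c d (chart_inv c y) * fst (s (chart_inv c y) E c)"
      unfolding tr by (rule ch(1))
    show "snd (s (chart_inv d (transition c d y)) E d) \<bullet> frechet_derivative (transition c d) (at y) u
      = weight_one c d (chart_inv c y) * (snd (s (chart_inv c y) E c) \<bullet> u)" for u
      using ch(2)[of u] unfolding tr dtransition_def q(4) .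
  qed
  then show ?thesis by (simp add: transition_snd c dtransition_def)
qed

text \<open>The derivative in direction \<open>u\<close> that a section with value \<open>w\<close> must have in order to be parallel there.\<close>

definition parallel_sec :: "('a, real^'n) conn \<Rightarrow> ('a, real^'n) chart \<Rightarrow> real^'n \<Rightarrow> real \<times> (real^'n)
    \<Rightarrow> real^'n \<Rightarrow> real \<times> (real^'n)" where
  "parallel_sec D c x w u = (snd w \<bullet> u - weight_one_form (D c) x u * fst w,
     \<Sum>k\<in>Basis. (snd w \<bullet> D c x u k - weight_one_form (D c) x u * (snd w \<bullet> k) - schouten (D c) x u k * fst w) *\<^sub>R k)"

text \<open>At one point parallelism only prescribes the first derivative, so an affine function of
  the coordinates satisfies it in every direction at once.\<close>

lemma parallel_sec:
  assumes D: "D \<in> P" and c: "c \<in> A" and x: "x \<in> chart_image c"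
  shows "linear (parallel_sec D c x w)"
    and "tractor_deriv (D c) (\<lambda>y. w + parallel_sec D c x w (y - x)) x u = 0"
proof -
  interpret D: smooth_conn "chart_image c" "D c" by (rule smooth_conn[OF D c])
  have lw: "weight_one_form (D c) x (u + v) = weight_one_form (D c) x u + weight_one_form (D c) x v"
    "weight_one_form (D c) x (r *\<^sub>R u) = r * weight_one_form (D c) x u" for u v r
    by (simp_all add: weight_one_form_def linear_add[OF D.lin(2)[OF x]] linear_scale[OF D.lin(2)[OF x]]
        inner_add_left sum.distrib add_divide_distrib sum_distrib_left)
  note ls = bilinear_linear[OF D.bilinear_schouten[OF x]]
  show lin: "linear (parallel_sec D c x w)"
  proof (rule linearI)
    show "parallel_sec D c x w (u + v) = parallel_sec D c x w u + parallel_sec D c x w v" for u v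
      by (simp add: parallel_sec_def lw linear_add[OF D.lin(2)[OF x]] linear_add[OF ls(2)]
          inner_add_right sum.distrib[symmetric] algebra_simps)
    show "parallel_sec D c x w (r *\<^sub>R u) = r *\<^sub>R parallel_sec D c x w u" for r u
      by (simp add: parallel_sec_def lw linear_scale[OF D.lin(2)[OF x]] linear_scale[OF ls(2)]
          scaleR_sum_right algebra_simps)
  qed
  let ?f = "\<lambda>y. w + parallel_sec D c x w (y - x)"
  have bl: "bounded_linear (parallel_sec D c x w)" using lin linear_conv_bounded_linear by blast
  have "((\<lambda>y. y - x) has_derivative (\<lambda>h. h)) (at x)" by (auto intro!: derivative_eq_intros)
  from bounded_linear.has_derivative[OF bl this]
  have fd: "(?f has_derivative (\<lambda>h. 0 + parallel_sec D c x w h)) (at x)"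
    by (intro has_derivative_add has_derivative_const)
  note f1 = frechet_derivative_eqI[OF has_derivative_fst[OF fd]]
  note f2 = frechet_derivative_eqI[OF has_derivative_snd[OF fd]]
  have fx: "?f x = w" by (simp add: linear_0[OF lin])
  have "fst (tractor_deriv (D c) ?f x u) = 0"
    unfolding D.tractor_deriv_fst f1 fx by (simp add: parallel_sec_def)
  moreover have "snd (tractor_deriv (D c) ?f x u) \<bullet> z = 0" for z
  proof -
    have "linear (\<lambda>k. snd w \<bullet> D c x u k - weight_one_form (D c) x u * (snd w \<bullet> k) - schouten (D c) x u k * fst w)"
      by (auto intro!: linearI simp: linear_add[OF D.lin(1)[OF x]] linear_scale[OF D.lin(1)[OF x]]
          linear_add[OF ls(1)] linear_scale[OF ls(1)] inner_add_right algebra_simps)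
    from riesz_sum[OF this, of z] show ?thesis
      unfolding D.tractor_deriv_snd[OF x] f2 fx by (simp add: parallel_sec_def)
  qed
  then have "snd (tractor_deriv (D c) ?f x u) = 0" by - (rule inner_eqI, simp)
  ultimately show "tractor_deriv (D c) ?f x u = 0" by (simp add: prod_eq_iff)
qed

text \<open>The section is affine in one chart. Parallel there for one connection, it is so for all
  connections and charts by \<open>tractor_zero_transport\<close>, as \<open>horizontal\<close>
  demands.\<close>

lemma parallel_section_exists:
  assumes D: "D \<in> P" and c: "c \<in> A" "p \<in> fst c" and U: "U \<in> cotractor_fibre A P p"
  shows "\<exists>s. section_near A P p s \<and> s p = U \<and> (\<forall>v \<in> tangent_space A p. \<forall>E\<in>P. \<forall>d\<in>A. p \<in> fst d \<longrightarrow>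
        tractor_deriv (E d) (\<lambda>x. s (chart_inv d x) E d) (snd d p) (v d) = 0)"
proof -
  let ?x = "snd c p"
  have x: "?x \<in> chart_image c" using c by (simp add: chart_image_def)
  define f where "f y = U D c + parallel_sec D c ?x (U D c) (y - ?x)" for y
  note ps = parallel_sec[OF D c(1) x, of "U D c"]
  define s where "s q = mk_cotractor D c q (f (snd c q))" for q
  have sf: "s q \<in> cotractor_fibre A P q" if "q \<in> fst c" for q
    unfolding s_def by (rule mk_cotractor_in[OF D c(1) that])
  have fsm: "smooth_on S f" for S
  proof -
    have bl: "bounded_linear (parallel_sec D c ?x (U D c))" using ps(1) linear_conv_bounded_linear by blast
    have "smooth_on UNIV f"
      unfolding f_def
      by (rule smooth_on_add[OF open_UNIV smooth_on_const smooth_on_linear_compose[OF open_UNIV bl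
            smooth_on_diff[OF open_UNIV smooth_on_ident smooth_on_const]]])
    then show ?thesis by (rule smooth_on_subset) simp
  qed
  have sm: "smooth_on (snd d ` (fst c \<inter> fst d)) (\<lambda>y. s (chart_inv d y) E d)" if E: "E \<in> P" and d: "d \<in> A" for E d
  proof -
    have tr: "snd c (chart_inv d y) = transition d c y" for y by (simp add: transition_def)
    have eq: "snd d ` (fst c \<inter> fst d) = overlap d c" by (simp add: overlap_def Int_commute)
    have "smooth_on (overlap d c) (\<lambda>y. ctr D c E d (chart_inv c (transition d c y)) (f (transition d c y)))"
    proof (rule smooth_ctr[OF D E c(1) d open_overlap[OF d c(1)] smooth_transition[OF d c(1)]])
      show "transition d c ` overlap d c \<subseteq> overlap c d" using transition_in[OF d c(1)] by blast
      show "smooth_on (overlap d c) (\<lambda>y. f (transition d c y))"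
        by (rule smooth_on_compose[OF open_overlap[OF d c(1)] open_UNIV _ fsm smooth_transition[OF d c(1)]]) simp
    qed
    then show ?thesis
      unfolding eq
      by (subst smooth_on_cong[OF open_overlap[OF d c(1)],
            where g = "\<lambda>y. ctr D c E d (chart_inv c (transition d c y)) (f (transition d c y))"])
        (simp_all add: s_def chart_inv_transition[OF d c(1)] mk_cotractor_apply[OF E d] overlap_iff[OF d] chart_inv_in tr)
  qed
  have sp: "s p = U"
    unfolding s_def f_def using cotractor_eq_mk[OF U D c] by (simp add: linear_0[OF ps(1)])
  have "section_near A P p s"
    unfolding section_near_def using openin_chart[OF c(1)] c(2) sf sm by blast
  moreover have "tractor_deriv (E d) (\<lambda>x. s (chart_inv d x) E d) (snd d p) (v d) = 0"
    if v: "v \<in> tangent_space A p" and E: "E \<in> P" and d: "d \<in> A" "p \<in> fst d" for v E d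
  proof -
    have "tractor_deriv (D c) (\<lambda>x. s (chart_inv c x) D c) ?x (v c) = tractor_deriv (D c) f ?x (v c)"
    proof -
      have e: "s (chart_inv c y) D c = f y" if "y \<in> chart_image c" for y
        using that by (simp add: s_def mk_cotractor_self D c chart_inv_in snd_chart_inv)
      have "frechet_derivative (\<lambda>y. fst (s (chart_inv c y) D c)) (at ?x) = frechet_derivative (\<lambda>y. fst (f y)) (at ?x)"
        "frechet_derivative (\<lambda>y. snd (s (chart_inv c y) D c)) (at ?x) = frechet_derivative (\<lambda>y. snd (f y)) (at ?x)"
        by (rule frechet_derivative_cong_open[OF open_chart_image[OF c(1)] x], simp add: e)+
      then show ?thesis
        by (simp add: tractor_deriv_def density_deriv_def weighted_covector_deriv_def e[OF x])
    qed
    also have "\<dots> = 0" unfolding f_def by (rule ps(2))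
    finally have z: "tractor_deriv (D c) (\<lambda>x. s (chart_inv c x) D c) ?x (v c) = 0" .
    have "tractor_deriv (E d) (\<lambda>x. s (chart_inv d x) E d) (snd d p) (dtransition c d p (v c)) = 0"
      by (rule tractor_zero_transport[where s = s and W = "fst c" and D = D,
            OF openin_chart[OF c(1)] c(2) sf sm D E c(1) d(1) c(2) d(2) z])
    then show ?thesis using tangent_space_D[OF v c(1) d(1) c(2) d(2)] by simp
  qed
  ultimately show ?thesis using sp by blast
qed

definition Hor :: "(real^'n \<Rightarrow> real^'n \<Rightarrow> real^'n \<Rightarrow> real^'n) \<Rightarrow> real^'n \<Rightarrow> real^'n \<Rightarrow> real^'n \<Rightarrow> real^'n" where
  "Hor \<Gamma> x \<xi> u = (\<Sum>k\<in>Basis. (\<xi> \<bullet> \<Gamma> x u k - (\<xi> \<bullet> u) * (\<xi> \<bullet> k) - schouten \<Gamma> x u k) *\<^sub>R k)"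

lemma Hor_inner:
  assumes D: "D \<in> P" and c: "c \<in> A" and x: "x \<in> chart_image c"
  shows "Hor (D c) x \<xi> u \<bullet> z = \<xi> \<bullet> D c x u z - (\<xi> \<bullet> u) * (\<xi> \<bullet> z) - schouten (D c) x u z"
proof -
  interpret D: smooth_conn "chart_image c" "D c" by (rule smooth_conn[OF D c])
  note ls = bilinear_linear[OF D.bilinear_schouten[OF x]]
  have "linear (\<lambda>k. \<xi> \<bullet> D c x u k - (\<xi> \<bullet> u) * (\<xi> \<bullet> k) - schouten (D c) x u k)"
    by (auto intro!: linearI simp: linear_add[OF D.lin(1)[OF x]] linear_scale[OF D.lin(1)[OF x]]
        linear_add[OF ls(1)] linear_scale[OF ls(1)] inner_add_right algebra_simps)
  from riesz_sum[OF this] show ?thesis by (simp add: Hor_def)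
qed

text \<open>In the derivative of the quotient the weight terms cancel, as both slots carry the same
  weight. The term \<open>\<mu> \<bullet> v\<close> in the derivative of the first slot produces the
  part quadratic in the quotient.\<close>

lemma parallel_quotient_deriv:
  assumes D: "D \<in> P" and c: "c \<in> A" and x: "x \<in> chart_image c"
    and f: "f differentiable at x" and nz: "fst (f x) \<noteq> 0" and z: "tractor_deriv (D c) f x v = 0"
  shows "frechet_derivative (\<lambda>y. nrm (1, 0) (f y)) (at x) v = Hor (D c) x (nrm (1, 0) (f x)) v"
    and "(\<lambda>y. nrm (1, 0) (f y)) differentiable at x"
proof -
  interpret D: smooth_conn "chart_image c" "D c" by (rule smooth_conn[OF D c])
  let ?f' = "frechet_derivative f (at x)"
  define \<sigma> \<mu> where "\<sigma> = fst (f x)" and "\<mu> = snd (f x)"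
  have s0: "\<sigma> \<noteq> 0" using nz by (simp add: \<sigma>_def)
  note fd = has_derivative_frechet[OF f]
  have f1: "((\<lambda>y. fst (f y)) has_derivative (\<lambda>h. fst (?f' h))) (at x)"
    and f2: "((\<lambda>y. snd (f y)) has_derivative (\<lambda>h. snd (?f' h))) (at x)"
    by (intro has_derivative_fst has_derivative_snd fd)+
  have d: "((\<lambda>y. nrm (1, 0) (f y)) has_derivative
      (\<lambda>h. inverse (fst (f x)) *\<^sub>R snd (?f' h) + (- (inverse (fst (f x)) * fst (?f' h) * inverse (fst (f x)))) *\<^sub>R snd (f x))) (at x)"
    unfolding nrm_infinity
    by (rule has_derivative_eq_rhs[OF has_derivative_scaleR[OF Deriv.has_derivative_inverse[OF nz f1] f2]]) (simp add: algebra_simps)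
  then show "(\<lambda>y. nrm (1, 0) (f y)) differentiable at x" by (rule differentiableI)
  have top: "fst (?f' v) = \<mu> \<bullet> v - weight_one_form (D c) x v * \<sigma>"
    using arg_cong[OF z, of fst] unfolding D.tractor_deriv_fst frechet_derivative_eqI[OF f1] by (simp add: \<sigma>_def \<mu>_def)
  have bot: "snd (?f' v) \<bullet> u = \<mu> \<bullet> D c x v u - weight_one_form (D c) x v * (\<mu> \<bullet> u) - schouten (D c) x v u * \<sigma>" for u
    using D.tractor_deriv_snd[OF x, of f v u] z unfolding frechet_derivative_eqI[OF f2] by (simp add: \<sigma>_def \<mu>_def)
  show "frechet_derivative (\<lambda>y. nrm (1, 0) (f y)) (at x) v = Hor (D c) x (nrm (1, 0) (f x)) v"
  proof (rule inner_eqI)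
    fix u
    show "frechet_derivative (\<lambda>y. nrm (1, 0) (f y)) (at x) v \<bullet> u = Hor (D c) x (nrm (1, 0) (f x)) v \<bullet> u"
      unfolding frechet_derivative_eqI[OF d]
      unfolding Hor_inner[OF D c x] nrm_infinity \<sigma>_def[symmetric] \<mu>_def[symmetric] top
      using s0 by (simp add: inner_add_left inner_diff_left bot field_simps)
  qed
qed

section \<open>Horizontal vectors on the projectivised bundle\<close>

abbreviation e0 where "e0 D c \<equiv> pch D c (1, 0)"

lemma e0_in: "D \<in> P \<Longrightarrow> c \<in> A \<Longrightarrow> e0 D c \<in> PAt"
  unfolding PAt_iff using infinity_Basis by blast

lemma cotractor_chart_inj:
  assumes "D \<in> P" "c \<in> A"
  shows "inj_on (snd (cotractor_chart A P D c)) (fst (cotractor_chart A P D c))"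
proof (rule inj_onI)
  fix a b assume a: "a \<in> fst (cotractor_chart A P D c)" and b: "b \<in> fst (cotractor_chart A P D c)"
    and e: "snd (cotractor_chart A P D c) a = snd (cotractor_chart A P D c) b"
  obtain p U q V where ab: "a = (p, U)" "b = (q, V)" by (metis prod.exhaust)
  have U: "p \<in> fst c" "U \<in> cotractor_fibre A P p" "q \<in> fst c" "V \<in> cotractor_fibre A P q"
    using a b unfolding ab by (simp_all add: cotractor_chart_def)
  have "snd c p = snd c q" "U D c = V D c" using e unfolding ab by (simp_all add: cotractor_chart_def)
  then show "a = b"
    using inj_onD[OF inj_chart[OF assms(2)], of p q] U cotractor_eqI[of U p V D c] assms by (simp add: ab)
qed

lemma cotractor_chart_inv:
  assumes "D \<in> P" "c \<in> A" "x \<in> chart_image c"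
  shows "chart_inv (cotractor_chart A P D c) (x, w) = (chart_inv c x, mk_cotractor D c (chart_inv c x) w)"
proof -
  let ?a = "(chart_inv c x, mk_cotractor D c (chart_inv c x) w)"
  have a: "?a \<in> fst (cotractor_chart A P D c)" "snd (cotractor_chart A P D c) ?a = (x, w)"
    using assms by (simp_all add: cotractor_chart_def chart_inv_in mk_cotractor_in mk_cotractor_self snd_chart_inv)
  have "chart_inv (cotractor_chart A P D c) (snd (cotractor_chart A P D c) ?a) = ?a"
    unfolding chart_inv_def[of "cotractor_chart A P D c"]
    by (rule inv_into_f_f[OF cotractor_chart_inj[OF assms(1,2)] a(1)])
  then show ?thesis by (simp only: a(2))
qed

text \<open>The chain rule for a section followed by the projection. It removes the cotractor bundle
  from the description of horizontal vectors and leaves the derivative of a map from the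
  base.\<close>

lemma section_proj_tangent:
  assumes s: "section_near A P p s" and v: "v \<in> tangent_space A p" and p: "p \<in> points A"
  shows "tangent_map (cotractor_atlas A P) PAt proj (p, s p) (tangent_map A (cotractor_atlas A P) (\<lambda>q. (q, s q)) p v)
    = tangent_map A PAt (\<lambda>q. proj (q, s q)) p v"
proof -
  let ?CA = "cotractor_atlas A P" and ?c = "chart_at A p" and ?F = "\<lambda>q. (q, s q)"
  let ?k = "chart_at ?CA (p, s p)"
  obtain c1 where c1: "c1 \<in> A" "p \<in> fst c1" using p unfolding points_def by blast
  note ca = chart_at_props[OF c1]
  obtain W where W: "openin (atlas_topology A) W" "p \<in> W" "\<And>q. q \<in> W \<Longrightarrow> s q \<in> cotractor_fibre A P q"
    "\<And>D c. D \<in> P \<Longrightarrow> c \<in> A \<Longrightarrow> smooth_on (snd c ` (W \<inter> fst c)) (\<lambda>x. s (chart_inv c x) D c)"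
    using s unfolding section_near_def by blast
  obtain D1 where D1: "D1 \<in> P" using P_nonempty by blast
  \<comment> \<open>\<open>tangent_map\<close> uses the chart picked by \<open>chart_at\<close>, of
    which only membership in the atlas is known; its connection \<open>D\<close> and base chart
    \<open>c\<close> are recovered from that.\<close>
  have "cotractor_chart A P D1 c1 \<in> ?CA \<and> (p, s p) \<in> fst (cotractor_chart A P D1 c1)"
    using D1 c1 W by (auto simp: cotractor_atlas_def cotractor_chart_def)
  then have "?k \<in> ?CA \<and> (p, s p) \<in> fst ?k" unfolding chart_at_def by (rule someI)
  then obtain D c where k: "D \<in> P" "c \<in> A" "?k = cotractor_chart A P D c" "(p, s p) \<in> fst ?k"
    unfolding cotractor_atlas_def by blast
  have pc: "p \<in> fst c" using k(3,4) by (simp add: cotractor_chart_def)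
  let ?N = "snd ?c ` (W \<inter> fst ?c) \<inter> overlap ?c c"
  have N: "open ?N" by (intro open_Int section_open W ca open_overlap k)
  have pN: "snd ?c p \<in> ?N" using W(2) ca pc by (auto simp: overlap_def)
  have Nin: "chart_inv ?c x \<in> W" "chart_inv ?c x \<in> fst c" if "x \<in> ?N" for x
    using iffD1[OF section_domain_iff[OF ca(1)] IntD1[OF that]] iffD1[OF overlap_iff[OF ca(1)] IntD2[OF that]]
    by simp_all
  show ?thesis
  proof (rule tangent_map_compose[where F = ?F and G = proj])
    show "?k \<in> ?CA" "(p, s p) \<in> fst ?k" using k unfolding cotractor_atlas_def by blast+
    show "inj_on (snd ?k) (fst ?k)" unfolding k(3) by (rule cotractor_chart_inj[OF k(1,2)])
    show "chart_inv ?c (snd ?c p) = p" by (rule chart_inv_snd[OF ca])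
    show "open ?N" "snd ?c p \<in> ?N" by (fact N pN)+
    show "?F (chart_inv ?c x) \<in> fst ?k" if "x \<in> ?N" for x
      unfolding k(3) using Nin[OF that] W(3) by (simp add: cotractor_chart_def)
    have "smooth_on ?N (\<lambda>x. (transition ?c c x, s (chart_inv c (transition ?c c x)) D c))"
    proof (rule smooth_on_Pair[OF N])
      show t: "smooth_on ?N (transition ?c c)"
        by (rule smooth_on_subset[OF smooth_transition[OF ca(1) k(2)]]) simp
      show "smooth_on ?N (\<lambda>x. s (chart_inv c (transition ?c c x)) D c)"
      proof (rule smooth_on_compose[OF N section_open[OF W(1) k(2)] _ W(4)[OF k(1,2)] t], rule image_subsetI)
        fix x assume x: "x \<in> ?N"
        then have "transition ?c c x \<in> overlap c ?c" using transition_in[OF ca(1) k(2)] by blast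
        then show "transition ?c c x \<in> snd c ` (W \<inter> fst c)"
          using Nin[OF x] chart_inv_transition[OF ca(1) k(2), of x] x
          unfolding section_domain_iff[OF k(2)] overlap_iff[OF k(2)] by simp
      qed
    qed
    have tr: "snd c (chart_inv ?c x) = transition ?c c x" for x by (simp add: transition_def)
    from smooth_on_differentiable[OF \<open>smooth_on ?N _\<close> pN]
    have "(\<lambda>x. (transition ?c c x, s (chart_inv c (transition ?c c x)) D c)) differentiable at (snd ?c p)" .
    then show "(\<lambda>x. snd ?k (?F (chart_inv ?c x))) differentiable at (snd ?c p)"
      by (subst differentiable_cong_open[OF N pN, where g = "\<lambda>x. (transition ?c c x, s (chart_inv c (transition ?c c x)) D c)"])
        (simp_all add: k(3) cotractor_chart_def chart_inv_transition[OF ca(1) k(2)] tr)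
    fix e assume "e \<in> PAt" and pe: "proj (p, s p) \<in> fst e"
    then obtain E d b where e: "E \<in> P" "d \<in> A" "b \<in> Basis" "e = pch E d b" unfolding PAt_iff by blast
    \<comment> \<open>In a cotractor chart the projection is \<open>PT\<close> as a function of base
      point and pair, so its smoothness into an arbitrary target chart is an instance of
      \<open>proj_param\<close>.\<close>
    let ?Z = "chart_image c \<times> (UNIV :: (real \<times> (real^'n)) set)"
    have Z: "open ?Z" by (simp add: open_Times open_chart_image k(2))
    let ?Z' = "{z \<in> ?Z. PT D c (fst z) (snd z) \<in> fst (pch E d b)}"
    have "fst ` ?Z \<subseteq> chart_image c" by auto
    note pp = proj_param[OF k(1) e(1) k(2) e(2,3) Z smooth_on_fst[OF Z smooth_on_ident] this smooth_on_snd[OF Z smooth_on_ident]]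
    have inv: "proj (chart_inv ?k z) = PT D c (fst z) (snd z)" if "z \<in> ?Z" for z
      using cotractor_chart_inv[OF k(1,2), of "fst z" "snd z"] that unfolding k(3) PT_def by (simp add: mem_Times_iff)
    have zp: "snd ?k (p, s p) = (snd c p, s p D c)" unfolding k(3) by (simp add: cotractor_chart_def)
    have "(snd c p, s p D c) \<in> ?Z'"
      using pe PT_cover[OF k(1,2) pc W(3)[OF W(2)]] pc unfolding e(4) by (simp add: chart_image_def)
    then have zZ: "snd ?k (p, s p) \<in> ?Z'" unfolding zp .
    show "(\<lambda>y. snd e (proj (chart_inv ?k y))) differentiable at (snd ?k (p, s p))"
      by (subst differentiable_cong_open[OF pp(1) zZ, where g = "\<lambda>z. snd (pch E d b) (PT D c (fst z) (snd z))"])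
        (use smooth_on_differentiable[OF pp(2) zZ] inv in \<open>auto simp: e(4)\<close>)
  qed
qed

text \<open>In the chart \<open>e0 D c\<close> the projected section is the graph of the quotient of
  its two slots, whose derivative in a parallel direction is known from
  \<open>parallel_quotient_deriv\<close>.\<close>

lemma section_proj_tangent_chart:
  assumes s: "section_near A P p s" and v: "v \<in> tangent_space A p"
    and D: "D \<in> P" and c: "c \<in> A" "p \<in> fst c" and nz: "fst (s p D c) \<noteq> 0"
    and z: "tractor_deriv (D c) (\<lambda>x. s (chart_inv c x) D c) (snd c p) (v c) = 0"
  shows "tangent_map A PAt (\<lambda>q. proj (q, s q)) p v \<in> tangent_space PAt (proj (p, s p))"
    and "tangent_map A PAt (\<lambda>q. proj (q, s q)) p v (e0 D c)
      = (v c, Hor (D c) (snd c p) (nrm (1, 0) (s p D c)) (v c))"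
proof -
  let ?G = "\<lambda>q. proj (q, s q)" and ?f = "\<lambda>x. s (chart_inv c x) D c"
  obtain W where W: "openin (atlas_topology A) W" "p \<in> W" "\<And>q. q \<in> W \<Longrightarrow> s q \<in> cotractor_fibre A P q"
    "\<And>D c. D \<in> P \<Longrightarrow> c \<in> A \<Longrightarrow> smooth_on (snd c ` (W \<inter> fst c)) (\<lambda>x. s (chart_inv c x) D c)"
    using s unfolding section_near_def by blast
  let ?W = "snd c ` (W \<inter> fst c)"
  have oW: "open ?W" by (rule section_open[OF W(1) c(1)])
  have sm: "smooth_on ?W ?f" by (rule W(4)[OF D c(1)])
  have pW: "snd c p \<in> ?W" using W c by blast
  have x: "snd c p \<in> chart_image c" using c by (simp add: chart_image_def)
  define N where "N = ?W \<inter> (\<lambda>x. fst (?f x)) -` (- {0})"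
  have N: "open N"
    unfolding N_def by (rule continuous_open_preimage[OF smooth_on_continuous[OF smooth_on_fst[OF oW sm]] oW open_nonzero_real])
  have pN: "snd c p \<in> N" using pW nz by (simp add: N_def chart_inv_snd c)
  have dom: "?G (chart_inv c x) \<in> fst (e0 D c)" "snd (e0 D c) (?G (chart_inv c x)) = (x, nrm (1, 0) (?f x))"
    if "x \<in> N" for x
  proof -
    have q: "chart_inv c x \<in> W" "x \<in> chart_image c" and nz': "fst (?f x) \<noteq> 0"
      using iffD1[OF section_domain_iff[OF c(1)], of x W] that by (simp_all add: N_def)
    show "?G (chart_inv c x) \<in> fst (e0 D c)"
      unfolding pch_dom_iff[OF W(3)[OF q(1)]] using nz' q by (simp add: chart_inv_in inner_prod_def)
    show "snd (e0 D c) (?G (chart_inv c x)) = (x, nrm (1, 0) (?f x))"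
      using pch_coords[OF infinity_Basis, of "s (chart_inv c x)" D c "chart_inv c x"] nz' q
      by (simp add: inner_prod_def snd_chart_inv)
  qed
  have nz': "fst (?f (snd c p)) \<noteq> 0" using nz by (simp add: chart_inv_snd c)
  note pq = parallel_quotient_deriv[OF D c(1) x smooth_on_differentiable[OF sm pW] nz' z]
  have "((\<lambda>x. (x, nrm (1, 0) (?f x))) has_derivative
      (\<lambda>h. (h, frechet_derivative (\<lambda>x. nrm (1, 0) (?f x)) (at (snd c p)) h))) (at (snd c p))"
    by (intro has_derivative_Pair has_derivative_ident has_derivative_frechet pq(2))
  then have d: "((\<lambda>x. snd (e0 D c) (?G (chart_inv c x))) has_derivative
      (\<lambda>h. (h, frechet_derivative (\<lambda>x. nrm (1, 0) (?f x)) (at (snd c p)) h))) (at (snd c p))"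
    by (rule has_derivative_transform_within_open[OF _ N pN]) (simp add: dom)
  have Gp: "?G p \<in> fst (e0 D c)" using dom(1)[OF pN] by (simp add: chart_inv_snd c)
  note tm = tangent_map_in[OF PA.atlas_axioms c e0_in[OF D c(1)] _ v N pN _ d]
  show "tangent_map A PAt ?G p v \<in> tangent_space PAt (?G p)" by (rule tm(1)) (use Gp dom in auto)
  have "tangent_map A PAt ?G p v (e0 D c) = (v c, frechet_derivative (\<lambda>x. nrm (1, 0) (?f x)) (at (snd c p)) (v c))"
    by (rule tm(2)) (use Gp dom in auto)
  then show "tangent_map A PAt ?G p v (e0 D c) = (v c, Hor (D c) (snd c p) (nrm (1, 0) (s p D c)) (v c))"
    unfolding pq(1) by (simp add: chart_inv_snd c)
qed

end

section \<open>The tractor metric in fibre coordinates\<close>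

definition sym_schouten :: "('e \<Rightarrow> 'e \<Rightarrow> 'e \<Rightarrow> 'e) \<Rightarrow> 'e::euclidean_space \<Rightarrow> 'e \<Rightarrow> 'e \<Rightarrow> real" where
  "sym_schouten \<Gamma> x u v = (schouten \<Gamma> x u v + schouten \<Gamma> x v u) / 2"

context projective
begin

lemma proj_horizontal_elem:
  assumes D: "D \<in> P" and c: "c \<in> A" "p \<in> fst c" and U: "U \<in> cotractor_fibre A P p" and nz: "fst (U D c) \<noteq> 0"
    and h: "h \<in> proj_horizontal A P (proj (p, U))"
  shows "\<exists>u. h (e0 D c) = (u, Hor (D c) (snd c p) (nrm (1, 0) (U D c)) u)"
proof -
  have pA: "p \<in> points A" using c by (auto simp: points_def)
  have fm: "fst (proj (p, U)) = p" "snd (proj (p, U)) = line U" by (simp_all add: proj_Pair)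
  obtain V w where V: "h = tangent_map (cotractor_atlas A P) PAt proj (p, V) w" "V \<in> line U" "nonzero V"
    "w \<in> horizontal A P p V"
    using h unfolding proj_horizontal_def fm by blast
  obtain s v where s: "w = tangent_map A (cotractor_atlas A P) (\<lambda>q. (q, s q)) p v" "section_near A P p s"
    "s p = V" "v \<in> tangent_space A p"
    "\<And>D c. D \<in> P \<Longrightarrow> c \<in> A \<Longrightarrow> p \<in> fst c \<Longrightarrow> tractor_deriv (D c) (\<lambda>x. s (chart_inv c x) D c) (snd c p) (v c) = 0"
    using V(4) unfolding horizontal_def by blast
  \<comment> \<open>Horizontal vectors may be pushed down from any representative of the line.
    Another representative is a multiple of \<open>U\<close>, and \<open>nrm\<close> does not see
    the factor.\<close>
  obtain r where r: "\<And>D c. V D c = r *\<^sub>R U D c" using line_memE[OF V(2)] by blast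
  have r0: "r \<noteq> 0" using V(3) r by (auto simp: nonzero_def)
  have h: "h = tangent_map A PAt (\<lambda>q. proj (q, s q)) p v"
    using section_proj_tangent[OF s(2,4) pA] V(1) s(1,3) by simp
  have nz': "fst (s p D c) \<noteq> 0" using nz r0 by (simp add: s(3) r)
  note t = section_proj_tangent_chart[OF s(2,4) D c nz' s(5)[OF D c]]
  show ?thesis
    using t(2) nrm_scale[OF r0, of "(1, 0)" "U D c"] unfolding h s(3) r by (intro exI[of _ "v c"]) simp
qed

lemma proj_horizontal_exists:
  assumes D: "D \<in> P" and c: "c \<in> A" "p \<in> fst c" and U: "U \<in> cotractor_fibre A P p" and nz: "fst (U D c) \<noteq> 0"
  shows "\<exists>h. h \<in> proj_horizontal A P (proj (p, U)) \<and> h \<in> tangent_space PAt (proj (p, U))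
    \<and> h (e0 D c) = (u, Hor (D c) (snd c p) (nrm (1, 0) (U D c)) u)"
proof -
  have pA: "p \<in> points A" using c by (auto simp: points_def)
  let ?v = "coord_vec A c p u"
  have v: "?v \<in> tangent_space A p" "?v c = u" using c by (simp_all add: coord_vec_in coord_vec_self)
  obtain s where s: "section_near A P p s" "s p = U" "\<And>E d. E \<in> P \<Longrightarrow> d \<in> A \<Longrightarrow> p \<in> fst d \<Longrightarrow>
        tractor_deriv (E d) (\<lambda>x. s (chart_inv d x) E d) (snd d p) (?v d) = 0"
    using parallel_section_exists[OF D c U] v(1) by blast
  have nz': "fst (s p D c) \<noteq> 0" using nz by (simp add: s(2))
  note t = section_proj_tangent_chart[OF s(1) v(1) D c nz' s(3)[OF D c]]
  let ?w = "tangent_map A (cotractor_atlas A P) (\<lambda>q. (q, s q)) p ?v"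
  have w: "?w \<in> horizontal A P p U"
    unfolding horizontal_def using s v(1) by blast
  have nU: "nonzero U" using nonzero_iff[OF U D c] nz by auto
  show ?thesis
  proof (intro exI conjI)
    show "tangent_map (cotractor_atlas A P) PAt proj (p, U) ?w \<in> proj_horizontal A P (proj (p, U))"
      unfolding proj_horizontal_def proj_Pair fst_conv snd_conv using line_self nU w by blast
    show "tangent_map (cotractor_atlas A P) PAt proj (p, U) ?w \<in> tangent_space PAt (proj (p, U))"
      using section_proj_tangent[OF s(1) v(1) pA] t(1) s(2) by simp
    show "tangent_map (cotractor_atlas A P) PAt proj (p, U) ?w (e0 D c)
      = (u, Hor (D c) (snd c p) (nrm (1, 0) (U D c)) u)"
      using section_proj_tangent[OF s(1) v(1) pA] t(2) s(2) v(2) by simp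
  qed
qed

lemma cotangent_supported:
  "\<eta> \<in> cotangent_space A p \<Longrightarrow> \<not> (d \<in> A \<and> p \<in> fst d) \<Longrightarrow> \<eta> d = 0"
  unfolding cotangent_space_def supported_at_def by blast

lemma weighted_cotractor_eq:
  assumes D: "D \<in> P" and c: "c \<in> A" "p \<in> fst c" and U: "U \<in> cotractor_fibre A P p"
    and \<eta>: "\<eta> \<in> cotangent_space A p"
  shows "weighted_cotractor P (tau P U) \<eta> = mk_cotractor D c p (0, fst (U D c) *\<^sub>R \<eta> c)"
proof (intro ext)
  fix E d
  show "weighted_cotractor P (tau P U) \<eta> E d = mk_cotractor D c p (0, fst (U D c) *\<^sub>R \<eta> c) E d"
  proof (cases "E \<in> P \<and> d \<in> A \<and> p \<in> fst d")
    case True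
    then have E: "E \<in> P" and d: "d \<in> A" "p \<in> fst d" by auto
    have "tau P U d = weight_one c d p * fst (U D c)"
      using tau_eq[OF U D d] fibre_chart_change(1)[OF U D c(1) d(1) c(2) d(2)] by simp
    then show ?thesis
      using True covector_change[OF \<eta> c(1) d(1) c(2) d(2)]
        linear_scale[OF adjoint_linear[OF linear_dtransition[OF d(1) c(1) d(2) c(2)]]]
      by (simp add: weighted_cotractor_def mk_cotractor_def ctr_def)
  next
    case False
    then show ?thesis
      using cotangent_supported[OF \<eta>, of d] by (auto simp: weighted_cotractor_def mk_cotractor_def zero_prod_def)
  qed
qed

text \<open>Adding multiples of \<open>\<tau>(U) \<eta>\<close> to \<open>U\<close> fixes the first
  slot and moves the quotient of the slots along a straight line with velocity
  \<open>\<eta>\<close>; the factor \<open>\<tau>(U)\<close> makes this independent of the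
  representative.\<close>

lemma vertical_chart:
  assumes D: "D \<in> P" and c: "c \<in> A" "p \<in> fst c" and U: "U \<in> cotractor_fibre A P p" and nz: "fst (U D c) \<noteq> 0"
    and \<eta>: "\<eta> \<in> cotangent_space A p"
  defines "w \<equiv> vertical_vec A P p U (weighted_cotractor P (tau P U) \<eta>)"
  shows "w \<in> tangent_space PAt (proj (p, U))" "w (e0 D c) = (0, \<eta> c)"
proof -
  let ?B = "mk_cotractor D c p (0, fst (U D c) *\<^sub>R \<eta> c)"
  let ?V = "\<lambda>t. (\<lambda>E d. U E d + t *\<^sub>R ?B E d)"
  define \<gamma> where "\<gamma> t = proj (p, ?V t)" for t
  have V: "?V t = mk_cotractor D c p (U D c + t *\<^sub>R (0, fst (U D c) *\<^sub>R \<eta> c))" for t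
    using cotractor_eq_mk[OF U D c] unfolding mk_cotractor_add[OF c] mk_cotractor_scale[OF c] by simp
  have Vin: "?V t \<in> cotractor_fibre A P p" for t unfolding V by (rule mk_cotractor_in[OF D c])
  have VD: "?V t D c = (fst (U D c), snd (U D c) + (t * fst (U D c)) *\<^sub>R \<eta> c)" for t
    by (simp add: mk_cotractor_self[OF D c] prod_eq_iff)
  have dom: "\<gamma> t \<in> fst (e0 D c)" for t
    unfolding \<gamma>_def pch_dom_iff[OF Vin] VD using c nz by (simp add: inner_prod_def)
  have co: "snd (e0 D c) (\<gamma> t) = (snd c p, nrm (1, 0) (U D c) + t *\<^sub>R \<eta> c)" for t
  proof -
    have "snd (e0 D c) (\<gamma> t) = (snd c p, nrm (1, 0) (?V t D c))"
      unfolding \<gamma>_def by (rule pch_coords[OF infinity_Basis]) (simp only: VD, simp add: inner_prod_def nz)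
    then show ?thesis unfolding VD using nz by (simp add: nrm_infinity scaleR_add_right)
  qed
  have "((\<lambda>t. (snd c p, nrm (1, 0) (U D c) + t *\<^sub>R \<eta> c)) has_vector_derivative (0, \<eta> c)) (at 0)"
    unfolding has_vector_derivative_def
    by (rule has_derivative_eq_rhs, rule has_derivative_Pair, rule has_derivative_const,
        rule has_derivative_add, rule has_derivative_const, rule has_derivative_scaleR_left, rule has_derivative_ident)
       (simp add: fun_eq_iff)
  then have d: "((\<lambda>t. snd (e0 D c) (\<gamma> t)) has_vector_derivative (0, \<eta> c)) (at 0)"
    unfolding co .
  have w: "w = velocity PAt \<gamma>"
    unfolding w_def vertical_vec_def weighted_cotractor_eq[OF D c U \<eta>] \<gamma>_def ..
  note vel = PA.velocity_in[OF e0_in[OF D c(1)] open_UNIV UNIV_I dom d]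
  have "\<gamma> 0 = proj (p, U)" by (simp add: \<gamma>_def)
  then show "w \<in> tangent_space PAt (proj (p, U))" "w (e0 D c) = (0, \<eta> c)"
    using vel unfolding w by simp_all
qed

definition mk_covector :: "('a, real^'n) chart \<Rightarrow> 'a \<Rightarrow> real^'n \<Rightarrow> ('a, real^'n) tensor" where
  "mk_covector c p a = (\<lambda>d. if d \<in> A \<and> p \<in> fst d then adjoint (dtransition d c p) a else 0)"

lemma mk_covector_in: "c \<in> A \<Longrightarrow> p \<in> fst c \<Longrightarrow> mk_covector c p a \<in> cotangent_space A p"
  unfolding cotangent_space_def supported_at_def
  by (auto simp: mk_covector_def adjoint_dtransition dtransition_trans)

lemma mk_covector_self: "c \<in> A \<Longrightarrow> p \<in> fst c \<Longrightarrow> mk_covector c p a c = a"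
  by (rule inner_eqI) (simp add: mk_covector_def adjoint_dtransition dtransition_refl)

lemma covector_eqI:
  assumes "\<eta> \<in> cotangent_space A p" "\<theta> \<in> cotangent_space A p" "c \<in> A" "p \<in> fst c" "\<eta> c = \<theta> c"
  shows "\<eta> = \<theta>"
proof
  fix d show "\<eta> d = \<theta> d"
    using covector_change[OF assms(1,3), of d] covector_change[OF assms(2,3), of d]
      cotangent_supported[OF assms(1), of d] cotangent_supported[OF assms(2), of d] assms(4,5)
    by (cases "d \<in> A \<and> p \<in> fst d") auto
qed

text \<open>Existence: subtract from \<open>w\<close> the horizontal vector with the same base
  component. Uniqueness: a vertical vector has no base component, so that of \<open>w\<close> fixes
  the horizontal part in the chart \<open>e0 D c\<close>, and the rest fixes the covector.\<close>

lemma Pi_V_chart: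
  assumes D: "D \<in> P" and c: "c \<in> A" "p \<in> fst c" and U: "U \<in> cotractor_fibre A P p" and nz: "fst (U D c) \<noteq> 0"
    and w: "w \<in> tangent_space PAt (proj (p, U))"
  shows "Pi_V A P (proj (p, U)) w \<in> cotangent_space A p"
    and "Pi_V A P (proj (p, U)) w c
      = snd (w (e0 D c)) - Hor (D c) (snd c p) (nrm (1, 0) (U D c)) (fst (w (e0 D c)))"
proof -
  let ?m = "proj (p, U)" and ?e = "e0 D c"
  let ?H = "Hor (D c) (snd c p) (nrm (1, 0) (U D c))"
  let ?vert = "\<lambda>V \<eta>. vertical_vec A P p V (weighted_cotractor P (tau P V) \<eta>)"
  have fm: "fst ?m = p" "snd ?m = line U" by (simp_all add: proj_Pair)
  have em: "?m \<in> fst ?e" unfolding pch_dom_iff[OF U] using c nz by (simp add: inner_prod_def)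
  define \<eta> where "\<eta> = mk_covector c p (snd (w ?e) - ?H (fst (w ?e)))"
  have \<eta>: "\<eta> \<in> cotangent_space A p" "\<eta> c = snd (w ?e) - ?H (fst (w ?e))"
    unfolding \<eta>_def using c by (simp_all add: mk_covector_in mk_covector_self)
  have "Pi_V A P ?m w = \<eta>"
    unfolding Pi_V_def fm
  proof (rule the_equality)
    have "\<exists>h. h \<in> proj_horizontal A P ?m \<and> h \<in> tangent_space PAt ?m \<and> h ?e = (fst (w ?e), ?H (fst (w ?e)))"
      by (rule proj_horizontal_exists[where D = D and c = c and p = p and U = U, OF D c U nz])
    then obtain h where "h \<in> proj_horizontal A P ?m \<and> h \<in> tangent_space PAt ?m
      \<and> h ?e = (fst (w ?e), ?H (fst (w ?e)))" ..
    then have h: "h \<in> proj_horizontal A P ?m" "h \<in> tangent_space PAt ?m"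
      "h ?e = (fst (w ?e), ?H (fst (w ?e)))" by simp_all
    note vc = vertical_chart[where D = D and c = c and p = p and U = U, OF D c U nz \<eta>(1)]
    have "w = (\<lambda>e. h e + ?vert U \<eta> e)"
      by (rule PA.tangent_space_eqI[OF w PA.tangent_space_add[OF h(2) vc(1) e0_in[OF D c(1)] em] e0_in[OF D c(1)] em])
        (simp add: h(3) vc(2) \<eta>(2))
    moreover have "nonzero U" using nonzero_iff[OF U D c] nz by auto
    ultimately show "\<eta> \<in> cotangent_space A p \<and> (\<exists>h\<in>proj_horizontal A P ?m. \<exists>V\<in>line U. nonzero V \<and>
        w = (\<lambda>e. h e + ?vert V \<eta> e))"
      using \<eta>(1) h(1) line_self[of U] by blast
    fix \<theta> assume "\<theta> \<in> cotangent_space A p \<and> (\<exists>h\<in>proj_horizontal A P ?m. \<exists>V\<in>line U. nonzero V \<and>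
        w = (\<lambda>e. h e + ?vert V \<theta> e))"
    then obtain h V where \<theta>: "\<theta> \<in> cotangent_space A p" and h: "h \<in> proj_horizontal A P ?m"
      and V: "V \<in> line U" "nonzero V" and we: "w = (\<lambda>e. h e + ?vert V \<theta> e)" by blast
    obtain u where u: "h ?e = (u, ?H u)"
      using proj_horizontal_elem[where D = D and c = c and p = p and U = U, OF D c U nz h] ..
    have VF: "V \<in> cotractor_fibre A P p" by (rule fibre_line[OF U V(1) c])
    \<comment> \<open>The representative \<open>V\<close> need not be \<open>U\<close>, but the
      density \<open>\<tau>(V)\<close> scales along with \<open>V\<close>, and the vertical
      component is still the covector itself.\<close>
    obtain r where r: "\<And>D c. V D c = r *\<^sub>R U D c" using line_memE[OF V(1)] by blast
    have "r \<noteq> 0" using V(2) r by (auto simp: nonzero_def)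
    then have "fst (V D c) \<noteq> 0" using nz by (simp add: r)
    from vertical_chart(2)[where D = D and c = c and p = p and U = V, OF D c VF this \<theta>] have "w ?e = (u, ?H u + \<theta> c)"
      using u by (simp add: we)
    then have "\<theta> c = \<eta> c" by (simp add: \<eta>(2))
    then show "\<theta> = \<eta>" by (rule covector_eqI[OF \<theta> \<eta>(1) c])
  qed
  then show "Pi_V A P ?m w \<in> cotangent_space A p" "Pi_V A P ?m w c = snd (w ?e) - ?H (fst (w ?e))"
    using \<eta> by simp_all
qed

lemma fst_PT: "fst (PT D c x w) = chart_inv c x"
  by (simp add: PT_def proj_Pair)

lemma Pi_H_chart:
  assumes D: "D \<in> P" and c: "c \<in> A" "p \<in> fst c" and U: "U \<in> cotractor_fibre A P p" and nz: "fst (U D c) \<noteq> 0"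
    and w: "w \<in> tangent_space PAt (proj (p, U))"
  shows "Pi_H A P (proj (p, U)) w \<in> tangent_space A p"
    and "Pi_H A P (proj (p, U)) w c = fst (w (e0 D c))"
proof -
  let ?m = "proj (p, U)" and ?e = "e0 D c"
  have em: "?m \<in> fst ?e" unfolding pch_dom_iff[OF U] using c nz by (simp add: inner_prod_def)
  have fm: "fst ?m = p" by (simp add: proj_Pair)
  let ?N = "chart_image ?e"
  have im: "?N = chart_image c \<times> UNIV" by (rule pch_image[OF D c(1) infinity_Basis])
  have N: "open ?N" "snd ?e ?m \<in> ?N"
    using PA.open_chart_image[OF e0_in[OF D c(1)]] em by (auto simp: chart_image_def)
  have f: "fst (chart_inv ?e z) = chart_inv c (fst z)" "fst z \<in> chart_image c" if "z \<in> ?N" for z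
    using pch_inv[OF D c(1) infinity_Basis, of "fst z" "snd z"] that unfolding im by (auto simp: fst_PT)
  have "(fst has_derivative fst) (at (snd ?e ?m))"
    using has_derivative_fst[OF has_derivative_ident] by blast
  then have d: "((\<lambda>z. snd c (fst (chart_inv ?e z))) has_derivative fst) (at (snd ?e ?m))"
    by (rule has_derivative_transform_within_open[OF _ N]) (simp add: f snd_chart_inv)
  have Fm: "fst ?m \<in> fst c" unfolding fm by (rule c(2))
  have Nin: "fst (chart_inv ?e z) \<in> fst c" if "z \<in> ?N" for z
    using f[OF that] by (simp add: chart_inv_in)
  note tm = PA.tangent_map_in[OF atlas_axioms e0_in[OF D c(1)] em c(1) Fm w N Nin d]
  show "Pi_H A P ?m w \<in> tangent_space A p" "Pi_H A P ?m w c = fst (w ?e)"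
    using tm unfolding Pi_H_def fm by simp_all
qed

text \<open>Each of the two pairings contributes minus a horizontal component. Symmetrising them
  removes the antisymmetric part of the Schouten tensor, hence \<open>sym_schouten\<close>.\<close>

lemma tractor_metric_chart:
  assumes D: "D \<in> P" and c: "c \<in> A" and m: "m \<in> fst (e0 D c)"
    and w: "w1 \<in> tangent_space PAt m" "w2 \<in> tangent_space PAt m"
  shows "tractor_metric A P m w1 w2
    = model_metric (D c) (sym_schouten (D c)) (snd (e0 D c) m) (w1 (e0 D c)) (w2 (e0 D c))"
proof -
  obtain p U where U: "m = proj (p, U)" "p \<in> fst c" "U \<in> cotractor_fibre A P p" "fst (U D c) \<noteq> 0"
    using m unfolding pch_dom by (auto simp: inner_prod_def)
  have x: "snd c p \<in> chart_image c" using U by (simp add: chart_image_def)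
  interpret D: smooth_conn "chart_image c" "D c" by (rule smooth_conn[OF D c])
  let ?\<xi> = "nrm (1, 0) (U D c)" and ?e = "e0 D c" and ?x = "snd c p"
  have co: "snd ?e m = (?x, ?\<xi>)"
    unfolding U(1) by (rule pch_coords[OF infinity_Basis]) (simp add: inner_prod_def U(4))
  have fm: "fst m = p" by (simp add: U(1) proj_Pair)
  have con: "contract A p (Pi_H A P m w) (Pi_V A P m w')
    = (snd (w' ?e) - Hor (D c) ?x ?\<xi> (fst (w' ?e))) \<bullet> fst (w ?e)"
    if "w \<in> tangent_space PAt m" "w' \<in> tangent_space PAt m" for w w'
    using contract_eq[OF Pi_H_chart(1)[where D = D and c = c and p = p and U = U, OF D c U(2-4) that(1)[unfolded U(1)]]
        Pi_V_chart(1)[where D = D and c = c and p = p and U = U, OF D c U(2-4) that(2)[unfolded U(1)]] c U(2)]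
      Pi_H_chart(2)[where D = D and c = c and p = p and U = U, OF D c U(2-4) that(1)[unfolded U(1)]] Pi_V_chart(2)[where D = D and c = c and p = p and U = U, OF D c U(2-4) that(2)[unfolded U(1)]]
    unfolding U(1) by simp
  show ?thesis
    unfolding tractor_metric_def fm con[OF w(1,2)] con[OF w(2,1)] co model_metric_def model_tensor_def sym_schouten_def
    by (simp add: inner_diff_left Hor_inner[OF D c x] D.sym[OF x, of "fst (w2 ?e)" "fst (w1 ?e)"] field_simps)
qed

lemma fibre_model_schouten:
  assumes D: "D \<in> P" and c: "c \<in> A"
  shows "fibre_model (chart_image c) (D c) (sym_schouten (D c))"
proof -
  interpret D: smooth_conn "chart_image c" "D c" by (rule smooth_conn[OF D c])
  show ?thesis
  proof
    fix x assume x: "x \<in> chart_image c"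
    note ls = bilinear_linear[OF D.bilinear_schouten[OF x]]
    show "bilinear (sym_schouten (D c) x)"
      unfolding bilinear_def sym_schouten_def
      by (auto intro!: linearI simp: linear_add[OF ls(1)] linear_add[OF ls(2)] linear_scale[OF ls(1)]
          linear_scale[OF ls(2)] algebra_simps add_divide_distrib)
  next
    show "smooth_on (chart_image c) (\<lambda>x. sym_schouten (D c) x u v)" for u v
      unfolding sym_schouten_def
      by (intro smooth_on_divide[OF D.open_S] smooth_on_add[OF D.open_S] D.smooth_schouten)
  qed (auto simp: D.open_S D.bil D.sym D.smooth sym_schouten_def)
qed

text \<open>In the sum of the Schouten tensor and its transpose the part with factor 1/(n+1)
  cancels; n \<ge> 2 makes n - 1 invertible. This is the hypothesis of
  \<open>ricci_LC\<close>.\<close>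

lemma sym_schouten_ricci:
  fixes \<Gamma> :: "real^'n \<Rightarrow> real^'n \<Rightarrow> real^'n \<Rightarrow> real^'n"
  shows "2 * (real DIM(real^'n) - 1) * sym_schouten \<Gamma> x u v = ricci \<Gamma> x u v + ricci \<Gamma> x v u"
proof -
  define K L R S where "K = real DIM(real^'n) - 1" and "L = 1 / (real DIM(real^'n) + 1)"
    and "R = ricci \<Gamma> x u v" and "S = ricci \<Gamma> x v u"
  have K: "K \<noteq> 0" using dim2 by (simp add: K_def)
  have "sym_schouten \<Gamma> x u v
      = (1 / K * ((R + S) / 2) + L * ((R - S) / 2) + (1 / K * ((S + R) / 2) + L * ((S - R) / 2))) / 2"
    unfolding sym_schouten_def schouten_def K_def L_def R_def S_def ..
  then have "K * (2 * K * sym_schouten \<Gamma> x u v) = K * (R + S)"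
    using K by (simp add: field_simps)
  then show ?thesis
    unfolding K_def[symmetric] R_def[symmetric] S_def[symmetric] using K by simp
qed

section \<open>Neutrality and the Einstein equation outside the zero locus\<close>

lemma metric_coords_e0:
  assumes D: "D \<in> P" and c: "c \<in> A" and z: "z \<in> chart_image (e0 D c)"
  shows "metric_coords PAt (tractor_metric A P) (e0 D c) z a b = model_metric (D c) (sym_schouten (D c)) z a b"
proof -
  let ?m = "chart_inv (e0 D c) z"
  have m: "?m \<in> fst (e0 D c)" by (rule chart_inv_in[OF z])
  note e = e0_in[OF D c]
  show ?thesis
    unfolding metric_coords_def
    using tractor_metric_chart[OF D c m PA.coord_vec_in[OF e m] PA.coord_vec_in[OF e m], of a b]
    by (simp add: PA.coord_vec_self[OF e m] snd_chart_inv[OF z])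
qed

text \<open>The model chart keeps \<open>D\<close> and \<open>c\<close> of the given chart; only
  \<open>b\<close> is replaced by \<open>(1, 0)\<close>. No two connections of the class have to be
  compared for the curvature.\<close>

lemma atlas_model_e0:
  assumes D: "D \<in> P" and c: "c \<in> A" and b: "b \<in> Basis"
  shows "atlas_model PAt (tractor_metric A P) (pch D c b) (e0 D c) (model_metric (D c) (sym_schouten (D c)))
    (fibre_model.LC (D c) (sym_schouten (D c))) (2 * (real CARD('n) + 1))"
proof -
  interpret M: fibre_model "chart_image c" "D c" "sym_schouten (D c)" by (rule fibre_model_schouten[OF D c])
  have im: "chart_image (e0 D c) = chart_image c \<times> UNIV" by (rule pch_image[OF D c infinity_Basis])
  have "pch D c b \<in> PAt" unfolding PAt_iff using D c b by blast
  then show ?thesis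
  proof (intro atlas_model.intro atlas_model_axioms.intro PA.atlas_axioms e0_in[OF D c])
    fix y assume y: "y \<in> chart_image (e0 D c)"
    then have yZ: "y \<in> chart_image c \<times> UNIV" by (simp add: im)
    show "metric_coords PAt (tractor_metric A P) (e0 D c) y u v = model_metric (D c) (sym_schouten (D c)) y u v" for u v
      by (rule metric_coords_e0[OF D c y])
    show "neutral_form (M.G y)" by (rule M.neutral_G[OF yZ])
    show "M.G y (M.LC y u v) z = koszul M.G y u v z" for u v z by (rule M.koszul_G[OF yZ])
    show "bilinear (M.LC y)" by (rule M.bil_LC[OF yZ])
    show "ricci M.LC y u v = 2 * (real CARD('n) + 1) * M.G y u v" for u v
      using M.ricci_LC[OF yZ sym_schouten_ricci, of u v] by simp
  qed (auto simp: im M.smooth_G M.smooth_LC)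
qed

lemma pch_MZ_overlap:
  assumes "D \<in> P" "c \<in> A" shows "snd (pch D c b) ` (fst (pch D c b) \<inter> MZ) = overlap (pch D c b) (e0 D c)"
  by (simp add: overlap_def MZ_chart[OF assms])

lemma neutral_metric_MZ: "neutral_metric_on PAt MZ (tractor_metric A P)"
  unfolding neutral_metric_on_def
proof (intro ballI conjI allI)
  fix e assume "e \<in> PAt"
  then obtain D c b where e: "D \<in> P" "c \<in> A" "b \<in> Basis" "e = pch D c b" unfolding PAt_iff by blast
  interpret M: atlas_model PAt "tractor_metric A P" "pch D c b" "e0 D c" "model_metric (D c) (sym_schouten (D c))"
    "fibre_model.LC (D c) (sym_schouten (D c))" "2 * (real CARD('n) + 1)"
    by (rule atlas_model_e0[OF e(1-3)])
  show "neutral_form (metric_coords PAt (tractor_metric A P) e x)" if "x \<in> snd e ` (fst e \<inter> MZ)" for x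
    using M.neutral_c that pch_MZ_overlap[OF e(1,2)] unfolding e(4) by blast
  show "smooth_on (snd e ` (fst e \<inter> MZ)) (\<lambda>x. metric_coords PAt (tractor_metric A P) e x u v)" for u v
    using M.smooth_c unfolding e(4) pch_MZ_overlap[OF e(1,2)] .
qed

lemma einstein_MZ: "einstein_on PAt MZ (tractor_metric A P)"
  unfolding einstein_on_def
proof (intro exI ballI allI)
  fix e x u v assume "e \<in> PAt" and x: "x \<in> snd e ` (fst e \<inter> MZ)"
  then obtain D c b where e: "D \<in> P" "c \<in> A" "b \<in> Basis" "e = pch D c b" unfolding PAt_iff by blast
  interpret M: atlas_model PAt "tractor_metric A P" "pch D c b" "e0 D c" "model_metric (D c) (sym_schouten (D c))"
    "fibre_model.LC (D c) (sym_schouten (D c))" "2 * (real CARD('n) + 1)"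
    by (rule atlas_model_e0[OF e(1-3)])
  show "ricci (levi_civita (metric_coords PAt (tractor_metric A P) e)) x u v
      = 2 * (real CARD('n) + 1) * metric_coords PAt (tractor_metric A P) e x u v"
    using M.einstein_c x unfolding e(4) pch_MZ_overlap[OF e(1,2)] by blast
qed

lemma scalar_curvature_MZ:
  assumes "e \<in> PAt" and x: "x \<in> snd e ` (fst e \<inter> MZ)"
  shows "scalar_curvature (metric_coords PAt (tractor_metric A P) e) x \<noteq> 0"
proof -
  obtain D c b where e: "D \<in> P" "c \<in> A" "b \<in> Basis" "e = pch D c b" using assms(1) unfolding PAt_iff by blast
  interpret M: atlas_model PAt "tractor_metric A P" "pch D c b" "e0 D c" "model_metric (D c) (sym_schouten (D c))"
    "fibre_model.LC (D c) (sym_schouten (D c))" "2 * (real CARD('n) + 1)"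
    by (rule atlas_model_e0[OF e(1-3)])
  have "x \<in> overlap (pch D c b) (e0 D c)" using x unfolding e(4) pch_MZ_overlap[OF e(1,2)] .
  from M.scalar_curvature_c[OF this] show ?thesis unfolding e(4) by simp
qed

end

section \<open>The identification with the cotangent bundle\<close>

context projective
begin

abbreviation CTA where "CTA \<equiv> cotangent_atlas A"
abbreviation cch where "cch \<equiv> cotangent_chart A"

lemma cch_inj:
  assumes c: "c \<in> A" shows "inj_on (snd (cch c)) (fst (cch c))"
proof (rule inj_onI)
  fix a b assume a: "a \<in> fst (cch c)" and b: "b \<in> fst (cch c)" and e: "snd (cch c) a = snd (cch c) b"
  obtain p \<xi> q \<eta> where ab: "a = (p, \<xi>)" "b = (q, \<eta>)" by (metis prod.exhaust)
  have U: "p \<in> fst c" "\<xi> \<in> cotangent_space A p" "q \<in> fst c" "\<eta> \<in> cotangent_space A q"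
    using a b unfolding ab by (simp_all add: cotangent_chart_def)
  have "snd c p = snd c q" "\<xi> c = \<eta> c" using e unfolding ab by (simp_all add: cotangent_chart_def)
  then show "a = b"
    using inj_onD[OF inj_chart[OF c], of p q] U covector_eqI[of \<xi> p \<eta> c] c by (simp add: ab)
qed

lemma cch_point:
  assumes c: "c \<in> A" and x: "x \<in> chart_image c"
  shows "(chart_inv c x, mk_covector c (chart_inv c x) a) \<in> fst (cch c)"
    "snd (cch c) (chart_inv c x, mk_covector c (chart_inv c x) a) = (x, a)"
  using assms by (simp_all add: cotangent_chart_def chart_inv_in mk_covector_in mk_covector_self snd_chart_inv)

lemma cch_inv:
  assumes c: "c \<in> A" and x: "x \<in> chart_image c"
  shows "chart_inv (cch c) (x, a) = (chart_inv c x, mk_covector c (chart_inv c x) a)"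
proof -
  let ?a = "(chart_inv c x, mk_covector c (chart_inv c x) a)"
  have "chart_inv (cch c) (snd (cch c) ?a) = ?a"
    unfolding chart_inv_def[of "cch c"] by (rule inv_into_f_f[OF cch_inj[OF c] cch_point(1)[OF assms]])
  then show ?thesis by (simp only: cch_point(2)[OF assms])
qed

lemma cch_dom_iff: "(p, \<xi>) \<in> fst (cch c) \<longleftrightarrow> p \<in> fst c \<and> \<xi> \<in> cotangent_space A p"
  by (simp add: cotangent_chart_def)

lemma cch_coords: "snd (cch c) (p, \<xi>) = (snd c p, \<xi> c)"
  by (simp add: cotangent_chart_def)

lemma cch_overlap:
  assumes c: "c \<in> A"
  shows "snd (cch c) ` (fst (cch c) \<inter> W) = {z \<in> chart_image c \<times> UNIV. chart_inv (cch c) z \<in> W}"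
proof (intro set_eqI iffI)
  fix z assume "z \<in> snd (cch c) ` (fst (cch c) \<inter> W)"
  then obtain a where a: "a \<in> fst (cch c)" "a \<in> W" "z = snd (cch c) a" by blast
  then have "chart_inv (cch c) z = a"
    using cch_inj[OF c] by (simp add: chart_inv_def)
  moreover have "z \<in> chart_image c \<times> UNIV"
    using a unfolding cotangent_chart_def chart_image_def by auto
  ultimately show "z \<in> {z \<in> chart_image c \<times> UNIV. chart_inv (cch c) z \<in> W}" using a by simp
next
  fix z assume z: "z \<in> {z \<in> chart_image c \<times> UNIV. chart_inv (cch c) z \<in> W}"
  obtain x a where xa: "z = (x, a)" by (cases z)
  have x: "x \<in> chart_image c" using z xa by simp
  have "chart_inv (cch c) z \<in> W" using z by simp
  then have "chart_inv (cch c) z \<in> fst (cch c) \<inter> W" "snd (cch c) (chart_inv (cch c) z) = z"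
    using cch_point[OF c x] unfolding xa cch_inv[OF c x] by simp_all
  then show "z \<in> snd (cch c) ` (fst (cch c) \<inter> W)" by (metis imageI)
qed

lemma cch_image: "c \<in> A \<Longrightarrow> chart_image (cch c) = chart_image c \<times> UNIV"
  using cch_overlap[of c UNIV] by (auto simp: chart_image_def[of "cch c"])

lemma smooth_atlas_CTA: "smooth_atlas CTA"
  unfolding smooth_atlas_def
proof (intro conjI ballI)
  fix C assume "C \<in> CTA"
  then obtain c where c: "c \<in> A" "C = cch c" unfolding cotangent_atlas_def by blast
  show "inj_on (snd C) (fst C)" "open (chart_image C)"
    using c by (simp_all add: cch_inj cch_image open_Times open_chart_image)
  fix C' assume "C' \<in> CTA"
  then obtain d where d: "d \<in> A" "C' = cch d" unfolding cotangent_atlas_def by blast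
  interpret cc: coord_change "overlap c d" "overlap d c" "transition c d" "transition d c"
    by (rule coord_change[OF c(1) d(1)])
  let ?Z = "overlap c d \<times> (UNIV :: (real^'n) set)"
  have eq: "snd C ` (fst C \<inter> fst C') = overlap c d \<times> UNIV"
  proof -
    have "(x, a) \<in> {z \<in> chart_image c \<times> UNIV. chart_inv (cch c) z \<in> fst (cch d)} \<longleftrightarrow> (x, a) \<in> overlap c d \<times> UNIV" for x a
      using cch_inv[OF c(1), of x a] overlap_iff[OF c(1), of x d]
      by (auto simp: cch_dom_iff mk_covector_in c(1) chart_inv_in)
    then have "z \<in> {z \<in> chart_image c \<times> UNIV. chart_inv (cch c) z \<in> fst (cch d)} \<longleftrightarrow> z \<in> overlap c d \<times> UNIV"
      for z by (cases z) blast
    then show ?thesis unfolding c(2) d(2) cch_overlap[OF c(1)] by (rule set_eqI)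
  qed
  have Z: "open (overlap c d \<times> (UNIV :: (real^'n) set))" by (simp add: open_Times cc.open_S)
  show "open (snd C ` (fst C \<inter> fst C'))" unfolding eq by (rule Z)
  \<comment> \<open>Base points change by the transition map, covectors by the adjoint of the
    inverse Jacobian.\<close>
  let ?h = "\<lambda>z. (transition c d (fst z), adjoint (cc.K (transition c d (fst z))) (snd z))"
  have f: "smooth_on (overlap c d \<times> (UNIV :: (real^'n) set)) (\<lambda>z. transition c d (fst z))"
    by (rule smooth_on_compose[OF Z cc.open_S _ cc.smooth_phi smooth_on_fst[OF Z smooth_on_ident]]) auto
  have "smooth_on ?Z ?h"
  proof (rule smooth_on_Pair[OF Z f], rule smooth_on_adjoint[OF Z])
    show "smooth_on ?Z (\<lambda>z. cc.K (transition c d (fst z)) u)" for u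
      by (rule smooth_on_frechet_derivative[OF Z cc.open_T _ cc.smooth_psi f smooth_on_const])
        (auto simp: cc.phi_in)
    show "linear (cc.K (transition c d (fst z)))" if "z \<in> ?Z" for z
      using that by (intro cc.linear_K cc.phi_in) auto
  qed (rule smooth_on_snd[OF Z smooth_on_ident])
  moreover have "transition C C' z = ?h z" if z: "z \<in> ?Z" for z
  proof -
    obtain x a where xa: "z = (x, a)" "x \<in> overlap c d" using z by auto
    have x: "x \<in> chart_image c" "chart_inv c x \<in> fst d" using xa(2) overlap_iff[OF c(1)] by blast+
    show ?thesis
      using x d(1) c(1) by (simp add: transition_def c(2) d(2) xa(1) cch_inv cch_coords mk_covector_def dtransition_def)
  qed
  ultimately show "smooth_on (snd C ` (fst C \<inter> fst C')) (transition C C')"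
    unfolding eq by (subst smooth_on_cong[OF Z, where g = ?h]) simp_all
qed

sublocale CT: atlas CTA
  by unfold_locales (rule smooth_atlas_CTA)

text \<open>A cotractor with the prescribed pair exists for the density that equals 1 in
  \<open>c\<close>; with any other non-zero density the cotractor is a multiple of it and spans the
  same line.\<close>

lemma iota_eq:
  assumes D: "D \<in> P" and c: "c \<in> A" "p \<in> fst c" and \<xi>: "\<xi> \<in> cotangent_space A p"
  shows "iota A P D (p, \<xi>) = PT D c (snd c p) (1, \<xi> c)"
  unfolding iota_def prod.case
proof (rule the_equality)
  let ?U = "mk_cotractor D c p (1, \<xi> c)"
  have PT: "PT D c (snd c p) (1, \<xi> c) = proj (p, ?U)" by (simp add: PT_def chart_inv_snd c)
  have UF: "?U \<in> cotractor_fibre A P p" by (rule mk_cotractor_in[OF D c])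
  show "\<exists>\<tau> U. \<tau> \<in> density_fibre A p \<and> \<tau> \<noteq> (\<lambda>c. 0) \<and> U \<in> cotractor_fibre A P p \<and>
      (\<forall>c. U D c = (\<tau> c, \<tau> c *\<^sub>R \<xi> c)) \<and> PT D c (snd c p) (1, \<xi> c) = proj (p, U)"
  proof (rule exI[of _ "\<lambda>d. fst (?U D d)"], rule exI[of _ ?U], intro conjI allI)
    show "(\<lambda>d. fst (?U D d)) \<in> density_fibre A p" using UF D unfolding cotractor_fibre_def by blast
    have "fst (?U D c) \<noteq> 0" by (simp add: mk_cotractor_self D c)
    then show "(\<lambda>d. fst (?U D d)) \<noteq> (\<lambda>c. 0)" by metis
    fix d
    show "?U D d = (fst (?U D d), fst (?U D d) *\<^sub>R \<xi> d)"
    proof (cases "d \<in> A \<and> p \<in> fst d")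
      case True
      then have d: "d \<in> A" "p \<in> fst d" by auto
      show ?thesis
        using covector_change[OF \<xi> c(1) d(1) c(2) d(2)]
          linear_scale[OF adjoint_linear[OF linear_dtransition[OF d(1) c(1) d(2) c(2)]]]
        by (simp add: mk_cotractor_def D d ctr_def ups_self c)
    next
      case False
      then show ?thesis by (auto simp: mk_cotractor_def zero_prod_def)
    qed
  qed (fact UF PT)+
  fix m assume "\<exists>\<tau> U. \<tau> \<in> density_fibre A p \<and> \<tau> \<noteq> (\<lambda>c. 0) \<and> U \<in> cotractor_fibre A P p \<and>
      (\<forall>c. U D c = (\<tau> c, \<tau> c *\<^sub>R \<xi> c)) \<and> m = proj (p, U)"
  then obtain \<tau> U where \<tau>: "\<tau> \<in> density_fibre A p" "\<tau> \<noteq> (\<lambda>c. 0)" and U: "U \<in> cotractor_fibre A P p"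
    "\<And>c. U D c = (\<tau> c, \<tau> c *\<^sub>R \<xi> c)" and m: "m = proj (p, U)" by blast
  \<comment> \<open>A density that vanishes in one chart around the point vanishes in all of
    them.\<close>
  have nz: "\<tau> c \<noteq> 0"
  proof
    assume z: "\<tau> c = 0"
    have "\<tau> d = 0" for d
    proof (cases "d \<in> A \<and> p \<in> fst d")
      case True
      then have "\<tau> d = weight_one c d p * \<tau> c" using \<tau>(1) c unfolding density_fibre_def by blast
      then show ?thesis using z by simp
    next
      case False
      then show ?thesis using \<tau>(1) unfolding density_fibre_def supported_at_def by blast
    qed
    then show False using \<tau>(2) by blast
  qed
  have UD: "U D c = \<tau> c *\<^sub>R (1, \<xi> c)" by (simp add: U(2))
  have x: "snd c p \<in> chart_image c" using c by (simp add: chart_image_def)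
  show "m = PT D c (snd c p) (1, \<xi> c)"
    unfolding m PT_cover[OF D c U(1)] UD by (rule PT_scale[OF D c(1) x nz])
qed

text \<open>With respect to \<open>cch c\<close> and \<open>e0 D c\<close> the map is the identity
  of coordinates. Injectivity, smoothness of the inverse and the transport of tangent vectors come
  down to this.\<close>

lemma iota_e0:
  assumes D: "D \<in> P" and c: "c \<in> A" "p \<in> fst c" and \<xi>: "\<xi> \<in> cotangent_space A p"
  shows "iota A P D (p, \<xi>) \<in> fst (e0 D c)" "snd (e0 D c) (iota A P D (p, \<xi>)) = (snd c p, \<xi> c)"
    "fst (iota A P D (p, \<xi>)) = p"
proof -
  have x: "snd c p \<in> chart_image c" using c by (simp add: chart_image_def)
  show "iota A P D (p, \<xi>) \<in> fst (e0 D c)" "snd (e0 D c) (iota A P D (p, \<xi>)) = (snd c p, \<xi> c)"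
    "fst (iota A P D (p, \<xi>)) = p"
    unfolding iota_eq[OF assms]
    using PT_self[OF D c(1) x infinity_Basis, of "(1, \<xi> c)"]
    by (simp_all add: inner_prod_def nrm_infinity fst_PT chart_inv_snd c)
qed

lemma points_CTA: "points CTA = {(p, \<xi>). p \<in> points A \<and> \<xi> \<in> cotangent_space A p}"
  unfolding points_def cotangent_atlas_def cotangent_chart_def by auto

lemma points_OPA: "points (open_submanifold PAt MZ) = MZ"
proof -
  have "points (open_submanifold PAt MZ) = points PAt \<inter> MZ"
    unfolding points_def open_submanifold_def by auto
  then show ?thesis using MZ_sub by blast
qed

lemma iota_surj:
  assumes D: "D \<in> P" and c: "c \<in> A" and m: "m \<in> MZ" "fst m \<in> fst c"
  defines "\<xi> \<equiv> mk_covector c (fst m) (snd (snd (e0 D c) m))"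
  shows "\<xi> \<in> cotangent_space A (fst m)" "iota A P D (fst m, \<xi>) = m" "snd (cch c) (fst m, \<xi>) = snd (e0 D c) m"
proof -
  let ?e = "e0 D c"
  have e: "m \<in> fst ?e" by (rule MZ_in_chart[OF D c m])
  note i = pch_inverse[OF D c infinity_Basis e]
  have fm: "snd c (fst m) = fst (snd ?e m)"
    using arg_cong[OF i(2), of fst] by (metis fst_PT i(1) snd_chart_inv)
  show \<xi>: "\<xi> \<in> cotangent_space A (fst m)" unfolding \<xi>_def by (rule mk_covector_in[OF c m(2)])
  have xc: "\<xi> c = snd (snd ?e m)" unfolding \<xi>_def by (rule mk_covector_self[OF c m(2)])
  show "iota A P D (fst m, \<xi>) = m"
    unfolding iota_eq[OF D c m(2) \<xi>] xc fm using i(2) by (simp add: rep_infinity)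
  show "snd (cch c) (fst m, \<xi>) = snd ?e m"
    by (simp add: cch_coords xc fm)
qed

lemma bij_iota:
  assumes D: "D \<in> P" shows "bij_betw (iota A P D) (points CTA) MZ"
  unfolding bij_betw_def
proof
  show "inj_on (iota A P D) (points CTA)"
  proof (rule inj_onI)
    fix a b assume ab: "a \<in> points CTA" "b \<in> points CTA" and e: "iota A P D a = iota A P D b"
    obtain p \<xi> q \<eta> where pq: "a = (p, \<xi>)" "b = (q, \<eta>)" by (metis prod.exhaust)
    have pA: "p \<in> points A" "q \<in> points A" "\<xi> \<in> cotangent_space A p" "\<eta> \<in> cotangent_space A q"
      using ab unfolding points_CTA pq by simp_all
    obtain c where c: "c \<in> A" "p \<in> fst c" using pA unfolding points_def by blast
    obtain d where d: "d \<in> A" "q \<in> fst d" using pA unfolding points_def by blast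
    have "p = q" using e iota_e0(3)[OF D c pA(3)] iota_e0(3)[OF D d pA(4)] unfolding pq by simp
    then have "\<xi> c = \<eta> c"
      using e iota_e0(2)[OF D c pA(3)] iota_e0(2)[OF D c(1), of q \<eta>] c pA(4) unfolding pq by simp
    then show "a = b" using covector_eqI[OF pA(3) _ c, of \<eta>] pA(4) \<open>p = q\<close> unfolding pq by simp
  qed
  show "iota A P D ` points CTA = MZ"
  proof (intro equalityI subsetI)
    fix m assume "m \<in> iota A P D ` points CTA"
    then obtain p \<xi> where pq: "m = iota A P D (p, \<xi>)" "p \<in> points A" "\<xi> \<in> cotangent_space A p"
      unfolding points_CTA by blast
    obtain c where c: "c \<in> A" "p \<in> fst c" using pq unfolding points_def by blast
    show "m \<in> MZ" using iota_e0(1)[OF D c pq(3)] unfolding pq(1) pch_infinity_MZ[OF D c(1)] by simp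
  next
    fix m assume m: "m \<in> MZ"
    obtain c p U where U: "c \<in> A" "p \<in> fst c" "m = proj (p, U)" using MZ_cover[OF m] by metis
    have fm: "fst m \<in> fst c" using U by (simp add: proj_Pair)
    note s = iota_surj[OF D U(1) m fm]
    have "fst m \<in> points A" using fm U(1) unfolding points_def by blast
    then have "(fst m, mk_covector c (fst m) (snd (snd (e0 D c) m))) \<in> points CTA"
      unfolding points_CTA using s(1) by simp
    then show "m \<in> iota A P D ` points CTA" using s(2) by (metis imageI)
  qed
qed

lemma iota_MZ: "D \<in> P \<Longrightarrow> a \<in> points CTA \<Longrightarrow> iota A P D a \<in> MZ"
  using bij_iota bij_betwE by blast

lemma cch_points: "c \<in> A \<Longrightarrow> fst (cch c) \<subseteq> points CTA"
  unfolding points_def cotangent_atlas_def by blast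

lemma iota_chart_inv:
  assumes D: "D \<in> P" and c: "c \<in> A" and z: "z \<in> chart_image c \<times> UNIV"
  shows "iota A P D (chart_inv (cch c) z) = PT D c (fst z) (1, snd z)"
proof -
  obtain x a where xa: "z = (x, a)" by (cases z)
  have x: "x \<in> chart_image c" using z xa by simp
  have p: "chart_inv c x \<in> fst c" by (rule chart_inv_in[OF x])
  show ?thesis
    using iota_eq[OF D c p mk_covector_in[OF c p], of a]
    by (simp add: xa cch_inv[OF c x] snd_chart_inv[OF x] mk_covector_self[OF c p])
qed

lemma smooth_iota:
  assumes D: "D \<in> P" shows "smooth_map CTA (open_submanifold PAt MZ) (iota A P D)"
  unfolding smooth_map_def
proof (intro ballI)
  fix C e' assume "C \<in> CTA" "e' \<in> open_submanifold PAt MZ"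
  then obtain c E d b where c: "c \<in> A" "C = cch c" and e: "E \<in> P" "d \<in> A" "b \<in> Basis"
    "e' = (fst (pch E d b) \<inter> MZ, snd (pch E d b))"
    unfolding cotangent_atlas_def open_submanifold_def PAt_iff by blast
  let ?Z = "chart_image c \<times> (UNIV :: (real^'n) set)"
  let ?Z' = "{z \<in> ?Z. PT D c (fst z) (1, snd z) \<in> fst (pch E d b)}"
  have Z: "open ?Z" by (simp add: open_Times open_chart_image c)
  have eq: "snd C ` (fst C \<inter> iota A P D -` fst e') = ?Z'"
    unfolding c(2) cch_overlap[OF c(1)]
  proof (rule Collect_cong)
    fix z
    have "iota A P D (chart_inv (cch c) z) \<in> MZ" if z: "z \<in> ?Z"
    proof (rule iota_MZ[OF D subsetD[OF cch_points[OF c(1)]]])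
      show "chart_inv (cch c) z \<in> fst (cch c)" using z cch_image[OF c(1)] by (intro chart_inv_in) simp
    qed
    then show "z \<in> ?Z \<and> chart_inv (cch c) z \<in> iota A P D -` fst e'
        \<longleftrightarrow> z \<in> ?Z \<and> PT D c (fst z) (1, snd z) \<in> fst (pch E d b)"
      using iota_chart_inv[OF D c(1), of z] by (auto simp: e(4))
  qed
  have sub: "fst ` ?Z \<subseteq> chart_image c" by auto
  note pp = proj_param[OF D e(1) c(1) e(2,3) Z smooth_on_fst[OF Z smooth_on_ident] sub
      smooth_on_Pair[OF Z smooth_on_const[of _ 1] smooth_on_snd[OF Z smooth_on_ident]]]
  have "smooth_on ?Z' (snd e' \<circ> iota A P D \<circ> chart_inv C)"
    by (subst smooth_on_cong[OF pp(1), where g = "\<lambda>z. snd (pch E d b) (PT D c (fst z) (1, snd z))"])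
      (use pp(2) iota_chart_inv[OF D c(1)] in \<open>auto simp: c(2) e(4)\<close>)
  then show "open (snd C ` (fst C \<inter> iota A P D -` fst e')) \<and>
      smooth_on (snd C ` (fst C \<inter> iota A P D -` fst e')) (snd e' \<circ> iota A P D \<circ> chart_inv C)"
    unfolding eq using pp(1) by blast
qed

text \<open>Followed by \<open>cch c\<close>, the inverse is the coordinate map of
  \<open>e0 D c\<close>, so its coordinate expression is a transition map of the projectivised
  bundle.\<close>

lemma smooth_iota_inverse:
  assumes D: "D \<in> P" shows "smooth_map (open_submanifold PAt MZ) CTA (inv_into (points CTA) (iota A P D))"
  unfolding smooth_map_def
proof (intro ballI)
  let ?F = "inv_into (points CTA) (iota A P D)"
  fix e' C assume "e' \<in> open_submanifold PAt MZ" "C \<in> CTA"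
  then obtain c E d b where c: "c \<in> A" "C = cch c" and e: "E \<in> P" "d \<in> A" "b \<in> Basis"
    "e' = (fst (pch E d b) \<inter> MZ, snd (pch E d b))"
    unfolding cotangent_atlas_def open_submanifold_def PAt_iff by blast
  let ?e = "pch E d b"
  have eP: "?e \<in> PAt" unfolding PAt_iff using e by blast
  have F: "?F m = (fst m, mk_covector c (fst m) (snd (snd (e0 D c) m)))" if "m \<in> MZ" "fst m \<in> fst c" for m
  proof -
    note s = iota_surj[OF D c(1) that]
    have "fst m \<in> points A" using that(2) c(1) unfolding points_def by blast
    then have "(fst m, mk_covector c (fst m) (snd (snd (e0 D c) m))) \<in> points CTA"
      unfolding points_CTA using s(1) by simp
    from inv_into_f_f[OF bij_betw_imp_inj_on[OF bij_iota[OF D]] this] show ?thesis unfolding s(2) .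
  qed
  have fstF: "fst (?F m) = fst m" if m: "m \<in> MZ" for m
  proof -
    have "m \<in> iota A P D ` points CTA" using m bij_betw_imp_surj_on[OF bij_iota[OF D]] by simp
    then have "?F m \<in> points CTA" "iota A P D (?F m) = m" by (rule inv_into_into, rule f_inv_into_f)
    then obtain p \<xi> where p: "?F m = (p, \<xi>)" "p \<in> points A" "\<xi> \<in> cotangent_space A p" unfolding points_CTA by blast
    obtain c where c: "c \<in> A" "p \<in> fst c" using p(2) unfolding points_def by blast
    show ?thesis using iota_e0(3)[OF D c p(3)] \<open>iota A P D (?F m) = m\<close> p(1) by simp
  qed
  have dom: "m \<in> MZ \<and> ?F m \<in> fst C \<longleftrightarrow> m \<in> fst (e0 D c)" for m
  proof
    assume m: "m \<in> MZ \<and> ?F m \<in> fst C"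
    then have "fst (?F m) \<in> fst c" unfolding c(2) by (cases "?F m") (simp add: cch_dom_iff)
    then show "m \<in> fst (e0 D c)" unfolding pch_infinity_MZ[OF D c(1)] using m fstF by simp
  next
    assume "m \<in> fst (e0 D c)"
    then have m: "m \<in> MZ" "fst m \<in> fst c" unfolding pch_infinity_MZ[OF D c(1)] by auto
    then show "m \<in> MZ \<and> ?F m \<in> fst C"
      using F[OF m] iota_surj(1)[OF D c(1) m] by (simp add: c(2) cch_dom_iff)
  qed
  have eq: "snd e' ` (fst e' \<inter> ?F -` fst C) = overlap ?e (e0 D c)"
  proof -
    have "fst e' \<inter> ?F -` fst C = fst ?e \<inter> fst (e0 D c)"
    proof (rule set_eqI)
      fix m show "m \<in> fst e' \<inter> ?F -` fst C \<longleftrightarrow> m \<in> fst ?e \<inter> fst (e0 D c)"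
        using dom[of m] unfolding e(4) fst_conv by blast
    qed
    then show ?thesis by (simp add: overlap_def e(4))
  qed
  have o: "open (overlap ?e (e0 D c))" by (rule PA.open_overlap[OF eP e0_in[OF D c(1)]])
  have "(snd C \<circ> ?F \<circ> chart_inv e') z = transition ?e (e0 D c) z" if z: "z \<in> overlap ?e (e0 D c)" for z
  proof -
    obtain m where m: "m \<in> fst ?e" "m \<in> fst (e0 D c)" "z = snd ?e m" using z unfolding overlap_def by blast
    have mZ: "m \<in> MZ" "fst m \<in> fst c" using m(2) unfolding pch_infinity_MZ[OF D c(1)] by auto
    \<comment> \<open>Charts of the open submanifold have a smaller domain, so their inverse is
      computed anew from injectivity on that domain.\<close>
    have "chart_inv e' z = m"
      unfolding chart_inv_def e(4) fst_conv snd_conv m(3)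
      by (rule inv_into_f_f[OF inj_on_subset[OF PA.inj_chart[OF eP]]]) (use m mZ in auto)
    then show ?thesis
      using F[OF mZ] iota_surj(3)[OF D c(1) mZ] PA.transition_snd[OF eP m(1), of "e0 D c"] by (simp add: c(2) m(3))
  qed
  then have "smooth_on (overlap ?e (e0 D c)) (snd C \<circ> ?F \<circ> chart_inv e')"
    by (subst smooth_on_cong[OF o, where g = "transition ?e (e0 D c)"])
      (simp_all add: PA.smooth_transition[OF eP e0_in[OF D c(1)]])
  then show "open (snd e' ` (fst e' \<inter> ?F -` fst C)) \<and>
      smooth_on (snd e' ` (fst e' \<inter> ?F -` fst C)) (snd C \<circ> ?F \<circ> chart_inv e')"
    unfolding eq using o by blast
qed

lemma diffeomorphism_iota:
  assumes D: "D \<in> P" shows "diffeomorphism CTA (open_submanifold PAt MZ) (iota A P D)"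
  unfolding diffeomorphism_def points_OPA
  using bij_iota[OF D] smooth_iota[OF D] smooth_iota_inverse[OF D] by blast

lemma iota_tangent:
  assumes D: "D \<in> P" and c: "c \<in> A" "p \<in> fst c" and \<xi>: "\<xi> \<in> cotangent_space A p"
    and a: "a \<in> tangent_space CTA (p, \<xi>)"
  shows "tangent_map CTA PAt (iota A P D) (p, \<xi>) a \<in> tangent_space PAt (iota A P D (p, \<xi>))"
    and "tangent_map CTA PAt (iota A P D) (p, \<xi>) a (e0 D c) = a (cch c)"
proof -
  have C: "cch c \<in> CTA" "(p, \<xi>) \<in> fst (cch c)"
    using c \<xi> by (auto simp: cotangent_atlas_def cch_dom_iff)
  let ?N = "chart_image (cch c)"
  have N: "open ?N" "snd (cch c) (p, \<xi>) \<in> ?N"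
    using CT.open_chart_image[OF C(1)] C(2) by (auto simp: chart_image_def)
  have im: "z \<in> chart_image c \<times> UNIV" if "z \<in> ?N" for z using that by (simp only: cch_image[OF c(1)])
  have dom: "iota A P D (chart_inv (cch c) z) \<in> fst (e0 D c)"
    "snd (e0 D c) (iota A P D (chart_inv (cch c) z)) = z" if z: "z \<in> ?N" for z
  proof -
    have x: "fst z \<in> chart_image c" using im[OF z] by auto
    show "iota A P D (chart_inv (cch c) z) \<in> fst (e0 D c)"
      "snd (e0 D c) (iota A P D (chart_inv (cch c) z)) = z"
      unfolding iota_chart_inv[OF D c(1) im[OF z]]
      using PT_self[OF D c(1) x infinity_Basis, of "(1, snd z)"] by (simp_all add: inner_prod_def nrm_infinity)
  qed
  have d: "((\<lambda>z. snd (e0 D c) (iota A P D (chart_inv (cch c) z))) has_derivative (\<lambda>h. h)) (at (snd (cch c) (p, \<xi>)))"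
    by (rule has_derivative_transform_within_open[OF has_derivative_ident N]) (simp add: dom)
  note tm = CT.tangent_map_in[OF PA.atlas_axioms C e0_in[OF D c(1)] iota_e0(1)[OF D c \<xi>] a N dom(1) d]
  show "tangent_map CTA PAt (iota A P D) (p, \<xi>) a \<in> tangent_space PAt (iota A P D (p, \<xi>))"
    "tangent_map CTA PAt (iota A P D) (p, \<xi>) a (e0 D c) = a (cch c)"
    using tm by simp_all
qed

end

section \<open>The metric in induced coordinates on the cotangent bundle\<close>

lemma linear_axis_expand:
  fixes L :: "real^'n \<Rightarrow> real" assumes "linear L" shows "L u = (\<Sum>i\<in>UNIV. u $ i * L (axis i 1))"
proof -
  have "u = (\<Sum>i\<in>UNIV. u $ i *\<^sub>R axis i 1)" by (simp add: vec_eq_iff axis_def if_distrib cong: if_cong)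
  then have "L u = L (\<Sum>i\<in>UNIV. u $ i *\<^sub>R axis i 1)" by simp
  also have "\<dots> = (\<Sum>i\<in>UNIV. u $ i * L (axis i 1))"
    by (simp add: linear_sum[OF assms] linear_scale[OF assms])
  finally show ?thesis .
qed

lemma bilinear_axis_expand:
  fixes B :: "real^'n \<Rightarrow> real^'n \<Rightarrow> real" assumes "bilinear B"
  shows "B u v = (\<Sum>i\<in>UNIV. \<Sum>j\<in>UNIV. B (axis i 1) (axis j 1) * (u $ i * v $ j))"
proof -
  note l = bilinear_linear[OF assms]
  have "B u v = (\<Sum>i\<in>UNIV. u $ i * B (axis i 1) v)" by (rule linear_axis_expand[OF l(2)])
  also have "\<dots> = (\<Sum>i\<in>UNIV. u $ i * (\<Sum>j\<in>UNIV. v $ j * B (axis i 1) (axis j 1)))"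
    by (subst linear_axis_expand[OF l(1), of _ v]) simp
  also have "\<dots> = (\<Sum>i\<in>UNIV. \<Sum>j\<in>UNIV. B (axis i 1) (axis j 1) * (u $ i * v $ j))"
    by (simp add: sum_distrib_left mult_ac)
  finally show ?thesis .
qed

context projective
begin

lemma model_metric_components:
  assumes D: "D \<in> P" and c: "c \<in> A" and x: "x \<in> chart_image c"
  shows "model_metric (D c) (sym_schouten (D c)) (x, \<xi>) (a (cch c)) (b (cch c))
    = (\<Sum>i\<in>UNIV. (d_xi A c i \<odot> d_x A c i) a b)
      - (\<Sum>i\<in>UNIV. \<Sum>j\<in>UNIV. ((\<Sum>k\<in>UNIV. christoffel (D c) x k i j * \<xi> $ k) - \<xi> $ i * \<xi> $ j - schouten_sym (D c) x i j)
          * (d_x A c i \<odot> d_x A c j) a b)"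
proof -
  interpret M: fibre_model "chart_image c" "D c" "sym_schouten (D c)" by (rule fibre_model_schouten[OF D c])
  have z: "(x, \<xi>) \<in> chart_image c \<times> UNIV" using x by simp
  obtain u \<alpha> v \<beta> where ab: "a (cch c) = (u, \<alpha>)" "b (cch c) = (v, \<beta>)" by (metis prod.exhaust)
  let ?T = "M.T (x, \<xi>)"
  have comp: "(\<Sum>k\<in>UNIV. christoffel (D c) x k i j * \<xi> $ k) - \<xi> $ i * \<xi> $ j - schouten_sym (D c) x i j
      = - ?T (axis i 1) (axis j 1)" for i j
  proof -
    have "\<xi> \<bullet> axis l 1 = \<xi> $ l" for l by (simp add: inner_axis)
    moreover have "\<xi> \<bullet> D c x (axis i 1) (axis j 1) = (\<Sum>k\<in>UNIV. christoffel (D c) x k i j * \<xi> $ k)"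
      by (simp add: inner_vec_def christoffel_def mult.commute)
    ultimately show ?thesis by (simp add: model_tensor_def schouten_sym_def sym_schouten_def)
  qed
  have "(\<Sum>i\<in>UNIV. (d_xi A c i \<odot> d_x A c i) a b) = (\<Sum>i\<in>UNIV. (\<alpha> $ i * v $ i + \<beta> $ i * u $ i) / 2)"
    by (simp add: sym_prod_def d_xi_def d_x_def ab mult.commute)
  also have "\<dots> = (\<alpha> \<bullet> v + \<beta> \<bullet> u) / 2"
    by (simp add: inner_vec_def sum.distrib sum_divide_distrib[symmetric])
  finally have 1: "(\<Sum>i\<in>UNIV. (d_xi A c i \<odot> d_x A c i) a b) = (\<alpha> \<bullet> v + \<beta> \<bullet> u) / 2" .
  \<comment> \<open>The symmetric product of coordinate forms yields the mean of the form at (u, v)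
    and at (v, u), which agree because \<open>T\<close> is symmetric.\<close>
  have "(\<Sum>i\<in>UNIV. \<Sum>j\<in>UNIV. - ?T (axis i 1) (axis j 1) * (d_x A c i \<odot> d_x A c j) a b)
    = - ((\<Sum>i\<in>UNIV. \<Sum>j\<in>UNIV. ?T (axis i 1) (axis j 1) * (u $ i * v $ j))
        + (\<Sum>i\<in>UNIV. \<Sum>j\<in>UNIV. ?T (axis i 1) (axis j 1) * (v $ i * u $ j))) / 2"
    by (simp add: sym_prod_def d_x_def ab sum.distrib[symmetric] sum_negf[symmetric] sum_divide_distrib algebra_simps add_divide_distrib diff_divide_distrib)
  also have "\<dots> = - (?T u v + ?T v u) / 2"
    by (simp only: bilinear_axis_expand[OF M.bil_T[OF z], symmetric])
  also have "\<dots> = - ?T u v" using M.sym_T[OF z, of v u] by simp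
  finally show ?thesis
    unfolding comp 1 ab model_metric_def by simp
qed

lemma tractor_metric_iota:
  assumes D: "D \<in> P" and c: "c \<in> A" "p \<in> fst c" and \<xi>: "\<xi> \<in> cotangent_space A p"
    and a: "a \<in> tangent_space CTA (p, \<xi>)" and b: "b \<in> tangent_space CTA (p, \<xi>)"
  shows "tractor_metric A P (iota A P D (p, \<xi>)) (tangent_map CTA PAt (iota A P D) (p, \<xi>) a)
      (tangent_map CTA PAt (iota A P D) (p, \<xi>) b)
    = (\<Sum>i\<in>UNIV. (d_xi A c i \<odot> d_x A c i) a b)
      - (\<Sum>i\<in>UNIV. \<Sum>j\<in>UNIV. ((\<Sum>k\<in>UNIV. christoffel (D c) (snd c p) k i j * \<xi> c $ k)
           - \<xi> c $ i * \<xi> c $ j - schouten_sym (D c) (snd c p) i j) * (d_x A c i \<odot> d_x A c j) a b)"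
proof -
  have x: "snd c p \<in> chart_image c" using c by (simp add: chart_image_def)
  note ta = iota_tangent[OF D c \<xi> a] and tb = iota_tangent[OF D c \<xi> b]
  show ?thesis
    unfolding tractor_metric_chart[OF D c(1) iota_e0(1)[OF D c \<xi>] ta(1) tb(1)] ta(2) tb(2) iota_e0(2)[OF D c \<xi>]
    by (rule model_metric_components[OF D c(1) x])
qed

end

theorem theorem4p2:
  fixes A :: "('a, real^'n) chart set"
    and P :: "('a, real^'n) conn set"
  assumes "smooth_manifold A" and "orientable A" and "CARD('n) \<ge> 2"
    and "projective_structure A P"
  defines "MZ \<equiv> proj_cotractor A P - zero_locus A P"
    and "g \<equiv> tractor_metric A P"
  shows "points (proj_atlas A P) = proj_cotractor A P
    \<and> openin (atlas_topology (proj_atlas A P)) MZ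
    \<and> neutral_metric_on (proj_atlas A P) MZ g
    \<and> einstein_on (proj_atlas A P) MZ g
    \<and> (\<forall>c \<in> proj_atlas A P. \<forall>x \<in> snd c ` (fst c \<inter> MZ).
         scalar_curvature (metric_coords (proj_atlas A P) g c) x \<noteq> 0)
    \<and> (\<forall>D\<in>P.
         diffeomorphism (cotangent_atlas A) (open_submanifold (proj_atlas A P) MZ) (iota A P D)
       \<and> (\<forall>c\<in>A. \<forall>p \<in> fst c. \<forall>\<xi> \<in> cotangent_space A p.
           \<forall>a \<in> tangent_space (cotangent_atlas A) (p, \<xi>).
           \<forall>b \<in> tangent_space (cotangent_atlas A) (p, \<xi>).
             g (iota A P D (p, \<xi>))
               (tangent_map (cotangent_atlas A) (proj_atlas A P) (iota A P D) (p, \<xi>) a)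
               (tangent_map (cotangent_atlas A) (proj_atlas A P) (iota A P D) (p, \<xi>) b)
           = (\<Sum>i\<in>UNIV. (d_xi A c i \<odot> d_x A c i) a b)
             - (\<Sum>i\<in>UNIV. \<Sum>j\<in>UNIV.
                  ((\<Sum>k\<in>UNIV. christoffel (D c) (snd c p) k i j * \<xi> c $ k)
                   - \<xi> c $ i * \<xi> c $ j - schouten_sym (D c) (snd c p) i j)
                  * (d_x A c i \<odot> d_x A c j) a b)))"
proof -
  interpret projective A P
    using assms(1,3,4) by unfold_locales (simp_all add: smooth_manifold_def)
  have MZ: "MZ = projective.MZ A P" by (simp add: MZ_def assms(5))
  show ?thesis
    unfolding MZ g_def
    by (intro conjI ballI points_PAt openin_MZ neutral_metric_MZ einstein_MZ scalar_curvature_MZ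
        diffeomorphism_iota tractor_metric_iota)
qed

end
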